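(* Let $H$ be a $*$-Hopf algebra over $\mathbb C$ and let $\mathcal F\in H\otimes H$ be an invertible element with $(\epsilon\otimes\mathrm{id})\mathcal F=(\mathrm{id}\otimes\epsilon)\mathcal F=1$. Let $H^{\mathcal F}$ be the twisted quasi-Hopf algebra and $F:{}_H\mathcal M\to{}_{H^{\mathcal F}}\mathcal M$ the twisting functor. Let $\varphi\in H$. Then there exist an antilinear algebra homomorphism $T_{\mathcal F}:H\to H$, an element $\gamma\in H$ and an element $\mathcal G\in H\otimes H$ such that the formulas $$h\triangleright\overline{F(x)}=\overline{T_{\mathcal F}(h)\triangleright F(x)},\quad \mathrm{bb}(F(x))=\overline{\overline{F(\gamma\triangleright x)}},\quad \Upsilon(\overline{F(x)\otimes F(y)})=\overline{F(\mathcal G^{(2)}\triangleright y)}\otimes\overline{F(\mathcal G^{(1)}\triangleright x)}$$ (together with complex conjugation $\star:\mathbb C\to\overline{\mathbb C}$) make ${}_{H^{\mathcal F}}\mathcal M$ into a strong bar category for which the twisting functor $F$ is a functor of bar categories with $$\mathrm{fb}(\overline{F(x)})=F(\overline{\varphi\triangleright x}),$$ if and only if $\varphi$ is invertible and $\epsilon(\varphi)=1$. In this case $$T_{\mathcal F}(h)=\varphi^{-1}(Sh)^*\varphi,\qquad \gamma=\varphi^{-1}(S\varphi^{-1})^*,\qquad \mathcal G=(\varphi^{-1}\otimes\varphi^{-1})\,\big(( *S\otimes *S)(\mathcal F_{21})\big)\,(\Delta\varphi)\,\mathcal F^{-1}.$$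
   Context: Monoidal conventions: $\Phi_{X,Y,Z}:(X\otimes Y)\otimes Z\to X\otimes(Y\otimes Z)$, $l_X:X\to X\otimes 1$, $r_X:X\to 1\otimes X$. A bar category is a monoidal category with: a functor bar, $X\mapsto\overline X$, $\theta\mapsto\overline\theta$; a natural isomorphism $\mathrm{bb}_X:X\to\overline{\overline X}$; an invertible morphism $\star:1\to\overline 1$; and a natural isomorphism $\Upsilon_{X,Y}:\overline{X\otimes Y}\to\overline Y\otimes\overline X$; such that (a) $(\star^{-1}\otimes\mathrm{id})\Upsilon_{X,1}\overline{l_X}=r_{\overline X}$ and $(\mathrm{id}\otimes\star^{-1})\Upsilon_{1,X}\overline{r_X}=l_{\overline X}$; (b) $\Phi_{\overline Z,\overline Y,\overline X}(\Upsilon_{Y,Z}\otimes\mathrm{id})\Upsilon_{X,Y\otimes Z}\overline{\Phi_{X,Y,Z}}=(\mathrm{id}\otimes\Upsilon_{X,Y})\Upsilon_{X\otimes Y,Z}$; (c) $\overline\star\,\star=\mathrm{bb}_1$; (d) $\overline{\mathrm{bb}_X}=\mathrm{bb}_{\overline X}$. It is strong if $\Upsilon_{\overline Y,\overline X}\,\overline{\Upsilon_{X,Y}}\,\mathrm{bb}_{X\otimes Y}=\mathrm{bb}_X\otimes\mathrm{bb}_Y$ for all $X,Y$. A functor of bar categories is a monoidal functor $(F,f)$, $f_{X,Y}:F(X)\otimes F(Y)\to F(X\otimes Y)$, with (1) a natural isomorphism $\mathrm{fb}_Y:\overline{F(Y)}\to F(\overline Y)$; (2) $F(\overline 1)=\overline{F(1)}$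 and $F(\star)=\star$; (3) $F(\mathrm{bb}_Y)=\mathrm{fb}_{\overline Y}\circ\overline{\mathrm{fb}_Y}\circ\mathrm{bb}_{F(Y)}$; (4) $(\mathrm{fb}_Y\otimes\mathrm{fb}_X)\circ\Upsilon_{F(X),F(Y)}\circ\overline{f_{X,Y}^{-1}}=f_{\overline Y,\overline X}^{-1}\circ F(\Upsilon_{X,Y})\circ\mathrm{fb}_{X\otimes Y}$. For a complex vector space $V$, $\overline V$ is the same abelian group, with $v$ written $\overline v$ and $\lambda\overline v=\overline{\overline\lambda v}$; $\overline\theta(\overline v)=\overline{\theta(v)}$ for a map $\theta$. A $*$-Hopf algebra is a Hopf algebra $H$ over $\mathbb C$ (coproduct $\Delta h=h_{(1)}\otimes h_{(2)}$, counit $\epsilon$, antipode $S$) that is a $*$-algebra (antilinear order-reversing involution) with $\Delta\circ *=( *\otimes * )\circ\Delta$ (so $S$ is invertible and $(Sh)^*=S^{-1}(h^* )$). Its category ${}_H\mathcal M$ of left modules is a strong bar category with $h\triangleright\overline v=\overline{S^{-1}(h^* )\triangleright v}$, $\mathrm{bb}(v)=\overline{\overline v}$, $\Upsilon(\overline{v\otimes w})=\overline w\otimes\overline v$, $\star$ complex conjugation. $H^{\mathcal F}$ is the algebra $H$ with coproduct $\Delta_{\mathcal F}=\mathcal F\,\Delta(\ )\,\mathcal F^{-1}$ and quasi-Hopf associator $\phi=(1\otimes\mathcal F)\big((\mathrm{id}\otimes\Delta)\mathcal F\big)\big((\Delta\otimes\mathrm{id})\mathcal F^{-1}\big)(\mathcal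 F^{-1}\otimes 1)\in H^{\otimes 3}$, whose action is the associator $\Phi$ of ${}_{H^{\mathcal F}}\mathcal M$. The twisting functor $F$ is the identity on objects and morphisms; $F(x)$ denotes $x\in X$ viewed in $F(X)$, so $h\triangleright F(x)=F(h\triangleright x)$; its monoidal structure is $f_{X,Y}(F(x)\otimes F(y))=F(\mathcal F^{-(1)}\triangleright x\otimes\mathcal F^{-(2)}\triangleright y)$, where $\mathcal F^{-1}=\mathcal F^{-(1)}\otimes\mathcal F^{-(2)}$. $\mathcal F_{21}$ is $\mathcal F$ with its two tensor factors exchanged, and $*S$ is the map $h\mapsto(Sh)^*$. *)

theory Defs
  imports Complex_Main "HOL-Algebra.Module"
begin

section \<open>Monoidal categories, bar categories and their functors\<close>

text \<open>
  Composition and the tensor product of morphisms are total operations on the type of morphisms;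
  they are only meaningful on composable, respectively genuine, morphisms.
  \<open>Lun X\<close> and \<open>Run X\<close> go from \<open>X\<close> to \<open>X \<boxtimes> 1\<close> and from \<open>X\<close> to \<open>1 \<boxtimes> X\<close>.
\<close>

record ('o, 'm) cat =
  Ob :: "'o set"
  Hom :: "'o \<Rightarrow> 'o \<Rightarrow> 'm set"
  Idm :: "'o \<Rightarrow> 'm" (\<open>Id\<index>\<close>)
  Comp :: "'m \<Rightarrow> 'm \<Rightarrow> 'm" (infixr \<open>\<cdot>\<index>\<close> 55)

record ('o, 'm) moncat = "('o, 'm) cat" +
  TensO :: "'o \<Rightarrow> 'o \<Rightarrow> 'o" (infixr \<open>\<boxtimes>\<index>\<close> 70)
  TensM :: "'m \<Rightarrow> 'm \<Rightarrow> 'm" (infixr \<open>\<boxdot>\<index>\<close> 70)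
  Unit :: "'o" (\<open>\<I>\<index>\<close>)
  Assoc :: "'o \<Rightarrow> 'o \<Rightarrow> 'o \<Rightarrow> 'm" (\<open>\<Phi>\<index>\<close>)
  Lun :: "'o \<Rightarrow> 'm"
  Run :: "'o \<Rightarrow> 'm"

record ('o, 'm) barstr =
  barO :: "'o \<Rightarrow> 'o"
  barM :: "'m \<Rightarrow> 'm"
  bbM :: "'o \<Rightarrow> 'm"
  starM :: "'m"
  Ups :: "'o \<Rightarrow> 'o \<Rightarrow> 'm"

locale category = fixes C :: "('o, 'm, 'z) cat_scheme" (structure)
  assumes id_hom: "X \<in> Ob C \<Longrightarrow> Id X \<in> Hom C X X"
    and comp_hom: "\<lbrakk>X \<in> Ob C; Y \<in> Ob C; Z \<in> Ob C; f \<in> Hom C X Y; g \<in> Hom C Y Z\<rbrakk>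
        \<Longrightarrow> g \<cdot> f \<in> Hom C X Z"
    and comp_id_right: "\<lbrakk>X \<in> Ob C; Y \<in> Ob C; f \<in> Hom C X Y\<rbrakk> \<Longrightarrow> f \<cdot> Id X = f"
    and comp_id_left: "\<lbrakk>X \<in> Ob C; Y \<in> Ob C; f \<in> Hom C X Y\<rbrakk> \<Longrightarrow> Id Y \<cdot> f = f"
    and comp_assoc: "\<lbrakk>W \<in> Ob C; X \<in> Ob C; Y \<in> Ob C; Z \<in> Ob C;
        f \<in> Hom C W X; g \<in> Hom C X Y; h \<in> Hom C Y Z\<rbrakk> \<Longrightarrow> (h \<cdot> g) \<cdot> f = h \<cdot> (g \<cdot> f)"

definition inverse_of :: "('o, 'm, 'z) cat_scheme \<Rightarrow> 'o \<Rightarrow> 'o \<Rightarrow> 'm \<Rightarrow> 'm \<Rightarrow> bool" where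
  "inverse_of C X Y f g \<longleftrightarrow> g \<in> Hom C Y X \<and> g \<cdot>\<^bsub>C\<^esub> f = Id\<^bsub>C\<^esub> X \<and> f \<cdot>\<^bsub>C\<^esub> g = Id\<^bsub>C\<^esub> Y"

definition iso_mor :: "('o, 'm, 'z) cat_scheme \<Rightarrow> 'o \<Rightarrow> 'o \<Rightarrow> 'm \<Rightarrow> bool" where
  "iso_mor C X Y f \<longleftrightarrow> f \<in> Hom C X Y \<and> (\<exists>g. inverse_of C X Y f g)"

definition inv_mor :: "('o, 'm, 'z) cat_scheme \<Rightarrow> 'o \<Rightarrow> 'o \<Rightarrow> 'm \<Rightarrow> 'm" where
  "inv_mor C X Y f = (THE g. inverse_of C X Y f g)"

locale monoidal_category = category C for C :: "('o, 'm, 'z) moncat_scheme" (structure) +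
  assumes tens_ob: "\<lbrakk>X \<in> Ob C; Y \<in> Ob C\<rbrakk> \<Longrightarrow> X \<boxtimes> Y \<in> Ob C"
    and tens_hom: "\<lbrakk>X \<in> Ob C; X' \<in> Ob C; Y \<in> Ob C; Y' \<in> Ob C; f \<in> Hom C X X'; g \<in> Hom C Y Y'\<rbrakk>
        \<Longrightarrow> f \<boxdot> g \<in> Hom C (X \<boxtimes> Y) (X' \<boxtimes> Y')"
    and tens_id: "\<lbrakk>X \<in> Ob C; Y \<in> Ob C\<rbrakk> \<Longrightarrow> Id X \<boxdot> Id Y = Id (X \<boxtimes> Y)"
    and tens_comp: "\<lbrakk>X \<in> Ob C; X' \<in> Ob C; X'' \<in> Ob C; Y \<in> Ob C; Y' \<in> Ob C; Y'' \<in> Ob C;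
        f \<in> Hom C X X'; f' \<in> Hom C X' X''; g \<in> Hom C Y Y'; g' \<in> Hom C Y' Y''\<rbrakk>
        \<Longrightarrow> (f' \<cdot> f) \<boxdot> (g' \<cdot> g) = (f' \<boxdot> g') \<cdot> (f \<boxdot> g)"
    and unit_ob: "\<I> \<in> Ob C"
    and assoc_iso: "\<lbrakk>X \<in> Ob C; Y \<in> Ob C; Z \<in> Ob C\<rbrakk>
        \<Longrightarrow> iso_mor C ((X \<boxtimes> Y) \<boxtimes> Z) (X \<boxtimes> (Y \<boxtimes> Z)) (\<Phi> X Y Z)"
    and assoc_nat: "\<lbrakk>X \<in> Ob C; X' \<in> Ob C; Y \<in> Ob C; Y' \<in> Ob C; Z \<in> Ob C; Z' \<in> Ob C;
        f \<in> Hom C X X'; g \<in> Hom C Y Y'; h \<in> Hom C Z Z'\<rbrakk>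
        \<Longrightarrow> \<Phi> X' Y' Z' \<cdot> ((f \<boxdot> g) \<boxdot> h) = (f \<boxdot> (g \<boxdot> h)) \<cdot> \<Phi> X Y Z"
    and pentagon: "\<lbrakk>W \<in> Ob C; X \<in> Ob C; Y \<in> Ob C; Z \<in> Ob C\<rbrakk>
        \<Longrightarrow> \<Phi> W X (Y \<boxtimes> Z) \<cdot> \<Phi> (W \<boxtimes> X) Y Z
          = (Id W \<boxdot> \<Phi> X Y Z) \<cdot> \<Phi> W (X \<boxtimes> Y) Z \<cdot> (\<Phi> W X Y \<boxdot> Id Z)"
    and lun_iso: "X \<in> Ob C \<Longrightarrow> iso_mor C X (X \<boxtimes> \<I>) (Lun C X)"
    and run_iso: "X \<in> Ob C \<Longrightarrow> iso_mor C X (\<I> \<boxtimes> X) (Run C X)"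
    and lun_nat: "\<lbrakk>X \<in> Ob C; X' \<in> Ob C; f \<in> Hom C X X'\<rbrakk>
        \<Longrightarrow> Lun C X' \<cdot> f = (f \<boxdot> Id \<I>) \<cdot> Lun C X"
    and run_nat: "\<lbrakk>X \<in> Ob C; X' \<in> Ob C; f \<in> Hom C X X'\<rbrakk>
        \<Longrightarrow> Run C X' \<cdot> f = (Id \<I> \<boxdot> f) \<cdot> Run C X"
    and triangle: "\<lbrakk>X \<in> Ob C; Y \<in> Ob C\<rbrakk>
        \<Longrightarrow> \<Phi> X \<I> Y \<cdot> (Lun C X \<boxdot> Id Y) = Id X \<boxdot> Run C Y"

locale bar_category = monoidal_category C
  for C :: "('o, 'm, 'z) moncat_scheme" (structure) and B :: "('o, 'm) barstr" +
  assumes bar_ob: "X \<in> Ob C \<Longrightarrow> barO B X \<in> Ob C"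
    and bar_hom: "\<lbrakk>X \<in> Ob C; Y \<in> Ob C; f \<in> Hom C X Y\<rbrakk> \<Longrightarrow> barM B f \<in> Hom C (barO B X) (barO B Y)"
    and bar_id: "X \<in> Ob C \<Longrightarrow> barM B (Id X) = Id (barO B X)"
    and bar_comp: "\<lbrakk>X \<in> Ob C; Y \<in> Ob C; Z \<in> Ob C; f \<in> Hom C X Y; g \<in> Hom C Y Z\<rbrakk>
        \<Longrightarrow> barM B (g \<cdot> f) = barM B g \<cdot> barM B f"
    and bb_iso: "X \<in> Ob C \<Longrightarrow> iso_mor C X (barO B (barO B X)) (bbM B X)"
    and bb_nat: "\<lbrakk>X \<in> Ob C; Y \<in> Ob C; f \<in> Hom C X Y\<rbrakk>
        \<Longrightarrow> bbM B Y \<cdot> f = barM B (barM B f) \<cdot> bbM B X"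
    and star_iso: "iso_mor C \<I> (barO B \<I>) (starM B)"
    and ups_iso: "\<lbrakk>X \<in> Ob C; Y \<in> Ob C\<rbrakk>
        \<Longrightarrow> iso_mor C (barO B (X \<boxtimes> Y)) (barO B Y \<boxtimes> barO B X) (Ups B X Y)"
    and ups_nat: "\<lbrakk>X \<in> Ob C; X' \<in> Ob C; Y \<in> Ob C; Y' \<in> Ob C; f \<in> Hom C X X'; g \<in> Hom C Y Y'\<rbrakk>
        \<Longrightarrow> Ups B X' Y' \<cdot> barM B (f \<boxdot> g) = (barM B g \<boxdot> barM B f) \<cdot> Ups B X Y"
    and bar_lun: "X \<in> Ob C
        \<Longrightarrow> (inv_mor C \<I> (barO B \<I>) (starM B) \<boxdot> Id (barO B X)) \<cdot> Ups B X \<I> \<cdot> barM B (Lun C X)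
          = Run C (barO B X)"
    and bar_run: "X \<in> Ob C
        \<Longrightarrow> (Id (barO B X) \<boxdot> inv_mor C \<I> (barO B \<I>) (starM B)) \<cdot> Ups B \<I> X \<cdot> barM B (Run C X)
          = Lun C (barO B X)"
    and bar_assoc: "\<lbrakk>X \<in> Ob C; Y \<in> Ob C; Z \<in> Ob C\<rbrakk>
        \<Longrightarrow> \<Phi> (barO B Z) (barO B Y) (barO B X) \<cdot> (Ups B Y Z \<boxdot> Id (barO B X))
              \<cdot> Ups B X (Y \<boxtimes> Z) \<cdot> barM B (\<Phi> X Y Z)
          = (Id (barO B Z) \<boxdot> Ups B X Y) \<cdot> Ups B (X \<boxtimes> Y) Z"
    and star_star: "barM B (starM B) \<cdot> starM B = bbM B \<I>"
    and bar_bb: "X \<in> Ob C \<Longrightarrow> barM B (bbM B X) = bbM B (barO B X)"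

locale strong_bar_category = bar_category C B
  for C :: "('o, 'm, 'z) moncat_scheme" (structure) and B +
  assumes strong: "\<lbrakk>X \<in> Ob C; Y \<in> Ob C\<rbrakk>
        \<Longrightarrow> Ups B (barO B Y) (barO B X) \<cdot> barM B (Ups B X Y) \<cdot> bbM B (X \<boxtimes> Y) = bbM B X \<boxdot> bbM B Y"

text \<open>
  Monoidal functors are strictly unital, \<open>F(1) = 1\<close>: this identification is what gives the
  condition \<open>F(\<star>) = \<star>\<close> in the definition of a functor of bar categories a meaning.
\<close>

locale monoidal_functor = C: monoidal_category C + D: monoidal_category D
  for C :: "('o, 'm, 'z) moncat_scheme" and D :: "('p, 'n, 'y) moncat_scheme" +
  fixes Fo :: "'o \<Rightarrow> 'p" and Fm :: "'m \<Rightarrow> 'n" and f :: "'o \<Rightarrow> 'o \<Rightarrow> 'n"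
  assumes F_ob: "X \<in> Ob C \<Longrightarrow> Fo X \<in> Ob D"
    and F_hom: "\<lbrakk>X \<in> Ob C; Y \<in> Ob C; u \<in> Hom C X Y\<rbrakk> \<Longrightarrow> Fm u \<in> Hom D (Fo X) (Fo Y)"
    and F_id: "X \<in> Ob C \<Longrightarrow> Fm (Id\<^bsub>C\<^esub> X) = Id\<^bsub>D\<^esub> (Fo X)"
    and F_comp: "\<lbrakk>X \<in> Ob C; Y \<in> Ob C; Z \<in> Ob C; u \<in> Hom C X Y; v \<in> Hom C Y Z\<rbrakk>
        \<Longrightarrow> Fm (v \<cdot>\<^bsub>C\<^esub> u) = Fm v \<cdot>\<^bsub>D\<^esub> Fm u"
    and F_unit: "Fo \<I>\<^bsub>C\<^esub> = \<I>\<^bsub>D\<^esub>"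
    and f_iso: "\<lbrakk>X \<in> Ob C; Y \<in> Ob C\<rbrakk>
        \<Longrightarrow> iso_mor D (Fo X \<boxtimes>\<^bsub>D\<^esub> Fo Y) (Fo (X \<boxtimes>\<^bsub>C\<^esub> Y)) (f X Y)"
    and f_nat: "\<lbrakk>X \<in> Ob C; X' \<in> Ob C; Y \<in> Ob C; Y' \<in> Ob C; u \<in> Hom C X X'; v \<in> Hom C Y Y'\<rbrakk>
        \<Longrightarrow> f X' Y' \<cdot>\<^bsub>D\<^esub> (Fm u \<boxdot>\<^bsub>D\<^esub> Fm v) = Fm (u \<boxdot>\<^bsub>C\<^esub> v) \<cdot>\<^bsub>D\<^esub> f X Y"
    and f_assoc: "\<lbrakk>X \<in> Ob C; Y \<in> Ob C; Z \<in> Ob C\<rbrakk>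
        \<Longrightarrow> Fm (\<Phi>\<^bsub>C\<^esub> X Y Z) \<cdot>\<^bsub>D\<^esub> f (X \<boxtimes>\<^bsub>C\<^esub> Y) Z \<cdot>\<^bsub>D\<^esub> (f X Y \<boxdot>\<^bsub>D\<^esub> Id\<^bsub>D\<^esub> (Fo Z))
          = f X (Y \<boxtimes>\<^bsub>C\<^esub> Z) \<cdot>\<^bsub>D\<^esub> (Id\<^bsub>D\<^esub> (Fo X) \<boxdot>\<^bsub>D\<^esub> f Y Z) \<cdot>\<^bsub>D\<^esub> \<Phi>\<^bsub>D\<^esub> (Fo X) (Fo Y) (Fo Z)"
    and f_lun: "X \<in> Ob C \<Longrightarrow> Fm (Lun C X) = f X \<I>\<^bsub>C\<^esub> \<cdot>\<^bsub>D\<^esub> Lun D (Fo X)"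
    and f_run: "X \<in> Ob C \<Longrightarrow> Fm (Run C X) = f \<I>\<^bsub>C\<^esub> X \<cdot>\<^bsub>D\<^esub> Run D (Fo X)"

locale bar_functor = C: bar_category C B + D: bar_category D E + monoidal_functor C D Fo Fm f
  for C :: "('o, 'm, 'z) moncat_scheme" and B
    and D :: "('p, 'n, 'y) moncat_scheme" and E and Fo and Fm and f +
  fixes fb :: "'o \<Rightarrow> 'n"
  assumes fb_iso: "Y \<in> Ob C \<Longrightarrow> iso_mor D (barO E (Fo Y)) (Fo (barO B Y)) (fb Y)"
    and fb_nat: "\<lbrakk>X \<in> Ob C; Y \<in> Ob C; u \<in> Hom C X Y\<rbrakk>
        \<Longrightarrow> fb Y \<cdot>\<^bsub>D\<^esub> barM E (Fm u) = Fm (barM B u) \<cdot>\<^bsub>D\<^esub> fb X"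
    and F_bar_unit: "Fo (barO B \<I>\<^bsub>C\<^esub>) = barO E (Fo \<I>\<^bsub>C\<^esub>)"
    and F_star: "Fm (starM B) = starM E"
    and F_bb: "Y \<in> Ob C \<Longrightarrow> Fm (bbM B Y) = fb (barO B Y) \<cdot>\<^bsub>D\<^esub> barM E (fb Y) \<cdot>\<^bsub>D\<^esub> bbM E (Fo Y)"
    and F_ups: "\<lbrakk>X \<in> Ob C; Y \<in> Ob C\<rbrakk>
        \<Longrightarrow> (fb Y \<boxdot>\<^bsub>D\<^esub> fb X) \<cdot>\<^bsub>D\<^esub> Ups E (Fo X) (Fo Y) \<cdot>\<^bsub>D\<^esub>
              barM E (inv_mor D (Fo X \<boxtimes>\<^bsub>D\<^esub> Fo Y) (Fo (X \<boxtimes>\<^bsub>C\<^esub> Y)) (f X Y))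
          = inv_mor D (Fo (barO B Y) \<boxtimes>\<^bsub>D\<^esub> Fo (barO B X)) (Fo (barO B Y \<boxtimes>\<^bsub>C\<^esub> barO B X))
                (f (barO B Y) (barO B X)) \<cdot>\<^bsub>D\<^esub> Fm (Ups B X Y) \<cdot>\<^bsub>D\<^esub> fb (X \<boxtimes>\<^bsub>C\<^esub> Y)"


section \<open>A universe of vectors and tensor products of complex vector spaces\<close>

definition complex_ring :: "complex ring" where
  "complex_ring = \<lparr>carrier = UNIV, mult = (*), one = 1, zero = 0, add = (+)\<rparr>"

text \<open>
  All vector spaces have their carrier inside one type that is closed under tensor products, so
  that the modules over a given algebra form a single category. \<open>Atom\<close> supplies arbitrary generators
  (\<open>'a\<close> is arbitrary), \<open>Scalar\<close> the ground field, and \<open>Formal [(x\<^sub>1,y\<^sub>1),\<dots>]\<close> stands for the formal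
  sum of the \<open>x\<^sub>i \<otimes> y\<^sub>i\<close>. The carrier of \<open>V \<otimes>\<^sub>v W\<close> is the set of formal sums modulo the relations of
  the tensor product, each class being represented by a chosen element.
\<close>

datatype 'a vuniv =
    Atom 'a
  | Scalar (scalar_of: complex)
  | Formal (terms: "('a vuniv \<times> 'a vuniv) list")

text \<open>
  As usual in the library, the fields \<open>mult\<close> and \<open>one\<close> of the record are irrelevant when a
  record is used as a vector space or module only.
\<close>

type_synonym 'a vspace = "(complex, 'a vuniv) module"

inductive tensor_eq ::
  "(complex, 'a vuniv, 'b) module_scheme \<Rightarrow> (complex, 'a vuniv, 'c) module_scheme
    \<Rightarrow> ('a vuniv \<times> 'a vuniv) list \<Rightarrow> ('a vuniv \<times> 'a vuniv) list \<Rightarrow> bool"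
  for V :: "(complex, 'a vuniv, 'b) module_scheme" and W :: "(complex, 'a vuniv, 'c) module_scheme"
where
  refl: "k \<in> lists (carrier V \<times> carrier W) \<Longrightarrow> tensor_eq V W k k"
| sym: "tensor_eq V W k l \<Longrightarrow> tensor_eq V W l k"
| trans: "tensor_eq V W k l \<Longrightarrow> tensor_eq V W l m \<Longrightarrow> tensor_eq V W k m"
| append: "tensor_eq V W k k' \<Longrightarrow> tensor_eq V W l l' \<Longrightarrow> tensor_eq V W (k @ l) (k' @ l')"
| commute: "k \<in> lists (carrier V \<times> carrier W) \<Longrightarrow> l \<in> lists (carrier V \<times> carrier W)
    \<Longrightarrow> tensor_eq V W (k @ l) (l @ k)"
| zero: "y \<in> carrier W \<Longrightarrow> tensor_eq V W [(\<zero>\<^bsub>V\<^esub>, y)] []"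
| add_left: "x \<in> carrier V \<Longrightarrow> x' \<in> carrier V \<Longrightarrow> y \<in> carrier W
    \<Longrightarrow> tensor_eq V W [(x \<oplus>\<^bsub>V\<^esub> x', y)] [(x, y), (x', y)]"
| add_right: "x \<in> carrier V \<Longrightarrow> y \<in> carrier W \<Longrightarrow> y' \<in> carrier W
    \<Longrightarrow> tensor_eq V W [(x, y \<oplus>\<^bsub>W\<^esub> y')] [(x, y), (x, y')]"
| scale: "x \<in> carrier V \<Longrightarrow> y \<in> carrier W
    \<Longrightarrow> tensor_eq V W [(c \<odot>\<^bsub>V\<^esub> x, y)] [(x, c \<odot>\<^bsub>W\<^esub> y)]"

definition tensor_class ::
  "(complex, 'a vuniv, 'b) module_scheme \<Rightarrow> (complex, 'a vuniv, 'c) module_scheme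
    \<Rightarrow> ('a vuniv \<times> 'a vuniv) list \<Rightarrow> 'a vuniv" where
  "tensor_class V W l = Formal (SOME k. tensor_eq V W l k)"

definition pure ::
  "(complex, 'a vuniv, 'b) module_scheme \<Rightarrow> (complex, 'a vuniv, 'c) module_scheme
    \<Rightarrow> 'a vuniv \<Rightarrow> 'a vuniv \<Rightarrow> 'a vuniv" where
  "pure V W x y = tensor_class V W [(x, y)]"

text \<open>
  The multiplication is the one of the tensor product of algebras.
\<close>

definition vtensor ::
  "(complex, 'a vuniv, 'b) module_scheme \<Rightarrow> (complex, 'a vuniv, 'c) module_scheme \<Rightarrow> 'a vspace"
  (infixr \<open>\<otimes>\<^sub>v\<close> 70) where
  "V \<otimes>\<^sub>v W =
    \<lparr>carrier = tensor_class V W ` lists (carrier V \<times> carrier W),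
     mult = (\<lambda>s t. tensor_class V W
       [(x \<otimes>\<^bsub>V\<^esub> x', y \<otimes>\<^bsub>W\<^esub> y'). (x, y) \<leftarrow> terms s, (x', y') \<leftarrow> terms t]),
     one = pure V W \<one>\<^bsub>V\<^esub> \<one>\<^bsub>W\<^esub>,
     zero = tensor_class V W [],
     add = (\<lambda>s t. tensor_class V W (terms s @ terms t)),
     smult = (\<lambda>c t. tensor_class V W [(c \<odot>\<^bsub>V\<^esub> x, y). (x, y) \<leftarrow> terms t])\<rparr>"

text \<open>
  \<open>tensor_lift U \<beta>\<close> is the map \<open>x \<otimes> y \<mapsto> \<beta> x y\<close> into \<open>U\<close> induced by a map \<open>\<beta>\<close> which is biadditive and
  satisfies \<open>\<beta> (c x) y = \<beta> x (c y)\<close>. It is linear for bilinear \<open>\<beta>\<close>, but it also serves for maps that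
  are antilinear in both arguments.
\<close>

definition tensor_lift ::
  "(complex, 'a vuniv, 'b) module_scheme \<Rightarrow> ('a vuniv \<Rightarrow> 'a vuniv \<Rightarrow> 'a vuniv) \<Rightarrow> 'a vuniv \<Rightarrow> 'a vuniv"
where
  "tensor_lift U \<beta> t = foldr (\<lambda>(x, y) s. \<beta> x y \<oplus>\<^bsub>U\<^esub> s) (terms t) \<zero>\<^bsub>U\<^esub>"

definition tensor_map ::
  "(complex, 'a vuniv, 'b) module_scheme \<Rightarrow> (complex, 'a vuniv, 'c) module_scheme
    \<Rightarrow> ('a vuniv \<Rightarrow> 'a vuniv) \<Rightarrow> ('a vuniv \<Rightarrow> 'a vuniv) \<Rightarrow> 'a vuniv \<Rightarrow> 'a vuniv" where
  "tensor_map V W f g = tensor_lift (V \<otimes>\<^sub>v W) (\<lambda>x y. pure V W (f x) (g y))"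

definition tensor_swap ::
  "(complex, 'a vuniv, 'b) module_scheme \<Rightarrow> (complex, 'a vuniv, 'c) module_scheme
    \<Rightarrow> 'a vuniv \<Rightarrow> 'a vuniv" where
  "tensor_swap V W = tensor_lift (W \<otimes>\<^sub>v V) (\<lambda>x y. pure W V y x)"

definition tensor_assoc ::
  "(complex, 'a vuniv, 'b) module_scheme \<Rightarrow> (complex, 'a vuniv, 'c) module_scheme
    \<Rightarrow> (complex, 'a vuniv, 'd) module_scheme \<Rightarrow> 'a vuniv \<Rightarrow> 'a vuniv" where
  "tensor_assoc U V W = tensor_lift (U \<otimes>\<^sub>v V \<otimes>\<^sub>v W)
    (\<lambda>t z. tensor_lift (U \<otimes>\<^sub>v V \<otimes>\<^sub>v W) (\<lambda>x y. pure U (V \<otimes>\<^sub>v W) x (pure V W y z)) t)"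

text \<open>
  The componentwise action \<open>(a \<otimes> b) \<triangleright> (x \<otimes> y) = \<alpha> a x \<otimes> \<beta> b y\<close> on \<open>V \<otimes>\<^sub>v W\<close>.
\<close>

definition tensor_act ::
  "(complex, 'a vuniv, 'b) module_scheme \<Rightarrow> (complex, 'a vuniv, 'c) module_scheme
    \<Rightarrow> ('a vuniv \<Rightarrow> 'a vuniv \<Rightarrow> 'a vuniv) \<Rightarrow> ('a vuniv \<Rightarrow> 'a vuniv \<Rightarrow> 'a vuniv)
    \<Rightarrow> 'a vuniv \<Rightarrow> 'a vuniv \<Rightarrow> 'a vuniv" where
  "tensor_act V W \<alpha> \<beta> t s =
    tensor_lift (V \<otimes>\<^sub>v W) (\<lambda>a b. tensor_map V W (\<alpha> a) (\<beta> b) s) t"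

definition linear_map ::
  "(complex, 'a vuniv, 'b) module_scheme \<Rightarrow> (complex, 'a vuniv, 'c) module_scheme
    \<Rightarrow> ('a vuniv \<Rightarrow> 'a vuniv) \<Rightarrow> bool" where
  "linear_map V W f \<longleftrightarrow> f \<in> carrier V \<rightarrow> carrier W
    \<and> (\<forall>x\<in>carrier V. \<forall>y\<in>carrier V. f (x \<oplus>\<^bsub>V\<^esub> y) = f x \<oplus>\<^bsub>W\<^esub> f y)
    \<and> (\<forall>c. \<forall>x\<in>carrier V. f (c \<odot>\<^bsub>V\<^esub> x) = c \<odot>\<^bsub>W\<^esub> f x)"

definition antilinear_map ::
  "(complex, 'a vuniv, 'b) module_scheme \<Rightarrow> (complex, 'a vuniv, 'c) module_scheme
    \<Rightarrow> ('a vuniv \<Rightarrow> 'a vuniv) \<Rightarrow> bool" where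
  "antilinear_map V W f \<longleftrightarrow> f \<in> carrier V \<rightarrow> carrier W
    \<and> (\<forall>x\<in>carrier V. \<forall>y\<in>carrier V. f (x \<oplus>\<^bsub>V\<^esub> y) = f x \<oplus>\<^bsub>W\<^esub> f y)
    \<and> (\<forall>c. \<forall>x\<in>carrier V. f (c \<odot>\<^bsub>V\<^esub> x) = cnj c \<odot>\<^bsub>W\<^esub> f x)"


section \<open>Star-Hopf algebras and their twists\<close>

record 'a bialg = "(complex, 'a vuniv) module" +
  coprod :: "'a vuniv \<Rightarrow> 'a vuniv"
  counit :: "'a vuniv \<Rightarrow> complex"

record 'a star_hopf = "'a bialg" +
  antipode :: "'a vuniv \<Rightarrow> 'a vuniv"
  star :: "'a vuniv \<Rightarrow> 'a vuniv"

text \<open>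
  The part of a quasi-Hopf algebra that determines its monoidal category of modules;
  \<open>reassoc A\<close> is an element of \<open>A \<otimes> (A \<otimes> A)\<close>, which serves as the triple tensor power throughout.
\<close>

record 'a quasi_bialg = "'a bialg" +
  reassoc :: "'a vuniv"

locale complex_algebra = ring A + Module.module complex_ring A
  for A :: "(complex, 'a vuniv, 'b) module_scheme" (structure) +
  assumes smult_mult_left: "\<lbrakk>x \<in> carrier A; y \<in> carrier A\<rbrakk> \<Longrightarrow> (c \<odot> x) \<otimes> y = c \<odot> (x \<otimes> y)"
    and smult_mult_right: "\<lbrakk>x \<in> carrier A; y \<in> carrier A\<rbrakk> \<Longrightarrow> x \<otimes> (c \<odot> y) = c \<odot> (x \<otimes> y)"

locale star_hopf_algebra = complex_algebra H for H :: "'a star_hopf" (structure) +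
  assumes coprod_linear: "linear_map H (H \<otimes>\<^sub>v H) (coprod H)"
    and coprod_mult: "\<lbrakk>x \<in> carrier H; y \<in> carrier H\<rbrakk>
        \<Longrightarrow> coprod H (x \<otimes> y) = coprod H x \<otimes>\<^bsub>H \<otimes>\<^sub>v H\<^esub> coprod H y"
    and coprod_one: "coprod H \<one> = \<one>\<^bsub>H \<otimes>\<^sub>v H\<^esub>"
    and counit_add: "\<lbrakk>x \<in> carrier H; y \<in> carrier H\<rbrakk> \<Longrightarrow> counit H (x \<oplus> y) = counit H x + counit H y"
    and counit_smult: "x \<in> carrier H \<Longrightarrow> counit H (c \<odot> x) = c * counit H x"
    and counit_mult: "\<lbrakk>x \<in> carrier H; y \<in> carrier H\<rbrakk> \<Longrightarrow> counit H (x \<otimes> y) = counit H x * counit H y"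
    and counit_one: "counit H \<one> = 1"
    and coassoc: "h \<in> carrier H
        \<Longrightarrow> tensor_map H (H \<otimes>\<^sub>v H) (\<lambda>x. x) (coprod H) (coprod H h)
          = tensor_assoc H H H (tensor_map (H \<otimes>\<^sub>v H) H (coprod H) (\<lambda>x. x) (coprod H h))"
    and counit_left: "h \<in> carrier H \<Longrightarrow> tensor_lift H (\<lambda>x y. counit H x \<odot> y) (coprod H h) = h"
    and counit_right: "h \<in> carrier H \<Longrightarrow> tensor_lift H (\<lambda>x y. counit H y \<odot> x) (coprod H h) = h"
    and antipode_linear: "linear_map H H (antipode H)"
    and antipode_left: "h \<in> carrier H
        \<Longrightarrow> tensor_lift H (\<lambda>x y. antipode H x \<otimes> y) (coprod H h) = counit H h \<odot> \<one>"
    and antipode_right: "h \<in> carrier H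
        \<Longrightarrow> tensor_lift H (\<lambda>x y. x \<otimes> antipode H y) (coprod H h) = counit H h \<odot> \<one>"
    and star_antilinear: "antilinear_map H H (star H)"
    and star_mult: "\<lbrakk>x \<in> carrier H; y \<in> carrier H\<rbrakk> \<Longrightarrow> star H (x \<otimes> y) = star H y \<otimes> star H x"
    and star_star: "x \<in> carrier H \<Longrightarrow> star H (star H x) = x"
    and coprod_star: "x \<in> carrier H
        \<Longrightarrow> coprod H (star H x) = tensor_map H H (star H) (star H) (coprod H x)"

definition hopf_quasi :: "'a star_hopf \<Rightarrow> 'a quasi_bialg" where
  "hopf_quasi H = bialg.extend (bialg.truncate H) (quasi_bialg.fields \<one>\<^bsub>H \<otimes>\<^sub>v H \<otimes>\<^sub>v H\<^esub>)"

text \<open>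
  The associator \<open>(1 \<otimes> F) ((id \<otimes> \<Delta>) F) ((\<Delta> \<otimes> id) F\<inverse>) (F\<inverse> \<otimes> 1)\<close> of the twist.
\<close>

definition twist_assoc :: "'a star_hopf \<Rightarrow> 'a vuniv \<Rightarrow> 'a vuniv" where
  "twist_assoc H F =
    pure H (H \<otimes>\<^sub>v H) \<one>\<^bsub>H\<^esub> F
    \<otimes>\<^bsub>H \<otimes>\<^sub>v H \<otimes>\<^sub>v H\<^esub> tensor_map H (H \<otimes>\<^sub>v H) (\<lambda>x. x) (coprod H) F
    \<otimes>\<^bsub>H \<otimes>\<^sub>v H \<otimes>\<^sub>v H\<^esub> tensor_assoc H H H
          (tensor_map (H \<otimes>\<^sub>v H) H (coprod H) (\<lambda>x. x) (inv\<^bsub>H \<otimes>\<^sub>v H\<^esub> F))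
    \<otimes>\<^bsub>H \<otimes>\<^sub>v H \<otimes>\<^sub>v H\<^esub> tensor_assoc H H H (pure (H \<otimes>\<^sub>v H) H (inv\<^bsub>H \<otimes>\<^sub>v H\<^esub> F) \<one>\<^bsub>H\<^esub>)"

definition twist :: "'a star_hopf \<Rightarrow> 'a vuniv \<Rightarrow> 'a quasi_bialg" where
  "twist H F = bialg.extend
    ((bialg.truncate H)
      \<lparr>coprod := \<lambda>h. F \<otimes>\<^bsub>H \<otimes>\<^sub>v H\<^esub> coprod H h \<otimes>\<^bsub>H \<otimes>\<^sub>v H\<^esub> inv\<^bsub>H \<otimes>\<^sub>v H\<^esub> F\<rparr>)
    (quasi_bialg.fields (twist_assoc H F))"


section \<open>The category of modules\<close>

record 'a hmod = "(complex, 'a vuniv) module" +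
  act :: "'a vuniv \<Rightarrow> 'a vuniv \<Rightarrow> 'a vuniv"

locale left_module = Module.module complex_ring X
  for A :: "(complex, 'a vuniv, 'b) module_scheme" and X :: "'a hmod" +
  assumes act_linear: "h \<in> carrier A \<Longrightarrow> linear_map X X (act X h)"
    and act_add: "\<lbrakk>h \<in> carrier A; k \<in> carrier A; x \<in> carrier X\<rbrakk>
        \<Longrightarrow> act X (h \<oplus>\<^bsub>A\<^esub> k) x = act X h x \<oplus>\<^bsub>X\<^esub> act X k x"
    and act_smult: "\<lbrakk>h \<in> carrier A; x \<in> carrier X\<rbrakk>
        \<Longrightarrow> act X (c \<odot>\<^bsub>A\<^esub> h) x = c \<odot>\<^bsub>X\<^esub> act X h x"
    and act_mult: "\<lbrakk>h \<in> carrier A; k \<in> carrier A; x \<in> carrier X\<rbrakk>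
        \<Longrightarrow> act X (h \<otimes>\<^bsub>A\<^esub> k) x = act X h (act X k x)"
    and act_one: "x \<in> carrier X \<Longrightarrow> act X \<one>\<^bsub>A\<^esub> x = x"

record 'a harr =
  src :: "'a hmod"
  trg :: "'a hmod"
  fn :: "'a vuniv \<Rightarrow> 'a vuniv"

definition tensor_mod :: "'a quasi_bialg \<Rightarrow> 'a hmod \<Rightarrow> 'a hmod \<Rightarrow> 'a hmod" where
  "tensor_mod A X Y = module.extend (X \<otimes>\<^sub>v Y)
    (hmod.fields (\<lambda>h\<in>carrier A. \<lambda>t\<in>carrier (X \<otimes>\<^sub>v Y). tensor_act X Y (act X) (act Y) (coprod A h) t))"

definition unit_mod :: "'a quasi_bialg \<Rightarrow> 'a hmod" where
  "unit_mod A =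
    \<lparr>carrier = range Scalar,
     mult = (\<lambda>s t. Scalar (scalar_of s * scalar_of t)),
     one = Scalar 1,
     zero = Scalar 0,
     add = (\<lambda>s t. Scalar (scalar_of s + scalar_of t)),
     smult = (\<lambda>c s. Scalar (c * scalar_of s)),
     act = (\<lambda>h\<in>carrier A. \<lambda>s\<in>range Scalar. Scalar (counit A h * scalar_of s))\<rparr>"

definition module_category :: "'a quasi_bialg \<Rightarrow> ('a hmod, 'a harr) moncat" where
  "module_category A =
    \<lparr>Ob = {X. left_module A X},
     Hom = (\<lambda>X Y. {u. src u = X \<and> trg u = Y \<and> fn u \<in> extensional (carrier X)
        \<and> linear_map X Y (fn u)
        \<and> (\<forall>h\<in>carrier A. \<forall>x\<in>carrier X. fn u (act X h x) = act Y h (fn u x))}),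
     Idm = (\<lambda>X. \<lparr>src = X, trg = X, fn = (\<lambda>x\<in>carrier X. x)\<rparr>),
     Comp = (\<lambda>v u. \<lparr>src = src u, trg = trg v, fn = compose (carrier (src u)) (fn v) (fn u)\<rparr>),
     TensO = tensor_mod A,
     TensM = (\<lambda>u v. \<lparr>src = tensor_mod A (src u) (src v), trg = tensor_mod A (trg u) (trg v),
        fn = (\<lambda>t\<in>carrier (src u \<otimes>\<^sub>v src v). tensor_map (trg u) (trg v) (fn u) (fn v) t)\<rparr>),
     Unit = unit_mod A,
     Assoc = (\<lambda>X Y Z.
        \<lparr>src = tensor_mod A (tensor_mod A X Y) Z, trg = tensor_mod A X (tensor_mod A Y Z),
         fn = (\<lambda>t\<in>carrier ((X \<otimes>\<^sub>v Y) \<otimes>\<^sub>v Z).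
           tensor_act X (Y \<otimes>\<^sub>v Z) (act X) (tensor_act Y Z (act Y) (act Z)) (reassoc A)
             (tensor_assoc X Y Z t))\<rparr>),
     Lun = (\<lambda>X. \<lparr>src = X, trg = tensor_mod A X (unit_mod A),
        fn = (\<lambda>x\<in>carrier X. pure X (unit_mod A) x (Scalar 1))\<rparr>),
     Run = (\<lambda>X. \<lparr>src = X, trg = tensor_mod A (unit_mod A) X,
        fn = (\<lambda>x\<in>carrier X. pure (unit_mod A) X (Scalar 1) x)\<rparr>)\<rparr>"

text \<open>
  The conjugate space has the same elements, so \<open>bar x\<close> and \<open>x\<close>, and likewise a map and its bar, coincide as elements and functions.
\<close>

definition bar_mod :: "'a quasi_bialg \<Rightarrow> ('a vuniv \<Rightarrow> 'a vuniv) \<Rightarrow> 'a hmod \<Rightarrow> 'a hmod" where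
  "bar_mod A T X = X\<lparr>smult := \<lambda>c. smult X (cnj c),
     act := \<lambda>h\<in>carrier A. \<lambda>x\<in>carrier X. act X (T h) x\<rparr>"

text \<open>
  The operations of a bar category given by
  \<open>h \<triangleright> bar x = bar (T h \<triangleright> x)\<close>, \<open>bb x = bar (bar (\<gamma> \<triangleright> x))\<close> and
  \<open>\<Upsilon> (bar (x \<otimes> y)) = bar (G\<^sup>2 \<triangleright> y) \<otimes> bar (G\<^sup>1 \<triangleright> x)\<close> for \<open>G = G\<^sup>1 \<otimes> G\<^sup>2\<close> (a sum).
\<close>

definition bar_structure ::
  "'a quasi_bialg \<Rightarrow> ('a vuniv \<Rightarrow> 'a vuniv) \<Rightarrow> 'a vuniv \<Rightarrow> 'a vuniv \<Rightarrow> ('a hmod, 'a harr) barstr" where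
  "bar_structure A T \<gamma> G =
    \<lparr>barO = bar_mod A T,
     barM = (\<lambda>u. \<lparr>src = bar_mod A T (src u), trg = bar_mod A T (trg u), fn = fn u\<rparr>),
     bbM = (\<lambda>X. \<lparr>src = X, trg = bar_mod A T (bar_mod A T X), fn = (\<lambda>x\<in>carrier X. act X \<gamma> x)\<rparr>),
     starM = \<lparr>src = unit_mod A, trg = bar_mod A T (unit_mod A),
        fn = (\<lambda>s\<in>range Scalar. Scalar (cnj (scalar_of s)))\<rparr>,
     Ups = (\<lambda>X Y.
        let Xb = bar_mod A T X; Yb = bar_mod A T Y in
        \<lparr>src = bar_mod A T (tensor_mod A X Y), trg = tensor_mod A Yb Xb,
         fn = (\<lambda>t\<in>carrier (X \<otimes>\<^sub>v Y).
           tensor_lift (Yb \<otimes>\<^sub>v Xb)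
             (\<lambda>x y. tensor_lift (Yb \<otimes>\<^sub>v Xb) (\<lambda>a b. pure Yb Xb (act Y b y) (act X a x)) G) t)\<rparr>)\<rparr>"

text \<open>
  For \<open>\<gamma> = 1\<close> and \<open>G = 1 \<otimes> 1\<close> these are \<open>bb x = bar (bar x)\<close> and
  \<open>\<Upsilon> (bar (x \<otimes> y)) = bar y \<otimes> bar x\<close>.
\<close>

definition hopf_bar_structure :: "'a star_hopf \<Rightarrow> ('a hmod, 'a harr) barstr" where
  "hopf_bar_structure H = bar_structure (hopf_quasi H)
    (\<lambda>h. inv_into (carrier H) (antipode H) (star H h)) \<one>\<^bsub>H\<^esub> \<one>\<^bsub>H \<otimes>\<^sub>v H\<^esub>"

definition twist_iso :: "'a star_hopf \<Rightarrow> 'a vuniv \<Rightarrow> 'a hmod \<Rightarrow> 'a hmod \<Rightarrow> 'a harr" where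
  "twist_iso H F X Y =
    \<lparr>src = tensor_mod (twist H F) X Y, trg = tensor_mod (hopf_quasi H) X Y,
     fn = (\<lambda>t\<in>carrier (X \<otimes>\<^sub>v Y). tensor_act X Y (act X) (act Y) (inv\<^bsub>H \<otimes>\<^sub>v H\<^esub> F) t)\<rparr>"

definition twist_fb ::
  "'a star_hopf \<Rightarrow> ('a hmod, 'a harr) barstr \<Rightarrow> 'a vuniv \<Rightarrow> 'a hmod \<Rightarrow> 'a harr" where
  "twist_fb H E \<phi> X =
    \<lparr>src = barO E X, trg = barO (hopf_bar_structure H) X, fn = (\<lambda>x\<in>carrier X. act X \<phi> x)\<rparr>"

definition antilinear_algebra_hom :: "'a star_hopf \<Rightarrow> ('a vuniv \<Rightarrow> 'a vuniv) \<Rightarrow> bool" where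
  "antilinear_algebra_hom H T \<longleftrightarrow> antilinear_map H H T
    \<and> (\<forall>h\<in>carrier H. \<forall>k\<in>carrier H. T (h \<otimes>\<^bsub>H\<^esub> k) = T h \<otimes>\<^bsub>H\<^esub> T k) \<and> T \<one>\<^bsub>H\<^esub> = \<one>\<^bsub>H\<^esub>"

text \<open>
  The twisting functor is the identity on objects and morphisms, since modules over \<open>H\<close> and over
  the twist, which has the same underlying algebra, are the same.
\<close>

definition twisted_bar_data ::
  "'a star_hopf \<Rightarrow> 'a vuniv \<Rightarrow> 'a vuniv \<Rightarrow> ('a vuniv \<Rightarrow> 'a vuniv) \<Rightarrow> 'a vuniv \<Rightarrow> 'a vuniv \<Rightarrow> bool" where
  "twisted_bar_data H F \<phi> T \<gamma> G \<longleftrightarrow>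
    antilinear_algebra_hom H T \<and> \<gamma> \<in> carrier H \<and> G \<in> carrier (H \<otimes>\<^sub>v H) \<and>
    (let E = bar_structure (twist H F) T \<gamma> G in
      strong_bar_category (module_category (twist H F)) E \<and>
      bar_functor (module_category (hopf_quasi H)) (hopf_bar_structure H)
        (module_category (twist H F)) E (\<lambda>X. X) (\<lambda>u. u) (twist_iso H F) (twist_fb H E \<phi>))"

end

theory Submission
  imports Defs
begin

text \<open>
  The map \<open>* S\<close> is an antilinear involutive algebra automorphism which reverses the coproduct, so that for
  modules over \<open>H\<close> the flip of tensor factors and the identity give a strong bar category. Modules over \<open>H\<close>
  and over the twist form the same category with two tensor products, and acting with \<open>F\<inverse>\<close> is a natural
  isomorphism \<open>f\<close> between these. All structure is transported along \<open>f\<close> and along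
  the action of \<open>\<phi>\<close> on conjugate modules: the associator of the twist is \<open>f\<close>-conjugate to that of vector spaces, and
  \<open>\<Upsilon>\<close> becomes \<open>(\<phi>\<inverse> \<otimes> \<phi>\<inverse>) f\<inverse> flip \<phi> f\<close>, which is the action of \<open>G\<close> followed by the flip. Every axiom
  follows by composing both sides with invertible untwisting maps, under which it becomes the axiom for the flip.
  Conversely, the axioms of a functor of bar categories for the regular module, evaluated at \<open>1\<close>, force the
  invertibility of \<open>\<phi>\<close> and the formulas.
\<close>

section \<open>Complex vector spaces and their tensor products\<close>

text \<open>The formulas are solutions of equations. Let \<open>sS\<close> be antipode followed by
  star. Equivariance of \<open>fb\<close> says
  \<open>\<phi> \<otimes> T h = sS h \<otimes> \<phi>\<close>, its compatibility with
  \<open>bb\<close> says \<open>sS \<phi> \<otimes> (\<phi> \<otimes> \<gamma>) = \<one>\<close>,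
  and its compatibility with \<Upsilon> places \<open>G\<close> between invertible factors. So an
  invertible \<phi> leaves one candidate, and sufficiency is a check of that candidate. The
  condition \<epsilon>(\<phi>) = 1 comes from the unit: \<star> is the same conjugation on both
  sides of the functor, which leaves no room for a scalar in \<Upsilon> on a product with the unit
  module.

  Working with maps instead of elements avoids identities in higher tensor powers of
  \<open>H\<close>: the four factors of the associator of the twist act as two maps
  \<open>tw\<close> before and two maps \<open>un\<close> after the associator of spaces, so a
  coherence axiom reduces to naturality of \<open>tw\<close> and its injectivity.

  That \<open>sS\<close> is an involution is derived from the Hopf axioms. It gives injectivity of
  the antipode, makes the identity of spaces an admissible \<open>bb\<close> over \<open>H\<close>,
  and makes the square of \<open>T\<close> inner.\<close>

abbreviation vsp :: "(complex, 'a vuniv, 'b) module_scheme \<Rightarrow> bool" where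
  "vsp \<equiv> Module.module complex_ring"

lemma complex_ring_simps [simp]:
  "carrier complex_ring = UNIV" "mult complex_ring = (*)" "one complex_ring = 1"
  "zero complex_ring = 0" "add complex_ring = (+)"
  by (simp_all add: complex_ring_def)

lemma cring_complex_ring: "cring complex_ring"
proof (rule cringI)
  show "abelian_group complex_ring"
  proof (rule abelian_groupI)
    fix x :: complex
    show "\<exists>y\<in>carrier complex_ring. y \<oplus>\<^bsub>complex_ring\<^esub> x = \<zero>\<^bsub>complex_ring\<^esub>"
      by (auto intro!: exI[of _ "- x"])
  qed auto
  show "comm_monoid complex_ring" by (rule comm_monoidI) auto
qed (auto simp: algebra_simps)

lemma vsp_closed [simp]:
  assumes "vsp V"
  shows "\<zero>\<^bsub>V\<^esub> \<in> carrier V"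
    and "\<lbrakk>x \<in> carrier V; y \<in> carrier V\<rbrakk> \<Longrightarrow> x \<oplus>\<^bsub>V\<^esub> y \<in> carrier V"
    and "x \<in> carrier V \<Longrightarrow> c \<odot>\<^bsub>V\<^esub> x \<in> carrier V"
proof -
  interpret Module.module complex_ring V by fact
  show "\<zero>\<^bsub>V\<^esub> \<in> carrier V" "\<lbrakk>x \<in> carrier V; y \<in> carrier V\<rbrakk> \<Longrightarrow> x \<oplus>\<^bsub>V\<^esub> y \<in> carrier V"
    by simp_all
  show "x \<in> carrier V \<Longrightarrow> c \<odot>\<^bsub>V\<^esub> x \<in> carrier V" using smult_closed[of c x] by simp
qed

lemma vsp_add:
  assumes "vsp V" "x \<in> carrier V" "y \<in> carrier V"
  shows vsp_add_comm: "x \<oplus>\<^bsub>V\<^esub> y = y \<oplus>\<^bsub>V\<^esub> x"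
    and vsp_add_assoc: "z \<in> carrier V \<Longrightarrow> (x \<oplus>\<^bsub>V\<^esub> y) \<oplus>\<^bsub>V\<^esub> z = x \<oplus>\<^bsub>V\<^esub> (y \<oplus>\<^bsub>V\<^esub> z)"
    and vsp_add_lcomm: "z \<in> carrier V \<Longrightarrow> x \<oplus>\<^bsub>V\<^esub> (y \<oplus>\<^bsub>V\<^esub> z) = y \<oplus>\<^bsub>V\<^esub> (x \<oplus>\<^bsub>V\<^esub> z)"
proof -
  interpret Module.module complex_ring V by fact
  note assms [simp]
  show "x \<oplus>\<^bsub>V\<^esub> y = y \<oplus>\<^bsub>V\<^esub> x" by (rule M.a_comm) auto
  show "(x \<oplus>\<^bsub>V\<^esub> y) \<oplus>\<^bsub>V\<^esub> z = x \<oplus>\<^bsub>V\<^esub> (y \<oplus>\<^bsub>V\<^esub> z)" if "z \<in> carrier V"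
    using that by (intro M.a_assoc) auto
  show "x \<oplus>\<^bsub>V\<^esub> (y \<oplus>\<^bsub>V\<^esub> z) = y \<oplus>\<^bsub>V\<^esub> (x \<oplus>\<^bsub>V\<^esub> z)" if "z \<in> carrier V"
    using that by (intro M.a_lcomm) auto
qed

lemma vsp_zero [simp]:
  assumes "vsp V"
  shows "x \<in> carrier V \<Longrightarrow> \<zero>\<^bsub>V\<^esub> \<oplus>\<^bsub>V\<^esub> x = x"
    and "x \<in> carrier V \<Longrightarrow> x \<oplus>\<^bsub>V\<^esub> \<zero>\<^bsub>V\<^esub> = x"
    and "x \<in> carrier V \<Longrightarrow> 0 \<odot>\<^bsub>V\<^esub> x = \<zero>\<^bsub>V\<^esub>"
    and "c \<odot>\<^bsub>V\<^esub> \<zero>\<^bsub>V\<^esub> = \<zero>\<^bsub>V\<^esub>"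
    and "x \<in> carrier V \<Longrightarrow> 1 \<odot>\<^bsub>V\<^esub> x = x"
proof -
  interpret Module.module complex_ring V by fact
  show "x \<in> carrier V \<Longrightarrow> \<zero>\<^bsub>V\<^esub> \<oplus>\<^bsub>V\<^esub> x = x" "x \<in> carrier V \<Longrightarrow> x \<oplus>\<^bsub>V\<^esub> \<zero>\<^bsub>V\<^esub> = x" by simp_all
  show "x \<in> carrier V \<Longrightarrow> 0 \<odot>\<^bsub>V\<^esub> x = \<zero>\<^bsub>V\<^esub>" using smult_l_null[of x] by simp
  show "c \<odot>\<^bsub>V\<^esub> \<zero>\<^bsub>V\<^esub> = \<zero>\<^bsub>V\<^esub>" using smult_r_null[of c] by simp
  show "x \<in> carrier V \<Longrightarrow> 1 \<odot>\<^bsub>V\<^esub> x = x" using smult_one[of x] by simp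
qed

lemma vsp_smult:
  assumes "vsp V" "x \<in> carrier V"
  shows vsp_smult_l_distr: "(a + b) \<odot>\<^bsub>V\<^esub> x = a \<odot>\<^bsub>V\<^esub> x \<oplus>\<^bsub>V\<^esub> b \<odot>\<^bsub>V\<^esub> x"
    and vsp_smult_r_distr: "y \<in> carrier V \<Longrightarrow> a \<odot>\<^bsub>V\<^esub> (x \<oplus>\<^bsub>V\<^esub> y) = a \<odot>\<^bsub>V\<^esub> x \<oplus>\<^bsub>V\<^esub> a \<odot>\<^bsub>V\<^esub> y"
    and vsp_smult_assoc: "a \<odot>\<^bsub>V\<^esub> (b \<odot>\<^bsub>V\<^esub> x) = (a * b) \<odot>\<^bsub>V\<^esub> x"
proof -
  interpret Module.module complex_ring V by fact
  note assms [simp]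
  show "(a + b) \<odot>\<^bsub>V\<^esub> x = a \<odot>\<^bsub>V\<^esub> x \<oplus>\<^bsub>V\<^esub> b \<odot>\<^bsub>V\<^esub> x" using smult_l_distr[of a b x] by simp
  show "a \<odot>\<^bsub>V\<^esub> (x \<oplus>\<^bsub>V\<^esub> y) = a \<odot>\<^bsub>V\<^esub> x \<oplus>\<^bsub>V\<^esub> a \<odot>\<^bsub>V\<^esub> y" if "y \<in> carrier V"
    using smult_r_distr[of a x y] that by simp
  show "a \<odot>\<^bsub>V\<^esub> (b \<odot>\<^bsub>V\<^esub> x) = (a * b) \<odot>\<^bsub>V\<^esub> x" using smult_assoc1[of a b x] by simp
qed

text \<open>Negatives come from the scalars: \<open>(- 1) \<odot> x\<close> added to
  \<open>1 \<odot> x\<close> gives \<open>0 \<odot> x\<close>, so the laws for scalars already make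
  the additive structure a group.\<close>

lemma vspI:
  fixes V (structure)
  assumes "\<zero> \<in> carrier V"
    and "\<And>x y. \<lbrakk>x \<in> carrier V; y \<in> carrier V\<rbrakk> \<Longrightarrow> x \<oplus> y \<in> carrier V"
    and "\<And>x y z. \<lbrakk>x \<in> carrier V; y \<in> carrier V; z \<in> carrier V\<rbrakk> \<Longrightarrow> (x \<oplus> y) \<oplus> z = x \<oplus> (y \<oplus> z)"
    and "\<And>x y. \<lbrakk>x \<in> carrier V; y \<in> carrier V\<rbrakk> \<Longrightarrow> x \<oplus> y = y \<oplus> x"
    and "\<And>x. x \<in> carrier V \<Longrightarrow> \<zero> \<oplus> x = x"
    and "\<And>c x. x \<in> carrier V \<Longrightarrow> c \<odot> x \<in> carrier V"
    and "\<And>a b x. x \<in> carrier V \<Longrightarrow> (a + b) \<odot> x = a \<odot> x \<oplus> b \<odot> x"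
    and "\<And>a x y. \<lbrakk>x \<in> carrier V; y \<in> carrier V\<rbrakk> \<Longrightarrow> a \<odot> (x \<oplus> y) = a \<odot> x \<oplus> a \<odot> y"
    and "\<And>a b x. x \<in> carrier V \<Longrightarrow> (a * b) \<odot> x = a \<odot> (b \<odot> x)"
    and "\<And>x. x \<in> carrier V \<Longrightarrow> 1 \<odot> x = x"
    and "\<And>x. x \<in> carrier V \<Longrightarrow> 0 \<odot> x = \<zero>"
  shows "vsp V"
proof (rule moduleI)
  show "abelian_group V"
  proof (rule abelian_groupI)
    fix x assume x: "x \<in> carrier V"
    have "(- 1) \<odot> x \<oplus> 1 \<odot> x = \<zero>"
      using assms(7)[OF x, of "- 1" 1] assms(11)[OF x] by simp
    then show "\<exists>y\<in>carrier V. y \<oplus> x = \<zero>"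
      using assms(6,10) x by (intro bexI[of _ "(- 1) \<odot> x"]) auto
  qed (use assms in auto)
qed (use assms cring_complex_ring in auto)

subsection \<open>Linear and bilinear maps\<close>

lemma linear_mapI:
  assumes "\<And>x. x \<in> carrier V \<Longrightarrow> f x \<in> carrier W"
    and "\<And>x y. \<lbrakk>x \<in> carrier V; y \<in> carrier V\<rbrakk> \<Longrightarrow> f (x \<oplus>\<^bsub>V\<^esub> y) = f x \<oplus>\<^bsub>W\<^esub> f y"
    and "\<And>c x. x \<in> carrier V \<Longrightarrow> f (c \<odot>\<^bsub>V\<^esub> x) = c \<odot>\<^bsub>W\<^esub> f x"
  shows "linear_map V W f"
  using assms by (auto simp: linear_map_def)

lemma linear_mapD:
  assumes "linear_map V W f"
  shows linear_closed: "x \<in> carrier V \<Longrightarrow> f x \<in> carrier W"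
    and linear_add: "\<lbrakk>x \<in> carrier V; y \<in> carrier V\<rbrakk> \<Longrightarrow> f (x \<oplus>\<^bsub>V\<^esub> y) = f x \<oplus>\<^bsub>W\<^esub> f y"
    and linear_smult: "x \<in> carrier V \<Longrightarrow> f (c \<odot>\<^bsub>V\<^esub> x) = c \<odot>\<^bsub>W\<^esub> f x"
  using assms by (auto simp: linear_map_def)

lemma linear_zero:
  assumes "linear_map V W f" "vsp V" "vsp W"
  shows "f \<zero>\<^bsub>V\<^esub> = \<zero>\<^bsub>W\<^esub>"
  using linear_smult[OF assms(1), of "\<zero>\<^bsub>V\<^esub>" 0] linear_closed[OF assms(1), of "\<zero>\<^bsub>V\<^esub>"] assms by simp

lemma linear_cong:
  assumes "linear_map V W f" "vsp V" "\<And>x. x \<in> carrier V \<Longrightarrow> f x = g x"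
  shows "linear_map V W g"
  using assms(1) assms(2) by (auto simp: linear_map_def assms(3)[symmetric])

lemma linear_id: "linear_map V V (\<lambda>x. x)"
  by (auto simp: linear_map_def)

lemma linear_comp: "\<lbrakk>linear_map V W g; linear_map W U f\<rbrakk> \<Longrightarrow> linear_map V U (\<lambda>x. f (g x))"
  by (auto simp: linear_map_def Pi_iff)

lemma linear_sum:
  assumes "vsp W" "linear_map V W f" "linear_map V W g"
  shows "linear_map V W (\<lambda>x. f x \<oplus>\<^bsub>W\<^esub> g x)"
  using assms by (auto intro!: linear_mapI simp: linear_mapD vsp_add vsp_smult_r_distr)

lemma linear_scale:
  assumes "vsp W" "linear_map V W f"
  shows "linear_map V W (\<lambda>x. c \<odot>\<^bsub>W\<^esub> f x)"
  using assms by (auto intro!: linear_mapI simp: linear_mapD vsp_smult mult.commute)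

lemma linear_const_zero: "vsp W \<Longrightarrow> linear_map V W (\<lambda>x. \<zero>\<^bsub>W\<^esub>)"
  by (auto intro!: linear_mapI)

definition blin ::
  "(complex, 'a vuniv, 'b) module_scheme \<Rightarrow> (complex, 'a vuniv, 'c) module_scheme
    \<Rightarrow> (complex, 'a vuniv, 'd) module_scheme \<Rightarrow> ('a vuniv \<Rightarrow> 'a vuniv \<Rightarrow> 'a vuniv) \<Rightarrow> bool" where
  "blin V W U \<beta> \<longleftrightarrow> (\<forall>y\<in>carrier W. linear_map V U (\<lambda>x. \<beta> x y)) \<and> (\<forall>x\<in>carrier V. linear_map W U (\<beta> x))"

lemma blinI:
  assumes "\<And>y. y \<in> carrier W \<Longrightarrow> linear_map V U (\<lambda>x. \<beta> x y)"
    and "\<And>x. x \<in> carrier V \<Longrightarrow> linear_map W U (\<lambda>y. \<beta> x y)"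
  shows "blin V W U \<beta>"
  using assms by (auto simp: blin_def)

lemma blinD:
  assumes "blin V W U \<beta>"
  shows blin_left: "y \<in> carrier W \<Longrightarrow> linear_map V U (\<lambda>x. \<beta> x y)"
    and blin_right: "x \<in> carrier V \<Longrightarrow> linear_map W U (\<lambda>y. \<beta> x y)"
    and blin_closed: "\<lbrakk>x \<in> carrier V; y \<in> carrier W\<rbrakk> \<Longrightarrow> \<beta> x y \<in> carrier U"
  using assms by (auto simp: blin_def linear_mapD)

subsection \<open>The tensor product\<close>

text \<open>\<open>tensor_lift\<close> reads off one chosen representative of a class.
  \<open>lsum\<close> is the same sum over an arbitrary list, which is what a statement of
  independence of the representative has to speak about.\<close>

definition lsum ::
  "(complex, 'a vuniv, 'b) module_scheme \<Rightarrow> ('a vuniv \<Rightarrow> 'a vuniv \<Rightarrow> 'a vuniv)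
    \<Rightarrow> ('a vuniv \<times> 'a vuniv) list \<Rightarrow> 'a vuniv" where
  "lsum U \<beta> l = foldr (\<lambda>(x, y) s. \<beta> x y \<oplus>\<^bsub>U\<^esub> s) l \<zero>\<^bsub>U\<^esub>"

lemma lsum_simps [simp]:
  "lsum U \<beta> [] = \<zero>\<^bsub>U\<^esub>" "lsum U \<beta> ((x, y) # l) = \<beta> x y \<oplus>\<^bsub>U\<^esub> lsum U \<beta> l"
  by (simp_all add: lsum_def)

lemma tensor_lift_lsum: "tensor_lift U \<beta> t = lsum U \<beta> (terms t)"
  by (simp add: tensor_lift_def lsum_def)

lemma lsum_closed:
  assumes "vsp U" "\<And>x y. (x, y) \<in> set l \<Longrightarrow> \<beta> x y \<in> carrier U"
  shows "lsum U \<beta> l \<in> carrier U"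
  using assms(2) by (induction l) (auto simp: assms(1))

lemma lsum_append:
  assumes "vsp U" "\<And>x y. (x, y) \<in> set k \<union> set l \<Longrightarrow> \<beta> x y \<in> carrier U"
  shows "lsum U \<beta> (k @ l) = lsum U \<beta> k \<oplus>\<^bsub>U\<^esub> lsum U \<beta> l"
  using assms(2)
proof (induction k)
  case (Cons p k)
  then show ?case
    using assms(1) lsum_closed[OF assms(1), of k \<beta>] lsum_closed[OF assms(1), of l \<beta>]
    by (cases p) (auto simp: vsp_add)
qed (simp add: assms(1) lsum_closed)

lemma lsum_cong:
  assumes "\<And>x y. (x, y) \<in> set l \<Longrightarrow> \<beta> x y = \<beta>' x y"
  shows "lsum U \<beta> l = lsum U \<beta>' l"
  using assms by (induction l) auto

lemma lsum_linear:
  assumes f: "linear_map U U' f" and V: "vsp U" "vsp U'"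
    and "\<And>x y. (x, y) \<in> set l \<Longrightarrow> \<beta> x y \<in> carrier U"
  shows "f (lsum U \<beta> l) = lsum U' (\<lambda>x y. f (\<beta> x y)) l"
  using assms(4)
proof (induction l)
  case (Cons p l)
  then show ?case
    using lsum_closed[OF V(1), of l \<beta>] by (cases p) (auto simp: linear_add[OF f])
qed (simp add: linear_zero[OF f V])

lemma tensor_eq_closed:
  assumes "vsp V" "vsp W" "tensor_eq V W k l"
  shows "k \<in> lists (carrier V \<times> carrier W) \<and> l \<in> lists (carrier V \<times> carrier W)"
  using assms(3) by induction (auto simp: assms(1,2))

text \<open>Each generating relation is respected by a bilinear map, so the sum depends on the class
  only. This makes \<open>tensor_lift\<close> well defined and is the substance of the universal
  property.\<close>

lemma tensor_eq_lsum:
  assumes V: "vsp V" "vsp W" "vsp U" and \<beta>: "blin V W U \<beta>" and "tensor_eq V W k l"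
  shows "lsum U \<beta> k = lsum U \<beta> l"
  using assms(5)
proof induction
  case (append k k' l l')
  have "\<beta> x y \<in> carrier U" if "(x, y) \<in> set k \<union> set k' \<union> set l \<union> set l'" for x y
    using that tensor_eq_closed[OF V(1,2) append(1)] tensor_eq_closed[OF V(1,2) append(2)]
    by (intro blin_closed[OF \<beta>]) (auto simp: in_lists_conv_set)
  then have "\<And>x y. (x, y) \<in> set k \<union> set l \<Longrightarrow> \<beta> x y \<in> carrier U"
      "\<And>x y. (x, y) \<in> set k' \<union> set l' \<Longrightarrow> \<beta> x y \<in> carrier U" by blast+
  then show ?case using append by (simp only: lsum_append[OF V(3)])
next
  case (commute k l)
  have c: "\<beta> x y \<in> carrier U" if "(x, y) \<in> set k \<union> set l" for x y
    using that commute by (intro blin_closed[OF \<beta>]) (auto simp: in_lists_conv_set)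
  then have "lsum U \<beta> k \<in> carrier U" "lsum U \<beta> l \<in> carrier U" by (auto intro!: lsum_closed V)
  moreover have "\<And>x y. (x, y) \<in> set l \<union> set k \<Longrightarrow> \<beta> x y \<in> carrier U" using c by blast
  ultimately show ?case using c by (simp only: lsum_append[OF V(3)] vsp_add_comm[OF V(3)])
next
  case (zero y)
  show ?case
    using linear_zero[OF blin_left[OF \<beta> zero] V(1,3)] V by simp
next
  case (add_left x x' y)
  then show ?case using linear_add[OF blin_left[OF \<beta> add_left(3)] add_left(1,2)] V
    by (simp add: blin_closed[OF \<beta>] vsp_add)
next
  case (add_right x y y')
  then show ?case using linear_add[OF blin_right[OF \<beta> add_right(1)] add_right(2,3)] V
    by (simp add: blin_closed[OF \<beta>] vsp_add)
next
  case (scale x y c)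
  then show ?case using linear_smult[OF blin_right[OF \<beta> scale(1)] scale(2)]
      linear_smult[OF blin_left[OF \<beta> scale(2)] scale(1)] V
    by (simp add: blin_closed[OF \<beta>])
qed auto

lemma tensor_class_eq:
  assumes "l \<in> lists (carrier V \<times> carrier W)"
  shows "tensor_eq V W l (terms (tensor_class V W l))"
  unfolding tensor_class_def using someI[of "tensor_eq V W l" l] tensor_eq.refl[OF assms] by simp

text \<open>Related lists are related to the same lists, so the choice operator in
  \<open>tensor_class\<close> picks the same representative for both.\<close>

lemma tensor_class_cong:
  assumes "tensor_eq V W k l"
  shows "tensor_class V W k = tensor_class V W l"
proof -
  have "tensor_eq V W k = tensor_eq V W l"
    using assms tensor_eq.sym tensor_eq.trans by blast
  then show ?thesis by (simp add: tensor_class_def)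
qed

lemma tensor_class_closed:
  "l \<in> lists (carrier V \<times> carrier W) \<Longrightarrow> tensor_class V W l \<in> carrier (V \<otimes>\<^sub>v W)"
  by (simp add: vtensor_def)

lemma terms_class:
  assumes "vsp V" "vsp W" "l \<in> lists (carrier V \<times> carrier W)"
  shows "terms (tensor_class V W l) \<in> lists (carrier V \<times> carrier W)"
  using tensor_eq_closed[OF assms(1,2) tensor_class_eq[OF assms(3)]] by simp

lemma class_terms:
  assumes "l \<in> lists (carrier V \<times> carrier W)"
  shows "tensor_class V W (terms (tensor_class V W l)) = tensor_class V W l"
  using tensor_class_cong[OF tensor_class_eq[OF assms]] by simp

lemma tensor_terms:
  assumes "vsp V" "vsp W" "t \<in> carrier (V \<otimes>\<^sub>v W)"
  shows "terms t \<in> lists (carrier V \<times> carrier W)" "tensor_class V W (terms t) = t"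
proof -
  obtain l where "l \<in> lists (carrier V \<times> carrier W)" "t = tensor_class V W l"
    using assms(3) by (auto simp: vtensor_def)
  then show "terms t \<in> lists (carrier V \<times> carrier W)" "tensor_class V W (terms t) = t"
    using terms_class[OF assms(1,2)] class_terms[of l V W] by simp_all
qed

lemma tensor_terms_mem:
  assumes "vsp V" "vsp W" "t \<in> carrier (V \<otimes>\<^sub>v W)" "(x, y) \<in> set (terms t)"
  shows "x \<in> carrier V" "y \<in> carrier W"
  using tensor_terms(1)[OF assms(1-3)] assms(4) by (auto simp: in_lists_conv_set)

lemma vtensor_add_class:
  assumes "vsp V" "vsp W" "k \<in> lists (carrier V \<times> carrier W)" "l \<in> lists (carrier V \<times> carrier W)"
  shows "tensor_class V W k \<oplus>\<^bsub>V \<otimes>\<^sub>v W\<^esub> tensor_class V W l = tensor_class V W (k @ l)"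
  using tensor_class_cong[OF tensor_eq.append[OF tensor_class_eq[OF assms(3)] tensor_class_eq[OF assms(4)]]]
  by (simp add: vtensor_def)

lemma vtensor_zero: "\<zero>\<^bsub>V \<otimes>\<^sub>v W\<^esub> = tensor_class V W []"
  by (simp add: vtensor_def)

abbreviation sc :: "(complex, 'a vuniv, 'b) module_scheme \<Rightarrow> complex
    \<Rightarrow> ('a vuniv \<times> 'a vuniv) list \<Rightarrow> ('a vuniv \<times> 'a vuniv) list" where
  "sc V c l \<equiv> [(c \<odot>\<^bsub>V\<^esub> x, y). (x, y) \<leftarrow> l]"

lemma sc_closed:
  "vsp V \<Longrightarrow> l \<in> lists (carrier V \<times> carrier W) \<Longrightarrow> sc V c l \<in> lists (carrier V \<times> carrier W)"
  by (induction l) auto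

lemma tensor_eq_sc:
  assumes V: "vsp V" "vsp W" and "tensor_eq V W k l"
  shows "tensor_eq V W (sc V c k) (sc V c l)"
  using assms(3)
proof induction
  case (refl k) then show ?case by (intro tensor_eq.refl sc_closed V)
next
  case (commute k l) then show ?case by (simp only: map_append concat_append, intro tensor_eq.commute sc_closed V)
next
  case (zero y) then show ?case using V by (auto intro: tensor_eq.zero)
next
  case (add_left x x' y)
  then show ?case using V by (auto simp: vsp_smult_r_distr intro: tensor_eq.add_left)
next
  case (add_right x y y')
  then show ?case using V by (auto intro: tensor_eq.add_right)
next
  case (scale x y a)
  have "c \<odot>\<^bsub>V\<^esub> (a \<odot>\<^bsub>V\<^esub> x) = a \<odot>\<^bsub>V\<^esub> (c \<odot>\<^bsub>V\<^esub> x)" using V scale by (simp add: vsp_smult mult.commute)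
  then show ?case using V scale by (auto intro: tensor_eq.scale)
qed (auto intro: tensor_eq.intros)

lemma vtensor_smult_class:
  assumes "vsp V" "vsp W" "l \<in> lists (carrier V \<times> carrier W)"
  shows "c \<odot>\<^bsub>V \<otimes>\<^sub>v W\<^esub> tensor_class V W l = tensor_class V W (sc V c l)"
  using tensor_class_cong[OF tensor_eq_sc[OF assms(1,2) tensor_class_eq[OF assms(3)]], of c]
  by (simp add: vtensor_def)

lemma sc_add:
  assumes V: "vsp V" "vsp W" and "l \<in> lists (carrier V \<times> carrier W)"
  shows "tensor_eq V W (sc V (a + b) l) (sc V a l @ sc V b l)"
  using assms(3)
proof (induction l)
  case (Cons p l)
  obtain x y where p: "p = (x, y)" "x \<in> carrier V" "y \<in> carrier W" using Cons by (cases p) auto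
  let ?A = "sc V a l" and ?B = "sc V b l" and ?a = "[(a \<odot>\<^bsub>V\<^esub> x, y)]" and ?b = "[(b \<odot>\<^bsub>V\<^esub> x, y)]"
  have mem: "?A \<in> lists (carrier V \<times> carrier W)" "?B \<in> lists (carrier V \<times> carrier W)"
    using sc_closed[OF V(1) Cons(2)] by auto
  have 1: "tensor_eq V W ([((a + b) \<odot>\<^bsub>V\<^esub> x, y)] @ sc V (a + b) l) ((?a @ ?b) @ (?A @ ?B))"
    using p V Cons(3) by (intro tensor_eq.append) (auto simp: vsp_smult_l_distr intro: tensor_eq.add_left)
  \<comment> \<open>Distributing term by term interleaves the two multiples; here \<open>?b\<close>
    moves past \<open>?A\<close>, so that all \<open>a\<close>-multiples come first.\<close>
  have 2: "tensor_eq V W (?a @ ((?b @ ?A) @ ?B)) (?a @ ((?A @ ?b) @ ?B))"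
    using p V mem by (intro tensor_eq.append tensor_eq.commute) (auto intro!: tensor_eq.refl)
  show ?case using tensor_eq.trans[OF 1] 2 p by simp
qed (auto intro: tensor_eq.refl)

lemma sc_zero:
  assumes V: "vsp V" "vsp W" and "l \<in> lists (carrier V \<times> carrier W)"
  shows "tensor_eq V W (sc V 0 l) []"
  using assms(3)
proof (induction l)
  case (Cons p l)
  obtain x y where p: "p = (x, y)" "x \<in> carrier V" "y \<in> carrier W" using Cons by (cases p) auto
  show ?case using tensor_eq.append[OF tensor_eq.zero[of y W V] Cons(3)] p V by simp
qed (auto intro: tensor_eq.refl)

lemma vsp_vtensor [simp]:
  assumes V: "vsp V" "vsp W"
  shows "vsp (V \<otimes>\<^sub>v W)"
proof -
  let ?L = "lists (carrier V \<times> carrier W)" and ?T = "V \<otimes>\<^sub>v W"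
  have ex: "\<exists>l\<in>?L. t = tensor_class V W l" if "t \<in> carrier ?T" for t
    using that by (auto simp: vtensor_def)
  note [simp] = vtensor_add_class[OF V] vtensor_smult_class[OF V] vtensor_zero tensor_class_closed sc_closed[OF V(1)]
  show ?thesis
  proof (rule vspI)
    show "\<zero>\<^bsub>?T\<^esub> \<in> carrier ?T" by (simp add: tensor_class_closed)
  next
    fix s t assume "s \<in> carrier ?T" "t \<in> carrier ?T"
    then obtain k l where k: "k \<in> ?L" "s = tensor_class V W k" and l: "l \<in> ?L" "t = tensor_class V W l"
      using ex by meson
    show "s \<oplus>\<^bsub>?T\<^esub> t \<in> carrier ?T" using k l by auto
    show "s \<oplus>\<^bsub>?T\<^esub> t = t \<oplus>\<^bsub>?T\<^esub> s" using k l by (auto intro!: tensor_class_cong tensor_eq.commute)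
    show "a \<odot>\<^bsub>?T\<^esub> (s \<oplus>\<^bsub>?T\<^esub> t) = a \<odot>\<^bsub>?T\<^esub> s \<oplus>\<^bsub>?T\<^esub> a \<odot>\<^bsub>?T\<^esub> t" for a using k l by auto
    show "(s \<oplus>\<^bsub>?T\<^esub> t) \<oplus>\<^bsub>?T\<^esub> u = s \<oplus>\<^bsub>?T\<^esub> (t \<oplus>\<^bsub>?T\<^esub> u)" if "u \<in> carrier ?T" for u
      using k l ex[OF that] by (elim bexE) simp
  next
    fix t assume "t \<in> carrier ?T"
    then obtain l where l: "l \<in> ?L" "t = tensor_class V W l" using ex by meson
    show "\<zero>\<^bsub>?T\<^esub> \<oplus>\<^bsub>?T\<^esub> t = t" using l by auto
    show "c \<odot>\<^bsub>?T\<^esub> t \<in> carrier ?T" for c using l by auto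
    show "(a + b) \<odot>\<^bsub>?T\<^esub> t = a \<odot>\<^bsub>?T\<^esub> t \<oplus>\<^bsub>?T\<^esub> b \<odot>\<^bsub>?T\<^esub> t" for a b
      using l by (auto intro!: tensor_class_cong sc_add V)
    show "0 \<odot>\<^bsub>?T\<^esub> t = \<zero>\<^bsub>?T\<^esub>" using l by (auto intro!: tensor_class_cong sc_zero V)
    have "sc V (a * b) l = sc V a (sc V b l)" for a b
      using l(1) V by (induction l) (auto simp: vsp_smult)
    then show "(a * b) \<odot>\<^bsub>?T\<^esub> t = a \<odot>\<^bsub>?T\<^esub> (b \<odot>\<^bsub>?T\<^esub> t)" for a b
      using l by (simp del: map_map concat_map_singleton)
    have "sc V 1 l = l" using l(1) V by (induction l) auto
    then show "1 \<odot>\<^bsub>?T\<^esub> t = t" using l by auto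
  qed
qed

lemma pure_closed [simp]:
  "\<lbrakk>x \<in> carrier V; y \<in> carrier W\<rbrakk> \<Longrightarrow> pure V W x y \<in> carrier (V \<otimes>\<^sub>v W)"
  by (simp add: pure_def tensor_class_closed)

lemma blin_pure:
  assumes V: "vsp V" "vsp W"
  shows "blin V W (V \<otimes>\<^sub>v W) (pure V W)"
proof (rule blinI; rule linear_mapI)
  fix x y c assume "x \<in> carrier V" "y \<in> carrier W"
  then show "pure V W (c \<odot>\<^bsub>V\<^esub> x) y = c \<odot>\<^bsub>V \<otimes>\<^sub>v W\<^esub> pure V W x y"
    and "pure V W x (c \<odot>\<^bsub>W\<^esub> y) = c \<odot>\<^bsub>V \<otimes>\<^sub>v W\<^esub> pure V W x y"
    using tensor_class_cong[OF tensor_eq.scale[of x V y W c]]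
    by (simp_all add: pure_def vtensor_smult_class[OF V])
qed (auto simp: pure_def vtensor_add_class[OF V] intro!: tensor_class_cong
    intro: tensor_eq.add_left tensor_eq.add_right tensor_class_closed)

lemma tensor_class_lsum:
  assumes V: "vsp V" "vsp W" and "l \<in> lists (carrier V \<times> carrier W)"
  shows "tensor_class V W l = lsum (V \<otimes>\<^sub>v W) (pure V W) l"
  using assms(3)
proof (induction l)
  case (Cons p l)
  then show ?case using vtensor_add_class[OF V, of "[p]" l] by (cases p) (simp add: pure_def)
qed (simp add: vtensor_zero)

lemma tensor_induct [consumes 3, case_names pure add]:
  assumes V: "vsp V" "vsp W" and "t \<in> carrier (V \<otimes>\<^sub>v W)"
    and pure: "\<And>x y. \<lbrakk>x \<in> carrier V; y \<in> carrier W\<rbrakk> \<Longrightarrow> P (pure V W x y)"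
    and add: "\<And>s t. \<lbrakk>s \<in> carrier (V \<otimes>\<^sub>v W); t \<in> carrier (V \<otimes>\<^sub>v W); P s; P t\<rbrakk> \<Longrightarrow> P (s \<oplus>\<^bsub>V \<otimes>\<^sub>v W\<^esub> t)"
  shows "P t"
proof -
  have "P (tensor_class V W l)" if "l \<in> lists (carrier V \<times> carrier W)" for l
    using that
  proof (induction l)
    case Nil
    \<comment> \<open>The empty sum is the pure tensor of two zeros, so the pure case also covers
      the zero tensor.\<close>
    have "pure V W \<zero>\<^bsub>V\<^esub> \<zero>\<^bsub>W\<^esub> = tensor_class V W []"
      using tensor_class_cong[OF tensor_eq.zero[of "\<zero>\<^bsub>W\<^esub>" W V]] V by (simp add: pure_def)
    then show ?case using pure[of "\<zero>\<^bsub>V\<^esub>" "\<zero>\<^bsub>W\<^esub>"] V by simp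
  next
    case (Cons p l)
    obtain x y where p: "p = (x, y)" "x \<in> carrier V" "y \<in> carrier W" using Cons by (cases p) auto
    then show ?case
      using add[OF pure_closed tensor_class_closed pure Cons(3), of x y] Cons(2)
        vtensor_add_class[OF V, of "[(x, y)]" l] by (simp add: pure_def)
  qed
  then show ?thesis using tensor_terms[OF V assms(3)] by metis
qed

lemma lift_closed:
  assumes "vsp V" "vsp W" "vsp U" "t \<in> carrier (V \<otimes>\<^sub>v W)"
    and "\<And>x y. \<lbrakk>x \<in> carrier V; y \<in> carrier W\<rbrakk> \<Longrightarrow> \<beta> x y \<in> carrier U"
  shows "tensor_lift U \<beta> t \<in> carrier U"
  unfolding tensor_lift_lsum using assms tensor_terms_mem[OF assms(1,2,4)]
  by (intro lsum_closed) auto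

lemma lift_cong:
  assumes "vsp V" "vsp W" "t \<in> carrier (V \<otimes>\<^sub>v W)"
    and "\<And>x y. \<lbrakk>x \<in> carrier V; y \<in> carrier W\<rbrakk> \<Longrightarrow> \<beta> x y = \<beta>' x y"
  shows "tensor_lift U \<beta> t = tensor_lift U \<beta>' t"
  unfolding tensor_lift_lsum using assms tensor_terms_mem[OF assms(1,2,3)]
  by (intro lsum_cong) auto

lemma lift_class:
  assumes "vsp V" "vsp W" "vsp U" "blin V W U \<beta>" "l \<in> lists (carrier V \<times> carrier W)"
  shows "tensor_lift U \<beta> (tensor_class V W l) = lsum U \<beta> l"
  using tensor_eq_lsum[OF assms(1-4) tensor_class_eq[OF assms(5)]] by (simp add: tensor_lift_lsum)

lemma lift_pure [simp]:
  assumes "vsp V" "vsp W" "vsp U" "blin V W U \<beta>" "x \<in> carrier V" "y \<in> carrier W"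
  shows "tensor_lift U \<beta> (pure V W x y) = \<beta> x y"
  using lift_class[OF assms(1-4), of "[(x, y)]"] assms(3,5,6) blin_closed[OF assms(4)]
  by (simp add: pure_def)

lemma linear_lift:
  assumes V: "vsp V" "vsp W" "vsp U" and \<beta>: "blin V W U \<beta>"
  shows "linear_map (V \<otimes>\<^sub>v W) U (tensor_lift U \<beta>)"
proof (rule linear_mapI)
  show "tensor_lift U \<beta> t \<in> carrier U" if "t \<in> carrier (V \<otimes>\<^sub>v W)" for t
    using lift_closed[OF V that] blin_closed[OF \<beta>] by auto
next
  fix s t assume st: "s \<in> carrier (V \<otimes>\<^sub>v W)" "t \<in> carrier (V \<otimes>\<^sub>v W)"
  note ts = tensor_terms[OF V(1,2) st(1)] tensor_terms[OF V(1,2) st(2)]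
  have "tensor_lift U \<beta> (s \<oplus>\<^bsub>V \<otimes>\<^sub>v W\<^esub> t) = lsum U \<beta> (terms s @ terms t)"
    using ts lift_class[OF V \<beta>, of "terms s @ terms t"] by (simp add: vtensor_def)
  then show "tensor_lift U \<beta> (s \<oplus>\<^bsub>V \<otimes>\<^sub>v W\<^esub> t) = tensor_lift U \<beta> s \<oplus>\<^bsub>U\<^esub> tensor_lift U \<beta> t"
    using ts V blin_closed[OF \<beta>] by (subst (asm) lsum_append) (auto simp: tensor_lift_lsum in_lists_conv_set)
next
  fix c t assume t: "t \<in> carrier (V \<otimes>\<^sub>v W)"
  show "tensor_lift U \<beta> (c \<odot>\<^bsub>V \<otimes>\<^sub>v W\<^esub> t) = c \<odot>\<^bsub>U\<^esub> tensor_lift U \<beta> t"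
  proof -
    note ts = tensor_terms[OF V(1,2) t]
    have "lsum U \<beta> (sc V c l) = c \<odot>\<^bsub>U\<^esub> lsum U \<beta> l" if "l \<in> lists (carrier V \<times> carrier W)" for l
      using that
    proof (induction l)
      case (Cons p l)
      have "lsum U \<beta> l \<in> carrier U" using Cons V by (intro lsum_closed) (auto intro: blin_closed[OF \<beta>])
      then show ?case using Cons V linear_smult[OF blin_left[OF \<beta>]]
        by (cases p) (auto simp: vsp_smult blin_closed[OF \<beta>])
    qed (simp add: V)
    then show ?thesis
      using ts lift_class[OF V \<beta> sc_closed[OF V(1) ts(1)], of c]
      by (simp add: vtensor_def tensor_lift_lsum)
  qed
qed

text \<open>\<open>tensor_lift\<close> is a finite sum over the chosen representative, and a linear
  map passes through any finite sum, so this holds for every \<open>\<beta>\<close> with values in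
  \<open>U\<close>. Most manipulations of coproduct sums below are instances.\<close>

lemma linear_of_lift:
  assumes "linear_map U U' f" "vsp V" "vsp W" "vsp U" "vsp U'" "t \<in> carrier (V \<otimes>\<^sub>v W)"
    and "\<And>x y. \<lbrakk>x \<in> carrier V; y \<in> carrier W\<rbrakk> \<Longrightarrow> \<beta> x y \<in> carrier U"
  shows "f (tensor_lift U \<beta> t) = tensor_lift U' (\<lambda>x y. f (\<beta> x y)) t"
  unfolding tensor_lift_lsum
  using assms tensor_terms_mem[OF assms(2,3,6)] by (intro lsum_linear) auto

lemma tensor_eqI:
  assumes "vsp V" "vsp W" "linear_map (V \<otimes>\<^sub>v W) U f" "linear_map (V \<otimes>\<^sub>v W) U g"
    and "t \<in> carrier (V \<otimes>\<^sub>v W)"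
    and "\<And>x y. \<lbrakk>x \<in> carrier V; y \<in> carrier W\<rbrakk> \<Longrightarrow> f (pure V W x y) = g (pure V W x y)"
  shows "f t = g t"
  using assms(1,2,5) by (induction rule: tensor_induct) (auto simp: assms(6) linear_add[OF assms(3)] linear_add[OF assms(4)])

lemma linear_lift_arg:
  assumes "linear_map X (V \<otimes>\<^sub>v W) f" "vsp V" "vsp W" "vsp U" "blin V W U \<beta>"
  shows "linear_map X U (\<lambda>x. tensor_lift U \<beta> (f x))"
  using linear_comp[OF assms(1) linear_lift[OF assms(2-5)]] .

lemma linear_lift_fun:
  assumes "t \<in> carrier (V \<otimes>\<^sub>v W)" "vsp V" "vsp W" "vsp U" 
    and "\<And>a b. \<lbrakk>a \<in> carrier V; b \<in> carrier W\<rbrakk> \<Longrightarrow> linear_map X U (\<lambda>x. \<beta> x a b)"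
  shows "linear_map X U (\<lambda>x. tensor_lift U (\<beta> x) t)"
proof -
  have "linear_map X U (\<lambda>x. lsum U (\<beta> x) l)" if "l \<in> lists (carrier V \<times> carrier W)" for l
    using that
  proof (induction l)
    case (Cons p l)
    then show ?case by (cases p) (auto intro!: linear_sum assms)
  qed (simp add: linear_const_zero assms)
  then show ?thesis using tensor_terms[OF assms(2,3,1)] by (simp add: tensor_lift_lsum)
qed

lemma linear_pure_left:
  "\<lbrakk>linear_map X V f; y \<in> carrier W; vsp V; vsp W\<rbrakk> \<Longrightarrow> linear_map X (V \<otimes>\<^sub>v W) (\<lambda>x. pure V W (f x) y)"
  using linear_comp[OF _ blin_left[OF blin_pure]] .

lemma linear_pure_right:
  "\<lbrakk>linear_map X W f; y \<in> carrier V; vsp V; vsp W\<rbrakk> \<Longrightarrow> linear_map X (V \<otimes>\<^sub>v W) (\<lambda>x. pure V W y (f x))"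
  using linear_comp[OF _ blin_right[OF blin_pure]] .

text \<open>Interchange of two finite sums. It lets a convolution in one variable be evaluated
  inside the coproduct sum of another, as in the proof that the antipode reverses products.\<close>

lemma lift_swap:
  assumes V: "vsp V" "vsp W" "vsp V'" "vsp W'" "vsp U" and "s \<in> carrier (V \<otimes>\<^sub>v W)" "t \<in> carrier (V' \<otimes>\<^sub>v W')"
    and "\<And>x y x' y'. \<lbrakk>x \<in> carrier V; y \<in> carrier W; x' \<in> carrier V'; y' \<in> carrier W'\<rbrakk> \<Longrightarrow> \<beta> x y x' y' \<in> carrier U"
  shows "tensor_lift U (\<lambda>x y. tensor_lift U (\<lambda>x' y'. \<beta> x y x' y') t) s
    = tensor_lift U (\<lambda>x' y'. tensor_lift U (\<lambda>x y. \<beta> x y x' y') s) t"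
proof -
  have cl: "lsum U (\<lambda>x' y'. \<beta> x y x' y') k \<in> carrier U"
    if "x \<in> carrier V" "y \<in> carrier W" "k \<in> lists (carrier V' \<times> carrier W')" for x y k
    using that assms by (intro lsum_closed) (auto simp: in_lists_conv_set)
  have z: "lsum U (\<lambda>x' y'. \<zero>\<^bsub>U\<^esub>) k = \<zero>\<^bsub>U\<^esub>" for k by (induction k) (auto simp: V)
  have add: "lsum U (\<lambda>x' y'. f x' y' \<oplus>\<^bsub>U\<^esub> g x' y') k = lsum U f k \<oplus>\<^bsub>U\<^esub> lsum U g k"
    if "k \<in> lists (carrier V' \<times> carrier W')" "\<And>x y. \<lbrakk>x \<in> carrier V'; y \<in> carrier W'\<rbrakk> \<Longrightarrow> f x y \<in> carrier U \<and> g x y \<in> carrier U"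
    for f g k
    using that(1)
  proof (induction k)
    case (Cons p k)
    obtain x y where p: "p = (x, y)" "x \<in> carrier V'" "y \<in> carrier W'" using Cons by (cases p) auto
    have "lsum U f k \<in> carrier U" "lsum U g k \<in> carrier U"
      using Cons that V by (auto intro!: lsum_closed simp: in_lists_conv_set)
    then show ?case using p Cons that(2)[OF p(2,3)] V(5) by (simp add: vsp_add)
  qed (simp add: V)
  have "lsum U (\<lambda>x y. lsum U (\<lambda>x' y'. \<beta> x y x' y') k) l = lsum U (\<lambda>x' y'. lsum U (\<lambda>x y. \<beta> x y x' y') l) k"
    if "l \<in> lists (carrier V \<times> carrier W)" "k \<in> lists (carrier V' \<times> carrier W')" for l k
    using that(1)
  proof (induction l)
    case (Cons p l)
    obtain x y where p: "p = (x, y)" "x \<in> carrier V" "y \<in> carrier W" using Cons by (cases p) auto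
    have "lsum U (\<lambda>x y. \<beta> x y x' y') l \<in> carrier U" if "x' \<in> carrier V'" "y' \<in> carrier W'" for x' y'
      using Cons that assms by (auto intro!: lsum_closed simp: in_lists_conv_set)
    then show ?case using p Cons(3) assms that(2) by (simp add: add)
  qed (simp add: z)
  then show ?thesis using tensor_terms[OF V(1,2)] tensor_terms[OF V(3,4)] assms by (simp add: tensor_lift_lsum)
qed

subsection \<open>Functoriality of the tensor product\<close>

lemma blin_tensor_map:
  assumes "linear_map X V f" "linear_map Y W g" "vsp V" "vsp W"
  shows "blin X Y (V \<otimes>\<^sub>v W) (\<lambda>x y. pure V W (f x) (g y))"
  using assms by (auto intro!: blinI linear_pure_left linear_pure_right simp: linear_closed)

lemma tmap_pure [simp]:
  assumes "linear_map X V f" "linear_map Y W g" "vsp X" "vsp Y" "vsp V" "vsp W" "x \<in> carrier X" "y \<in> carrier Y"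
  shows "tensor_map V W f g (pure X Y x y) = pure V W (f x) (g y)"
  unfolding tensor_map_def by (subst lift_pure[OF _ _ _ blin_tensor_map]) (use assms in auto)

lemma linear_tmap:
  assumes "linear_map X V f" "linear_map Y W g" "vsp X" "vsp Y" "vsp V" "vsp W"
  shows "linear_map (X \<otimes>\<^sub>v Y) (V \<otimes>\<^sub>v W) (tensor_map V W f g)"
  unfolding tensor_map_def by (intro linear_lift blin_tensor_map assms vsp_vtensor)

lemma tmap_closed [simp]:
  assumes "linear_map X V f" "linear_map Y W g" "vsp X" "vsp Y" "vsp V" "vsp W" "t \<in> carrier (X \<otimes>\<^sub>v Y)"
  shows "tensor_map V W f g t \<in> carrier (V \<otimes>\<^sub>v W)"
  using linear_closed[OF linear_tmap[OF assms(1-6)] assms(7)] .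

lemma tmap_cong:
  assumes "vsp X" "vsp Y" "t \<in> carrier (X \<otimes>\<^sub>v Y)"
    and "\<And>x. x \<in> carrier X \<Longrightarrow> f x = f' x" "\<And>y. y \<in> carrier Y \<Longrightarrow> g y = g' y"
  shows "tensor_map V W f g t = tensor_map V W f' g' t"
  unfolding tensor_map_def by (intro lift_cong[OF assms(1-3)]) (simp add: assms)

lemma tmap_id [simp]:
  assumes "vsp X" "vsp Y" "t \<in> carrier (X \<otimes>\<^sub>v Y)"
  shows "tensor_map X Y (\<lambda>x. x) (\<lambda>x. x) t = t"
  by (rule tensor_eqI[OF assms(1,2) linear_tmap[OF linear_id linear_id assms(1,2) assms(1,2)] linear_id assms(3)])
    (simp add: assms linear_id)

lemma tmap_comp:
  assumes "linear_map X V f" "linear_map Y W g" "linear_map V V' f'" "linear_map W W' g'"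
    and "vsp X" "vsp Y" "vsp V" "vsp W" "vsp V'" "vsp W'" "t \<in> carrier (X \<otimes>\<^sub>v Y)"
  shows "tensor_map V' W' f' g' (tensor_map V W f g t) = tensor_map V' W' (\<lambda>x. f' (f x)) (\<lambda>x. g' (g x)) t"
proof -
  note f'f = linear_comp[OF assms(1,3)] and g'g = linear_comp[OF assms(2,4)]
  have 1: "linear_map (X \<otimes>\<^sub>v Y) (V' \<otimes>\<^sub>v W') (\<lambda>t. tensor_map V' W' f' g' (tensor_map V W f g t))"
    by (rule linear_comp[OF linear_tmap linear_tmap]) (rule assms)+
  have 2: "linear_map (X \<otimes>\<^sub>v Y) (V' \<otimes>\<^sub>v W') (tensor_map V' W' (\<lambda>x. f' (f x)) (\<lambda>x. g' (g x)))"
    by (intro linear_tmap f'f g'g assms)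
  show ?thesis
    by (rule tensor_eqI[OF _ _ 1 2])
      (use assms f'f g'g in \<open>simp_all add: linear_closed[OF assms(1)] linear_closed[OF assms(2)]\<close>)
qed

lemma linear_tmap_fun:
  assumes "t \<in> carrier (X \<otimes>\<^sub>v Y)" "vsp X" "vsp Y" "vsp V" "vsp W"
  shows "\<lbrakk>\<And>x. x \<in> carrier X \<Longrightarrow> linear_map A V (\<lambda>a. f a x); \<And>y. y \<in> carrier Y \<Longrightarrow> g y \<in> carrier W\<rbrakk>
      \<Longrightarrow> linear_map A (V \<otimes>\<^sub>v W) (\<lambda>a. tensor_map V W (f a) g t)"
    and "\<lbrakk>\<And>y. y \<in> carrier Y \<Longrightarrow> linear_map A W (\<lambda>a. k a y); \<And>x. x \<in> carrier X \<Longrightarrow> l x \<in> carrier V\<rbrakk>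
      \<Longrightarrow> linear_map A (V \<otimes>\<^sub>v W) (\<lambda>a. tensor_map V W l (k a) t)"
  unfolding tensor_map_def using assms
  by (auto intro!: linear_lift_fun[OF assms(1)] linear_pure_left linear_pure_right)

lemma blin_swap: "\<lbrakk>vsp V; vsp W\<rbrakk> \<Longrightarrow> blin V W (W \<otimes>\<^sub>v V) (\<lambda>x y. pure W V y x)"
  by (auto intro!: blinI linear_pure_left linear_pure_right linear_id)

lemma swap_pure [simp]:
  "\<lbrakk>vsp V; vsp W; x \<in> carrier V; y \<in> carrier W\<rbrakk> \<Longrightarrow> tensor_swap V W (pure V W x y) = pure W V y x"
  unfolding tensor_swap_def by (subst lift_pure[OF _ _ _ blin_swap]) auto

lemma linear_swap: "\<lbrakk>vsp V; vsp W\<rbrakk> \<Longrightarrow> linear_map (V \<otimes>\<^sub>v W) (W \<otimes>\<^sub>v V) (tensor_swap V W)"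
  unfolding tensor_swap_def by (intro linear_lift blin_swap vsp_vtensor)

lemma swap_closed [simp]:
  "\<lbrakk>vsp V; vsp W; t \<in> carrier (V \<otimes>\<^sub>v W)\<rbrakk> \<Longrightarrow> tensor_swap V W t \<in> carrier (W \<otimes>\<^sub>v V)"
  using linear_closed[OF linear_swap] .

lemma swap_swap [simp]:
  assumes "vsp V" "vsp W" "t \<in> carrier (V \<otimes>\<^sub>v W)"
  shows "tensor_swap W V (tensor_swap V W t) = t"
  by (rule tensor_eqI[OF assms(1,2) linear_comp[OF linear_swap linear_swap] linear_id assms(3)])
    (simp_all add: assms)

lemma swap_tmap:
  assumes "linear_map X V f" "linear_map Y W g" "vsp X" "vsp Y" "vsp V" "vsp W" "t \<in> carrier (X \<otimes>\<^sub>v Y)"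
  shows "tensor_swap V W (tensor_map V W f g t) = tensor_map W V g f (tensor_swap X Y t)"
proof -
  have 1: "linear_map (X \<otimes>\<^sub>v Y) (W \<otimes>\<^sub>v V) (\<lambda>t. tensor_swap V W (tensor_map V W f g t))"
    by (rule linear_comp[OF linear_tmap linear_swap]) (rule assms)+
  have 2: "linear_map (X \<otimes>\<^sub>v Y) (W \<otimes>\<^sub>v V) (\<lambda>t. tensor_map W V g f (tensor_swap X Y t))"
    by (rule linear_comp[OF linear_swap linear_tmap]) (rule assms)+
  show ?thesis
    by (rule tensor_eqI[OF _ _ 1 2])
      (use assms in \<open>simp_all add: linear_closed[OF assms(1)] linear_closed[OF assms(2)]\<close>)
qed

definition tensor_unassoc ::
  "(complex, 'a vuniv, 'b) module_scheme \<Rightarrow> (complex, 'a vuniv, 'c) module_scheme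
    \<Rightarrow> (complex, 'a vuniv, 'd) module_scheme \<Rightarrow> 'a vuniv \<Rightarrow> 'a vuniv" where
  "tensor_unassoc U V W = tensor_lift ((U \<otimes>\<^sub>v V) \<otimes>\<^sub>v W)
    (\<lambda>x t. tensor_lift ((U \<otimes>\<^sub>v V) \<otimes>\<^sub>v W) (\<lambda>y z. pure (U \<otimes>\<^sub>v V) W (pure U V x y) z) t)"

context
  fixes U :: "(complex, 'a vuniv, 'b) module_scheme" and V :: "(complex, 'a vuniv, 'c) module_scheme"
    and W :: "(complex, 'a vuniv, 'd) module_scheme"
  assumes UVW: "vsp U" "vsp V" "vsp W"
begin

lemma blin_assoc_inner:
  "z \<in> carrier W \<Longrightarrow> blin U V (U \<otimes>\<^sub>v V \<otimes>\<^sub>v W) (\<lambda>x y. pure U (V \<otimes>\<^sub>v W) x (pure V W y z))"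
  using UVW by (auto intro!: blinI linear_pure_left linear_pure_right linear_id)

lemma blin_assoc:
  "blin (U \<otimes>\<^sub>v V) W (U \<otimes>\<^sub>v V \<otimes>\<^sub>v W)
    (\<lambda>t z. tensor_lift (U \<otimes>\<^sub>v V \<otimes>\<^sub>v W) (\<lambda>x y. pure U (V \<otimes>\<^sub>v W) x (pure V W y z)) t)"
proof (rule blinI)
  show "linear_map (U \<otimes>\<^sub>v V) (U \<otimes>\<^sub>v V \<otimes>\<^sub>v W)
      (\<lambda>t. tensor_lift (U \<otimes>\<^sub>v V \<otimes>\<^sub>v W) (\<lambda>x y. pure U (V \<otimes>\<^sub>v W) x (pure V W y z)) t)"
    if "z \<in> carrier W" for z
    using that by (intro linear_lift blin_assoc_inner UVW vsp_vtensor)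
  show "linear_map W (U \<otimes>\<^sub>v V \<otimes>\<^sub>v W)
      (\<lambda>z. tensor_lift (U \<otimes>\<^sub>v V \<otimes>\<^sub>v W) (\<lambda>x y. pure U (V \<otimes>\<^sub>v W) x (pure V W y z)) t)"
    if "t \<in> carrier (U \<otimes>\<^sub>v V)" for t
    using that by (rule linear_lift_fun) (simp_all add: UVW linear_pure_right linear_id)
qed

lemma linear_assoc: "linear_map ((U \<otimes>\<^sub>v V) \<otimes>\<^sub>v W) (U \<otimes>\<^sub>v V \<otimes>\<^sub>v W) (tensor_assoc U V W)"
  unfolding tensor_assoc_def by (intro linear_lift blin_assoc vsp_vtensor UVW)

lemma assoc_closed [simp]:
  "t \<in> carrier ((U \<otimes>\<^sub>v V) \<otimes>\<^sub>v W) \<Longrightarrow> tensor_assoc U V W t \<in> carrier (U \<otimes>\<^sub>v V \<otimes>\<^sub>v W)"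
  using linear_closed[OF linear_assoc] .

lemma assoc_pure [simp]:
  "\<lbrakk>x \<in> carrier U; y \<in> carrier V; z \<in> carrier W\<rbrakk>
    \<Longrightarrow> tensor_assoc U V W (pure (U \<otimes>\<^sub>v V) W (pure U V x y) z) = pure U (V \<otimes>\<^sub>v W) x (pure V W y z)"
  unfolding tensor_assoc_def
  by (subst lift_pure[OF _ _ _ blin_assoc]) (simp_all add: UVW lift_pure[OF _ _ _ blin_assoc_inner])

lemma blin_unassoc_inner:
  "x \<in> carrier U \<Longrightarrow> blin V W ((U \<otimes>\<^sub>v V) \<otimes>\<^sub>v W) (\<lambda>y z. pure (U \<otimes>\<^sub>v V) W (pure U V x y) z)"
  using UVW by (auto intro!: blinI linear_pure_left linear_pure_right linear_id)

lemma blin_unassoc: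
  "blin U (V \<otimes>\<^sub>v W) ((U \<otimes>\<^sub>v V) \<otimes>\<^sub>v W)
    (\<lambda>x t. tensor_lift ((U \<otimes>\<^sub>v V) \<otimes>\<^sub>v W) (\<lambda>y z. pure (U \<otimes>\<^sub>v V) W (pure U V x y) z) t)"
proof (rule blinI)
  show "linear_map U ((U \<otimes>\<^sub>v V) \<otimes>\<^sub>v W)
      (\<lambda>x. tensor_lift ((U \<otimes>\<^sub>v V) \<otimes>\<^sub>v W) (\<lambda>y z. pure (U \<otimes>\<^sub>v V) W (pure U V x y) z) t)"
    if "t \<in> carrier (V \<otimes>\<^sub>v W)" for t
    using that by (rule linear_lift_fun) (simp_all add: UVW linear_pure_left linear_id)
  show "linear_map (V \<otimes>\<^sub>v W) ((U \<otimes>\<^sub>v V) \<otimes>\<^sub>v W)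
      (\<lambda>t. tensor_lift ((U \<otimes>\<^sub>v V) \<otimes>\<^sub>v W) (\<lambda>y z. pure (U \<otimes>\<^sub>v V) W (pure U V x y) z) t)"
    if "x \<in> carrier U" for x
    using that by (intro linear_lift blin_unassoc_inner UVW vsp_vtensor)
qed

lemma linear_unassoc: "linear_map (U \<otimes>\<^sub>v V \<otimes>\<^sub>v W) ((U \<otimes>\<^sub>v V) \<otimes>\<^sub>v W) (tensor_unassoc U V W)"
  unfolding tensor_unassoc_def by (intro linear_lift blin_unassoc vsp_vtensor UVW)

lemma unassoc_closed [simp]:
  "t \<in> carrier (U \<otimes>\<^sub>v V \<otimes>\<^sub>v W) \<Longrightarrow> tensor_unassoc U V W t \<in> carrier ((U \<otimes>\<^sub>v V) \<otimes>\<^sub>v W)"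
  using linear_closed[OF linear_unassoc] .

lemma unassoc_pure [simp]:
  "\<lbrakk>x \<in> carrier U; y \<in> carrier V; z \<in> carrier W\<rbrakk>
    \<Longrightarrow> tensor_unassoc U V W (pure U (V \<otimes>\<^sub>v W) x (pure V W y z)) = pure (U \<otimes>\<^sub>v V) W (pure U V x y) z"
  unfolding tensor_unassoc_def
  by (subst lift_pure[OF _ _ _ blin_unassoc]) (simp_all add: UVW lift_pure[OF _ _ _ blin_unassoc_inner])

lemma tensor_eqI_left:
  assumes f: "linear_map ((U \<otimes>\<^sub>v V) \<otimes>\<^sub>v W) T f" and g: "linear_map ((U \<otimes>\<^sub>v V) \<otimes>\<^sub>v W) T g"
    and t: "t \<in> carrier ((U \<otimes>\<^sub>v V) \<otimes>\<^sub>v W)"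
    and eq: "\<And>x y z. \<lbrakk>x \<in> carrier U; y \<in> carrier V; z \<in> carrier W\<rbrakk>
      \<Longrightarrow> f (pure (U \<otimes>\<^sub>v V) W (pure U V x y) z) = g (pure (U \<otimes>\<^sub>v V) W (pure U V x y) z)"
  shows "f t = g t"
proof (rule tensor_eqI[OF _ _ f g t])
  fix s z assume s: "s \<in> carrier (U \<otimes>\<^sub>v V)" and z: "z \<in> carrier W"
  show "f (pure (U \<otimes>\<^sub>v V) W s z) = g (pure (U \<otimes>\<^sub>v V) W s z)"
    by (rule tensor_eqI[OF UVW(1,2) linear_comp[OF linear_pure_left[OF linear_id z] f]
          linear_comp[OF linear_pure_left[OF linear_id z] g] s]) (simp_all add: UVW z eq)
qed (simp_all add: UVW)

lemma tensor_eqI_right: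
  assumes f: "linear_map (U \<otimes>\<^sub>v V \<otimes>\<^sub>v W) T f" and g: "linear_map (U \<otimes>\<^sub>v V \<otimes>\<^sub>v W) T g"
    and t: "t \<in> carrier (U \<otimes>\<^sub>v V \<otimes>\<^sub>v W)"
    and eq: "\<And>x y z. \<lbrakk>x \<in> carrier U; y \<in> carrier V; z \<in> carrier W\<rbrakk>
      \<Longrightarrow> f (pure U (V \<otimes>\<^sub>v W) x (pure V W y z)) = g (pure U (V \<otimes>\<^sub>v W) x (pure V W y z))"
  shows "f t = g t"
proof (rule tensor_eqI[OF _ _ f g t])
  fix x s assume s: "s \<in> carrier (V \<otimes>\<^sub>v W)" and x: "x \<in> carrier U"
  show "f (pure U (V \<otimes>\<^sub>v W) x s) = g (pure U (V \<otimes>\<^sub>v W) x s)"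
    by (rule tensor_eqI[OF UVW(2,3) linear_comp[OF linear_pure_right[OF linear_id x] f]
          linear_comp[OF linear_pure_right[OF linear_id x] g] s]) (simp_all add: UVW x eq)
qed (simp_all add: UVW)

lemma unassoc_assoc [simp]:
  "t \<in> carrier ((U \<otimes>\<^sub>v V) \<otimes>\<^sub>v W) \<Longrightarrow> tensor_unassoc U V W (tensor_assoc U V W t) = t"
  by (rule tensor_eqI_left[OF linear_comp[OF linear_assoc linear_unassoc] linear_id]) simp_all

lemma assoc_unassoc [simp]:
  "t \<in> carrier (U \<otimes>\<^sub>v V \<otimes>\<^sub>v W) \<Longrightarrow> tensor_assoc U V W (tensor_unassoc U V W t) = t"
  by (rule tensor_eqI_right[OF linear_comp[OF linear_unassoc linear_assoc] linear_id]) simp_all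

end

lemma assoc_tmap:
  assumes f: "linear_map U U' f" "linear_map V V' g" "linear_map W W' h"
    and V: "vsp U" "vsp V" "vsp W" "vsp U'" "vsp V'" "vsp W'" and t: "t \<in> carrier ((U \<otimes>\<^sub>v V) \<otimes>\<^sub>v W)"
  shows "tensor_assoc U' V' W' (tensor_map (U' \<otimes>\<^sub>v V') W' (tensor_map U' V' f g) h t)
    = tensor_map U' (V' \<otimes>\<^sub>v W') f (tensor_map V' W' g h) (tensor_assoc U V W t)"
proof -
  note [simp] = f V linear_tmap[OF f(1,2)] linear_tmap[OF f(2,3)] linear_closed[OF f(1)]
    linear_closed[OF f(2)] linear_closed[OF f(3)]
  have lin1: "linear_map ((U \<otimes>\<^sub>v V) \<otimes>\<^sub>v W) (U' \<otimes>\<^sub>v V' \<otimes>\<^sub>v W')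
      (\<lambda>t. tensor_assoc U' V' W' (tensor_map (U' \<otimes>\<^sub>v V') W' (tensor_map U' V' f g) h t))"
    by (rule linear_comp[OF linear_tmap[OF linear_tmap[OF f(1,2)] f(3)] linear_assoc]) auto
  have lin2: "linear_map ((U \<otimes>\<^sub>v V) \<otimes>\<^sub>v W) (U' \<otimes>\<^sub>v V' \<otimes>\<^sub>v W')
      (\<lambda>t. tensor_map U' (V' \<otimes>\<^sub>v W') f (tensor_map V' W' g h) (tensor_assoc U V W t))"
    by (rule linear_comp[OF linear_assoc linear_tmap[OF f(1) linear_tmap[OF f(2,3)]]]) auto
  show ?thesis
  proof (rule tensor_eqI_left[OF V(1-3) lin1 lin2 t])
    fix x y z assume [simp]: "x \<in> carrier U" "y \<in> carrier V" "z \<in> carrier W"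
    have 1: "tensor_map U' V' f g (pure U V x y) = pure U' V' (f x) (g y)"
      and 2: "tensor_map V' W' g h (pure V W y z) = pure V' W' (g y) (h z)"
      by (intro tmap_pure[OF f(1,2)] tmap_pure[OF f(2,3)]; simp)+
    have 3: "tensor_map (U' \<otimes>\<^sub>v V') W' (tensor_map U' V' f g) h (pure (U \<otimes>\<^sub>v V) W (pure U V x y) z)
        = pure (U' \<otimes>\<^sub>v V') W' (pure U' V' (f x) (g y)) (h z)"
      by (subst tmap_pure[OF linear_tmap[OF f(1,2)] f(3)]) (simp_all add: 1)
    have 4: "tensor_map U' (V' \<otimes>\<^sub>v W') f (tensor_map V' W' g h) (pure U (V \<otimes>\<^sub>v W) x (pure V W y z))
        = pure U' (V' \<otimes>\<^sub>v W') (f x) (pure V' W' (g y) (h z))"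
      by (subst tmap_pure[OF f(1) linear_tmap[OF f(2,3)]]) (simp_all add: 2)
    show "tensor_assoc U' V' W'
            (tensor_map (U' \<otimes>\<^sub>v V') W' (tensor_map U' V' f g) h (pure (U \<otimes>\<^sub>v V) W (pure U V x y) z)) =
           tensor_map U' (V' \<otimes>\<^sub>v W') f (tensor_map V' W' g h)
            (tensor_assoc U V W (pure (U \<otimes>\<^sub>v V) W (pure U V x y) z))"
      by (simp add: 3 4)
  qed
qed

subsection \<open>Conjugate spaces\<close>

text \<open>
  An antilinear map \<open>V \<rightarrow> W\<close> is a linear map from \<open>V\<close> to \<open>cj W\<close>, so that the linear theory covers both.
  Since \<open>cj V \<otimes> cj W\<close> has the same elements as \<open>V \<otimes> W\<close>, conjugation disappears from all maps between
  tensor products.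
\<close>

definition cj :: "(complex, 'a vuniv, 'b) module_scheme \<Rightarrow> (complex, 'a vuniv, 'b) module_scheme" where
  "cj V = V\<lparr>smult := \<lambda>c. smult V (cnj c)\<rparr>"

lemma cj_simps [simp]:
  "carrier (cj V) = carrier V" "zero (cj V) = zero V" "add (cj V) = add V" "mult (cj V) = mult V"
  "one (cj V) = one V" "smult (cj V) = (\<lambda>c. smult V (cnj c))" "cj (cj V) = V"
  by (simp_all add: cj_def)

lemma vsp_cj [simp]: "vsp V \<Longrightarrow> vsp (cj V)"
  by (rule vspI) (auto simp: vsp_add vsp_smult)

lemma linear_cj [simp]: "linear_map (cj V) (cj W) f \<longleftrightarrow> linear_map V W f"
proof -
  have "(\<forall>c. \<forall>x\<in>carrier V. f (cnj c \<odot>\<^bsub>V\<^esub> x) = cnj c \<odot>\<^bsub>W\<^esub> f x)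
    \<longleftrightarrow> (\<forall>c. \<forall>x\<in>carrier V. f (c \<odot>\<^bsub>V\<^esub> x) = c \<odot>\<^bsub>W\<^esub> f x)"
    by (metis complex_cnj_cnj)
  then show ?thesis by (simp add: linear_map_def)
qed

lemma linear_cj_left: "linear_map (cj V) W f \<longleftrightarrow> linear_map V (cj W) f"
  by (metis linear_cj cj_simps(7))

lemma antilinear_iff: "antilinear_map V W f \<longleftrightarrow> linear_map V (cj W) f"
  by (simp add: antilinear_map_def linear_map_def)

text \<open>Only the rule \<open>scale\<close> mentions scalars, and conjugation merely permutes its
  instances. Since \<open>cj\<close> is an involution, the reverse inclusion is the same statement
  for the conjugate spaces.\<close>

lemma tensor_eq_cj_le: "tensor_eq (cj V) (cj W) k l \<Longrightarrow> tensor_eq V W k l"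
proof (induction rule: tensor_eq.induct)
  case sym then show ?case using tensor_eq.sym by blast
next
  case trans then show ?case using tensor_eq.trans by blast
qed (simp_all add: tensor_eq.refl tensor_eq.append tensor_eq.commute tensor_eq.zero tensor_eq.add_left
    tensor_eq.add_right tensor_eq.scale)

lemma tensor_eq_cj: "tensor_eq (cj V) (cj W) = tensor_eq V W"
  using tensor_eq_cj_le[of V W] tensor_eq_cj_le[of "cj V" "cj W"] by (auto intro!: ext)

lemma pure_cj [simp]: "pure (cj V) (cj W) = pure V W"
  by (simp add: pure_def tensor_class_def tensor_eq_cj fun_eq_iff)

lemma vtensor_cj [simp]: "cj V \<otimes>\<^sub>v cj W = cj (V \<otimes>\<^sub>v W)"
  by (simp add: vtensor_def cj_def[of "\<lparr>carrier = _, \<dots> = _\<rparr>"] tensor_class_def tensor_eq_cj)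

lemma lift_cj [simp]: "tensor_lift (cj U) \<beta> = tensor_lift U \<beta>"
  by (simp add: tensor_lift_def fun_eq_iff)

lemma tmap_cj [simp]: "tensor_map (cj V) (cj W) f g = tensor_map V W f g"
  by (simp add: tensor_map_def)

lemma swap_cj [simp]: "tensor_swap (cj V) (cj W) = tensor_swap V W"
  by (simp add: tensor_swap_def)

lemma assoc_cj [simp]: "tensor_assoc (cj U) (cj V) (cj W) = tensor_assoc U V W"
  by (simp add: tensor_assoc_def)

subsection \<open>Tensor products of algebras and of their representations\<close>

lemma (in complex_algebra) algebra_vsp [simp]: "vsp A"
  using complex_algebra_axioms unfolding complex_algebra_def by blast

lemma (in complex_algebra) algebra_ring: "ring A"
  using complex_algebra_axioms unfolding complex_algebra_def by blast

lemma (in complex_algebra)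
  assumes "x \<in> carrier A" "y \<in> carrier A" "z \<in> carrier A"
  shows alg_l_distr: "(x \<oplus> y) \<otimes> z = x \<otimes> z \<oplus> y \<otimes> z"
    and alg_r_distr: "z \<otimes> (x \<oplus> y) = z \<otimes> x \<oplus> z \<otimes> y"
    and alg_assoc: "(x \<otimes> y) \<otimes> z = x \<otimes> (y \<otimes> z)"
proof -
  have "ring_axioms A" and M: "monoid A" using algebra_ring by (auto simp only: ring_def)
  then show "(x \<oplus> y) \<otimes> z = x \<otimes> z \<oplus> y \<otimes> z" "z \<otimes> (x \<oplus> y) = z \<otimes> x \<oplus> z \<otimes> y"
    using assms unfolding ring_axioms_def by blast+
  show "(x \<otimes> y) \<otimes> z = x \<otimes> (y \<otimes> z)" using monoid.m_assoc[OF M assms] .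
qed

lemma (in complex_algebra) linear_mult_left: "\<lbrakk>linear_map X A f; y \<in> carrier A\<rbrakk> \<Longrightarrow> linear_map X A (\<lambda>x. f x \<otimes> y)"
  by (rule linear_mapI) (simp_all add: linear_closed[of X A f] linear_add[of X A f] linear_smult[of X A f] smult_mult_left alg_l_distr)

lemma (in complex_algebra) linear_mult_right: "\<lbrakk>linear_map X A f; y \<in> carrier A\<rbrakk> \<Longrightarrow> linear_map X A (\<lambda>x. y \<otimes> f x)"
  by (rule linear_mapI) (simp_all add: linear_closed[of X A f] linear_add[of X A f] linear_smult[of X A f] smult_mult_right alg_r_distr)

lemma complex_algebraI:
  fixes A (structure)
  assumes V: "vsp A"
    and closed: "\<And>x y. \<lbrakk>x \<in> carrier A; y \<in> carrier A\<rbrakk> \<Longrightarrow> x \<otimes> y \<in> carrier A" "\<one> \<in> carrier A"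
    and assoc: "\<And>x y z. \<lbrakk>x \<in> carrier A; y \<in> carrier A; z \<in> carrier A\<rbrakk> \<Longrightarrow> (x \<otimes> y) \<otimes> z = x \<otimes> (y \<otimes> z)"
    and one: "\<And>x. x \<in> carrier A \<Longrightarrow> \<one> \<otimes> x = x" "\<And>x. x \<in> carrier A \<Longrightarrow> x \<otimes> \<one> = x"
    and bil: "blin A A A (\<otimes>)"
  shows "complex_algebra A"
proof -
  have "abelian_group A" using V unfolding Module.module_def by blast
  moreover have "monoid A" by (rule monoidI) (use closed assoc one in auto)
  ultimately have "ring A"
    using linear_add[OF blin_left[OF bil]] linear_add[OF blin_right[OF bil]] by (intro ringI)
  then show ?thesis
    unfolding complex_algebra_def complex_algebra_axioms_def
    using V linear_smult[OF blin_left[OF bil]] linear_smult[OF blin_right[OF bil]] by blast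
qed

lemma (in complex_algebra) blin_mult: "blin A A A (\<otimes>)"
  using linear_mult_left[OF linear_id] linear_mult_right[OF linear_id] by (auto intro: blinI)

lemma blin_cj [simp]: "blin (cj V) (cj W) (cj U) \<beta> \<longleftrightarrow> blin V W U \<beta>"
  by (simp add: blin_def)

lemma complex_algebra_cj:
  assumes "complex_algebra A"
  shows "complex_algebra (cj A)"
proof -
  interpret complex_algebra A by fact
  show ?thesis by (rule complex_algebraI) (use alg_assoc in \<open>auto simp: blin_mult\<close>)
qed

lemma lsum_concat:
  assumes "vsp U" "\<And>x y x' y'. \<lbrakk>(x, y) \<in> set l; (x', y') \<in> set (g x y)\<rbrakk> \<Longrightarrow> \<beta> x' y' \<in> carrier U"
  shows "lsum U \<beta> (concat (map (\<lambda>(x, y). g x y) l)) = lsum U (\<lambda>x y. lsum U \<beta> (g x y)) l"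
  using assms(2)
proof (induction l)
  case (Cons p l)
  obtain x y where p: "p = (x, y)" by (cases p)
  have "lsum U \<beta> (g x y @ concat (map (\<lambda>(x, y). g x y) l))
      = lsum U \<beta> (g x y) \<oplus>\<^bsub>U\<^esub> lsum U \<beta> (concat (map (\<lambda>(x, y). g x y) l))"
    using Cons(2) p by (intro lsum_append assms(1)) fastforce
  moreover have "lsum U \<beta> (concat (map (\<lambda>(x, y). g x y) l)) = lsum U (\<lambda>x y. lsum U \<beta> (g x y)) l"
    by (rule Cons(1), rule Cons(2)) auto
  ultimately show ?case using p by simp
qed simp

lemma lsum_map: "lsum U \<beta> (map (\<lambda>(x, y). (f x, g y)) l) = lsum U (\<lambda>x y. \<beta> (f x) (g y)) l"
  by (induction l) auto

lemma blin_comp: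
  assumes "blin V W U \<beta>" "linear_map V' V f" "linear_map W' W g" "linear_map U U' h"
  shows "blin V' W' U' (\<lambda>x y. h (\<beta> (f x) (g y)))"
  by (rule blinI)
    (use assms in \<open>auto intro!: linear_comp[OF _ assms(4)] linear_comp[OF _ blin_left[OF assms(1)]]
      linear_comp[OF _ blin_right[OF assms(1)]] simp: linear_closed\<close>)

lemma tensor_eqI2:
  assumes V: "vsp A" "vsp B" "vsp V" "vsp W"
    and F: "blin (A \<otimes>\<^sub>v B) (V \<otimes>\<^sub>v W) U F" and G: "blin (A \<otimes>\<^sub>v B) (V \<otimes>\<^sub>v W) U G"
    and t: "t \<in> carrier (A \<otimes>\<^sub>v B)" and s: "s \<in> carrier (V \<otimes>\<^sub>v W)"
    and eq: "\<And>a b x y. \<lbrakk>a \<in> carrier A; b \<in> carrier B; x \<in> carrier V; y \<in> carrier W\<rbrakk>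
      \<Longrightarrow> F (pure A B a b) (pure V W x y) = G (pure A B a b) (pure V W x y)"
  shows "F t s = G t s"
proof (rule tensor_eqI[OF V(1,2) blin_left[OF F s] blin_left[OF G s] t])
  fix a b assume ab: "a \<in> carrier A" "b \<in> carrier B"
  show "F (pure A B a b) s = G (pure A B a b) s"
    by (rule tensor_eqI[OF V(3,4) blin_right[OF F] blin_right[OF G] s]) (simp_all add: ab eq)
qed

locale algebra_pair = A: complex_algebra A + B: complex_algebra B
  for A :: "(complex, 'a vuniv, 'b) module_scheme" and B :: "(complex, 'a vuniv, 'c) module_scheme"
begin

lemma blin_tensor_mult_inner:
  "\<lbrakk>x \<in> carrier A; y \<in> carrier B\<rbrakk> \<Longrightarrow> blin A B (A \<otimes>\<^sub>v B) (\<lambda>x' y'. pure A B (x \<otimes>\<^bsub>A\<^esub> x') (y \<otimes>\<^bsub>B\<^esub> y'))"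
  by (intro blin_tensor_map A.linear_mult_right B.linear_mult_right linear_id) simp_all

lemma blin_tensor_mult_outer:
  assumes "t \<in> carrier (A \<otimes>\<^sub>v B)"
  shows "blin A B (A \<otimes>\<^sub>v B)
    (\<lambda>x y. tensor_lift (A \<otimes>\<^sub>v B) (\<lambda>x' y'. pure A B (x \<otimes>\<^bsub>A\<^esub> x') (y \<otimes>\<^bsub>B\<^esub> y')) t)"
  by (intro blinI linear_lift_fun[OF assms] linear_pure_left linear_pure_right
      A.linear_mult_left B.linear_mult_left linear_id) simp_all

text \<open>The record multiplies representatives by listing all pairwise products of terms. As a
  nested \<open>tensor_lift\<close> the product comes under the results on bilinear maps, from which
  the algebra laws follow.\<close>

lemma tensor_mult:
  assumes "s \<in> carrier (A \<otimes>\<^sub>v B)" "t \<in> carrier (A \<otimes>\<^sub>v B)"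
  shows "s \<otimes>\<^bsub>A \<otimes>\<^sub>v B\<^esub> t = tensor_lift (A \<otimes>\<^sub>v B)
    (\<lambda>x y. tensor_lift (A \<otimes>\<^sub>v B) (\<lambda>x' y'. pure A B (x \<otimes>\<^bsub>A\<^esub> x') (y \<otimes>\<^bsub>B\<^esub> y')) t) s"
proof -
  note s = tensor_terms_mem[OF A.algebra_vsp B.algebra_vsp assms(1)]
  note t = tensor_terms_mem[OF A.algebra_vsp B.algebra_vsp assms(2)]
  let ?g = "\<lambda>x y. map (\<lambda>(x', y'). (x \<otimes>\<^bsub>A\<^esub> x', y \<otimes>\<^bsub>B\<^esub> y')) (terms t)"
  have "s \<otimes>\<^bsub>A \<otimes>\<^sub>v B\<^esub> t = tensor_class A B (concat (map (\<lambda>(x, y). ?g x y) (terms s)))"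
    by (simp add: vtensor_def)
  also have "\<dots> = lsum (A \<otimes>\<^sub>v B) (pure A B) (concat (map (\<lambda>(x, y). ?g x y) (terms s)))"
    using s t by (intro tensor_class_lsum A.algebra_vsp B.algebra_vsp) (auto simp: in_lists_conv_set)
  also have "\<dots> = lsum (A \<otimes>\<^sub>v B) (\<lambda>x y. lsum (A \<otimes>\<^sub>v B) (pure A B) (?g x y)) (terms s)"
    using s t by (intro lsum_concat) auto
  finally show ?thesis by (simp add: lsum_map tensor_lift_lsum)
qed

lemma tensor_mult_pure [simp]:
  assumes "x \<in> carrier A" "y \<in> carrier B" "x' \<in> carrier A" "y' \<in> carrier B"
  shows "pure A B x y \<otimes>\<^bsub>A \<otimes>\<^sub>v B\<^esub> pure A B x' y' = pure A B (x \<otimes>\<^bsub>A\<^esub> x') (y \<otimes>\<^bsub>B\<^esub> y')"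
  using assms by (simp add: tensor_mult lift_pure[OF _ _ _ blin_tensor_mult_outer]
      lift_pure[OF _ _ _ blin_tensor_mult_inner])

lemma tensor_one: "\<one>\<^bsub>A \<otimes>\<^sub>v B\<^esub> = pure A B \<one>\<^bsub>A\<^esub> \<one>\<^bsub>B\<^esub>"
  by (simp add: vtensor_def)

lemma blin_tensor_mult: "blin (A \<otimes>\<^sub>v B) (A \<otimes>\<^sub>v B) (A \<otimes>\<^sub>v B) (\<otimes>\<^bsub>A \<otimes>\<^sub>v B\<^esub>)"
proof (rule blinI)
  fix t assume t: "t \<in> carrier (A \<otimes>\<^sub>v B)"
  have "linear_map (A \<otimes>\<^sub>v B) (A \<otimes>\<^sub>v B) (\<lambda>s. tensor_lift (A \<otimes>\<^sub>v B)
    (\<lambda>x y. tensor_lift (A \<otimes>\<^sub>v B) (\<lambda>x' y'. pure A B (x \<otimes>\<^bsub>A\<^esub> x') (y \<otimes>\<^bsub>B\<^esub> y')) t) s)"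
    by (intro linear_lift blin_tensor_mult_outer t) simp_all
  then show "linear_map (A \<otimes>\<^sub>v B) (A \<otimes>\<^sub>v B) (\<lambda>s. s \<otimes>\<^bsub>A \<otimes>\<^sub>v B\<^esub> t)"
    by (rule linear_cong) (simp_all add: tensor_mult t)
  have "linear_map (A \<otimes>\<^sub>v B) (A \<otimes>\<^sub>v B) (\<lambda>s. tensor_lift (A \<otimes>\<^sub>v B)
    (\<lambda>x y. tensor_lift (A \<otimes>\<^sub>v B) (\<lambda>x' y'. pure A B (x \<otimes>\<^bsub>A\<^esub> x') (y \<otimes>\<^bsub>B\<^esub> y')) s) t)"
    by (intro linear_lift_fun[OF t] linear_lift blin_tensor_mult_inner) simp_all
  then show "linear_map (A \<otimes>\<^sub>v B) (A \<otimes>\<^sub>v B) (\<lambda>s. t \<otimes>\<^bsub>A \<otimes>\<^sub>v B\<^esub> s)"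
    by (rule linear_cong) (simp_all add: tensor_mult t)
qed

sublocale T: complex_algebra "A \<otimes>\<^sub>v B"
proof (rule complex_algebraI)
  let ?T = "A \<otimes>\<^sub>v B"
  note VA = A.algebra_vsp B.algebra_vsp
  note bl = linear_add[OF blin_left[OF blin_tensor_mult]] linear_add[OF blin_right[OF blin_tensor_mult]]
  show "vsp ?T" "blin ?T ?T ?T (\<otimes>\<^bsub>?T\<^esub>)" by (simp_all add: blin_tensor_mult)
  show cl: "s \<otimes>\<^bsub>?T\<^esub> t \<in> carrier ?T" if "s \<in> carrier ?T" "t \<in> carrier ?T" for s t
    using blin_closed[OF blin_tensor_mult that] .
  show "\<one>\<^bsub>?T\<^esub> \<in> carrier ?T" by (simp add: tensor_one)
  show "\<one>\<^bsub>?T\<^esub> \<otimes>\<^bsub>?T\<^esub> t = t" if "t \<in> carrier ?T" for t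
    using VA that by (induction rule: tensor_induct) (simp_all add: tensor_one bl)
  show "t \<otimes>\<^bsub>?T\<^esub> \<one>\<^bsub>?T\<^esub> = t" if "t \<in> carrier ?T" for t
    using VA that by (induction rule: tensor_induct) (simp_all add: tensor_one bl)
  fix s t u assume s: "s \<in> carrier ?T" and t: "t \<in> carrier ?T" and u: "u \<in> carrier ?T"
  show "(s \<otimes>\<^bsub>?T\<^esub> t) \<otimes>\<^bsub>?T\<^esub> u = s \<otimes>\<^bsub>?T\<^esub> (t \<otimes>\<^bsub>?T\<^esub> u)"
    using VA s
  proof (induction rule: tensor_induct)
    case s: (pure x y)
    show ?case using VA t
    proof (induction rule: tensor_induct)
      case (pure x' y')
      show ?case using VA u
        by (induction rule: tensor_induct) (simp_all add: s pure bl cl A.alg_assoc B.alg_assoc)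
    qed (simp add: bl cl u s)
  qed (simp add: bl cl u t)
qed

end

text \<open>A module without its record: algebra, space and action are separate arguments, so one
  space can carry actions of \<open>H\<close>, of its tensor powers and of conjugate algebras,
  pulled back along homomorphisms.\<close>

definition alg_rep ::
  "(complex, 'a vuniv, 'b) module_scheme \<Rightarrow> (complex, 'a vuniv, 'c) module_scheme
    \<Rightarrow> ('a vuniv \<Rightarrow> 'a vuniv \<Rightarrow> 'a vuniv) \<Rightarrow> bool" where
  "alg_rep A V \<alpha> \<longleftrightarrow> vsp V \<and> blin A V V \<alpha>
    \<and> (\<forall>h\<in>carrier A. \<forall>k\<in>carrier A. \<forall>x\<in>carrier V. \<alpha> (h \<otimes>\<^bsub>A\<^esub> k) x = \<alpha> h (\<alpha> k x))
    \<and> (\<forall>x\<in>carrier V. \<alpha> \<one>\<^bsub>A\<^esub> x = x)"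

lemma alg_repD:
  assumes "alg_rep A V \<alpha>"
  shows alg_rep_vsp: "vsp V" and alg_rep_blin: "blin A V V \<alpha>"
    and alg_rep_mult: "\<lbrakk>h \<in> carrier A; k \<in> carrier A; x \<in> carrier V\<rbrakk> \<Longrightarrow> \<alpha> (h \<otimes>\<^bsub>A\<^esub> k) x = \<alpha> h (\<alpha> k x)"
    and alg_rep_one: "x \<in> carrier V \<Longrightarrow> \<alpha> \<one>\<^bsub>A\<^esub> x = x"
    and alg_rep_closed: "\<lbrakk>h \<in> carrier A; x \<in> carrier V\<rbrakk> \<Longrightarrow> \<alpha> h x \<in> carrier V"
  using assms blin_closed[of A V V \<alpha>] unfolding alg_rep_def by blast+

context
  fixes A :: "(complex, 'a vuniv, 'b) module_scheme" and B :: "(complex, 'a vuniv, 'c) module_scheme"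
    and V :: "(complex, 'a vuniv, 'd) module_scheme" and W :: "(complex, 'a vuniv, 'e) module_scheme"
    and \<alpha> \<beta>
  assumes V: "vsp A" "vsp B" "vsp V" "vsp W" and bl: "blin A V V \<alpha>" "blin B W W \<beta>"
begin

lemma blin_tact_inner:
  assumes s: "s \<in> carrier (V \<otimes>\<^sub>v W)"
  shows "blin A B (V \<otimes>\<^sub>v W) (\<lambda>a b. tensor_map V W (\<alpha> a) (\<beta> b) s)"
  using blin_closed[OF bl(1)] blin_closed[OF bl(2)]
  by (intro blinI linear_tmap_fun[OF s] V blin_left[OF bl(1)] blin_left[OF bl(2)])

lemma tact_pure_left [simp]:
  "\<lbrakk>a \<in> carrier A; b \<in> carrier B; s \<in> carrier (V \<otimes>\<^sub>v W)\<rbrakk>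
    \<Longrightarrow> tensor_act V W \<alpha> \<beta> (pure A B a b) s = tensor_map V W (\<alpha> a) (\<beta> b) s"
  unfolding tensor_act_def by (subst lift_pure[OF _ _ _ blin_tact_inner]) (simp_all add: V)

lemma tact_pure [simp]:
  "\<lbrakk>a \<in> carrier A; b \<in> carrier B; x \<in> carrier V; y \<in> carrier W\<rbrakk>
    \<Longrightarrow> tensor_act V W \<alpha> \<beta> (pure A B a b) (pure V W x y) = pure V W (\<alpha> a x) (\<beta> b y)"
  by (simp add: tmap_pure[OF blin_right[OF bl(1)] blin_right[OF bl(2)]] V)

lemma blin_tact: "blin (A \<otimes>\<^sub>v B) (V \<otimes>\<^sub>v W) (V \<otimes>\<^sub>v W) (tensor_act V W \<alpha> \<beta>)"
proof (rule blinI)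
  show "linear_map (A \<otimes>\<^sub>v B) (V \<otimes>\<^sub>v W) (\<lambda>t. tensor_act V W \<alpha> \<beta> t s)" if "s \<in> carrier (V \<otimes>\<^sub>v W)" for s
    unfolding tensor_act_def by (intro linear_lift blin_tact_inner that V vsp_vtensor)
  show "linear_map (V \<otimes>\<^sub>v W) (V \<otimes>\<^sub>v W) (\<lambda>s. tensor_act V W \<alpha> \<beta> t s)" if "t \<in> carrier (A \<otimes>\<^sub>v B)" for t
    unfolding tensor_act_def
    by (intro linear_lift_fun[OF that] linear_tmap blin_right[OF bl(1)] blin_right[OF bl(2)] V vsp_vtensor)
qed

lemma tact_closed [simp]:
  "\<lbrakk>t \<in> carrier (A \<otimes>\<^sub>v B); s \<in> carrier (V \<otimes>\<^sub>v W)\<rbrakk> \<Longrightarrow> tensor_act V W \<alpha> \<beta> t s \<in> carrier (V \<otimes>\<^sub>v W)"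
  by (rule blin_closed[OF blin_tact])

end

lemma tact_cong:
  assumes "vsp A" "vsp B" "vsp V" "vsp W" "t \<in> carrier (A \<otimes>\<^sub>v B)" "s \<in> carrier (V \<otimes>\<^sub>v W)"
    and "\<And>a x. \<lbrakk>a \<in> carrier A; x \<in> carrier V\<rbrakk> \<Longrightarrow> \<alpha> a x = \<alpha>' a x"
    and "\<And>b y. \<lbrakk>b \<in> carrier B; y \<in> carrier W\<rbrakk> \<Longrightarrow> \<beta> b y = \<beta>' b y"
  shows "tensor_act V W \<alpha> \<beta> t s = tensor_act V W \<alpha>' \<beta>' t s"
  unfolding tensor_act_def using assms by (intro lift_cong[of A B] tmap_cong[of V W]) auto

lemma alg_rep_tact:
  assumes A: "complex_algebra A" "complex_algebra B" and R: "alg_rep A V \<alpha>" "alg_rep B W \<beta>"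
  shows "alg_rep (A \<otimes>\<^sub>v B) (V \<otimes>\<^sub>v W) (tensor_act V W \<alpha> \<beta>)"
proof -
  interpret algebra_pair A B using A by (simp add: algebra_pair_def)
  note [simp] = alg_rep_vsp[OF R(1)] alg_rep_vsp[OF R(2)] alg_rep_blin[OF R(1)] alg_rep_blin[OF R(2)]
    alg_rep_mult[OF R(1)] alg_rep_mult[OF R(2)] alg_rep_one[OF R(1)] alg_rep_one[OF R(2)]
    alg_rep_closed[OF R(1)] alg_rep_closed[OF R(2)]
  have bt: "blin (A \<otimes>\<^sub>v B) (V \<otimes>\<^sub>v W) (V \<otimes>\<^sub>v W) (tensor_act V W \<alpha> \<beta>)" by (rule blin_tact) simp_all
  note add = linear_add[OF blin_left[OF bt]] linear_add[OF blin_right[OF bt]]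
  show ?thesis unfolding alg_rep_def
  proof (intro conjI ballI)
    fix h k x assume h: "h \<in> carrier (A \<otimes>\<^sub>v B)" and k: "k \<in> carrier (A \<otimes>\<^sub>v B)" and x: "x \<in> carrier (V \<otimes>\<^sub>v W)"
    show "tensor_act V W \<alpha> \<beta> (h \<otimes>\<^bsub>A \<otimes>\<^sub>v B\<^esub> k) x = tensor_act V W \<alpha> \<beta> h (tensor_act V W \<alpha> \<beta> k x)"
      using A.algebra_vsp B.algebra_vsp h
    proof (induction rule: tensor_induct)
      case h: (pure a b)
      show ?case using A.algebra_vsp B.algebra_vsp k
      proof (induction rule: tensor_induct)
        case k: (pure a' b')
        have "tensor_act V W \<alpha> \<beta> (pure A B a b) (tensor_act V W \<alpha> \<beta> (pure A B a' b') x)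
          = tensor_act V W \<alpha> \<beta> (pure A B (a \<otimes>\<^bsub>A\<^esub> a') (b \<otimes>\<^bsub>B\<^esub> b')) x"
          by (rule tensor_eqI[OF _ _ linear_comp[OF blin_right[OF bt] blin_right[OF bt]] blin_right[OF bt] x])
            (simp_all add: h k tact_pure[of A B V W \<alpha> \<beta>] del: tact_pure_left)
        then show ?case using h k by simp
      qed (use h x in \<open>simp add: add T.alg_r_distr blin_closed[OF bt] del: tact_pure_left\<close>)
    qed (use k x in \<open>simp add: add T.alg_l_distr blin_closed[OF bt]\<close>)
  next
    fix x assume "x \<in> carrier (V \<otimes>\<^sub>v W)"
    then show "tensor_act V W \<alpha> \<beta> \<one>\<^bsub>A \<otimes>\<^sub>v B\<^esub> x = x"
      using tmap_cong[of V W x "\<alpha> \<one>\<^bsub>A\<^esub>" "\<lambda>x. x" "\<beta> \<one>\<^bsub>B\<^esub>" "\<lambda>x. x" V W]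
      by (simp add: tensor_one tact_pure_left[of A B V W \<alpha> \<beta>])
  qed (simp_all add: bt)
qed

lemma tact_tmap:
  assumes V: "vsp A" "vsp B" "vsp V" "vsp W" "vsp V'" "vsp W'"
    and bl: "blin A V V \<alpha>" "blin B W W \<beta>" "blin A V' V' \<alpha>'" "blin B W' W' \<beta>'"
    and uv: "linear_map V V' u" "linear_map W W' v"
    and "\<And>a x. \<lbrakk>a \<in> carrier A; x \<in> carrier V\<rbrakk> \<Longrightarrow> u (\<alpha> a x) = \<alpha>' a (u x)"
    and "\<And>b y. \<lbrakk>b \<in> carrier B; y \<in> carrier W\<rbrakk> \<Longrightarrow> v (\<beta> b y) = \<beta>' b (v y)"
    and t: "t \<in> carrier (A \<otimes>\<^sub>v B)" and s: "s \<in> carrier (V \<otimes>\<^sub>v W)"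
  shows "tensor_act V' W' \<alpha>' \<beta>' t (tensor_map V' W' u v s) = tensor_map V' W' u v (tensor_act V W \<alpha> \<beta> t s)"
  by (rule tensor_eqI2[OF V(1-4) blin_comp[OF blin_tact linear_id linear_tmap[OF uv] linear_id]
        blin_comp[OF blin_tact linear_id linear_id linear_tmap[OF uv]] t s])
    (simp_all add: assms linear_closed[OF uv(1)] linear_closed[OF uv(2)] tact_pure[of A B]
      blin_closed[OF bl(1)] blin_closed[OF bl(2)] tmap_pure[OF uv] del: tact_pure_left)

lemma blin_pull: "\<lbrakk>blin B V V \<alpha>; linear_map A B \<theta>\<rbrakk> \<Longrightarrow> blin A V V (\<lambda>a. \<alpha> (\<theta> a))"
  using blin_comp[OF _ _ linear_id linear_id] .

lemma tact_pull:
  assumes V: "vsp A" "vsp B" "vsp A'" "vsp B'" "vsp V" "vsp W"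
    and bl: "blin A V V \<alpha>" "blin B W W \<beta>"
    and \<theta>: "linear_map A' A \<theta>" "linear_map B' B \<eta>"
    and t: "t \<in> carrier (A' \<otimes>\<^sub>v B')" and s: "s \<in> carrier (V \<otimes>\<^sub>v W)"
  shows "tensor_act V W \<alpha> \<beta> (tensor_map A B \<theta> \<eta> t) s = tensor_act V W (\<lambda>a. \<alpha> (\<theta> a)) (\<lambda>b. \<beta> (\<eta> b)) t s"
  by (rule tensor_eqI2[OF V(3,4,5,6) blin_comp[OF blin_tact linear_tmap[OF \<theta>] linear_id linear_id]
        blin_tact t s])
    (simp_all add: assms blin_pull[OF bl(1) \<theta>(1)] blin_pull[OF bl(2) \<theta>(2)]
      linear_closed[OF \<theta>(1)] linear_closed[OF \<theta>(2)] tact_pure[of A B] tact_pure[of A' B'] tmap_pure[OF \<theta>]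
      del: tact_pure_left)

lemma tact_swap:
  assumes V: "vsp A" "vsp B" "vsp V" "vsp W" and bl: "blin A V V \<alpha>" "blin B W W \<beta>"
    and t: "t \<in> carrier (A \<otimes>\<^sub>v B)" and s: "s \<in> carrier (V \<otimes>\<^sub>v W)"
  shows "tensor_swap V W (tensor_act V W \<alpha> \<beta> t s) = tensor_act W V \<beta> \<alpha> (tensor_swap A B t) (tensor_swap V W s)"
  by (rule tensor_eqI2[OF V blin_comp[OF blin_tact linear_id linear_id linear_swap]
        blin_comp[OF blin_tact linear_swap linear_swap linear_id] t s])
    (simp_all add: assms blin_closed[OF bl(1)] blin_closed[OF bl(2)] tact_pure[of A B] tact_pure[of B A]
      del: tact_pure_left)

text \<open>Both sides are bilinear in the acting element and the vector, so pure tensors in both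
  decide. The lemma moves an element acting on the left bracketing across the associator, which is
  how the factors of \<open>twist_assoc\<close> wrapped in \<open>tensor_assoc\<close> will be
  read.\<close>

lemma tact_assoc:
  assumes V: "vsp A" "vsp B" "vsp C" "vsp U" "vsp V" "vsp W"
    and bl: "blin A U U \<alpha>" "blin B V V \<beta>" "blin C W W \<gamma>"
    and t: "t \<in> carrier ((A \<otimes>\<^sub>v B) \<otimes>\<^sub>v C)" and s: "s \<in> carrier ((U \<otimes>\<^sub>v V) \<otimes>\<^sub>v W)"
  shows "tensor_assoc U V W (tensor_act (U \<otimes>\<^sub>v V) W (tensor_act U V \<alpha> \<beta>) \<gamma> t s)
    = tensor_act U (V \<otimes>\<^sub>v W) \<alpha> (tensor_act V W \<beta> \<gamma>) (tensor_assoc A B C t) (tensor_assoc U V W s)"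
proof -
  note b1 = blin_tact[OF V(1,2,4,5) bl(1,2)] and b2 = blin_tact[OF V(2,3,5,6) bl(2,3)]
  have F: "blin ((A \<otimes>\<^sub>v B) \<otimes>\<^sub>v C) ((U \<otimes>\<^sub>v V) \<otimes>\<^sub>v W) (U \<otimes>\<^sub>v V \<otimes>\<^sub>v W)
    (\<lambda>t s. tensor_assoc U V W (tensor_act (U \<otimes>\<^sub>v V) W (tensor_act U V \<alpha> \<beta>) \<gamma> t s))"
    by (rule blin_comp[OF blin_tact[OF _ _ _ _ b1 bl(3)] linear_id linear_id linear_assoc]) (simp_all add: V)
  have G: "blin ((A \<otimes>\<^sub>v B) \<otimes>\<^sub>v C) ((U \<otimes>\<^sub>v V) \<otimes>\<^sub>v W) (U \<otimes>\<^sub>v V \<otimes>\<^sub>v W)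
    (\<lambda>t s. tensor_act U (V \<otimes>\<^sub>v W) \<alpha> (tensor_act V W \<beta> \<gamma>) (tensor_assoc A B C t) (tensor_assoc U V W s))"
    by (rule blin_comp[OF blin_tact[OF _ _ _ _ bl(1) b2] linear_assoc linear_assoc linear_id]) (simp_all add: V)
  show ?thesis
  proof (rule tensor_eqI_left[OF V(1-3) blin_left[OF F s] blin_left[OF G s] t])
    fix a b c assume a: "a \<in> carrier A" and b: "b \<in> carrier B" and c: "c \<in> carrier C"
    let ?t = "pure (A \<otimes>\<^sub>v B) C (pure A B a b) c"
    have t: "?t \<in> carrier ((A \<otimes>\<^sub>v B) \<otimes>\<^sub>v C)" by (simp add: a b c)
    show "tensor_assoc U V W (tensor_act (U \<otimes>\<^sub>v V) W (tensor_act U V \<alpha> \<beta>) \<gamma> ?t s)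
      = tensor_act U (V \<otimes>\<^sub>v W) \<alpha> (tensor_act V W \<beta> \<gamma>) (tensor_assoc A B C ?t) (tensor_assoc U V W s)"
    proof (rule tensor_eqI_left[OF V(4-6) blin_right[OF F t] blin_right[OF G t] s])
      fix x y z assume x: "x \<in> carrier U" and y: "y \<in> carrier V" and z: "z \<in> carrier W"
      have "tensor_act (U \<otimes>\<^sub>v V) W (tensor_act U V \<alpha> \<beta>) \<gamma> ?t (pure (U \<otimes>\<^sub>v V) W (pure U V x y) z)
        = pure (U \<otimes>\<^sub>v V) W (tensor_act U V \<alpha> \<beta> (pure A B a b) (pure U V x y)) (\<gamma> c z)"
        by (rule tact_pure[OF _ _ _ _ b1 bl(3)]) (simp_all add: V a b c x y z)
      moreover have "tensor_act U (V \<otimes>\<^sub>v W) \<alpha> (tensor_act V W \<beta> \<gamma>)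
          (pure A (B \<otimes>\<^sub>v C) a (pure B C b c)) (pure U (V \<otimes>\<^sub>v W) x (pure V W y z))
        = pure U (V \<otimes>\<^sub>v W) (\<alpha> a x) (tensor_act V W \<beta> \<gamma> (pure B C b c) (pure V W y z))"
        by (rule tact_pure[OF _ _ _ _ bl(1) b2]) (simp_all add: V a b c x y z)
      ultimately show "tensor_assoc U V W
          (tensor_act (U \<otimes>\<^sub>v V) W (tensor_act U V \<alpha> \<beta>) \<gamma> ?t (pure (U \<otimes>\<^sub>v V) W (pure U V x y) z))
        = tensor_act U (V \<otimes>\<^sub>v W) \<alpha> (tensor_act V W \<beta> \<gamma>) (tensor_assoc A B C ?t)
          (tensor_assoc U V W (pure (U \<otimes>\<^sub>v V) W (pure U V x y) z))"
        by (simp add: V a b c x y z tact_pure[OF V(1,2,4,5) bl(1,2)] tact_pure[OF V(2,3,5,6) bl(2,3)]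
            blin_closed[OF bl(1)] blin_closed[OF bl(2)] blin_closed[OF bl(3)] del: tact_pure_left)
    qed
  qed
qed

lemma tact_cj [simp]: "tensor_act (cj V) (cj W) = tensor_act V W"
  by (simp add: tensor_act_def fun_eq_iff)

lemma alg_rep_pull:
  assumes "alg_rep B V \<alpha>" "linear_map A B \<theta>" "\<theta> \<one>\<^bsub>A\<^esub> = \<one>\<^bsub>B\<^esub>"
    and "\<And>h k. \<lbrakk>h \<in> carrier A; k \<in> carrier A\<rbrakk> \<Longrightarrow> \<theta> (h \<otimes>\<^bsub>A\<^esub> k) = \<theta> h \<otimes>\<^bsub>B\<^esub> \<theta> k"
  shows "alg_rep A V (\<lambda>h. \<alpha> (\<theta> h))"
  using assms(3) linear_closed[OF assms(2)] alg_repD[OF assms(1)]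
  by (auto simp: alg_rep_def assms(4) intro!: blin_pull[OF _ assms(2)])

lemma alg_rep_cong:
  assumes "alg_rep A V \<alpha>" "complex_algebra A" "\<And>h x. \<lbrakk>h \<in> carrier A; x \<in> carrier V\<rbrakk> \<Longrightarrow> \<alpha> h x = \<alpha>' h x"
  shows "alg_rep A V \<alpha>'"
proof -
  interpret complex_algebra A by fact
  note R = alg_repD[OF assms(1)]
  have "blin A V V \<alpha>'"
    by (rule blinI; rule linear_cong[OF blin_left[OF R(2)]] linear_cong[OF blin_right[OF R(2)]])
      (simp_all add: R(1), (use assms(3) in blast)+)
  then show ?thesis using R by (simp add: alg_rep_def assms(3)[symmetric])
qed

lemma swap_mult:
  assumes "complex_algebra A" "complex_algebra B"
    and s: "s \<in> carrier (A \<otimes>\<^sub>v B)" and t: "t \<in> carrier (A \<otimes>\<^sub>v B)"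
  shows "tensor_swap A B (s \<otimes>\<^bsub>A \<otimes>\<^sub>v B\<^esub> t) = tensor_swap A B s \<otimes>\<^bsub>B \<otimes>\<^sub>v A\<^esub> tensor_swap A B t"
proof -
  interpret AB: algebra_pair A B using assms by (simp add: algebra_pair_def)
  interpret BA: algebra_pair B A using assms by (simp add: algebra_pair_def)
  have lt: "linear_map (A \<otimes>\<^sub>v B) (B \<otimes>\<^sub>v A) (tensor_swap A B)" by (rule linear_swap) simp_all
  show ?thesis
    by (rule tensor_eqI2[OF _ _ _ _ blin_comp[OF AB.blin_tensor_mult linear_id linear_id lt]
          blin_comp[OF BA.blin_tensor_mult lt lt linear_id] s t])
      simp_all
qed

section \<open>The antipode of a star-Hopf algebra\<close>

definition trilin ::
  "(complex, 'a vuniv, 'b) module_scheme \<Rightarrow> (complex, 'a vuniv, 'c) module_scheme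
    \<Rightarrow> ('a vuniv \<Rightarrow> 'a vuniv \<Rightarrow> 'a vuniv \<Rightarrow> 'a vuniv) \<Rightarrow> bool" where
  "trilin V U \<tau> \<longleftrightarrow> (\<forall>x\<in>carrier V. \<forall>y\<in>carrier V. linear_map V U (\<tau> x y)
    \<and> linear_map V U (\<lambda>z. \<tau> x z y) \<and> linear_map V U (\<lambda>z. \<tau> z x y))"

context star_hopf_algebra
begin

sublocale HH: algebra_pair H H
  by (simp add: algebra_pair_def complex_algebra_axioms)

abbreviation "\<Delta> \<equiv> coprod H"
abbreviation "S \<equiv> antipode H"

lemma coprod_closed [simp]: "h \<in> carrier H \<Longrightarrow> \<Delta> h \<in> carrier (H \<otimes>\<^sub>v H)"
  using linear_closed[OF coprod_linear] .

lemma antipode_closed [simp]: "h \<in> carrier H \<Longrightarrow> S h \<in> carrier H"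
  using linear_closed[OF antipode_linear] .

lemma star_linear: "linear_map H (cj H) (star H)"
  using star_antilinear by (simp add: antilinear_iff)

lemma star_closed [simp]: "h \<in> carrier H \<Longrightarrow> star H h \<in> carrier H"
  using linear_closed[OF star_linear] by simp

lemma linear_counit:
  assumes "vsp U" "u \<in> carrier U"
  shows "linear_map H U (\<lambda>x. counit H x \<odot>\<^bsub>U\<^esub> u)"
  using assms by (auto intro!: linear_mapI simp: counit_add counit_smult vsp_smult)

lemma linear_coprod_lift:
  assumes "vsp U" "blin H H U \<beta>"
  shows "linear_map H U (\<lambda>h. tensor_lift U \<beta> (\<Delta> h))"
  using linear_lift_arg[OF coprod_linear _ _ assms] by simp

text \<open>The trilinear \<open>\<tau>\<close> induces a linear map on
  \<open>H \<otimes>\<^sub>v H \<otimes>\<^sub>v H\<close>; applied to the two sides of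
  \<open>coassoc\<close> it yields the two nested sums. This is the licence to regroup indices in
  Sweedler notation.\<close>

lemma coassoc_lift:
  assumes U: "vsp U" and \<tau>: "trilin H U \<tau>" and h: "h \<in> carrier H"
  shows "tensor_lift U (\<lambda>a b. tensor_lift U (\<lambda>b1 b2. \<tau> a b1 b2) (\<Delta> b)) (\<Delta> h)
    = tensor_lift U (\<lambda>a b. tensor_lift U (\<lambda>a1 a2. \<tau> a1 a2 b) (\<Delta> a)) (\<Delta> h)"
proof -
  have tl: "linear_map H U (\<lambda>z. \<tau> x y z)" "linear_map H U (\<lambda>z. \<tau> x z y)" "linear_map H U (\<lambda>z. \<tau> z x y)"
    if "x \<in> carrier H" "y \<in> carrier H" for x y using that \<tau> by (auto simp: trilin_def)
  have b1: "blin H H U (\<lambda>b c. \<tau> a b c)" if "a \<in> carrier H" for a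
    using that by (intro blinI tl)
  have b1': "blin H H U (\<lambda>b c. \<tau> b c a)" if "a \<in> carrier H" for a
    using that by (intro blinI tl)
  define \<beta> where "\<beta> = (\<lambda>a t. tensor_lift U (\<lambda>b c. \<tau> a b c) t)"
  have b2: "blin H (H \<otimes>\<^sub>v H) U \<beta>"
  proof (rule blinI)
    show "linear_map H U (\<lambda>a. \<beta> a t)" if "t \<in> carrier (H \<otimes>\<^sub>v H)" for t
      unfolding \<beta>_def by (rule linear_lift_fun[OF that]) (simp_all add: U tl)
    show "linear_map (H \<otimes>\<^sub>v H) U (\<lambda>t. \<beta> a t)" if "a \<in> carrier H" for a
      unfolding \<beta>_def using b1[OF that] U by (intro linear_lift) simp_all
  qed
  have L: "linear_map (H \<otimes>\<^sub>v H \<otimes>\<^sub>v H) U (tensor_lift U \<beta>)"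
    by (rule linear_lift[OF _ _ U b2]) simp_all
  have "tensor_lift U \<beta> (tensor_map H (H \<otimes>\<^sub>v H) (\<lambda>x. x) \<Delta> (\<Delta> h))
      = tensor_lift U (\<lambda>a b. tensor_lift U \<beta> (pure H (H \<otimes>\<^sub>v H) a (\<Delta> b))) (\<Delta> h)"
    unfolding tensor_map_def using h by (intro linear_of_lift[OF L, of H H]) (simp_all add: U)
  also have "\<dots> = tensor_lift U (\<lambda>a b. \<beta> a (\<Delta> b)) (\<Delta> h)"
    using h U b2 by (intro lift_cong[of H H]) simp_all
  finally have 1: "tensor_lift U \<beta> (tensor_map H (H \<otimes>\<^sub>v H) (\<lambda>x. x) \<Delta> (\<Delta> h)) = \<dots>" .
  have L2: "linear_map ((H \<otimes>\<^sub>v H) \<otimes>\<^sub>v H) U (\<lambda>t. tensor_lift U \<beta> (tensor_assoc H H H t))"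
    by (rule linear_comp[OF linear_assoc L]) simp_all
  have 2: "tensor_lift U \<beta> (tensor_assoc H H H (pure (H \<otimes>\<^sub>v H) H s b))
      = tensor_lift U (\<lambda>a1 a2. \<tau> a1 a2 b) s" if "s \<in> carrier (H \<otimes>\<^sub>v H)" "b \<in> carrier H" for s b
  proof (rule tensor_eqI[OF _ _ linear_comp[OF linear_pure_left[OF linear_id that(2)] L2] linear_lift[OF _ _ U b1'[OF that(2)]] that(1)])
    fix x y assume "x \<in> carrier H" "y \<in> carrier H"
    then show "tensor_lift U \<beta> (tensor_assoc H H H (pure (H \<otimes>\<^sub>v H) H (pure H H x y) b))
        = tensor_lift U (\<lambda>a1 a2. \<tau> a1 a2 b) (pure H H x y)"
      using that U by (simp add: b2 b1') (simp add: \<beta>_def b1)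
  qed simp_all
  have "tensor_lift U \<beta> (tensor_assoc H H H (tensor_map (H \<otimes>\<^sub>v H) H \<Delta> (\<lambda>x. x) (\<Delta> h)))
      = tensor_lift U (\<lambda>a b. tensor_lift U \<beta> (tensor_assoc H H H (pure (H \<otimes>\<^sub>v H) H (\<Delta> a) b))) (\<Delta> h)"
    unfolding tensor_map_def using h by (intro linear_of_lift[OF L2, of H H]) (simp_all add: U)
  also have "\<dots> = tensor_lift U (\<lambda>a b. tensor_lift U (\<lambda>a1 a2. \<tau> a1 a2 b) (\<Delta> a)) (\<Delta> h)"
    using h by (intro lift_cong[of H H]) (simp_all add: 2)
  finally show ?thesis using 1 coassoc[OF h] by (simp add: \<beta>_def)
qed

text \<open>
  The uniqueness of convolution inverses, \<open>P = (P * N) * Q\<close> if \<open>N * Q\<close> is the unit; it yields all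
  properties of the antipode.
\<close>

lemma convolution_eq:
  assumes A: "complex_algebra A" and P: "linear_map H A P" and N: "linear_map H A N" and Q: "linear_map H A Q"
    and p: "p \<in> carrier A"
    and PN: "\<And>h. h \<in> carrier H \<Longrightarrow> tensor_lift A (\<lambda>a b. P a \<otimes>\<^bsub>A\<^esub> N b) (\<Delta> h) = counit H h \<odot>\<^bsub>A\<^esub> p"
    and NQ: "\<And>h. h \<in> carrier H \<Longrightarrow> tensor_lift A (\<lambda>a b. N a \<otimes>\<^bsub>A\<^esub> Q b) (\<Delta> h) = counit H h \<odot>\<^bsub>A\<^esub> \<one>\<^bsub>A\<^esub>"
    and h: "h \<in> carrier H"
  shows "P h = p \<otimes>\<^bsub>A\<^esub> Q h"
proof -
  interpret A: complex_algebra A by fact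
  note cl [simp] = linear_closed[OF P] linear_closed[OF N] linear_closed[OF Q] p
  \<comment> \<open>The chain evaluates \<open>P * (N * Q) = (P * N) * Q\<close> for convolution.
    The value of \<open>P * N\<close> is the counit times \<open>p\<close> rather than the
    convolution unit, as the two-variable argument for products requires.\<close>
  have "P h = P (tensor_lift H (\<lambda>x y. counit H y \<odot> x) (\<Delta> h))" using h by (simp add: counit_right)
  also have "\<dots> = tensor_lift A (\<lambda>x y. P (counit H y \<odot> x)) (\<Delta> h)"
    using h by (intro linear_of_lift[OF P, of H H]) simp_all
  also have "\<dots> = tensor_lift A (\<lambda>a b. tensor_lift A (\<lambda>b1 b2. P a \<otimes>\<^bsub>A\<^esub> (N b1 \<otimes>\<^bsub>A\<^esub> Q b2)) (\<Delta> b)) (\<Delta> h)"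
  proof (intro lift_cong[of H H])
    fix a b assume ab: "a \<in> carrier H" "b \<in> carrier H"
    have "tensor_lift A (\<lambda>b1 b2. P a \<otimes>\<^bsub>A\<^esub> (N b1 \<otimes>\<^bsub>A\<^esub> Q b2)) (\<Delta> b)
      = P a \<otimes>\<^bsub>A\<^esub> tensor_lift A (\<lambda>b1 b2. N b1 \<otimes>\<^bsub>A\<^esub> Q b2) (\<Delta> b)"
      using ab by (intro linear_of_lift[OF A.linear_mult_right[OF linear_id], symmetric, of _ H H]) simp_all
    then show "P (counit H b \<odot> a) = tensor_lift A (\<lambda>b1 b2. P a \<otimes>\<^bsub>A\<^esub> (N b1 \<otimes>\<^bsub>A\<^esub> Q b2)) (\<Delta> b)"
      using ab by (simp add: NQ A.smult_mult_right linear_smult[OF P])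
  qed (simp_all add: h)
  also have "\<dots> = tensor_lift A (\<lambda>a b. tensor_lift A (\<lambda>a1 a2. P a1 \<otimes>\<^bsub>A\<^esub> (N a2 \<otimes>\<^bsub>A\<^esub> Q b)) (\<Delta> a)) (\<Delta> h)"
    by (rule coassoc_lift[OF _ _ h])
      (auto simp: trilin_def intro!: A.linear_mult_right A.linear_mult_left P N Q)
  also have "\<dots> = tensor_lift A (\<lambda>a b. p \<otimes>\<^bsub>A\<^esub> Q (counit H a \<odot> b)) (\<Delta> h)"
  proof (intro lift_cong[of H H])
    fix a b assume ab: "a \<in> carrier H" "b \<in> carrier H"
    have "tensor_lift A (\<lambda>a1 a2. P a1 \<otimes>\<^bsub>A\<^esub> (N a2 \<otimes>\<^bsub>A\<^esub> Q b)) (\<Delta> a)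
      = tensor_lift A (\<lambda>a1 a2. (P a1 \<otimes>\<^bsub>A\<^esub> N a2) \<otimes>\<^bsub>A\<^esub> Q b) (\<Delta> a)"
      using ab by (intro lift_cong[of H H]) (simp_all add: A.alg_assoc)
    also have "\<dots> = tensor_lift A (\<lambda>a1 a2. P a1 \<otimes>\<^bsub>A\<^esub> N a2) (\<Delta> a) \<otimes>\<^bsub>A\<^esub> Q b"
      using ab by (intro linear_of_lift[OF A.linear_mult_left[OF linear_id], symmetric, of _ H H]) simp_all
    finally show "tensor_lift A (\<lambda>a1 a2. P a1 \<otimes>\<^bsub>A\<^esub> (N a2 \<otimes>\<^bsub>A\<^esub> Q b)) (\<Delta> a) = p \<otimes>\<^bsub>A\<^esub> Q (counit H a \<odot> b)"
      using ab by (simp add: PN A.smult_mult_left A.smult_mult_right linear_smult[OF Q])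
  qed (simp_all add: h)
  also have "\<dots> = p \<otimes>\<^bsub>A\<^esub> Q (tensor_lift H (\<lambda>a b. counit H a \<odot> b) (\<Delta> h))"
    using h by (intro linear_of_lift[OF A.linear_mult_right[OF Q], symmetric, of _ H H]) simp_all
  finally show ?thesis using h by (simp add: counit_left)
qed

lemma antipode_one: "S \<one> = \<one>"
proof -
  have "blin H H H (\<lambda>x y. S x \<otimes> y)"
    by (intro blinI linear_mult_left linear_mult_right antipode_linear linear_id) simp_all
  then have "tensor_lift H (\<lambda>x y. S x \<otimes> y) (\<Delta> \<one>) = S \<one>"
    by (simp add: coprod_one HH.tensor_one)
  then show ?thesis using antipode_left[of \<one>] by (simp add: counit_one)
qed

text \<open>
  The convolutions are taken in one argument at a time: first \<open>k \<mapsto> S (h\<^sub>1 k) h\<^sub>2\<close>, then \<open>h \<mapsto> S (h k)\<close>.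
\<close>

lemma antipode_mult:
  assumes h: "h \<in> carrier H" and k: "k \<in> carrier H"
  shows "S (h \<otimes> k) = S k \<otimes> S h"
proof (rule convolution_eq[of H "\<lambda>h. S (h \<otimes> k)" "\<lambda>h. h" S "S k" h])
  note bS = linear_comp[OF _ antipode_linear]
  fix h assume h: "h \<in> carrier H"
  have bl: "blin H H H (\<lambda>a b. S a \<otimes> b)"
    by (intro blinI linear_mult_left linear_mult_right antipode_linear linear_id) simp_all
  define X where "X = (\<lambda>k. tensor_lift H (\<lambda>a b. S (a \<otimes> k) \<otimes> b) (\<Delta> h))"
  have "X k = (counit H h \<odot> \<one>) \<otimes> S k"
  proof (rule convolution_eq[of H X "\<lambda>h. h" S])
    show "linear_map H H X" unfolding X_def using h
      by (intro linear_lift_fun[of _ H H] linear_mult_left bS linear_mult_right linear_id) simp_all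
    fix k assume k: "k \<in> carrier H"
    have "tensor_lift H (\<lambda>a b. X a \<otimes> b) (\<Delta> k)
      = tensor_lift H (\<lambda>a b. tensor_lift H (\<lambda>x y. S (x \<otimes> a) \<otimes> (y \<otimes> b)) (\<Delta> h)) (\<Delta> k)"
    proof (intro lift_cong[of H H])
      fix a b assume ab: "a \<in> carrier H" "b \<in> carrier H"
      have "X a \<otimes> b = tensor_lift H (\<lambda>x y. (S (x \<otimes> a) \<otimes> y) \<otimes> b) (\<Delta> h)"
        unfolding X_def using ab h by (intro linear_of_lift[OF linear_mult_left[OF linear_id], of _ H H]) simp_all
      also have "\<dots> = tensor_lift H (\<lambda>x y. S (x \<otimes> a) \<otimes> (y \<otimes> b)) (\<Delta> h)"
        using ab h by (intro lift_cong[of H H]) (simp_all add: alg_assoc)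
      finally show "X a \<otimes> b = \<dots>" .
    qed (simp_all add: k)
    also have "\<dots> = tensor_lift H (\<lambda>x y. tensor_lift H (\<lambda>a b. S (x \<otimes> a) \<otimes> (y \<otimes> b)) (\<Delta> k)) (\<Delta> h)"
      using h k by (intro lift_swap[of H H H H]) simp_all
    \<comment> \<open>The summand is \<open>S a \<otimes> b\<close> evaluated at a product of two
      pure tensors. The double sum therefore collapses to the product of \<open>\<Delta> h\<close>
      and \<open>\<Delta> k\<close>, that is to \<open>\<Delta> (h \<otimes> k)\<close>, where
      \<open>antipode_left\<close> applies.\<close>
    also have "\<dots> = tensor_lift H (\<lambda>x y. tensor_lift H (\<lambda>a b. S a \<otimes> b) (tensor_lift (H \<otimes>\<^sub>v H) (\<lambda>a b. pure H H (x \<otimes> a) (y \<otimes> b)) (\<Delta> k))) (\<Delta> h)"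
    proof (intro lift_cong[of H H])
      fix x y assume xy: "x \<in> carrier H" "y \<in> carrier H"
      have "tensor_lift H (\<lambda>a b. S a \<otimes> b) (tensor_lift (H \<otimes>\<^sub>v H) (\<lambda>a b. pure H H (x \<otimes> a) (y \<otimes> b)) (\<Delta> k))
        = tensor_lift H (\<lambda>a b. tensor_lift H (\<lambda>a b. S a \<otimes> b) (pure H H (x \<otimes> a) (y \<otimes> b))) (\<Delta> k)"
        using xy k by (intro linear_of_lift[OF linear_lift[OF _ _ _ bl], of H H]) simp_all
      also have "\<dots> = tensor_lift H (\<lambda>a b. S (x \<otimes> a) \<otimes> (y \<otimes> b)) (\<Delta> k)"
        using xy k bl by (intro lift_cong[of H H]) simp_all
      finally show "tensor_lift H (\<lambda>a b. S (x \<otimes> a) \<otimes> (y \<otimes> b)) (\<Delta> k)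
        = tensor_lift H (\<lambda>a b. S a \<otimes> b) (tensor_lift (H \<otimes>\<^sub>v H) (\<lambda>a b. pure H H (x \<otimes> a) (y \<otimes> b)) (\<Delta> k))" by simp
    qed (simp_all add: h)
    also have "\<dots> = tensor_lift H (\<lambda>a b. S a \<otimes> b) (\<Delta> h \<otimes>\<^bsub>H \<otimes>\<^sub>v H\<^esub> \<Delta> k)"
      unfolding HH.tensor_mult[OF coprod_closed[OF h] coprod_closed[OF k]] using h k
      by (intro linear_of_lift[OF linear_lift[OF _ _ _ bl], symmetric, of H H] lift_closed[of H H]) simp_all
    also have "\<dots> = counit H k \<odot> (counit H h \<odot> \<one>)"
      using h k antipode_left[of "h \<otimes> k"] by (simp add: coprod_mult counit_mult vsp_smult mult.commute)
    finally show "tensor_lift H (\<lambda>a b. X a \<otimes> b) (\<Delta> k) = counit H k \<odot> (counit H h \<odot> \<one>)" .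
  qed (simp_all add: k h complex_algebra_axioms linear_id antipode_linear antipode_right)
  then show "tensor_lift H (\<lambda>a b. S (a \<otimes> k) \<otimes> b) (\<Delta> h) = counit H h \<odot> S k"
    using h k by (simp add: X_def smult_mult_left)
qed (use h k in \<open>simp_all add: complex_algebra_axioms linear_id antipode_linear antipode_right
      linear_comp[OF linear_mult_left[OF linear_id] antipode_linear]\<close>)

text \<open>Both sides are convolution inverses of \<open>\<Delta>\<close> among the maps from
  \<open>H\<close> to \<open>H \<otimes>\<^sub>v H\<close>: the left one because
  \<open>\<Delta>\<close> is multiplicative, the right one because neighbouring factors cancel from
  the inside outwards.\<close>

lemma coprod_antipode:
  assumes h: "h \<in> carrier H"
  shows "\<Delta> (S h) = tensor_swap H H (tensor_map H H S S (\<Delta> h))"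
proof -
  let ?T = "H \<otimes>\<^sub>v H" and ?Q = "\<lambda>t. tensor_swap H H (tensor_map H H S S t)"
  note mT = HH.T.linear_mult_left HH.T.linear_mult_right
  have QL: "linear_map ?T ?T ?Q"
    by (rule linear_comp[OF linear_tmap[OF antipode_linear antipode_linear] linear_swap]) simp_all
  have Q: "linear_map H ?T (\<lambda>h. ?Q (\<Delta> h))"
    by (rule linear_comp[OF coprod_linear QL])
  \<comment> \<open>The general term of the product of \<open>\<Delta> a\<close> with the flipped
    image of \<open>\<Delta> b\<close> under \<open>S\<close> in both factors. It is kept as a
    function of four arguments so that coassociativity can regroup them.\<close>
  define \<tau> where "\<tau> = (\<lambda>a1 a2 b1 b2. pure H H (a1 \<otimes> S b2) (a2 \<otimes> S b1))"
  have \<tau>cl [simp]: "\<tau> a b c d \<in> carrier ?T"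
    if "a \<in> carrier H" "b \<in> carrier H" "c \<in> carrier H" "d \<in> carrier H" for a b c d
    using that by (simp add: \<tau>_def)
  note lin = linear_pure_left linear_pure_right linear_mult_left linear_mult_right antipode_linear linear_id
  have \<tau>lin: "linear_map H ?T (\<lambda>z. \<tau> z a b c)" "linear_map H ?T (\<lambda>z. \<tau> a z b c)"
     "linear_map H ?T (\<lambda>z. \<tau> a b z c)" "linear_map H ?T (\<lambda>z. \<tau> a b c z)"
    if "a \<in> carrier H" "b \<in> carrier H" "c \<in> carrier H" for a b c
    unfolding \<tau>_def using that by (intro lin; simp)+
  have \<tau>bl: "blin H H ?T (\<lambda>c d. \<tau> a b c d)" if "a \<in> carrier H" "b \<in> carrier H" for a b
    using that by (intro blinI \<tau>lin)
  have \<tau>: "\<Delta> a \<otimes>\<^bsub>?T\<^esub> ?Q t = tensor_lift ?T (\<lambda>a1 a2. tensor_lift ?T (\<lambda>b1 b2. \<tau> a1 a2 b1 b2) t) (\<Delta> a)"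
    if a: "a \<in> carrier H" and t: "t \<in> carrier ?T" for a t
  proof -
    have F: "blin ?T ?T ?T (\<lambda>s t. s \<otimes>\<^bsub>?T\<^esub> ?Q t)"
      using blin_comp[OF HH.blin_tensor_mult linear_id QL linear_id] .
    have bo: "blin H H ?T (\<lambda>a1 a2. tensor_lift ?T (\<lambda>b1 b2. \<tau> a1 a2 b1 b2) t)" if "t \<in> carrier ?T" for t
      by (intro blinI linear_lift_fun[OF that]) (simp_all add: \<tau>lin)
    have G: "blin ?T ?T ?T (\<lambda>s t. tensor_lift ?T (\<lambda>a1 a2. tensor_lift ?T (\<lambda>b1 b2. \<tau> a1 a2 b1 b2) t) s)"
    proof (rule blinI)
      show "linear_map ?T ?T (\<lambda>s. tensor_lift ?T (\<lambda>a1 a2. tensor_lift ?T (\<lambda>b1 b2. \<tau> a1 a2 b1 b2) t) s)"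
        if "t \<in> carrier ?T" for t
        by (intro linear_lift bo that) simp_all
      show "linear_map ?T ?T (\<lambda>t. tensor_lift ?T (\<lambda>a1 a2. tensor_lift ?T (\<lambda>b1 b2. \<tau> a1 a2 b1 b2) t) s)"
        if "s \<in> carrier ?T" for s
        by (intro linear_lift_fun[OF that] linear_lift \<tau>bl) simp_all
    qed
    show ?thesis
    proof (rule tensor_eqI2[OF _ _ _ _ F G])
      fix a b x y assume "a \<in> carrier H" "b \<in> carrier H" "x \<in> carrier H" "y \<in> carrier H"
      then show "pure H H a b \<otimes>\<^bsub>?T\<^esub> ?Q (pure H H x y)
        = tensor_lift ?T (\<lambda>a1 a2. tensor_lift ?T (\<lambda>b1 b2. \<tau> a1 a2 b1 b2) (pure H H x y)) (pure H H a b)"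
        by (simp add: bo \<tau>bl tmap_pure[OF antipode_linear antipode_linear]) (simp add: \<tau>_def)
    qed (simp_all add: a t)
  qed
  have "\<Delta> (S h) = \<one>\<^bsub>?T\<^esub> \<otimes>\<^bsub>?T\<^esub> ?Q (\<Delta> h)"
  proof (rule convolution_eq[OF HH.T.complex_algebra_axioms linear_comp[OF antipode_linear coprod_linear] coprod_linear Q _ _ _ h])
    fix h assume h: "h \<in> carrier H"
    have "tensor_lift ?T (\<lambda>a b. \<Delta> (S a) \<otimes>\<^bsub>?T\<^esub> \<Delta> b) (\<Delta> h) = tensor_lift ?T (\<lambda>a b. \<Delta> (S a \<otimes> b)) (\<Delta> h)"
      using h by (intro lift_cong[of H H]) (simp_all add: coprod_mult)
    also have "\<dots> = \<Delta> (tensor_lift H (\<lambda>a b. S a \<otimes> b) (\<Delta> h))"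
      using h by (intro linear_of_lift[OF coprod_linear, symmetric, of H H]) simp_all
    finally show "tensor_lift ?T (\<lambda>a b. \<Delta> (S a) \<otimes>\<^bsub>?T\<^esub> \<Delta> b) (\<Delta> h) = counit H h \<odot>\<^bsub>?T\<^esub> \<one>\<^bsub>?T\<^esub>"
      using h by (simp add: antipode_left linear_smult[OF coprod_linear] coprod_one)
    have "tensor_lift ?T (\<lambda>a b. \<Delta> a \<otimes>\<^bsub>?T\<^esub> ?Q (\<Delta> b)) (\<Delta> h)
      = tensor_lift ?T (\<lambda>a b. tensor_lift ?T (\<lambda>a1 a2. tensor_lift ?T (\<lambda>b1 b2. \<tau> a1 a2 b1 b2) (\<Delta> b)) (\<Delta> a)) (\<Delta> h)"
      using h by (intro lift_cong[of H H]) (simp_all add: \<tau>)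
    \<comment> \<open>Two uses of coassociativity make the two middle factors a coproduct of their
      own. They cancel to a counit in the second tensor factor, after which the outer two cancel in
      the first.\<close>
    also have "\<dots> = tensor_lift ?T (\<lambda>a b. tensor_lift ?T (\<lambda>c d. tensor_lift ?T (\<lambda>b1 b2. \<tau> a c b1 b2) (\<Delta> d)) (\<Delta> b)) (\<Delta> h)"
      by (rule coassoc_lift[OF _ _ h, symmetric])
        (simp_all add: trilin_def linear_coprod_lift \<tau>bl linear_lift_fun[of _ H H] \<tau>lin)
    also have "\<dots> = tensor_lift ?T (\<lambda>a b. tensor_lift ?T (\<lambda>c d. tensor_lift ?T (\<lambda>b1 b2. \<tau> a b1 b2 d) (\<Delta> c)) (\<Delta> b)) (\<Delta> h)"
      using h by (intro lift_cong[of H H] coassoc_lift) (simp_all add: trilin_def \<tau>lin)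
    also have "\<dots> = tensor_lift ?T (\<lambda>a b. pure H H (a \<otimes> S b) \<one>) (\<Delta> h)"
    proof (intro lift_cong[of H H])
      fix a b assume ab: "a \<in> carrier H" "b \<in> carrier H"
      have "tensor_lift ?T (\<lambda>b1 b2. \<tau> a b1 b2 d) (\<Delta> c) = pure H H (a \<otimes> S (counit H c \<odot> d)) \<one>"
        if cd: "c \<in> carrier H" "d \<in> carrier H" for c d
      proof -
        have "tensor_lift ?T (\<lambda>b1 b2. \<tau> a b1 b2 d) (\<Delta> c) = pure H H (a \<otimes> S d) (tensor_lift H (\<lambda>b1 b2. b1 \<otimes> S b2) (\<Delta> c))"
          unfolding \<tau>_def using ab cd
          by (intro linear_of_lift[OF linear_pure_right[OF linear_id], symmetric, of _ H _ H H]) simp_all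
        then show ?thesis using ab cd
          by (simp add: antipode_right linear_smult[OF antipode_linear] smult_mult_right
              linear_smult[OF blin_left[OF blin_pure]] linear_smult[OF blin_right[OF blin_pure]])
      qed
      then have "tensor_lift ?T (\<lambda>c d. tensor_lift ?T (\<lambda>b1 b2. \<tau> a b1 b2 d) (\<Delta> c)) (\<Delta> b)
        = tensor_lift ?T (\<lambda>c d. pure H H (a \<otimes> S (counit H c \<odot> d)) \<one>) (\<Delta> b)"
        using ab by (intro lift_cong[of H H]) simp_all
      also have "\<dots> = pure H H (a \<otimes> S (tensor_lift H (\<lambda>c d. counit H c \<odot> d) (\<Delta> b))) \<one>"
        using ab by (intro linear_of_lift[OF linear_pure_left[OF linear_mult_right[OF antipode_linear]], symmetric, of _ _ H H H]) simp_all
      finally show "tensor_lift ?T (\<lambda>c d. tensor_lift ?T (\<lambda>b1 b2. \<tau> a b1 b2 d) (\<Delta> c)) (\<Delta> b) = pure H H (a \<otimes> S b) \<one>"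
        using ab by (simp add: counit_left)
    qed (simp_all add: h)
    also have "\<dots> = pure H H (tensor_lift H (\<lambda>a b. a \<otimes> S b) (\<Delta> h)) \<one>"
      using h by (intro linear_of_lift[OF linear_pure_left[OF linear_id], symmetric, of _ H H H H]) simp_all
    finally show "tensor_lift ?T (\<lambda>a b. \<Delta> a \<otimes>\<^bsub>?T\<^esub> ?Q (\<Delta> b)) (\<Delta> h) = counit H h \<odot>\<^bsub>?T\<^esub> \<one>\<^bsub>?T\<^esub>"
      using h by (simp add: antipode_right HH.tensor_one linear_smult[OF blin_left[OF blin_pure]])
  qed simp
  then show ?thesis using h linear_closed[OF QL] by simp
qed

text \<open>The counit is a left inverse of \<open>a \<mapsto> a \<odot> \<one>\<close>. Identities
  between scalars are thus proved after multiplication with \<open>\<one>\<close>, where the results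
  on linear maps between spaces of vectors apply.\<close>

lemma smult_one_inj: "a \<odot> \<one> = b \<odot> \<one> \<Longrightarrow> a = b"
proof -
  assume "a \<odot> \<one> = b \<odot> \<one>"
  then have "counit H (a \<odot> \<one>) = counit H (b \<odot> \<one>)" by (rule arg_cong)
  moreover have "\<one> \<in> carrier H" by (rule monoid.one_closed[OF ring.axioms(2)[OF algebra_ring]])
  ultimately show "a = b" by (simp only: counit_smult counit_one mult_1_right)
qed

text \<open>Apply the counit to the antipode axiom: the sum becomes \<epsilon> of \<open>S h\<close>
  by the counit axiom, and the right side is \<epsilon> of \<open>h\<close>.\<close>

lemma counit_antipode:
  assumes h: "h \<in> carrier H"
  shows "counit H (S h) = counit H h"
proof -
  let ?E = "\<lambda>x. counit H x \<odot> \<one>"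
  have E: "linear_map H H ?E" by (rule linear_counit) simp_all
  have "?E (S h) = ?E (S (tensor_lift H (\<lambda>x y. counit H y \<odot> x) (\<Delta> h)))" using h by (simp add: counit_right)
  also have "\<dots> = tensor_lift H (\<lambda>x y. ?E (S (counit H y \<odot> x))) (\<Delta> h)"
    using h by (intro linear_of_lift[OF linear_comp[OF antipode_linear E], of H H]) simp_all
  also have "\<dots> = tensor_lift H (\<lambda>x y. ?E (S x \<otimes> y)) (\<Delta> h)"
    using h by (intro lift_cong[of H H])
      (simp_all add: linear_smult[OF antipode_linear] counit_smult counit_mult mult.commute)
  also have "\<dots> = ?E (tensor_lift H (\<lambda>x y. S x \<otimes> y) (\<Delta> h))"
    using h by (intro linear_of_lift[OF E, symmetric, of H H]) simp_all
  finally show ?thesis using h by (intro smult_one_inj) (simp add: antipode_left counit_smult counit_one)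
qed

text \<open>The conjugate of \<epsilon> after \<open>star\<close> is again a left counit, because
  \<open>star\<close> respects the coproduct, and a left counit agrees with the right counit
  \<epsilon>.\<close>

lemma counit_star:
  assumes h: "h \<in> carrier H"
  shows "counit H (star H h) = cnj (counit H h)"
proof -
  let ?e = "\<lambda>x. cnj (counit H (star H x))"
  have se: "star H (x \<oplus> y) = star H x \<oplus> star H y" "star H (c \<odot> x) = cnj c \<odot> star H x"
    if "x \<in> carrier H" "y \<in> carrier H" for x y c
    using that linear_add[OF star_linear] linear_smult[OF star_linear] by simp_all
  have e: "linear_map H H (\<lambda>x. ?e x \<odot> \<one>)"
    by (rule linear_mapI) (simp_all add: se counit_add counit_smult vsp_smult)
  have E: "linear_map H H (\<lambda>x. counit H x \<odot> \<one>)" by (rule linear_counit) simp_all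
  have bl: "blin H H H (\<lambda>x y. counit H x \<odot> y)"
    by (intro blinI linear_counit linear_scale linear_id) simp_all
  have "star H (tensor_lift H (\<lambda>x y. counit H x \<odot> y) (tensor_map H H (star H) (star H) t))
    = tensor_lift H (\<lambda>x y. ?e x \<odot> y) t" if t: "t \<in> carrier (H \<otimes>\<^sub>v H)" for t
  proof -
    have T: "linear_map (H \<otimes>\<^sub>v H) (cj H \<otimes>\<^sub>v cj H) (tensor_map H H (star H) (star H))"
      using linear_tmap[OF star_linear star_linear] by simp
    have L: "linear_map (cj H \<otimes>\<^sub>v cj H) (cj H) (tensor_lift H (\<lambda>x y. counit H x \<odot> y))"
      using linear_lift[OF _ _ _ bl] by simp
    have S: "linear_map (cj H) H (star H)" using star_linear by (simp add: linear_cj_left)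
    have bl': "blin H H H (\<lambda>x y. ?e x \<odot> y)"
      by (intro blinI linear_scale linear_id, rule linear_mapI)
       (simp_all add: se counit_add counit_smult vsp_smult)
    show ?thesis
    proof (rule tensor_eqI[OF _ _ linear_comp[OF linear_comp[OF T L] S] linear_lift[OF _ _ _ bl'] t])
      fix x y assume xy: "x \<in> carrier H" "y \<in> carrier H"
      then have "tensor_map H H (star H) (star H) (pure H H x y) = pure H H (star H x) (star H y)"
        using tmap_pure[OF star_linear star_linear] by simp
      then show "star H (tensor_lift H (\<lambda>x y. counit H x \<odot> y) (tensor_map H H (star H) (star H) (pure H H x y)))
        = tensor_lift H (\<lambda>x y. ?e x \<odot> y) (pure H H x y)"
        using xy by (simp add: bl bl' se star_star)
    qed simp_all
  qed
  from this[of "\<Delta> h"] have *: "tensor_lift H (\<lambda>x y. ?e x \<odot> y) (\<Delta> h) = h"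
    using h by (simp add: coprod_star[symmetric] counit_left star_star)
  have "?e h \<odot> \<one> = ?e (tensor_lift H (\<lambda>x y. counit H y \<odot> x) (\<Delta> h)) \<odot> \<one>" using h by (simp add: counit_right)
  also have "\<dots> = tensor_lift H (\<lambda>x y. ?e (counit H y \<odot> x) \<odot> \<one>) (\<Delta> h)"
    using h by (intro linear_of_lift[OF e, of H H]) simp_all
  also have "\<dots> = tensor_lift H (\<lambda>x y. counit H (?e x \<odot> y) \<odot> \<one>) (\<Delta> h)"
    using h by (intro lift_cong[of H H]) (simp_all add: se counit_smult mult.commute)
  also have "\<dots> = counit H (tensor_lift H (\<lambda>x y. ?e x \<odot> y) (\<Delta> h)) \<odot> \<one>"
    using h by (intro linear_of_lift[OF E, symmetric, of H H]) simp_all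
  finally have "?e h = counit H h" using * smult_one_inj by simp
  then show ?thesis using h by (metis complex_cnj_cnj)
qed

definition sS :: "'a vuniv \<Rightarrow> 'a vuniv" where "sS h = star H (S h)"

lemma sS_linear: "linear_map H (cj H) sS"
  unfolding sS_def by (rule linear_comp[OF antipode_linear star_linear])

lemma sS_closed [simp]: "h \<in> carrier H \<Longrightarrow> sS h \<in> carrier H"
  by (simp add: sS_def)

lemma sS_mult: "\<lbrakk>h \<in> carrier H; k \<in> carrier H\<rbrakk> \<Longrightarrow> sS (h \<otimes> k) = sS h \<otimes> sS k"
  by (simp add: sS_def antipode_mult star_mult)

lemma star_one: "star H \<one> = \<one>"
proof -
  have "star H \<one> \<otimes> \<one> = \<one>" using star_mult[of "star H \<one>" \<one>] by (simp add: star_star)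
  then show ?thesis by simp
qed

lemma sS_one [simp]: "sS \<one> = \<one>"
  by (simp add: sS_def antipode_one star_one)

lemma counit_sS: "h \<in> carrier H \<Longrightarrow> counit H (sS h) = cnj (counit H h)"
  by (simp add: sS_def counit_star counit_antipode)

lemma coprod_sS:
  assumes h: "h \<in> carrier H"
  shows "\<Delta> (sS h) = tensor_swap H H (tensor_map H H sS sS (\<Delta> h))"
proof -
  have "\<Delta> (sS h) = tensor_map H H (star H) (star H) (tensor_swap H H (tensor_map H H S S (\<Delta> h)))"
    using h by (simp add: sS_def coprod_star coprod_antipode)
  also have "\<dots> = tensor_swap H H (tensor_map H H (star H) (star H) (tensor_map H H S S (\<Delta> h)))"
    using h swap_tmap[OF star_linear star_linear, of "tensor_map H H S S (\<Delta> h)"]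
    by (simp add: tmap_closed[OF antipode_linear antipode_linear])
  also have "tensor_map H H (star H) (star H) (tensor_map H H S S (\<Delta> h)) = tensor_map H H sS sS (\<Delta> h)"
    using h tmap_comp[OF antipode_linear antipode_linear star_linear star_linear, of "\<Delta> h"]
    by (simp add: sS_def[abs_def])
  finally show ?thesis .
qed

text \<open>Both the identity and the square of \<open>* S\<close> are convolution inverse to \<open>S\<close>.\<close>

lemma sS_sS [simp]:
  assumes h: "h \<in> carrier H"
  shows "sS (sS h) = h"
proof -
  have lin: "linear_map H H (\<lambda>h. sS (sS h))"
    using linear_comp[OF sS_linear, of H sS] sS_linear by (simp add: linear_cj_left)
  have "h = \<one> \<otimes> sS (sS h)"
  proof (rule convolution_eq[OF complex_algebra_axioms linear_id antipode_linear lin _ _ _ h])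
    fix h assume h: "h \<in> carrier H"
    show "tensor_lift H (\<lambda>a b. a \<otimes> S b) (\<Delta> h) = counit H h \<odot> \<one>" using h by (rule antipode_right)
    \<comment> \<open>The sum of \<open>?\<beta>\<close> over the coproduct of \<open>sS h\<close>
      is computed twice. By \<open>coprod_sS\<close> it is the convolution of \<open>S\<close> with
      the square of \<open>sS\<close>; and since \<open>?\<beta> x y\<close> is \<open>star\<close>
      of \<open>S x \<otimes> y\<close>, the antipode axiom makes it a multiple of
      \<open>\<one>\<close>.\<close>
    let ?\<beta> = "\<lambda>x y. star H y \<otimes> sS x"
    interpret cH: complex_algebra "cj H" by (rule complex_algebra_cj[OF complex_algebra_axioms])
    have bl: "blin H H (cj H) ?\<beta>"
      using cH.linear_mult_left[OF star_linear] cH.linear_mult_right[OF sS_linear] by (intro blinI) simp_all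
    have T: "linear_map (H \<otimes>\<^sub>v H) (cj H \<otimes>\<^sub>v cj H) (\<lambda>t. tensor_swap H H (tensor_map H H sS sS t))"
      using linear_comp[OF linear_tmap[OF sS_linear sS_linear] linear_swap] by simp
    have L: "linear_map (cj H \<otimes>\<^sub>v cj H) H (tensor_lift H ?\<beta>)"
      using linear_lift[OF _ _ _ bl] by (simp add: linear_cj_left)
    have bl': "blin H H H (\<lambda>a b. S a \<otimes> sS (sS b))"
      by (intro blinI linear_mult_left linear_mult_right antipode_linear lin) simp_all
    have "tensor_lift H ?\<beta> (tensor_swap H H (tensor_map H H sS sS t)) = tensor_lift H (\<lambda>a b. S a \<otimes> sS (sS b)) t"
      if t: "t \<in> carrier (H \<otimes>\<^sub>v H)" for t
    proof (rule tensor_eqI[OF _ _ linear_comp[OF T L] linear_lift[OF _ _ _ bl'] t])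
      fix x y assume xy: "x \<in> carrier H" "y \<in> carrier H"
      then have "tensor_map H H sS sS (pure H H x y) = pure H H (sS x) (sS y)"
        using tmap_pure[OF sS_linear sS_linear] by simp
      moreover have "tensor_lift H ?\<beta> (pure H H a b) = ?\<beta> a b" if "a \<in> carrier H" "b \<in> carrier H" for a b
        using lift_pure[OF _ _ _ bl] that by simp
      ultimately show "tensor_lift H ?\<beta> (tensor_swap H H (tensor_map H H sS sS (pure H H x y)))
        = tensor_lift H (\<lambda>a b. S a \<otimes> sS (sS b)) (pure H H x y)"
        using xy by (simp add: bl') (simp add: sS_def star_star)
    qed simp_all
    then have 1: "tensor_lift H ?\<beta> (\<Delta> (sS h)) = tensor_lift H (\<lambda>a b. S a \<otimes> sS (sS b)) (\<Delta> h)"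
      using h by (simp add: coprod_sS)
    have "tensor_lift H ?\<beta> (\<Delta> g) = cnj (counit H g) \<odot> \<one>" if g: "g \<in> carrier H" for g
    proof -
      have "tensor_lift H ?\<beta> (\<Delta> g) = tensor_lift (cj H) (\<lambda>x y. star H (S x \<otimes> y)) (\<Delta> g)"
        using g lift_cong[of H H "\<Delta> g" ?\<beta> "\<lambda>x y. star H (S x \<otimes> y)" H] by (simp add: star_mult sS_def)
      also have "\<dots> = star H (tensor_lift H (\<lambda>x y. S x \<otimes> y) (\<Delta> g))"
        using g by (intro linear_of_lift[OF star_linear, symmetric, of H H]) simp_all
      finally show ?thesis using g linear_smult[OF star_linear] by (simp add: antipode_left star_one)
    qed
    from this[of "sS h"] show "tensor_lift H (\<lambda>a b. S a \<otimes> sS (sS b)) (\<Delta> h) = counit H h \<odot> \<one>"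
      using h 1 by (simp add: counit_sS)
  qed simp
  then show ?thesis using h by simp
qed

text \<open>The bar structure over \<open>H\<close> is written with the inverse antipode.
  Involutivity of \<open>sS\<close> shows that \<open>S\<close> is injective and that it sends
  \<open>sS h\<close> to \<open>star H h\<close>, so no inverse has to be handled
  afterwards.\<close>

lemma inv_antipode_star: 
  assumes h: "h \<in> carrier H"
  shows "inv_into (carrier H) S (star H h) = sS h"
proof -
  have "S (sS h) = star H h" if "h \<in> carrier H" for h
    using sS_sS[OF that] that star_star[of "S (sS h)"] by (simp add: sS_def)
  moreover have "inj_on S (carrier H)"
  proof (rule inj_onI)
    fix x y assume "x \<in> carrier H" "y \<in> carrier H" "S x = S y"
    then show "x = y" by (metis sS_def sS_sS)
  qed
  ultimately show ?thesis using h inv_into_f_f[of S "carrier H" "sS h"] by simp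
qed

end

section \<open>Modules over a twist\<close>

text \<open>
  Objects are normalised to their underlying space, since tensor products of modules over \<open>H\<close> and over
  its twist differ in the action only.
\<close>

definition vs :: "'a hmod \<Rightarrow> 'a vspace" where "vs X = module.truncate X"

lemma vs_simps [simp]:
  "carrier (vs X) = carrier X" "zero (vs X) = zero X" "add (vs X) = add X" "smult (vs X) = smult X"
  "mult (vs X) = mult X" "one (vs X) = one X"
  by (simp_all add: vs_def module.truncate_def)

text \<open>The relation sees its arguments only through their vector space fields. Hence records of
  different types, such as a module and its underlying space, or the regular module and
  \<open>H\<close> itself, give the same tensor product.\<close>

lemma tensor_eq_mono:
  assumes "carrier V = carrier V'" "zero V = zero V'" "add V = add V'" "smult V = smult V'"
    and "carrier W = carrier W'" "add W = add W'" "smult W = smult W'"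
    and "tensor_eq V W k l"
  shows "tensor_eq V' W' k l"
  using assms(8)
proof (induction rule: tensor_eq.induct)
  case sym then show ?case using tensor_eq.sym by blast
next
  case trans then show ?case using tensor_eq.trans by blast
qed (use assms(1-7) in \<open>auto simp: tensor_eq.append intro: tensor_eq.refl tensor_eq.commute tensor_eq.zero
    tensor_eq.add_left tensor_eq.add_right tensor_eq.scale\<close>)

lemma tensor_eq_vs:
  "tensor_eq (X :: 'a hmod) W = tensor_eq (vs X) W" "tensor_eq W (X :: 'a hmod) = tensor_eq W (vs X)"
  by (intro ext iffI; erule tensor_eq_mono[rotated 7]; simp)+

text \<open>Fixing the type of \<open>X\<close> makes these terminating rewrite rules:
  \<open>vs X\<close> has another record type, to which they do not apply again.\<close>

lemma slot_vs:
  fixes X :: "'a hmod"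
  shows "pure X = pure (vs X)" "pure V X = pure V (vs X)"
    and "X \<otimes>\<^sub>v V = vs X \<otimes>\<^sub>v V" "V \<otimes>\<^sub>v X = V \<otimes>\<^sub>v vs X"
    and "tensor_lift X = tensor_lift (vs X)"
    and "linear_map X V = linear_map (vs X) V" "linear_map V X = linear_map V (vs X)"
  by (simp_all add: fun_eq_iff pure_def vtensor_def tensor_class_def tensor_eq_vs tensor_lift_def linear_map_def)

lemma slot_vs2:
  fixes X :: "'a hmod"
  shows "tensor_map X = tensor_map (vs X)" "tensor_map V X = tensor_map V (vs X)"
    and "tensor_swap X = tensor_swap (vs X)" "tensor_swap V X = tensor_swap V (vs X)"
  by (simp_all add: fun_eq_iff tensor_map_def tensor_swap_def slot_vs)

lemma slot_vs3:
  fixes X :: "'a hmod"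
  shows "tensor_assoc X = tensor_assoc (vs X)" "tensor_assoc V X = tensor_assoc V (vs X)"
    "tensor_assoc V W X = tensor_assoc V W (vs X)"
    and "tensor_act X = tensor_act (vs X)" "tensor_act V X = tensor_act V (vs X)"
  by (simp_all add: fun_eq_iff tensor_assoc_def tensor_act_def slot_vs slot_vs2)

lemmas to_vs = slot_vs slot_vs2 slot_vs3

lemma vsp_cong:
  assumes "vsp V" "carrier W = carrier V" "zero W = zero V" "add W = add V" "smult W = smult V"
  shows "vsp W"
  by (rule vspI) (use assms in \<open>simp_all add: vsp_add[OF assms(1)] vsp_smult[OF assms(1)]\<close>)

lemma vsp_vs [simp]: "vsp (vs X) \<longleftrightarrow> vsp X"
  using vsp_cong[of X "vs X"] vsp_cong[of "vs X" X] by auto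

lemma left_module_iff: "left_module A X \<longleftrightarrow> alg_rep A (vs X) (act X)"
proof
  assume "left_module A X"
  then interpret left_module A X .
  have "blin A (vs X) (vs X) (act X)"
    using act_linear act_add act_smult linear_closed[OF act_linear] linear_add[OF act_linear]
      linear_smult[OF act_linear] by (intro blinI linear_mapI) simp_all
  then show "alg_rep A (vs X) (act X)"
    using act_mult act_one module_axioms by (auto simp: alg_rep_def)
next
  assume R: "alg_rep A (vs X) (act X)"
  note b = alg_rep_blin[OF R]
  show "left_module A X"
    unfolding left_module_def left_module_axioms_def
    using alg_repD[OF R] linear_add[OF blin_left[OF b]] linear_smult[OF blin_left[OF b]] blin_right[OF b]
    by (auto simp: slot_vs)
qed

lemma quasi_simps [simp]:
  "carrier (twist H F) = carrier H" "carrier (hopf_quasi H) = carrier H"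
  "zero (twist H F) = zero H" "zero (hopf_quasi H) = zero H"
  "add (twist H F) = add H" "add (hopf_quasi H) = add H"
  "mult (twist H F) = mult H" "mult (hopf_quasi H) = mult H"
  "one (twist H F) = one H" "one (hopf_quasi H) = one H"
  "smult (twist H F) = smult H" "smult (hopf_quasi H) = smult H"
  "counit (twist H F) = counit H" "counit (hopf_quasi H) = counit H"
  "coprod (hopf_quasi H) = coprod H"
  "coprod (twist H F) = (\<lambda>h. F \<otimes>\<^bsub>H \<otimes>\<^sub>v H\<^esub> coprod H h \<otimes>\<^bsub>H \<otimes>\<^sub>v H\<^esub> inv\<^bsub>H \<otimes>\<^sub>v H\<^esub> F)"
  "reassoc (hopf_quasi H) = \<one>\<^bsub>H \<otimes>\<^sub>v H \<otimes>\<^sub>v H\<^esub>" "reassoc (twist H F) = twist_assoc H F"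
  by (simp_all add: twist_def hopf_quasi_def bialg.defs quasi_bialg.defs)

lemma left_module_quasi [simp]:
  "left_module (twist H F) X \<longleftrightarrow> left_module H X" "left_module (hopf_quasi H) X \<longleftrightarrow> left_module H X"
  by (simp_all add: left_module_iff alg_rep_def blin_def linear_map_def)

lemma tensor_mod_simps:
  "carrier (tensor_mod A X Y) = carrier (vs X \<otimes>\<^sub>v vs Y)" "vs (tensor_mod A X Y) = vs X \<otimes>\<^sub>v vs Y"
  "act (tensor_mod A X Y) = (\<lambda>h\<in>carrier A. \<lambda>t\<in>carrier (vs X \<otimes>\<^sub>v vs Y).
      tensor_act (vs X) (vs Y) (act X) (act Y) (coprod A h) t)"
  by (simp_all add: tensor_mod_def module.defs hmod.defs vs_def[of "\<lparr>carrier = _, \<dots> = _\<rparr>"] to_vs)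

declare tensor_mod_simps(1,2) [simp]

lemma unit_mod_simps [simp]:
  "carrier (unit_mod A) = range Scalar" "zero (unit_mod A) = Scalar 0"
  "add (unit_mod A) = (\<lambda>s t. Scalar (scalar_of s + scalar_of t))"
  "smult (unit_mod A) = (\<lambda>c s. Scalar (c * scalar_of s))"
  "act (unit_mod A) = (\<lambda>h\<in>carrier A. \<lambda>s\<in>range Scalar. Scalar (counit A h * scalar_of s))"
  by (simp_all add: unit_mod_def)

lemma vsp_unit_mod [simp]: "vsp (unit_mod A)"
  by (rule vspI) (auto simp: algebra_simps)

text \<open>The morphisms of \<open>module_category\<close> without source, target and
  extensionality, so that they compose as plain functions. Since \<open>H\<close> and its twist have
  the same underlying algebra, one predicate serves both categories.\<close>

definition equivariant :: "'a star_hopf \<Rightarrow> 'a hmod \<Rightarrow> 'a hmod \<Rightarrow> ('a vuniv \<Rightarrow> 'a vuniv) \<Rightarrow> bool" where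
  "equivariant H X Y u \<longleftrightarrow> linear_map (vs X) (vs Y) u
    \<and> (\<forall>h\<in>carrier H. \<forall>x\<in>carrier X. u (act X h x) = act Y h (u x))"

context star_hopf_algebra
begin

abbreviation lm :: "'a hmod \<Rightarrow> bool" where "lm X \<equiv> left_module H X"
abbreviation hm :: "'a hmod \<Rightarrow> 'a hmod \<Rightarrow> ('a vuniv \<Rightarrow> 'a vuniv) \<Rightarrow> bool" where "hm \<equiv> equivariant H"

lemma lmD:
  assumes "lm X"
  shows lm_rep: "alg_rep H (vs X) (act X)"
    and lm_vsp [simp]: "vsp X"
    and lm_blin: "blin H (vs X) (vs X) (act X)"
    and lm_act_closed [simp]: "\<lbrakk>h \<in> carrier H; x \<in> carrier X\<rbrakk> \<Longrightarrow> act X h x \<in> carrier X"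
    and lm_act_mult: "\<lbrakk>h \<in> carrier H; k \<in> carrier H; x \<in> carrier X\<rbrakk> \<Longrightarrow> act X (h \<otimes> k) x = act X h (act X k x)"
    and lm_act_one [simp]: "x \<in> carrier X \<Longrightarrow> act X \<one> x = x"
  using alg_repD[of H "vs X" "act X"] assms by (simp_all add: left_module_iff)

lemma hmD:
  assumes "hm X Y u"
  shows hm_linear: "linear_map (vs X) (vs Y) u"
    and hm_closed: "x \<in> carrier X \<Longrightarrow> u x \<in> carrier Y"
    and hm_act: "\<lbrakk>h \<in> carrier H; x \<in> carrier X\<rbrakk> \<Longrightarrow> u (act X h x) = act Y h (u x)"
  using assms linear_closed[of "vs X" "vs Y" u x] by (auto simp: equivariant_def)

lemma hm_id: "hm X X (\<lambda>x. x)"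
  by (simp add: equivariant_def linear_id)

lemma hm_comp: "\<lbrakk>hm X Y u; hm Y Z v\<rbrakk> \<Longrightarrow> hm X Z (\<lambda>x. v (u x))"
  using linear_closed[of "vs X" "vs Y" u] by (auto simp: equivariant_def intro: linear_comp)

lemma hm_cong: "\<lbrakk>hm X Y u; lm X; \<And>x. x \<in> carrier X \<Longrightarrow> u x = v x\<rbrakk> \<Longrightarrow> hm X Y v"
  using linear_cong[of "vs X" "vs Y" u v] lm_act_closed[of X] by (auto simp: equivariant_def)

definition a2 :: "'a hmod \<Rightarrow> 'a hmod \<Rightarrow> 'a vuniv \<Rightarrow> 'a vuniv \<Rightarrow> 'a vuniv" where
  "a2 X Y = tensor_act (vs X) (vs Y) (act X) (act Y)"

lemma a2_rep: "\<lbrakk>lm X; lm Y\<rbrakk> \<Longrightarrow> alg_rep (H \<otimes>\<^sub>v H) (vs X \<otimes>\<^sub>v vs Y) (a2 X Y)"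
  unfolding a2_def by (intro alg_rep_tact complex_algebra_axioms lm_rep)

lemma a2_blin: "\<lbrakk>lm X; lm Y\<rbrakk> \<Longrightarrow> blin (H \<otimes>\<^sub>v H) (vs X \<otimes>\<^sub>v vs Y) (vs X \<otimes>\<^sub>v vs Y) (a2 X Y)"
  by (rule alg_rep_blin[OF a2_rep])

lemma a2_closed [simp]:
  "\<lbrakk>lm X; lm Y; t \<in> carrier (H \<otimes>\<^sub>v H); s \<in> carrier (vs X \<otimes>\<^sub>v vs Y)\<rbrakk> \<Longrightarrow> a2 X Y t s \<in> carrier (vs X \<otimes>\<^sub>v vs Y)"
  by (rule blin_closed[OF a2_blin])

lemma a2_mult: "\<lbrakk>lm X; lm Y; s \<in> carrier (H \<otimes>\<^sub>v H); t \<in> carrier (H \<otimes>\<^sub>v H); x \<in> carrier (vs X \<otimes>\<^sub>v vs Y)\<rbrakk>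
    \<Longrightarrow> a2 X Y (s \<otimes>\<^bsub>H \<otimes>\<^sub>v H\<^esub> t) x = a2 X Y s (a2 X Y t x)"
  by (rule alg_rep_mult[OF a2_rep])

lemma a2_pure_left:
  "\<lbrakk>lm X; lm Y; a \<in> carrier H; b \<in> carrier H; s \<in> carrier (vs X \<otimes>\<^sub>v vs Y)\<rbrakk>
    \<Longrightarrow> a2 X Y (pure H H a b) s = tensor_map (vs X) (vs Y) (act X a) (act Y b) s"
  unfolding a2_def by (rule tact_pure_left) (simp_all add: lm_blin)

lemma a2_pure:
  "\<lbrakk>lm X; lm Y; a \<in> carrier H; b \<in> carrier H; x \<in> carrier X; y \<in> carrier Y\<rbrakk>
    \<Longrightarrow> a2 X Y (pure H H a b) (pure (vs X) (vs Y) x y) = pure (vs X) (vs Y) (act X a x) (act Y b y)"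
  unfolding a2_def by (rule tact_pure) (simp_all add: lm_blin)

text \<open>Equivariant maps commute with the action in each factor, hence with every element of
  \<open>H \<otimes>\<^sub>v H\<close>. Naturality of \<open>tw\<close>, \<open>un\<close> and
  \<Upsilon> are instances.\<close>

lemma a2_nat:
  assumes "lm X" "lm Y" "lm X'" "lm Y'" "hm X X' u" "hm Y Y' v" "t \<in> carrier (H \<otimes>\<^sub>v H)" "s \<in> carrier (vs X \<otimes>\<^sub>v vs Y)"
  shows "a2 X' Y' t (tensor_map (vs X') (vs Y') u v s) = tensor_map (vs X') (vs Y') u v (a2 X Y t s)"
  unfolding a2_def by (rule tact_tmap) (use assms in \<open>simp_all add: lm_blin hmD\<close>)

end

lemma linear_pure_left_id: "\<lbrakk>y \<in> carrier W; vsp V; vsp W\<rbrakk> \<Longrightarrow> linear_map V (V \<otimes>\<^sub>v W) (\<lambda>x. pure V W x y)"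
  by (rule linear_pure_left[OF linear_id])

lemma linear_pure_right_id: "\<lbrakk>y \<in> carrier V; vsp V; vsp W\<rbrakk> \<Longrightarrow> linear_map W (V \<otimes>\<^sub>v W) (pure V W y)"
  using linear_pure_right[OF linear_id] .

section \<open>Twisting the tensor product of two modules\<close>

locale twisted = star_hopf_algebra H for H :: "'a star_hopf" (structure) +
  fixes F :: "'a vuniv"
  assumes F_Units: "F \<in> Units (H \<otimes>\<^sub>v H)"
    and F_left: "tensor_lift H (\<lambda>x y. counit H x \<odot> y) F = \<one>"
    and F_right: "tensor_lift H (\<lambda>x y. counit H y \<odot> x) F = \<one>"
begin

definition Fi :: "'a vuniv" where "Fi = inv\<^bsub>H \<otimes>\<^sub>v H\<^esub> F"

lemma monoid_HH: "monoid (H \<otimes>\<^sub>v H)"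
  by (rule ring.axioms(2)[OF HH.T.algebra_ring])

lemma F_closed [simp]: "F \<in> carrier (H \<otimes>\<^sub>v H)" and Fi_closed [simp]: "Fi \<in> carrier (H \<otimes>\<^sub>v H)"
  and F_Fi: "F \<otimes>\<^bsub>H \<otimes>\<^sub>v H\<^esub> Fi = \<one>\<^bsub>H \<otimes>\<^sub>v H\<^esub>" and Fi_F: "Fi \<otimes>\<^bsub>H \<otimes>\<^sub>v H\<^esub> F = \<one>\<^bsub>H \<otimes>\<^sub>v H\<^esub>"
  using monoid.Units_closed[OF monoid_HH F_Units] monoid.Units_inv_closed[OF monoid_HH F_Units]
    monoid.Units_r_inv[OF monoid_HH F_Units] monoid.Units_l_inv[OF monoid_HH F_Units]
  by (simp_all add: Fi_def)

lemma HH_simps [simp]: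
  "\<lbrakk>s \<in> carrier (H \<otimes>\<^sub>v H); t \<in> carrier (H \<otimes>\<^sub>v H)\<rbrakk> \<Longrightarrow> s \<otimes>\<^bsub>H \<otimes>\<^sub>v H\<^esub> t \<in> carrier (H \<otimes>\<^sub>v H)"
  "\<one>\<^bsub>H \<otimes>\<^sub>v H\<^esub> \<in> carrier (H \<otimes>\<^sub>v H)"
  "t \<in> carrier (H \<otimes>\<^sub>v H) \<Longrightarrow> \<one>\<^bsub>H \<otimes>\<^sub>v H\<^esub> \<otimes>\<^bsub>H \<otimes>\<^sub>v H\<^esub> t = t"
  "t \<in> carrier (H \<otimes>\<^sub>v H) \<Longrightarrow> t \<otimes>\<^bsub>H \<otimes>\<^sub>v H\<^esub> \<one>\<^bsub>H \<otimes>\<^sub>v H\<^esub> = t"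
  using monoid.m_closed[OF monoid_HH] monoid.one_closed[OF monoid_HH] monoid.l_one[OF monoid_HH]
    monoid.r_one[OF monoid_HH] by auto

lemma F_cancel:
  "t \<in> carrier (H \<otimes>\<^sub>v H) \<Longrightarrow> Fi \<otimes>\<^bsub>H \<otimes>\<^sub>v H\<^esub> (F \<otimes>\<^bsub>H \<otimes>\<^sub>v H\<^esub> t) = t"
  "t \<in> carrier (H \<otimes>\<^sub>v H) \<Longrightarrow> F \<otimes>\<^bsub>H \<otimes>\<^sub>v H\<^esub> (Fi \<otimes>\<^bsub>H \<otimes>\<^sub>v H\<^esub> t) = t"
  using HH.T.alg_assoc[of Fi F t] HH.T.alg_assoc[of F Fi t] by (simp_all add: F_Fi Fi_F)

text \<open>
  \<open>tC\<close> and \<open>tD\<close> are the tensor products of modules over \<open>H\<close> and over the twist; \<open>tw X Y\<close> is the monoidal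
  structure \<open>f\<close> of the twisting functor and \<open>un X Y\<close> its inverse.
\<close>

abbreviation tC :: "'a hmod \<Rightarrow> 'a hmod \<Rightarrow> 'a hmod" where "tC \<equiv> tensor_mod (hopf_quasi H)"
abbreviation tD :: "'a hmod \<Rightarrow> 'a hmod \<Rightarrow> 'a hmod" where "tD \<equiv> tensor_mod (twist H F)"
abbreviation tm :: "'a hmod \<Rightarrow> 'a hmod \<Rightarrow> ('a vuniv \<Rightarrow> 'a vuniv) \<Rightarrow> ('a vuniv \<Rightarrow> 'a vuniv) \<Rightarrow> 'a vuniv \<Rightarrow> 'a vuniv"
  where "tm X Y \<equiv> tensor_map (vs X) (vs Y)"
abbreviation tw :: "'a hmod \<Rightarrow> 'a hmod \<Rightarrow> 'a vuniv \<Rightarrow> 'a vuniv" where "tw X Y \<equiv> a2 X Y Fi"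
abbreviation un :: "'a hmod \<Rightarrow> 'a hmod \<Rightarrow> 'a vuniv \<Rightarrow> 'a vuniv" where "un X Y \<equiv> a2 X Y F"

lemma act_tC [simp]: "\<lbrakk>h \<in> carrier H; s \<in> carrier (vs X \<otimes>\<^sub>v vs Y)\<rbrakk> \<Longrightarrow> act (tC X Y) h s = a2 X Y (\<Delta> h) s"
  and act_tD [simp]: "\<lbrakk>h \<in> carrier H; s \<in> carrier (vs X \<otimes>\<^sub>v vs Y)\<rbrakk>
    \<Longrightarrow> act (tD X Y) h s = a2 X Y (F \<otimes>\<^bsub>H \<otimes>\<^sub>v H\<^esub> \<Delta> h \<otimes>\<^bsub>H \<otimes>\<^sub>v H\<^esub> Fi) s"
  by (simp_all add: tensor_mod_simps(3) a2_def Fi_def)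

text \<open>Both tensor products restrict the action of \<open>H \<otimes>\<^sub>v H\<close> along
  an algebra homomorphism \<open>\<theta>\<close>: the coproduct itself, or its conjugate by
  \<open>F\<close>.\<close>

lemma lm_tensor:
  assumes "lm X" "lm Y" and \<theta>: "linear_map H (H \<otimes>\<^sub>v H) \<theta>" "\<theta> \<one> = \<one>\<^bsub>H \<otimes>\<^sub>v H\<^esub>"
    "\<And>h k. \<lbrakk>h \<in> carrier H; k \<in> carrier H\<rbrakk> \<Longrightarrow> \<theta> (h \<otimes> k) = \<theta> h \<otimes>\<^bsub>H \<otimes>\<^sub>v H\<^esub> \<theta> k"
    and "vs Z = vs X \<otimes>\<^sub>v vs Y"
    and "\<And>h s. \<lbrakk>h \<in> carrier H; s \<in> carrier (vs X \<otimes>\<^sub>v vs Y)\<rbrakk> \<Longrightarrow> a2 X Y (\<theta> h) s = act Z h s"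
  shows "lm Z"
  unfolding left_module_iff assms(6)
  by (rule alg_rep_cong[OF alg_rep_pull[OF a2_rep[OF assms(1,2)] \<theta>] complex_algebra_axioms assms(7)])

lemma lm_tC [simp]: "\<lbrakk>lm X; lm Y\<rbrakk> \<Longrightarrow> lm (tC X Y)"
  by (rule lm_tensor[of X Y, OF _ _ coprod_linear]) (simp_all add: coprod_one coprod_mult)

lemma lm_tD [simp]: "\<lbrakk>lm X; lm Y\<rbrakk> \<Longrightarrow> lm (tD X Y)"
  by (rule lm_tensor[of X Y, OF _ _ HH.T.linear_mult_left[OF HH.T.linear_mult_right[OF coprod_linear F_closed] Fi_closed]])
    (simp_all add: coprod_one coprod_mult F_Fi HH.T.alg_assoc F_cancel act_tD)

lemma a2_linear: "\<lbrakk>lm X; lm Y; t \<in> carrier (H \<otimes>\<^sub>v H)\<rbrakk> \<Longrightarrow> linear_map (vs X \<otimes>\<^sub>v vs Y) (vs X \<otimes>\<^sub>v vs Y) (a2 X Y t)"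
  by (rule blin_right[OF a2_blin])

lemma tw_un [simp]: "\<lbrakk>lm X; lm Y; s \<in> carrier (vs X \<otimes>\<^sub>v vs Y)\<rbrakk> \<Longrightarrow> tw X Y (un X Y s) = s"
  and un_tw [simp]: "\<lbrakk>lm X; lm Y; s \<in> carrier (vs X \<otimes>\<^sub>v vs Y)\<rbrakk> \<Longrightarrow> un X Y (tw X Y s) = s"
  by (simp_all add: a2_mult[symmetric] F_Fi Fi_F alg_rep_one[OF a2_rep])

text \<open>The twisted coproduct is \<open>\<Delta>\<close> conjugated by \<open>F\<close>, so
  \<open>Fi\<close> and \<open>F\<close> intertwine the two actions of \<open>H\<close>.\<close>

lemma hm_tw: "\<lbrakk>lm X; lm Y\<rbrakk> \<Longrightarrow> hm (tD X Y) (tC X Y) (tw X Y)"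
  and hm_un: "\<lbrakk>lm X; lm Y\<rbrakk> \<Longrightarrow> hm (tC X Y) (tD X Y) (un X Y)"
  by (simp_all add: equivariant_def a2_linear a2_mult[symmetric] HH.T.alg_assoc F_cancel Fi_F)

lemma tm_linear: "\<lbrakk>lm X; lm Y; lm X'; lm Y'; hm X X' u; hm Y Y' v\<rbrakk>
    \<Longrightarrow> linear_map (vs X \<otimes>\<^sub>v vs Y) (vs X' \<otimes>\<^sub>v vs Y') (tm X' Y' u v)"
  by (rule linear_tmap) (simp_all add: hm_linear)

lemma tm_closed: "\<lbrakk>lm X; lm Y; lm X'; lm Y'; hm X X' u; hm Y Y' v; s \<in> carrier (vs X \<otimes>\<^sub>v vs Y)\<rbrakk>
    \<Longrightarrow> tm X' Y' u v s \<in> carrier (vs X' \<otimes>\<^sub>v vs Y')"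
  using linear_closed[OF tm_linear] .

lemma hm_tm:
  assumes "lm X" "lm Y" "lm X'" "lm Y'" "hm X X' u" "hm Y Y' v"
  shows "hm (tC X Y) (tC X' Y') (tm X' Y' u v)" "hm (tD X Y) (tD X' Y') (tm X' Y' u v)"
  using assms a2_nat[OF assms]
  by (simp_all add: equivariant_def[of H "tC X Y"] equivariant_def[of H "tD X Y"] tm_linear tm_closed)

text \<open>\<open>H\<close> acts on \<open>tC X Y\<close> through \<open>\<Delta>\<close>, so an
  element acting on the outer product acts on the three factors by its image under \<Delta>
  \<otimes> id. For \<open>Fi\<close> that image is, up to reassociation, the third factor of
  \<open>twist_assoc\<close>; \<open>a2_right\<close> with \<open>F\<close> gives the
  second.\<close>

lemma a2_left:
  assumes "lm X" "lm Y" "lm Z" "t \<in> carrier (H \<otimes>\<^sub>v H)" "s \<in> carrier ((vs X \<otimes>\<^sub>v vs Y) \<otimes>\<^sub>v vs Z)"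
  shows "a2 (tC X Y) Z t s = tensor_act (vs X \<otimes>\<^sub>v vs Y) (vs Z) (a2 X Y) (act Z)
    (tensor_map (H \<otimes>\<^sub>v H) H \<Delta> (\<lambda>x. x) t) s"
  using assms unfolding a2_def[of "tC X Y" Z]
  by (subst tact_pull[OF _ _ _ _ _ _ a2_blin lm_blin coprod_linear linear_id])
    (auto intro!: tact_cong[of H H])

lemma a2_right:
  assumes "lm X" "lm Y" "lm Z" "t \<in> carrier (H \<otimes>\<^sub>v H)" "s \<in> carrier (vs X \<otimes>\<^sub>v vs Y \<otimes>\<^sub>v vs Z)"
  shows "a2 X (tC Y Z) t s = tensor_act (vs X) (vs Y \<otimes>\<^sub>v vs Z) (act X) (a2 Y Z)
    (tensor_map H (H \<otimes>\<^sub>v H) (\<lambda>x. x) \<Delta> t) s"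
  using assms unfolding a2_def[of X "tC Y Z"]
  by (subst tact_pull[OF _ _ _ _ _ _ lm_blin a2_blin linear_id coprod_linear])
    (auto intro!: tact_cong[of H H])

section \<open>The associator of the twist\<close>

abbreviation a3 :: "'a hmod \<Rightarrow> 'a hmod \<Rightarrow> 'a hmod \<Rightarrow> 'a vuniv \<Rightarrow> 'a vuniv \<Rightarrow> 'a vuniv" where
  "a3 X Y Z \<equiv> tensor_act (vs X) (vs Y \<otimes>\<^sub>v vs Z) (act X) (a2 Y Z)"
abbreviation a3l :: "'a hmod \<Rightarrow> 'a hmod \<Rightarrow> 'a hmod \<Rightarrow> 'a vuniv \<Rightarrow> 'a vuniv \<Rightarrow> 'a vuniv" where
  "a3l X Y Z \<equiv> tensor_act (vs X \<otimes>\<^sub>v vs Y) (vs Z) (a2 X Y) (act Z)"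
abbreviation as :: "'a hmod \<Rightarrow> 'a hmod \<Rightarrow> 'a hmod \<Rightarrow> 'a vuniv \<Rightarrow> 'a vuniv" where
  "as X Y Z \<equiv> tensor_assoc (vs X) (vs Y) (vs Z)"

definition asc :: "'a hmod \<Rightarrow> 'a hmod \<Rightarrow> 'a hmod \<Rightarrow> 'a vuniv \<Rightarrow> 'a vuniv" where
  "asc X Y Z t = a3 X Y Z (twist_assoc H F) (as X Y Z t)"

lemma a3_assoc:
  assumes "lm X" "lm Y" "lm Z" "t \<in> carrier ((H \<otimes>\<^sub>v H) \<otimes>\<^sub>v H)" "s \<in> carrier ((vs X \<otimes>\<^sub>v vs Y) \<otimes>\<^sub>v vs Z)"
  shows "a3 X Y Z (tensor_assoc H H H t) (as X Y Z s) = as X Y Z (a3l X Y Z t s)"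
  using assms unfolding a2_def by (intro tact_assoc[symmetric]) (simp_all add: lm_blin)

text \<open>This is coassociativity, read through the actions on the two bracketings.\<close>

lemma hm_assoc:
  assumes "lm X" "lm Y" "lm Z"
  shows "hm (tC (tC X Y) Z) (tC X (tC Y Z)) (as X Y Z)"
  unfolding equivariant_def
proof (intro conjI ballI)
  show "linear_map (vs (tC (tC X Y) Z)) (vs (tC X (tC Y Z))) (as X Y Z)"
    using assms by (simp add: linear_assoc)
  fix h s assume h: "h \<in> carrier H" and "s \<in> carrier (tC (tC X Y) Z)"
  then have s: "s \<in> carrier ((vs X \<otimes>\<^sub>v vs Y) \<otimes>\<^sub>v vs Z)" by simp
  have d: "tensor_map (H \<otimes>\<^sub>v H) H \<Delta> (\<lambda>x. x) (\<Delta> h) \<in> carrier ((H \<otimes>\<^sub>v H) \<otimes>\<^sub>v H)"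
    by (rule tmap_closed[OF coprod_linear linear_id]) (simp_all add: h)
  have "as X Y Z (act (tC (tC X Y) Z) h s) = as X Y Z (a2 (tC X Y) Z (\<Delta> h) s)"
    using h s by simp
  also have "\<dots> = a3 X Y Z (tensor_assoc H H H (tensor_map (H \<otimes>\<^sub>v H) H \<Delta> (\<lambda>x. x) (\<Delta> h))) (as X Y Z s)"
    using assms h s d by (simp add: a2_left a3_assoc)
  also have "\<dots> = a2 X (tC Y Z) (\<Delta> h) (as X Y Z s)"
    using assms h s by (simp add: coassoc[symmetric] a2_right)
  finally show "as X Y Z (act (tC (tC X Y) Z) h s) = act (tC X (tC Y Z)) h (as X Y Z s)"
    using assms h s by simp
qed

text \<open>Each of the four factors of \<open>twist_assoc\<close> acts as a single map. The last
  two act before reassociation, where \<open>a3_assoc\<close> turns them into \<open>tw\<close> on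
  the inner and then on the outer product of the left bracketing; the first two are
  \<open>un\<close> on the outer and then on the inner product of the right bracketing.\<close>

lemma asc_eq:
  assumes X: "lm X" "lm Y" "lm Z" and t: "t \<in> carrier ((vs X \<otimes>\<^sub>v vs Y) \<otimes>\<^sub>v vs Z)"
  shows "asc X Y Z t = tensor_map (vs X) (vs Y \<otimes>\<^sub>v vs Z) (\<lambda>x. x) (un Y Z)
    (un X (tC Y Z) (as X Y Z (tw (tC X Y) Z (tensor_map (vs X \<otimes>\<^sub>v vs Y) (vs Z) (tw X Y) (\<lambda>x. x) t))))"
proof -
  let ?U = "H \<otimes>\<^sub>v H \<otimes>\<^sub>v H"
  interpret HHH: algebra_pair H "H \<otimes>\<^sub>v H"
    by (simp add: algebra_pair_def complex_algebra_axioms HH.T.complex_algebra_axioms)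
  have m: "monoid ?U" by (rule ring.axioms(2)[OF HHH.T.algebra_ring])
  have R: "alg_rep ?U (vs X \<otimes>\<^sub>v vs Y \<otimes>\<^sub>v vs Z) (a3 X Y Z)"
    by (intro alg_rep_tact complex_algebra_axioms HH.T.complex_algebra_axioms lm_rep a2_rep X)
  note cl = monoid.m_closed[OF m]
  have 1: "pure H (H \<otimes>\<^sub>v H) \<one> F \<in> carrier ?U" "pure (H \<otimes>\<^sub>v H) H Fi \<one> \<in> carrier ((H \<otimes>\<^sub>v H) \<otimes>\<^sub>v H)" by simp_all
  have 2: "tensor_map H (H \<otimes>\<^sub>v H) (\<lambda>x. x) \<Delta> F \<in> carrier ?U"
    by (rule tmap_closed[OF linear_id coprod_linear]) simp_all
  have 3: "tensor_map (H \<otimes>\<^sub>v H) H \<Delta> (\<lambda>x. x) Fi \<in> carrier ((H \<otimes>\<^sub>v H) \<otimes>\<^sub>v H)"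
    by (rule tmap_closed[OF coprod_linear linear_id]) simp_all
  have as: "as X Y Z s \<in> carrier (vs X \<otimes>\<^sub>v vs Y \<otimes>\<^sub>v vs Z)" if "s \<in> carrier ((vs X \<otimes>\<^sub>v vs Y) \<otimes>\<^sub>v vs Z)" for s
    using that X by simp
  have al: "a3l X Y Z u s \<in> carrier ((vs X \<otimes>\<^sub>v vs Y) \<otimes>\<^sub>v vs Z)"
    if "s \<in> carrier ((vs X \<otimes>\<^sub>v vs Y) \<otimes>\<^sub>v vs Z)" "u \<in> carrier ((H \<otimes>\<^sub>v H) \<otimes>\<^sub>v H)" for s u
    by (rule tact_closed[OF _ _ _ _ a2_blin[OF X(1,2)] lm_blin[OF X(3)] that(2,1)]) (simp_all add: X)
  have p1: "a3l X Y Z (pure (H \<otimes>\<^sub>v H) H Fi \<one>) t = tensor_map (vs X \<otimes>\<^sub>v vs Y) (vs Z) (tw X Y) (act Z \<one>) t"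
    by (rule tact_pure_left[OF _ _ _ _ a2_blin[OF X(1,2)] lm_blin[OF X(3)]]) (simp_all add: X t)
  have p1': "\<dots> = tensor_map (vs X \<otimes>\<^sub>v vs Y) (vs Z) (tw X Y) (\<lambda>x. x) t"
    by (rule tmap_cong[OF _ _ t]) (simp_all add: X)
  have p2: "a3 X Y Z (pure H (H \<otimes>\<^sub>v H) \<one> F) s = tensor_map (vs X) (vs Y \<otimes>\<^sub>v vs Z) (act X \<one>) (un Y Z) s"
    if s: "s \<in> carrier (vs X \<otimes>\<^sub>v vs Y \<otimes>\<^sub>v vs Z)" for s
    by (rule tact_pure_left[OF _ _ _ _ lm_blin[OF X(1)] a2_blin[OF X(2,3)]]) (simp_all add: X s)
  have p2': "\<dots> s = tensor_map (vs X) (vs Y \<otimes>\<^sub>v vs Z) (\<lambda>x. x) (un Y Z) s"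
    if s: "s \<in> carrier (vs X \<otimes>\<^sub>v vs Y \<otimes>\<^sub>v vs Z)" for s
    by (rule tmap_cong[OF _ _ s]) (simp_all add: X)
  have p0: "tensor_map (vs X \<otimes>\<^sub>v vs Y) (vs Z) (tw X Y) (\<lambda>x. x) t \<in> carrier ((vs X \<otimes>\<^sub>v vs Y) \<otimes>\<^sub>v vs Z)"
    by (rule tmap_closed[OF a2_linear linear_id _ _ _ _ t]) (simp_all add: X)
  have "asc X Y Z t = a3 X Y Z (pure H (H \<otimes>\<^sub>v H) \<one> F) (a3 X Y Z (tensor_map H (H \<otimes>\<^sub>v H) (\<lambda>x. x) \<Delta> F)
    (a3 X Y Z (tensor_assoc H H H (tensor_map (H \<otimes>\<^sub>v H) H \<Delta> (\<lambda>x. x) Fi))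
      (a3 X Y Z (tensor_assoc H H H (pure (H \<otimes>\<^sub>v H) H Fi \<one>)) (as X Y Z t))))"
    unfolding asc_def twist_assoc_def Fi_def[symmetric]
    using 1 2 3 as[OF t]
    by (simp add: alg_rep_mult[OF R] alg_rep_closed[OF R] cl)
  also have "a3 X Y Z (tensor_assoc H H H (pure (H \<otimes>\<^sub>v H) H Fi \<one>)) (as X Y Z t)
    = as X Y Z (tensor_map (vs X \<otimes>\<^sub>v vs Y) (vs Z) (tw X Y) (\<lambda>x. x) t)"
    unfolding a3_assoc[OF X 1(2) t] p1 p1' ..
  also have "a3 X Y Z (tensor_assoc H H H (tensor_map (H \<otimes>\<^sub>v H) H \<Delta> (\<lambda>x. x) Fi)) \<dots>
    = as X Y Z (tw (tC X Y) Z (tensor_map (vs X \<otimes>\<^sub>v vs Y) (vs Z) (tw X Y) (\<lambda>x. x) t))"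
    unfolding a3_assoc[OF X 3 p0] a2_left[OF X Fi_closed p0] ..
  also have "a3 X Y Z (tensor_map H (H \<otimes>\<^sub>v H) (\<lambda>x. x) \<Delta> F) \<dots>
    = un X (tC Y Z) (as X Y Z (tw (tC X Y) Z (tensor_map (vs X \<otimes>\<^sub>v vs Y) (vs Z) (tw X Y) (\<lambda>x. x) t)))"
    using X p0 a2_closed[of "tC X Y" Z Fi] by (intro a2_right[symmetric]) simp_all
  finally show ?thesis
    using X p0 a2_closed[of "tC X Y" Z Fi] a2_closed[of X "tC Y Z" F] by (simp add: p2 p2')
qed

text \<open>\<open>R3\<close> and \<open>L3\<close> untwist the products \<open>X (Y Z)\<close> and \<open>(X Y) Z\<close>; \<open>asc\<close> is conjugate to the associator of spaces.\<close>

definition R3 :: "'a hmod \<Rightarrow> 'a hmod \<Rightarrow> 'a hmod \<Rightarrow> 'a vuniv \<Rightarrow> 'a vuniv" where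
  "R3 X Y Z s = tw X (tC Y Z) (tensor_map (vs X) (vs Y \<otimes>\<^sub>v vs Z) (\<lambda>x. x) (tw Y Z) s)"
definition L3 :: "'a hmod \<Rightarrow> 'a hmod \<Rightarrow> 'a hmod \<Rightarrow> 'a vuniv \<Rightarrow> 'a vuniv" where
  "L3 X Y Z s = tw (tC X Y) Z (tensor_map (vs X \<otimes>\<^sub>v vs Y) (vs Z) (tw X Y) (\<lambda>x. x) s)"

definition R3i :: "'a hmod \<Rightarrow> 'a hmod \<Rightarrow> 'a hmod \<Rightarrow> 'a vuniv \<Rightarrow> 'a vuniv" where
  "R3i X Y Z s = tensor_map (vs X) (vs Y \<otimes>\<^sub>v vs Z) (\<lambda>x. x) (un Y Z) (un X (tC Y Z) s)"
definition L3i :: "'a hmod \<Rightarrow> 'a hmod \<Rightarrow> 'a hmod \<Rightarrow> 'a vuniv \<Rightarrow> 'a vuniv" where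
  "L3i X Y Z s = tensor_map (vs X \<otimes>\<^sub>v vs Y) (vs Z) (un X Y) (\<lambda>x. x) (un (tC X Y) Z s)"

lemma hm_R3: "\<lbrakk>lm X; lm Y; lm Z\<rbrakk> \<Longrightarrow> hm (tD X (tD Y Z)) (tC X (tC Y Z)) (R3 X Y Z)"
  and hm_R3i: "\<lbrakk>lm X; lm Y; lm Z\<rbrakk> \<Longrightarrow> hm (tC X (tC Y Z)) (tD X (tD Y Z)) (R3i X Y Z)"
  and hm_L3: "\<lbrakk>lm X; lm Y; lm Z\<rbrakk> \<Longrightarrow> hm (tD (tD X Y) Z) (tC (tC X Y) Z) (L3 X Y Z)"
  and hm_L3i: "\<lbrakk>lm X; lm Y; lm Z\<rbrakk> \<Longrightarrow> hm (tC (tC X Y) Z) (tD (tD X Y) Z) (L3i X Y Z)"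
  using hm_comp[OF hm_tm(2)[of X "tD Y Z" X "tC Y Z", OF _ _ _ _ hm_id hm_tw] hm_tw]
    hm_comp[OF hm_un hm_tm(2)[of X "tC Y Z" X "tD Y Z", OF _ _ _ _ hm_id hm_un]]
    hm_comp[OF hm_tm(2)[of "tD X Y" Z "tC X Y" Z, OF _ _ _ _ hm_tw hm_id] hm_tw]
    hm_comp[OF hm_un hm_tm(2)[of "tC X Y" Z "tD X Y" Z, OF _ _ _ _ hm_un hm_id]]
  by (simp_all add: R3_def[abs_def] R3i_def[abs_def] L3_def[abs_def] L3i_def[abs_def])

lemma R3_linear: "\<lbrakk>lm X; lm Y; lm Z\<rbrakk> \<Longrightarrow> linear_map (vs X \<otimes>\<^sub>v vs Y \<otimes>\<^sub>v vs Z) (vs X \<otimes>\<^sub>v vs Y \<otimes>\<^sub>v vs Z) (R3 X Y Z)"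
  and R3i_linear: "\<lbrakk>lm X; lm Y; lm Z\<rbrakk> \<Longrightarrow> linear_map (vs X \<otimes>\<^sub>v vs Y \<otimes>\<^sub>v vs Z) (vs X \<otimes>\<^sub>v vs Y \<otimes>\<^sub>v vs Z) (R3i X Y Z)"
  and L3_linear: "\<lbrakk>lm X; lm Y; lm Z\<rbrakk> \<Longrightarrow> linear_map ((vs X \<otimes>\<^sub>v vs Y) \<otimes>\<^sub>v vs Z) ((vs X \<otimes>\<^sub>v vs Y) \<otimes>\<^sub>v vs Z) (L3 X Y Z)"
  using hm_linear[OF hm_R3] hm_linear[OF hm_R3i] hm_linear[OF hm_L3] by simp_all

lemma R3_closed [simp]: "\<lbrakk>lm X; lm Y; lm Z; s \<in> carrier (vs X \<otimes>\<^sub>v vs Y \<otimes>\<^sub>v vs Z)\<rbrakk> \<Longrightarrow> R3 X Y Z s \<in> carrier (vs X \<otimes>\<^sub>v vs Y \<otimes>\<^sub>v vs Z)"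
  and R3i_closed [simp]: "\<lbrakk>lm X; lm Y; lm Z; s \<in> carrier (vs X \<otimes>\<^sub>v vs Y \<otimes>\<^sub>v vs Z)\<rbrakk> \<Longrightarrow> R3i X Y Z s \<in> carrier (vs X \<otimes>\<^sub>v vs Y \<otimes>\<^sub>v vs Z)"
  and L3_closed [simp]: "\<lbrakk>lm X; lm Y; lm Z; t \<in> carrier ((vs X \<otimes>\<^sub>v vs Y) \<otimes>\<^sub>v vs Z)\<rbrakk> \<Longrightarrow> L3 X Y Z t \<in> carrier ((vs X \<otimes>\<^sub>v vs Y) \<otimes>\<^sub>v vs Z)"
  and L3i_closed [simp]: "\<lbrakk>lm X; lm Y; lm Z; t \<in> carrier ((vs X \<otimes>\<^sub>v vs Y) \<otimes>\<^sub>v vs Z)\<rbrakk> \<Longrightarrow> L3i X Y Z t \<in> carrier ((vs X \<otimes>\<^sub>v vs Y) \<otimes>\<^sub>v vs Z)"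
  using hm_closed[OF hm_R3] hm_closed[OF hm_R3i] hm_closed[OF hm_L3] hm_closed[OF hm_L3i] by simp_all

lemma tm_inverse:
  assumes "vsp V" "vsp W" "vsp V'" "vsp W'"
    and "linear_map V V' u" "linear_map V' V u'" "linear_map W W' v" "linear_map W' W v'"
    and "\<And>x. x \<in> carrier V \<Longrightarrow> u' (u x) = x" "\<And>x. x \<in> carrier W \<Longrightarrow> v' (v x) = x"
    and "t \<in> carrier (V \<otimes>\<^sub>v W)"
  shows "tensor_map V W u' v' (tensor_map V' W' u v t) = t"
proof -
  have "tensor_map V W u' v' (tensor_map V' W' u v t) = tensor_map V W (\<lambda>x. u' (u x)) (\<lambda>x. v' (v x)) t"
    by (rule tmap_comp) (rule assms)+
  also have "\<dots> = tensor_map V W (\<lambda>x. x) (\<lambda>x. x) t"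
    by (rule tmap_cong) (use assms in auto)
  finally show ?thesis using assms by simp
qed

lemma R3i_R3 [simp]:
  assumes X: "lm X" "lm Y" "lm Z" and s: "s \<in> carrier (vs X \<otimes>\<^sub>v vs Y \<otimes>\<^sub>v vs Z)"
  shows "R3i X Y Z (R3 X Y Z s) = s"
proof -
  have "tensor_map (vs X) (vs Y \<otimes>\<^sub>v vs Z) (\<lambda>x. x) (tw Y Z) s \<in> carrier (vs X \<otimes>\<^sub>v vs Y \<otimes>\<^sub>v vs Z)"
    by (rule tmap_closed[OF linear_id a2_linear _ _ _ _ s]) (simp_all add: X)
  then have "R3i X Y Z (R3 X Y Z s)
    = tensor_map (vs X) (vs Y \<otimes>\<^sub>v vs Z) (\<lambda>x. x) (un Y Z) (tensor_map (vs X) (vs Y \<otimes>\<^sub>v vs Z) (\<lambda>x. x) (tw Y Z) s)"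
    using X by (simp add: R3_def R3i_def)
  also have "\<dots> = s"
    by (rule tm_inverse[OF _ _ _ _ linear_id linear_id a2_linear a2_linear _ _ s]) (simp_all add: X)
  finally show ?thesis .
qed

lemma R3_R3i [simp]:
  assumes X: "lm X" "lm Y" "lm Z" and s: "s \<in> carrier (vs X \<otimes>\<^sub>v vs Y \<otimes>\<^sub>v vs Z)"
  shows "R3 X Y Z (R3i X Y Z s) = s"
proof -
  have u: "un X (tC Y Z) s \<in> carrier (vs X \<otimes>\<^sub>v vs Y \<otimes>\<^sub>v vs Z)" using X s a2_closed[of X "tC Y Z" F s] by simp
  have "tensor_map (vs X) (vs Y \<otimes>\<^sub>v vs Z) (\<lambda>x. x) (tw Y Z)
     (tensor_map (vs X) (vs Y \<otimes>\<^sub>v vs Z) (\<lambda>x. x) (un Y Z) (un X (tC Y Z) s)) = un X (tC Y Z) s"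
    by (rule tm_inverse[OF _ _ _ _ linear_id linear_id a2_linear a2_linear _ _ u]) (simp_all add: X)
  then show ?thesis using X s by (simp add: R3_def R3i_def)
qed

lemma L3i_L3 [simp]:
  assumes X: "lm X" "lm Y" "lm Z" and s: "s \<in> carrier ((vs X \<otimes>\<^sub>v vs Y) \<otimes>\<^sub>v vs Z)"
  shows "L3i X Y Z (L3 X Y Z s) = s"
proof -
  have "tensor_map (vs X \<otimes>\<^sub>v vs Y) (vs Z) (tw X Y) (\<lambda>x. x) s \<in> carrier ((vs X \<otimes>\<^sub>v vs Y) \<otimes>\<^sub>v vs Z)"
    by (rule tmap_closed[OF a2_linear linear_id _ _ _ _ s]) (simp_all add: X)
  then have "L3i X Y Z (L3 X Y Z s)
    = tensor_map (vs X \<otimes>\<^sub>v vs Y) (vs Z) (un X Y) (\<lambda>x. x) (tensor_map (vs X \<otimes>\<^sub>v vs Y) (vs Z) (tw X Y) (\<lambda>x. x) s)"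
    using X by (simp add: L3_def L3i_def)
  also have "\<dots> = s"
    by (rule tm_inverse[OF _ _ _ _ a2_linear a2_linear linear_id linear_id _ _ s]) (simp_all add: X)
  finally show ?thesis .
qed

lemma L3_L3i [simp]:
  assumes X: "lm X" "lm Y" "lm Z" and s: "s \<in> carrier ((vs X \<otimes>\<^sub>v vs Y) \<otimes>\<^sub>v vs Z)"
  shows "L3 X Y Z (L3i X Y Z s) = s"
proof -
  have u: "un (tC X Y) Z s \<in> carrier ((vs X \<otimes>\<^sub>v vs Y) \<otimes>\<^sub>v vs Z)" using X s a2_closed[of "tC X Y" Z F s] by simp
  have "tensor_map (vs X \<otimes>\<^sub>v vs Y) (vs Z) (tw X Y) (\<lambda>x. x)
     (tensor_map (vs X \<otimes>\<^sub>v vs Y) (vs Z) (un X Y) (\<lambda>x. x) (un (tC X Y) Z s)) = un (tC X Y) Z s"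
    by (rule tm_inverse[OF _ _ _ _ a2_linear a2_linear linear_id linear_id _ _ u]) (simp_all add: X)
  then show ?thesis using X s by (simp add: L3_def L3i_def)
qed

lemma asc_R3i:
  "\<lbrakk>lm X; lm Y; lm Z; t \<in> carrier ((vs X \<otimes>\<^sub>v vs Y) \<otimes>\<^sub>v vs Z)\<rbrakk> \<Longrightarrow> asc X Y Z t = R3i X Y Z (as X Y Z (L3 X Y Z t))"
  by (simp add: asc_eq R3i_def L3_def)

lemma asc_closed [simp]:
  "\<lbrakk>lm X; lm Y; lm Z; t \<in> carrier ((vs X \<otimes>\<^sub>v vs Y) \<otimes>\<^sub>v vs Z)\<rbrakk> \<Longrightarrow> asc X Y Z t \<in> carrier (vs X \<otimes>\<^sub>v vs Y \<otimes>\<^sub>v vs Z)"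
  by (simp add: asc_R3i)

lemma R3_asc:
  "\<lbrakk>lm X; lm Y; lm Z; t \<in> carrier ((vs X \<otimes>\<^sub>v vs Y) \<otimes>\<^sub>v vs Z)\<rbrakk> \<Longrightarrow> R3 X Y Z (asc X Y Z t) = as X Y Z (L3 X Y Z t)"
  by (simp add: asc_R3i)

lemma hm_asc:
  assumes "lm X" "lm Y" "lm Z"
  shows "hm (tD (tD X Y) Z) (tD X (tD Y Z)) (asc X Y Z)"
  by (rule hm_cong[OF hm_comp[OF hm_comp[OF hm_L3 hm_assoc] hm_R3i]]) (simp_all add: assms asc_R3i)

definition asci :: "'a hmod \<Rightarrow> 'a hmod \<Rightarrow> 'a hmod \<Rightarrow> 'a vuniv \<Rightarrow> 'a vuniv" where
  "asci X Y Z s = L3i X Y Z (tensor_unassoc (vs X) (vs Y) (vs Z) (R3 X Y Z s))"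

lemma asci_asc:
  "\<lbrakk>lm X; lm Y; lm Z; t \<in> carrier ((vs X \<otimes>\<^sub>v vs Y) \<otimes>\<^sub>v vs Z)\<rbrakk> \<Longrightarrow> asci X Y Z (asc X Y Z t) = t"
  and asc_asci:
  "\<lbrakk>lm X; lm Y; lm Z; s \<in> carrier (vs X \<otimes>\<^sub>v vs Y \<otimes>\<^sub>v vs Z)\<rbrakk> \<Longrightarrow> asc X Y Z (asci X Y Z s) = s"
  by (simp_all add: asci_def R3_asc) (simp add: asc_R3i)

lemma asci_closed: "\<lbrakk>lm X; lm Y; lm Z; s \<in> carrier (vs X \<otimes>\<^sub>v vs Y \<otimes>\<^sub>v vs Z)\<rbrakk> \<Longrightarrow> asci X Y Z s \<in> carrier ((vs X \<otimes>\<^sub>v vs Y) \<otimes>\<^sub>v vs Z)"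
  by (simp add: asci_def)

lemma hm_inverse:
  assumes u: "hm X Y u" and X: "lm X" "lm Y"
    and v: "\<And>y. y \<in> carrier Y \<Longrightarrow> v y \<in> carrier X" "\<And>y. y \<in> carrier Y \<Longrightarrow> u (v y) = y"
    and vu: "\<And>x. x \<in> carrier X \<Longrightarrow> v (u x) = x"
  shows "hm Y X v"
  unfolding equivariant_def
proof (intro conjI ballI linear_mapI)
  note L = hm_linear[OF u]
  show "v (y \<oplus>\<^bsub>vs Y\<^esub> y') = v y \<oplus>\<^bsub>vs X\<^esub> v y'" if "y \<in> carrier (vs Y)" "y' \<in> carrier (vs Y)" for y y'
    using that linear_add[OF L, of "v y" "v y'"] v vu[of "v y \<oplus>\<^bsub>X\<^esub> v y'"] X by simp
  show "v (c \<odot>\<^bsub>vs Y\<^esub> y) = c \<odot>\<^bsub>vs X\<^esub> v y" if "y \<in> carrier (vs Y)" for c y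
    using that linear_smult[OF L, of "v y" c] v vu[of "c \<odot>\<^bsub>X\<^esub> v y"] X by simp
  show "v (act Y h y) = act X h (v y)" if "h \<in> carrier H" "y \<in> carrier Y" for h y
    using that hm_act[OF u, of h "v y"] v vu[of "act X h (v y)"] X by simp
qed (simp_all add: v)

lemma hm_asci: "\<lbrakk>lm X; lm Y; lm Z\<rbrakk> \<Longrightarrow> hm (tD X (tD Y Z)) (tD (tD X Y) Z) (asci X Y Z)"
  by (rule hm_inverse[OF hm_asc]) (simp_all add: asci_asc asc_asci asci_closed)

text \<open>\<open>asc\<close> is the associator of spaces followed by the action of one fixed
  element of the threefold tensor power, and both are natural.\<close>

lemma asc_nat:
  assumes X: "lm X" "lm Y" "lm Z" "lm X'" "lm Y'" "lm Z'" and u: "hm X X' u" "hm Y Y' v" "hm Z Z' w"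
    and t: "t \<in> carrier ((vs X \<otimes>\<^sub>v vs Y) \<otimes>\<^sub>v vs Z)"
  shows "asc X' Y' Z' (tensor_map (vs X' \<otimes>\<^sub>v vs Y') (vs Z') (tm X' Y' u v) w t)
    = tensor_map (vs X') (vs Y' \<otimes>\<^sub>v vs Z') u (tm Y' Z' v w) (asc X Y Z t)"
proof -
  let ?U = "H \<otimes>\<^sub>v H \<otimes>\<^sub>v H"
  interpret HHH: algebra_pair H "H \<otimes>\<^sub>v H"
    by (simp add: algebra_pair_def complex_algebra_axioms HH.T.complex_algebra_axioms)
  note cl = monoid.m_closed[OF ring.axioms(2)[OF HHH.T.algebra_ring]]
  have \<phi>: "twist_assoc H F \<in> carrier ?U"
    unfolding twist_assoc_def Fi_def[symmetric]
    by (intro cl assoc_closed tmap_closed[OF linear_id coprod_linear] tmap_closed[OF coprod_linear linear_id]) simp_all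
  have "asc X' Y' Z' (tensor_map (vs X' \<otimes>\<^sub>v vs Y') (vs Z') (tm X' Y' u v) w t)
    = a3 X' Y' Z' (twist_assoc H F) (tensor_map (vs X') (vs Y' \<otimes>\<^sub>v vs Z') u (tm Y' Z' v w) (as X Y Z t))"
    unfolding asc_def by (subst assoc_tmap[OF hm_linear hm_linear hm_linear, OF u]) (simp_all add: X t)
  also have "\<dots> = tensor_map (vs X') (vs Y' \<otimes>\<^sub>v vs Z') u (tm Y' Z' v w) (asc X Y Z t)"
    unfolding asc_def
    by (rule tact_tmap[OF _ _ _ _ _ _ lm_blin a2_blin lm_blin a2_blin hm_linear[OF u(1)] tm_linear[OF _ _ _ _ u(2,3)]])
      (use X u t \<phi> in \<open>simp_all add: hm_act a2_nat\<close>)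
  finally show ?thesis .
qed

text \<open>
  For the pentagon, each of the five bracketings of a fourfold product is untwisted; this turns the
  associators of the twist into those of vector spaces.
\<close>

lemma pentagon_edge1:
  assumes X: "lm W" "lm X" "lm Y" "lm Z" and t: "t \<in> carrier (((vs W \<otimes>\<^sub>v vs X) \<otimes>\<^sub>v vs Y) \<otimes>\<^sub>v vs Z)"
  shows "tw (tC W (tC X Y)) Z (tm (tC W (tC X Y)) Z (R3 W X Y) (\<lambda>x. x)
      (tm (tC W (tC X Y)) Z (asc W X Y) (\<lambda>x. x) t))
    = tm (tC W (tC X Y)) Z (as W X Y) (\<lambda>x. x) (tw (tC (tC W X) Y) Z (tm (tC (tC W X) Y) Z (L3 W X Y) (\<lambda>x. x) t))"
proof -
  note R = hm_linear[OF hm_R3, of W X Y, simplified] and L = hm_linear[OF hm_L3, of W X Y, simplified]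
    and A = hm_linear[OF hm_asc, of W X Y, simplified] and a = hm_linear[OF hm_assoc, of W X Y, simplified]
  have "tm (tC W (tC X Y)) Z (R3 W X Y) (\<lambda>x. x) (tm (tC W (tC X Y)) Z (asc W X Y) (\<lambda>x. x) t)
    = tm (tC W (tC X Y)) Z (\<lambda>s. R3 W X Y (asc W X Y s)) (\<lambda>x. x) t"
    using tmap_comp[OF A linear_id R linear_id, of "vs Z" t] X t by simp
  also have "\<dots> = tm (tC W (tC X Y)) Z (\<lambda>s. as W X Y (L3 W X Y s)) (\<lambda>x. x) t"
    by (rule tmap_cong[OF _ _ t]) (simp_all add: X R3_asc)
  also have "\<dots> = tm (tC W (tC X Y)) Z (as W X Y) (\<lambda>x. x) (tm (tC (tC W X) Y) Z (L3 W X Y) (\<lambda>x. x) t)"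
    using tmap_comp[OF L linear_id a linear_id, of "vs Z" t] X t by simp
  finally show ?thesis
    using a2_nat[of "tC (tC W X) Y" Z "tC W (tC X Y)" Z "as W X Y" "\<lambda>x. x" Fi "tm (tC (tC W X) Y) Z (L3 W X Y) (\<lambda>x. x) t"]
      X hm_assoc hm_id tmap_closed[OF L linear_id _ _ _ _ t] by simp
qed

lemma pentagon_edge2:
  assumes X: "lm W" "lm X" "lm Y" "lm Z" and t: "t \<in> carrier (vs W \<otimes>\<^sub>v ((vs X \<otimes>\<^sub>v vs Y) \<otimes>\<^sub>v vs Z))"
  shows "tw W (tC X (tC Y Z)) (tm W (tC X (tC Y Z)) (\<lambda>x. x) (R3 X Y Z)
      (tm W (tC X (tC Y Z)) (\<lambda>x. x) (asc X Y Z) t))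
    = tm W (tC X (tC Y Z)) (\<lambda>x. x) (as X Y Z) (tw W (tC (tC X Y) Z) (tm W (tC (tC X Y) Z) (\<lambda>x. x) (L3 X Y Z) t))"
proof -
  note R = hm_linear[OF hm_R3, of X Y Z, simplified] and L = hm_linear[OF hm_L3, of X Y Z, simplified]
    and A = hm_linear[OF hm_asc, of X Y Z, simplified] and a = hm_linear[OF hm_assoc, of X Y Z, simplified]
  have "tm W (tC X (tC Y Z)) (\<lambda>x. x) (R3 X Y Z) (tm W (tC X (tC Y Z)) (\<lambda>x. x) (asc X Y Z) t)
    = tm W (tC X (tC Y Z)) (\<lambda>x. x) (\<lambda>s. R3 X Y Z (asc X Y Z s)) t"
    using tmap_comp[OF linear_id A linear_id R, of "vs W" t] X t by simp
  also have "\<dots> = tm W (tC X (tC Y Z)) (\<lambda>x. x) (\<lambda>s. as X Y Z (L3 X Y Z s)) t"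
    by (rule tmap_cong[OF _ _ t]) (simp_all add: X R3_asc)
  also have "\<dots> = tm W (tC X (tC Y Z)) (\<lambda>x. x) (as X Y Z) (tm W (tC (tC X Y) Z) (\<lambda>x. x) (L3 X Y Z) t)"
    using tmap_comp[OF linear_id L linear_id a, of "vs W" t] X t by simp
  finally show ?thesis
    using a2_nat[of W "tC (tC X Y) Z" W "tC X (tC Y Z)" "\<lambda>x. x" "as X Y Z" Fi "tm W (tC (tC X Y) Z) (\<lambda>x. x) (L3 X Y Z) t"]
      X hm_assoc hm_id tmap_closed[OF linear_id L _ _ _ _ t] by simp
qed

text \<open>The associator has the twisted product \<open>tD X Y\<close> as its middle argument,
  while the right side is stated with \<open>tC X Y\<close>. Naturality of \<open>asc\<close> along
  \<open>tw X Y\<close> exchanges them, after which \<open>R3_asc\<close> applies.\<close>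

lemma pentagon_edge3:
  assumes X: "lm W" "lm X" "lm Y" "lm Z" and t: "t \<in> carrier ((vs W \<otimes>\<^sub>v (vs X \<otimes>\<^sub>v vs Y)) \<otimes>\<^sub>v vs Z)"
  shows "tw W (tC (tC X Y) Z) (tm W (tC (tC X Y) Z) (\<lambda>x. x) (L3 X Y Z) (asc W (tD X Y) Z t))
    = as W (tC X Y) Z (tw (tC W (tC X Y)) Z (tm (tC W (tC X Y)) Z (R3 W X Y) (\<lambda>x. x) t))"
proof -
  let ?f = "tm W (tC X Y) (\<lambda>x. x) (tw X Y)"
  have f: "linear_map (vs W \<otimes>\<^sub>v vs X \<otimes>\<^sub>v vs Y) (vs W \<otimes>\<^sub>v vs X \<otimes>\<^sub>v vs Y) ?f"
    using linear_tmap[OF linear_id a2_linear, of X Y Fi "vs W"] X by simp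
  have g: "linear_map ((vs X \<otimes>\<^sub>v vs Y) \<otimes>\<^sub>v vs Z) ((vs X \<otimes>\<^sub>v vs Y) \<otimes>\<^sub>v vs Z) (tm (tC X Y) Z (tw X Y) (\<lambda>x. x))"
    using linear_tmap[OF a2_linear linear_id, of X Y Fi "vs Z"] X by simp
  have h: "linear_map ((vs X \<otimes>\<^sub>v vs Y) \<otimes>\<^sub>v vs Z) ((vs X \<otimes>\<^sub>v vs Y) \<otimes>\<^sub>v vs Z) (tw (tC X Y) Z)"
    using a2_linear[of "tC X Y" Z Fi] X by simp
  have k: "linear_map (vs W \<otimes>\<^sub>v vs X \<otimes>\<^sub>v vs Y) (vs W \<otimes>\<^sub>v vs X \<otimes>\<^sub>v vs Y) (tw W (tC X Y))"
    using a2_linear[of W "tC X Y" Fi] X by simp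
  have at: "asc W (tD X Y) Z t \<in> carrier (vs W \<otimes>\<^sub>v ((vs X \<otimes>\<^sub>v vs Y) \<otimes>\<^sub>v vs Z))"
    using asc_closed[of W "tD X Y" Z t] X t by simp
  have ft: "tm (tC W (tC X Y)) Z ?f (\<lambda>x. x) t \<in> carrier ((vs W \<otimes>\<^sub>v (vs X \<otimes>\<^sub>v vs Y)) \<otimes>\<^sub>v vs Z)"
    using tmap_closed[OF f linear_id _ _ _ _ t] X by simp
  have "tm W (tC (tC X Y) Z) (\<lambda>x. x) (L3 X Y Z) (asc W (tD X Y) Z t)
    = tm W (tC (tC X Y) Z) (\<lambda>x. x) (tw (tC X Y) Z)
        (tm W (tC (tC X Y) Z) (\<lambda>x. x) (tm (tC X Y) Z (tw X Y) (\<lambda>x. x)) (asc W (tD X Y) Z t))"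
    using tmap_comp[OF linear_id g linear_id h _ _ _ _ _ _ at] X by (simp add: L3_def[abs_def])
  also have "tm W (tC (tC X Y) Z) (\<lambda>x. x) (tm (tC X Y) Z (tw X Y) (\<lambda>x. x)) (asc W (tD X Y) Z t)
    = asc W (tC X Y) Z (tm (tC W (tC X Y)) Z ?f (\<lambda>x. x) t)"
    using asc_nat[of W "tD X Y" Z W "tC X Y" Z "\<lambda>x. x" "tw X Y" "\<lambda>x. x" t] X t hm_id hm_tw by simp
  finally have "tw W (tC (tC X Y) Z) (tm W (tC (tC X Y) Z) (\<lambda>x. x) (L3 X Y Z) (asc W (tD X Y) Z t))
    = R3 W (tC X Y) Z (asc W (tC X Y) Z (tm (tC W (tC X Y)) Z ?f (\<lambda>x. x) t))"
    by (simp add: R3_def)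
  also have "\<dots> = as W (tC X Y) Z (L3 W (tC X Y) Z (tm (tC W (tC X Y)) Z ?f (\<lambda>x. x) t))"
    using R3_asc[of W "tC X Y" Z] X ft by simp
  also have "L3 W (tC X Y) Z (tm (tC W (tC X Y)) Z ?f (\<lambda>x. x) t)
    = tw (tC W (tC X Y)) Z (tm (tC W (tC X Y)) Z (R3 W X Y) (\<lambda>x. x) t)"
    using tmap_comp[OF f linear_id k linear_id _ _ _ _ _ _ t] X by (simp add: L3_def R3_def[abs_def])
  finally show ?thesis .
qed

text \<open>The same device for a twisted product in the first argument, with naturality along
  \<open>tw W X\<close>; the remaining \<open>tw Y Z\<close> belongs to \<open>R3\<close> with first
  argument \<open>tC W X\<close>. The next edge treats the third argument.\<close>

lemma pentagon_edge4:
  assumes X: "lm W" "lm X" "lm Y" "lm Z" and t: "t \<in> carrier (((vs W \<otimes>\<^sub>v vs X) \<otimes>\<^sub>v vs Y) \<otimes>\<^sub>v vs Z)"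
  shows "tw (tC W X) (tC Y Z) (tm (tC W X) (tC Y Z) (tw W X) (tw Y Z) (asc (tD W X) Y Z t))
    = as (tC W X) Y Z (tw (tC (tC W X) Y) Z (tm (tC (tC W X) Y) Z (L3 W X Y) (\<lambda>x. x) t))"
proof -
  let ?f = "tm (tC W X) Y (tw W X) (\<lambda>x. x)"
  have wx: "linear_map (vs W \<otimes>\<^sub>v vs X) (vs W \<otimes>\<^sub>v vs X) (tw W X)" and yz: "linear_map (vs Y \<otimes>\<^sub>v vs Z) (vs Y \<otimes>\<^sub>v vs Z) (tw Y Z)"
    using X by (simp_all add: a2_linear)
  have f: "linear_map ((vs W \<otimes>\<^sub>v vs X) \<otimes>\<^sub>v vs Y) ((vs W \<otimes>\<^sub>v vs X) \<otimes>\<^sub>v vs Y) ?f"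
    using linear_tmap[OF wx linear_id, of "vs Y"] X by simp
  have k: "linear_map ((vs W \<otimes>\<^sub>v vs X) \<otimes>\<^sub>v vs Y) ((vs W \<otimes>\<^sub>v vs X) \<otimes>\<^sub>v vs Y) (tw (tC W X) Y)"
    using a2_linear[of "tC W X" Y Fi] X by simp
  have at: "asc (tD W X) Y Z t \<in> carrier ((vs W \<otimes>\<^sub>v vs X) \<otimes>\<^sub>v (vs Y \<otimes>\<^sub>v vs Z))"
    using asc_closed[of "tD W X" Y Z t] X t by simp
  have ft: "tm (tC (tC W X) Y) Z ?f (\<lambda>x. x) t \<in> carrier (((vs W \<otimes>\<^sub>v vs X) \<otimes>\<^sub>v vs Y) \<otimes>\<^sub>v vs Z)"
    using tmap_closed[OF f linear_id _ _ _ _ t] X by simp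
  have "tm (tC W X) (tC Y Z) (tw W X) (tw Y Z) (asc (tD W X) Y Z t)
    = tm (tC W X) (tC Y Z) (\<lambda>x. x) (tw Y Z) (tm (tC W X) (tC Y Z) (tw W X) (\<lambda>x. x) (asc (tD W X) Y Z t))"
    using tmap_comp[OF wx linear_id linear_id yz _ _ _ _ _ _ at] X by simp
  also have "tm (tC W X) (tC Y Z) (tw W X) (\<lambda>x. x) (asc (tD W X) Y Z t)
    = tm (tC W X) (tC Y Z) (tw W X) (tm Y Z (\<lambda>x. x) (\<lambda>x. x)) (asc (tD W X) Y Z t)"
    using tmap_cong[OF _ _ at, of "tw W X" "tw W X" "\<lambda>x. x" "tm Y Z (\<lambda>x. x) (\<lambda>x. x)"] X by simp
  also have "\<dots> = asc (tC W X) Y Z (tm (tC (tC W X) Y) Z ?f (\<lambda>x. x) t)"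
    using asc_nat[of "tD W X" Y Z "tC W X" Y Z "tw W X" "\<lambda>x. x" "\<lambda>x. x" t] X t hm_id hm_tw by simp
  finally have "tw (tC W X) (tC Y Z) (tm (tC W X) (tC Y Z) (tw W X) (tw Y Z) (asc (tD W X) Y Z t))
    = R3 (tC W X) Y Z (asc (tC W X) Y Z (tm (tC (tC W X) Y) Z ?f (\<lambda>x. x) t))"
    by (simp add: R3_def)
  also have "\<dots> = as (tC W X) Y Z (L3 (tC W X) Y Z (tm (tC (tC W X) Y) Z ?f (\<lambda>x. x) t))"
    using R3_asc[of "tC W X" Y Z] X ft by simp
  also have "L3 (tC W X) Y Z (tm (tC (tC W X) Y) Z ?f (\<lambda>x. x) t)
    = tw (tC (tC W X) Y) Z (tm (tC (tC W X) Y) Z (L3 W X Y) (\<lambda>x. x) t)"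
    using tmap_comp[OF f linear_id k linear_id _ _ _ _ _ _ t] X by (simp add: L3_def[of "tC W X"] L3_def[of W, abs_def])
  finally show ?thesis .
qed

lemma pentagon_edge5:
  assumes X: "lm W" "lm X" "lm Y" "lm Z" and t: "t \<in> carrier ((vs W \<otimes>\<^sub>v vs X) \<otimes>\<^sub>v (vs Y \<otimes>\<^sub>v vs Z))"
  shows "tw W (tC X (tC Y Z)) (tm W (tC X (tC Y Z)) (\<lambda>x. x) (R3 X Y Z) (asc W X (tD Y Z) t))
    = as W X (tC Y Z) (tw (tC W X) (tC Y Z) (tm (tC W X) (tC Y Z) (tw W X) (tw Y Z) t))"
proof -
  let ?f = "tm X (tC Y Z) (\<lambda>x. x) (tw Y Z)"
  have wx: "linear_map (vs W \<otimes>\<^sub>v vs X) (vs W \<otimes>\<^sub>v vs X) (tw W X)" and yz: "linear_map (vs Y \<otimes>\<^sub>v vs Z) (vs Y \<otimes>\<^sub>v vs Z) (tw Y Z)"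
    using X by (simp_all add: a2_linear)
  have f: "linear_map (vs X \<otimes>\<^sub>v vs Y \<otimes>\<^sub>v vs Z) (vs X \<otimes>\<^sub>v vs Y \<otimes>\<^sub>v vs Z) ?f"
    using linear_tmap[OF linear_id yz, of "vs X"] X by simp
  have k: "linear_map (vs X \<otimes>\<^sub>v vs Y \<otimes>\<^sub>v vs Z) (vs X \<otimes>\<^sub>v vs Y \<otimes>\<^sub>v vs Z) (tw X (tC Y Z))"
    using a2_linear[of X "tC Y Z" Fi] X by simp
  have at: "asc W X (tD Y Z) t \<in> carrier (vs W \<otimes>\<^sub>v vs X \<otimes>\<^sub>v (vs Y \<otimes>\<^sub>v vs Z))"
    using asc_closed[of W X "tD Y Z" t] X t by simp
  have ft: "tm (tC W X) (tC Y Z) (\<lambda>x. x) (tw Y Z) t \<in> carrier ((vs W \<otimes>\<^sub>v vs X) \<otimes>\<^sub>v (vs Y \<otimes>\<^sub>v vs Z))"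
    using tmap_closed[OF linear_id yz _ _ _ _ t] X by simp
  have "tm W (tC X (tC Y Z)) (\<lambda>x. x) (R3 X Y Z) (asc W X (tD Y Z) t)
    = tm W (tC X (tC Y Z)) (\<lambda>x. x) (tw X (tC Y Z)) (tm W (tC X (tC Y Z)) (\<lambda>x. x) ?f (asc W X (tD Y Z) t))"
    using tmap_comp[OF linear_id f linear_id k _ _ _ _ _ _ at] X by (simp add: R3_def[abs_def])
  also have "tm W (tC X (tC Y Z)) (\<lambda>x. x) ?f (asc W X (tD Y Z) t)
    = asc W X (tC Y Z) (tm (tC W X) (tC Y Z) (tm W X (\<lambda>x. x) (\<lambda>x. x)) (tw Y Z) t)"
    using asc_nat[of W X "tD Y Z" W X "tC Y Z" "\<lambda>x. x" "\<lambda>x. x" "tw Y Z" t] X t hm_id hm_tw by simp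
  also have "tm (tC W X) (tC Y Z) (tm W X (\<lambda>x. x) (\<lambda>x. x)) (tw Y Z) t = tm (tC W X) (tC Y Z) (\<lambda>x. x) (tw Y Z) t"
    using tmap_cong[OF _ _ t, of "tm W X (\<lambda>x. x) (\<lambda>x. x)" "\<lambda>x. x" "tw Y Z" "tw Y Z"] X by simp
  finally have "tw W (tC X (tC Y Z)) (tm W (tC X (tC Y Z)) (\<lambda>x. x) (R3 X Y Z) (asc W X (tD Y Z) t))
    = R3 W X (tC Y Z) (asc W X (tC Y Z) (tm (tC W X) (tC Y Z) (\<lambda>x. x) (tw Y Z) t))"
    by (simp add: R3_def[abs_def])
  also have "\<dots> = as W X (tC Y Z) (L3 W X (tC Y Z) (tm (tC W X) (tC Y Z) (\<lambda>x. x) (tw Y Z) t))"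
    using R3_asc[of W X "tC Y Z"] X ft by simp
  also have "L3 W X (tC Y Z) (tm (tC W X) (tC Y Z) (\<lambda>x. x) (tw Y Z) t)
    = tw (tC W X) (tC Y Z) (tm (tC W X) (tC Y Z) (tw W X) (tw Y Z) t)"
    using tmap_comp[OF linear_id yz wx linear_id _ _ _ _ _ _ t] X by (simp add: L3_def)
  finally show ?thesis .
qed

end

lemma assoc_pentagon:
  assumes V: "vsp V" "vsp W" "vsp X" "vsp Y" and s: "s \<in> carrier (((V \<otimes>\<^sub>v W) \<otimes>\<^sub>v X) \<otimes>\<^sub>v Y)"
  shows "tensor_assoc V W (X \<otimes>\<^sub>v Y) (tensor_assoc (V \<otimes>\<^sub>v W) X Y s)
    = tensor_map V (W \<otimes>\<^sub>v X \<otimes>\<^sub>v Y) (\<lambda>x. x) (tensor_assoc W X Y)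
        (tensor_assoc V (W \<otimes>\<^sub>v X) Y (tensor_map (V \<otimes>\<^sub>v W \<otimes>\<^sub>v X) Y (tensor_assoc V W X) (\<lambda>x. x) s))"
proof -
  note [simp] = V
  have a1: "linear_map ((V \<otimes>\<^sub>v W) \<otimes>\<^sub>v X) (V \<otimes>\<^sub>v W \<otimes>\<^sub>v X) (tensor_assoc V W X)"
    and a2: "linear_map ((W \<otimes>\<^sub>v X) \<otimes>\<^sub>v Y) (W \<otimes>\<^sub>v X \<otimes>\<^sub>v Y) (tensor_assoc W X Y)" by (simp_all add: linear_assoc)
  have F: "linear_map (((V \<otimes>\<^sub>v W) \<otimes>\<^sub>v X) \<otimes>\<^sub>v Y) (V \<otimes>\<^sub>v W \<otimes>\<^sub>v X \<otimes>\<^sub>v Y)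
      (\<lambda>s. tensor_assoc V W (X \<otimes>\<^sub>v Y) (tensor_assoc (V \<otimes>\<^sub>v W) X Y s))"
    by (rule linear_comp[OF linear_assoc linear_assoc]) simp_all
  have G: "linear_map (((V \<otimes>\<^sub>v W) \<otimes>\<^sub>v X) \<otimes>\<^sub>v Y) (V \<otimes>\<^sub>v W \<otimes>\<^sub>v X \<otimes>\<^sub>v Y)
      (\<lambda>s. tensor_map V (W \<otimes>\<^sub>v X \<otimes>\<^sub>v Y) (\<lambda>x. x) (tensor_assoc W X Y)
        (tensor_assoc V (W \<otimes>\<^sub>v X) Y (tensor_map (V \<otimes>\<^sub>v W \<otimes>\<^sub>v X) Y (tensor_assoc V W X) (\<lambda>x. x) s)))"
    by (rule linear_comp[OF linear_comp[OF linear_tmap[OF a1 linear_id] linear_assoc] linear_tmap[OF linear_id a2]]) simp_all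
  show ?thesis
  proof (rule tensor_eqI_left[OF _ _ _ F G s])
    fix p x y assume p: "p \<in> carrier (V \<otimes>\<^sub>v W)" and x: "x \<in> carrier X" and y: "y \<in> carrier Y"
    note lp = linear_pure_left[OF linear_pure_left[OF linear_id x] y]
    show "tensor_assoc V W (X \<otimes>\<^sub>v Y) (tensor_assoc (V \<otimes>\<^sub>v W) X Y (pure ((V \<otimes>\<^sub>v W) \<otimes>\<^sub>v X) Y (pure (V \<otimes>\<^sub>v W) X p x) y))
      = tensor_map V (W \<otimes>\<^sub>v X \<otimes>\<^sub>v Y) (\<lambda>x. x) (tensor_assoc W X Y)
        (tensor_assoc V (W \<otimes>\<^sub>v X) Y (tensor_map (V \<otimes>\<^sub>v W \<otimes>\<^sub>v X) Y (tensor_assoc V W X) (\<lambda>x. x)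
          (pure ((V \<otimes>\<^sub>v W) \<otimes>\<^sub>v X) Y (pure (V \<otimes>\<^sub>v W) X p x) y)))"
    proof (rule tensor_eqI[OF _ _ linear_comp[OF lp F] linear_comp[OF lp G] p])
      fix v w assume "v \<in> carrier V" "w \<in> carrier W"
      then show "tensor_assoc V W (X \<otimes>\<^sub>v Y) (tensor_assoc (V \<otimes>\<^sub>v W) X Y (pure ((V \<otimes>\<^sub>v W) \<otimes>\<^sub>v X) Y (pure (V \<otimes>\<^sub>v W) X (pure V W v w) x) y))
      = tensor_map V (W \<otimes>\<^sub>v X \<otimes>\<^sub>v Y) (\<lambda>x. x) (tensor_assoc W X Y)
        (tensor_assoc V (W \<otimes>\<^sub>v X) Y (tensor_map (V \<otimes>\<^sub>v W \<otimes>\<^sub>v X) Y (tensor_assoc V W X) (\<lambda>x. x)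
          (pure ((V \<otimes>\<^sub>v W) \<otimes>\<^sub>v X) Y (pure (V \<otimes>\<^sub>v W) X (pure V W v w) x) y)))"
        using x y by (simp add: tmap_pure[OF a1 linear_id] tmap_pure[OF linear_id a2])
    qed simp_all
  qed simp_all
qed

context twisted
begin

lemma pentagon_D:
  assumes X: "lm W" "lm X" "lm Y" "lm Z" and t: "t \<in> carrier (((vs W \<otimes>\<^sub>v vs X) \<otimes>\<^sub>v vs Y) \<otimes>\<^sub>v vs Z)"
  shows "asc W X (tD Y Z) (asc (tD W X) Y Z t)
    = tm W (tC X (tC Y Z)) (\<lambda>x. x) (asc X Y Z) (asc W (tD X Y) Z (tm (tC W (tC X Y)) Z (asc W X Y) (\<lambda>x. x) t))"
    (is "?l = ?r")
proof -
  define u where "u = tm (tC W (tC X Y)) Z (asc W X Y) (\<lambda>x. x) t"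
  \<comment> \<open>\<open>J\<close> carries the target bracketing to its untwisted form, and
    \<open>J1\<close> is the untwisted argument. Both composites become the pentagon of spaces at
    \<open>J1\<close>, and the left inverse of \<open>J\<close> in \<open>inv\<close>
    concludes.\<close>
  define J where "J s = tw W (tC X (tC Y Z)) (tm W (tC X (tC Y Z)) (\<lambda>x. x) (R3 X Y Z) s)" for s
  define J1 where "J1 = tw (tC (tC W X) Y) Z (tm (tC (tC W X) Y) Z (L3 W X Y) (\<lambda>x. x) t)"
  have A: "linear_map ((vs W \<otimes>\<^sub>v vs X) \<otimes>\<^sub>v vs Y) (vs W \<otimes>\<^sub>v vs X \<otimes>\<^sub>v vs Y) (asc W X Y)"
    and A': "linear_map ((vs X \<otimes>\<^sub>v vs Y) \<otimes>\<^sub>v vs Z) (vs X \<otimes>\<^sub>v vs Y \<otimes>\<^sub>v vs Z) (asc X Y Z)"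
    using hm_linear[OF hm_asc, of W X Y] hm_linear[OF hm_asc, of X Y Z] X by simp_all
  have u: "u \<in> carrier ((vs W \<otimes>\<^sub>v vs X \<otimes>\<^sub>v vs Y) \<otimes>\<^sub>v vs Z)"
    using tmap_closed[OF A linear_id _ _ _ _ t] X by (simp add: u_def)
  have b: "asc W (tD X Y) Z u \<in> carrier (vs W \<otimes>\<^sub>v ((vs X \<otimes>\<^sub>v vs Y) \<otimes>\<^sub>v vs Z))"
    using asc_closed[of W "tD X Y" Z u] X u by simp
  have c: "asc (tD W X) Y Z t \<in> carrier ((vs W \<otimes>\<^sub>v vs X) \<otimes>\<^sub>v vs Y \<otimes>\<^sub>v vs Z)"
    using asc_closed[of "tD W X" Y Z t] X t by simp
  have l: "?l \<in> carrier (vs W \<otimes>\<^sub>v vs X \<otimes>\<^sub>v vs Y \<otimes>\<^sub>v vs Z)"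
    using asc_closed[of W X "tD Y Z"] X c by simp
  have r: "?r \<in> carrier (vs W \<otimes>\<^sub>v vs X \<otimes>\<^sub>v vs Y \<otimes>\<^sub>v vs Z)"
    using tmap_closed[OF linear_id A' _ _ _ _ b] X by (simp add: u_def)
  have J1: "J1 \<in> carrier (((vs W \<otimes>\<^sub>v vs X) \<otimes>\<^sub>v vs Y) \<otimes>\<^sub>v vs Z)"
    using a2_closed[of "tC (tC W X) Y" Z Fi] tmap_closed[OF L3_linear linear_id _ _ _ _ t] X by (simp add: J1_def)
  have "J ?l = as W X (tC Y Z) (as (tC W X) Y Z J1)"
    unfolding J_def J1_def pentagon_edge5[OF X c] pentagon_edge4[OF X t] ..
  also have "\<dots> = tm W (tC X (tC Y Z)) (\<lambda>x. x) (as X Y Z) (as W (tC X Y) Z (tm (tC W (tC X Y)) Z (as W X Y) (\<lambda>x. x) J1))"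
    using assoc_pentagon[OF _ _ _ _ J1] X by simp
  also have "\<dots> = J ?r"
    unfolding J_def u_def[symmetric] pentagon_edge2[OF X b] pentagon_edge3[OF X u]
    unfolding u_def J1_def pentagon_edge1[OF X t] ..
  finally have eq: "J ?l = J ?r" .
  have inv: "tm W (tC X (tC Y Z)) (\<lambda>x. x) (R3i X Y Z) (un W (tC X (tC Y Z)) (J s)) = s"
    if s: "s \<in> carrier (vs W \<otimes>\<^sub>v vs X \<otimes>\<^sub>v vs Y \<otimes>\<^sub>v vs Z)" for s
  proof -
    have "tm W (tC X (tC Y Z)) (\<lambda>x. x) (R3 X Y Z) s \<in> carrier (vs W \<otimes>\<^sub>v vs X \<otimes>\<^sub>v vs Y \<otimes>\<^sub>v vs Z)"
      using tmap_closed[OF linear_id R3_linear _ _ _ _ s] X by simp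
    then show ?thesis
      using X tm_inverse[OF _ _ _ _ linear_id linear_id R3_linear R3i_linear _ _ s] by (simp add: J_def)
  qed
  show ?thesis using inv[OF l] inv[OF r] eq by simp
qed

section \<open>Unit constraints and the triangle\<close>

abbreviation "\<I>\<^sub>1 \<equiv> unit_mod (hopf_quasi H)"

lemma unit_mod_twist: "unit_mod (twist H F) = \<I>\<^sub>1"
  by (simp add: unit_mod_def)

lemma act_unit [simp]: "h \<in> carrier H \<Longrightarrow> act \<I>\<^sub>1 h (Scalar c) = Scalar (counit H h * c)"
  by simp

lemma lm_unit [simp]: "lm \<I>\<^sub>1"
  unfolding left_module_iff alg_rep_def
  by (auto intro!: blinI linear_mapI simp: counit_add counit_smult counit_mult counit_one algebra_simps)

text \<open>On the unit module an element acts by its counit, so \<open>t\<close> acts on the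
  product as (id \<otimes> \<epsilon>) \<open>t\<close> acts on \<open>X\<close>. The counit
  conditions on \<open>F\<close> therefore make \<open>un\<close> and \<open>tw\<close> trivial on
  the images of the unit constraints.\<close>

lemma a2_unit_right:
  assumes X: "lm X" and t: "t \<in> carrier (H \<otimes>\<^sub>v H)" and x: "x \<in> carrier X"
  shows "a2 X \<I>\<^sub>1 t (pure (vs X) (vs \<I>\<^sub>1) x (Scalar d))
    = pure (vs X) (vs \<I>\<^sub>1) (act X (tensor_lift H (\<lambda>a b. counit H b \<odot> a) t) x) (Scalar d)"
proof -
  have bl: "blin H H H (\<lambda>a b. counit H b \<odot> a)"
    by (intro blinI linear_scale linear_id linear_counit) simp_all
  have d: "Scalar d \<in> carrier (vs \<I>\<^sub>1)" by simp
  have bx: "linear_map H (vs X) (\<lambda>h. act X h x)" using blin_left[OF lm_blin[OF X]] x by simp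
  have p: "pure (vs X) (vs \<I>\<^sub>1) x (Scalar d) \<in> carrier (vs X \<otimes>\<^sub>v vs \<I>\<^sub>1)" using x by simp
  show ?thesis
  proof (rule tensor_eqI[OF _ _ blin_left[OF a2_blin p] linear_comp[OF linear_lift[OF _ _ _ bl]
          linear_comp[OF bx linear_pure_left_id[OF d]]] t])
    fix a b assume ab: "a \<in> carrier H" "b \<in> carrier H"
    have "pure (vs X) (vs \<I>\<^sub>1) (act X a x) (counit H b \<odot>\<^bsub>vs \<I>\<^sub>1\<^esub> Scalar d)
      = pure (vs X) (vs \<I>\<^sub>1) (act X (counit H b \<odot> a) x) (Scalar d)"
      using ab x X linear_smult[OF blin_right[OF blin_pure[of "vs X" "vs \<I>\<^sub>1"]], of "act X a x" "Scalar d" "counit H b"]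
        linear_smult[OF blin_left[OF blin_pure[of "vs X" "vs \<I>\<^sub>1"]], of "Scalar d" "act X a x" "counit H b"]
        linear_smult[OF bx, of a "counit H b"]
      by simp
    then show "a2 X \<I>\<^sub>1 (pure H H a b) (pure (vs X) (vs \<I>\<^sub>1) x (Scalar d))
      = pure (vs X) (vs \<I>\<^sub>1) (act X (tensor_lift H (\<lambda>a b. counit H b \<odot> a) (pure H H a b)) x) (Scalar d)"
      using ab x X bl by (simp add: a2_pure del: unit_mod_simps(5))
  qed (simp_all add: X)
qed

lemma a2_unit_left:
  assumes X: "lm X" and t: "t \<in> carrier (H \<otimes>\<^sub>v H)" and x: "x \<in> carrier X"
  shows "a2 \<I>\<^sub>1 X t (pure (vs \<I>\<^sub>1) (vs X) (Scalar d) x)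
    = pure (vs \<I>\<^sub>1) (vs X) (Scalar d) (act X (tensor_lift H (\<lambda>a b. counit H a \<odot> b) t) x)"
proof -
  have bl: "blin H H H (\<lambda>a b. counit H a \<odot> b)"
    by (intro blinI linear_scale linear_id linear_counit) simp_all
  have d: "Scalar d \<in> carrier (vs \<I>\<^sub>1)" by simp
  have bx: "linear_map H (vs X) (\<lambda>h. act X h x)" using blin_left[OF lm_blin[OF X]] x by simp
  have p: "pure (vs \<I>\<^sub>1) (vs X) (Scalar d) x \<in> carrier (vs \<I>\<^sub>1 \<otimes>\<^sub>v vs X)" using x by simp
  show ?thesis
  proof (rule tensor_eqI[OF _ _ blin_left[OF a2_blin p] linear_comp[OF linear_lift[OF _ _ _ bl]
          linear_comp[OF bx linear_pure_right_id[OF d]]] t])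
    fix a b assume ab: "a \<in> carrier H" "b \<in> carrier H"
    have "pure (vs \<I>\<^sub>1) (vs X) (counit H a \<odot>\<^bsub>vs \<I>\<^sub>1\<^esub> Scalar d) (act X b x)
      = pure (vs \<I>\<^sub>1) (vs X) (Scalar d) (act X (counit H a \<odot> b) x)"
      using ab x X linear_smult[OF blin_right[OF blin_pure[of "vs \<I>\<^sub>1" "vs X"]], of "Scalar d" "act X b x" "counit H a"]
        linear_smult[OF blin_left[OF blin_pure[of "vs \<I>\<^sub>1" "vs X"]], of "act X b x" "Scalar d" "counit H a"]
        linear_smult[OF bx, of b "counit H a"]
      by simp
    then show "a2 \<I>\<^sub>1 X (pure H H a b) (pure (vs \<I>\<^sub>1) (vs X) (Scalar d) x)
      = pure (vs \<I>\<^sub>1) (vs X) (Scalar d) (act X (tensor_lift H (\<lambda>a b. counit H a \<odot> b) (pure H H a b)) x)"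
      using ab x X bl by (simp add: a2_pure del: unit_mod_simps(5))
  qed (simp_all add: X)
qed

abbreviation lu :: "'a hmod \<Rightarrow> 'a vuniv \<Rightarrow> 'a vuniv" where
  "lu X x \<equiv> pure (vs X) (vs \<I>\<^sub>1) x (Scalar 1)"
abbreviation ru :: "'a hmod \<Rightarrow> 'a vuniv \<Rightarrow> 'a vuniv" where
  "ru X x \<equiv> pure (vs \<I>\<^sub>1) (vs X) (Scalar 1) x"

lemma lu_closed: "\<lbrakk>lm X; x \<in> carrier X\<rbrakk> \<Longrightarrow> lu X x \<in> carrier (vs X \<otimes>\<^sub>v vs \<I>\<^sub>1)"
  and ru_closed: "\<lbrakk>lm X; x \<in> carrier X\<rbrakk> \<Longrightarrow> ru X x \<in> carrier (vs \<I>\<^sub>1 \<otimes>\<^sub>v vs X)"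
  by simp_all

lemma un_lu: "\<lbrakk>lm X; x \<in> carrier X\<rbrakk> \<Longrightarrow> un X \<I>\<^sub>1 (lu X x) = lu X x"
  and un_ru: "\<lbrakk>lm X; x \<in> carrier X\<rbrakk> \<Longrightarrow> un \<I>\<^sub>1 X (ru X x) = ru X x"
  by (simp_all add: a2_unit_left a2_unit_right F_left F_right)

lemma tw_lu: "\<lbrakk>lm X; x \<in> carrier X\<rbrakk> \<Longrightarrow> tw X \<I>\<^sub>1 (lu X x) = lu X x"
  and tw_ru: "\<lbrakk>lm X; x \<in> carrier X\<rbrakk> \<Longrightarrow> tw \<I>\<^sub>1 X (ru X x) = ru X x"
  using un_tw[of X \<I>\<^sub>1 "lu X x"] tw_un[of X \<I>\<^sub>1 "lu X x"] un_lu[of X x]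
    un_tw[of \<I>\<^sub>1 X "ru X x"] tw_un[of \<I>\<^sub>1 X "ru X x"] un_ru[of X x] lu_closed[of X x] ru_closed[of X x]
  by (metis lm_unit)+

lemma hm_lu_C: "lm X \<Longrightarrow> hm X (tC X \<I>\<^sub>1) (lu X)"
  and hm_ru_C: "lm X \<Longrightarrow> hm X (tC \<I>\<^sub>1 X) (ru X)"
  unfolding equivariant_def
  by (auto intro!: linear_pure_left_id linear_pure_right_id
      simp: a2_unit_left a2_unit_right counit_left counit_right simp del: unit_mod_simps(5))

lemma hm_lu: "lm X \<Longrightarrow> hm X (tD X \<I>\<^sub>1) (lu X)"
  and hm_ru: "lm X \<Longrightarrow> hm X (tD \<I>\<^sub>1 X) (ru X)"
  using hm_cong[OF hm_comp[OF hm_lu_C hm_un], of X "lu X"] hm_cong[OF hm_comp[OF hm_ru_C hm_un], of X "ru X"]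
  by (simp_all add: un_lu un_ru)

text \<open>\<open>tw\<close> fixes the vectors \<open>lu X x\<close> and \<open>ru Y y\<close>, so
  naturality reduces both sides, after removal of the twists, to the triangle of spaces applied to
  \<open>tw X Y t\<close>. Then \<open>R3\<close> is cancelled.\<close>

lemma triangle_D:
  assumes X: "lm X" "lm Y" and t: "t \<in> carrier (vs X \<otimes>\<^sub>v vs Y)"
  shows "asc X \<I>\<^sub>1 Y (tm (tC X \<I>\<^sub>1) Y (lu X) (\<lambda>x. x) t) = tm X (tC \<I>\<^sub>1 Y) (\<lambda>x. x) (ru Y) t"
proof -
  note [simp del] = unit_mod_simps
  have lu: "linear_map (vs X) (vs X \<otimes>\<^sub>v vs \<I>\<^sub>1) (lu X)" and ru: "linear_map (vs Y) (vs \<I>\<^sub>1 \<otimes>\<^sub>v vs Y) (ru Y)"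
    using hm_linear[OF hm_lu] hm_linear[OF hm_ru] X by simp_all
  have lt: "tm (tC X \<I>\<^sub>1) Y (lu X) (\<lambda>x. x) t \<in> carrier ((vs X \<otimes>\<^sub>v vs \<I>\<^sub>1) \<otimes>\<^sub>v vs Y)"
    using tmap_closed[OF lu linear_id _ _ _ _ t] X by simp
  have rt: "tm X (tC \<I>\<^sub>1 Y) (\<lambda>x. x) (ru Y) t \<in> carrier (vs X \<otimes>\<^sub>v vs \<I>\<^sub>1 \<otimes>\<^sub>v vs Y)"
    using tmap_closed[OF linear_id ru _ _ _ _ t] X by simp
  have tt: "tw X Y t \<in> carrier (vs X \<otimes>\<^sub>v vs Y)" using X t by simp
  have "L3 X \<I>\<^sub>1 Y (tm (tC X \<I>\<^sub>1) Y (lu X) (\<lambda>x. x) t) = tw (tC X \<I>\<^sub>1) Y (tm (tC X \<I>\<^sub>1) Y (\<lambda>x. tw X \<I>\<^sub>1 (lu X x)) (\<lambda>x. x) t)"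
    unfolding L3_def using tmap_comp[OF lu linear_id a2_linear[of X \<I>\<^sub>1 Fi] linear_id _ _ _ _ _ _ t] X by simp
  also have "tm (tC X \<I>\<^sub>1) Y (\<lambda>x. tw X \<I>\<^sub>1 (lu X x)) (\<lambda>x. x) t = tm (tC X \<I>\<^sub>1) Y (lu X) (\<lambda>x. x) t"
    by (rule tmap_cong[OF _ _ t]) (simp_all add: X tw_lu)
  also have "tw (tC X \<I>\<^sub>1) Y \<dots> = tm (tC X \<I>\<^sub>1) Y (lu X) (\<lambda>x. x) (tw X Y t)"
    using X t by (intro a2_nat hm_lu_C hm_id) simp_all
  finally have L: "L3 X \<I>\<^sub>1 Y (tm (tC X \<I>\<^sub>1) Y (lu X) (\<lambda>x. x) t) = \<dots>" .
  have "R3 X \<I>\<^sub>1 Y (tm X (tC \<I>\<^sub>1 Y) (\<lambda>x. x) (ru Y) t) = tw X (tC \<I>\<^sub>1 Y) (tm X (tC \<I>\<^sub>1 Y) (\<lambda>x. x) (\<lambda>x. tw \<I>\<^sub>1 Y (ru Y x)) t)"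
    unfolding R3_def using tmap_comp[OF linear_id ru linear_id a2_linear[of \<I>\<^sub>1 Y Fi] _ _ _ _ _ _ t] X by simp
  also have "tm X (tC \<I>\<^sub>1 Y) (\<lambda>x. x) (\<lambda>x. tw \<I>\<^sub>1 Y (ru Y x)) t = tm X (tC \<I>\<^sub>1 Y) (\<lambda>x. x) (ru Y) t"
    by (rule tmap_cong[OF _ _ t]) (simp_all add: X tw_ru)
  also have "tw X (tC \<I>\<^sub>1 Y) \<dots> = tm X (tC \<I>\<^sub>1 Y) (\<lambda>x. x) (ru Y) (tw X Y t)"
    using X t by (intro a2_nat hm_ru_C hm_id) simp_all
  finally have R: "R3 X \<I>\<^sub>1 Y (tm X (tC \<I>\<^sub>1 Y) (\<lambda>x. x) (ru Y) t) = \<dots>" .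
  have "as X \<I>\<^sub>1 Y (tm (tC X \<I>\<^sub>1) Y (lu X) (\<lambda>x. x) s) = tm X (tC \<I>\<^sub>1 Y) (\<lambda>x. x) (ru Y) s"
    if s: "s \<in> carrier (vs X \<otimes>\<^sub>v vs Y)" for s
    unfolding tensor_mod_simps(2)
    by (rule tensor_eqI[OF _ _ linear_comp[OF linear_tmap[OF lu linear_id] linear_assoc] linear_tmap[OF linear_id ru] s])
      (use X in \<open>simp_all add: tmap_pure[OF lu linear_id] tmap_pure[OF linear_id ru] unit_mod_simps(1)\<close>)
  from this[OF tt] have "R3 X \<I>\<^sub>1 Y (asc X \<I>\<^sub>1 Y (tm (tC X \<I>\<^sub>1) Y (lu X) (\<lambda>x. x) t)) = R3 X \<I>\<^sub>1 Y (tm X (tC \<I>\<^sub>1 Y) (\<lambda>x. x) (ru Y) t)"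
    using R3_asc[OF _ _ _ lt] X L R by simp
  then show ?thesis
    using R3i_R3[OF _ _ _ rt] R3i_R3[OF _ _ _ asc_closed[OF _ _ _ lt]] X by (metis lm_unit)
qed

end

section \<open>The monoidal category of modules over a twist\<close>

text \<open>\<open>Hom\<close> requires extensional functions. With the restriction built in, arrows
  agree as soon as their functions agree on the carrier of the source.\<close>

definition arr :: "'a hmod \<Rightarrow> 'a hmod \<Rightarrow> ('a vuniv \<Rightarrow> 'a vuniv) \<Rightarrow> 'a harr" where
  "arr X Y f = \<lparr>src = X, trg = Y, fn = restrict f (carrier X)\<rparr>"

lemma arr_simps [simp]: "src (arr X Y f) = X" "trg (arr X Y f) = Y" "fn (arr X Y f) = restrict f (carrier X)"
  by (simp_all add: arr_def)

lemma arr_cong: "(\<And>x. x \<in> carrier X \<Longrightarrow> f x = g x) \<Longrightarrow> arr X Y f = arr X Y g"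
  by (auto simp: arr_def intro!: restrict_ext)

lemma arr_eqD: "arr X Y f = arr X Y g \<Longrightarrow> x \<in> carrier X \<Longrightarrow> f x = g x"
  by (metis arr_simps(3) restrict_apply')

context twisted
begin

abbreviation M :: "('a hmod, 'a harr) moncat" where "M \<equiv> module_category (twist H F)"

lemma Ob_M [simp]: "X \<in> Ob M \<longleftrightarrow> lm X"
  by (simp add: module_category_def)

lemma Hom_M: "u \<in> Hom M X Y \<longleftrightarrow> u = arr X Y (fn u) \<and> hm X Y (fn u)"
proof -
  have "u = arr X Y (fn u) \<longleftrightarrow> src u = X \<and> trg u = Y \<and> fn u \<in> extensional (carrier X)"
    by (cases u) (auto simp: arr_def extensional_restrict restrict_extensional, metis restrict_extensional)
  then show ?thesis by (auto simp: module_category_def equivariant_def to_vs)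
qed

lemma hm_restrict [simp]: "lm X \<Longrightarrow> hm X Y (restrict f (carrier X)) \<longleftrightarrow> hm X Y f"
  using hm_cong[of X Y "restrict f (carrier X)" f] hm_cong[of X Y f "restrict f (carrier X)"] by auto

lemma arr_hom: "\<lbrakk>lm X; hm X Y f\<rbrakk> \<Longrightarrow> arr X Y f \<in> Hom M X Y"
  by (simp add: Hom_M)

lemma HomE:
  assumes "u \<in> Hom M X Y"
  obtains f where "u = arr X Y f" "hm X Y f"
  using assms unfolding Hom_M by blast

lemma Id_M [simp]: "Idm M X = arr X X (\<lambda>x. x)"
  by (simp add: module_category_def arr_def)

lemma Comp_M [simp]: "\<lbrakk>hm X Y f\<rbrakk> \<Longrightarrow> Comp M (arr Y Z g) (arr X Y f) = arr X Z (\<lambda>x. g (f x))"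
  by (auto simp: module_category_def arr_def compose_def hm_closed intro!: restrict_ext)

lemma TensO_M [simp]: "TensO M = tD"
  by (simp add: module_category_def)

lemma TensM_M [simp]:
  assumes "lm X" "lm Y"
  shows "TensM M (arr X X' u) (arr Y Y' v) = arr (tD X Y) (tD X' Y') (tm X' Y' u v)"
  by (simp add: module_category_def arr_def to_vs)
    (intro restrict_ext tmap_cong[of "vs X" "vs Y"]; simp add: assms)

lemma Unit_M [simp]: "Unit M = \<I>\<^sub>1"
  by (simp add: module_category_def unit_mod_twist)

lemma Assoc_M [simp]: "Assoc M X Y Z = arr (tD (tD X Y) Z) (tD X (tD Y Z)) (asc X Y Z)"
  by (simp add: module_category_def arr_def to_vs asc_def[abs_def] a2_def)

lemma Lun_M [simp]: "Lun M X = arr X (tD X \<I>\<^sub>1) (lu X)"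
  and Run_M [simp]: "Run M X = arr X (tD \<I>\<^sub>1 X) (ru X)"
  by (simp_all add: module_category_def arr_def to_vs unit_mod_twist)

lemma inverse_arr:
  assumes "lm X" "lm Y" "hm X Y f" "hm Y X g"
    and "\<And>x. x \<in> carrier X \<Longrightarrow> g (f x) = x" "\<And>y. y \<in> carrier Y \<Longrightarrow> f (g y) = y"
  shows "inverse_of M X Y (arr X Y f) (arr Y X g)"
  using assms by (auto simp: inverse_of_def arr_hom intro!: arr_cong)

lemma iso_arr:
  assumes "lm X" "lm Y" "hm X Y f" "hm Y X g"
    and "\<And>x. x \<in> carrier X \<Longrightarrow> g (f x) = x" "\<And>y. y \<in> carrier Y \<Longrightarrow> f (g y) = y"
  shows "iso_mor M X Y (arr X Y f)"
  using inverse_arr[OF assms] assms by (auto simp: iso_mor_def arr_hom)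

lemma inv_arr:
  assumes "lm X" "lm Y" "hm X Y f" "hm Y X g"
    and "\<And>x. x \<in> carrier X \<Longrightarrow> g (f x) = x" "\<And>y. y \<in> carrier Y \<Longrightarrow> f (g y) = y"
  shows "inv_mor M X Y (arr X Y f) = arr Y X g"
  unfolding inv_mor_def
proof (rule the_equality)
  show "inverse_of M X Y (arr X Y f) (arr Y X g)" by (rule inverse_arr) (use assms in auto)
  fix k assume k: "inverse_of M X Y (arr X Y f) k"
  then obtain k' where k': "k = arr Y X k'" "hm Y X k'" by (auto simp: inverse_of_def elim: HomE)
  have "arr X X (\<lambda>x. k' (f x)) = arr X X (\<lambda>x. x)" using k k' assms by (simp add: inverse_of_def)
  then have "k' (f x) = x" if "x \<in> carrier X" for x by (rule arr_eqD) (rule that)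
  then show "k = arr Y X g" unfolding k'(1) using assms hm_closed[OF assms(4)] by (intro arr_cong) metis
qed

lemma lu_inverse:
  assumes "lm X"
  obtains g where "\<And>t. t \<in> carrier (vs X \<otimes>\<^sub>v vs \<I>\<^sub>1) \<Longrightarrow> g t \<in> carrier X"
    "\<And>x. x \<in> carrier X \<Longrightarrow> g (lu X x) = x" "\<And>t. t \<in> carrier (vs X \<otimes>\<^sub>v vs \<I>\<^sub>1) \<Longrightarrow> lu X (g t) = t"
proof
  let ?g = "tensor_lift (vs X) (\<lambda>x s. scalar_of s \<odot>\<^bsub>X\<^esub> x)"
  have bl: "blin (vs X) (vs \<I>\<^sub>1) (vs X) (\<lambda>x s. scalar_of s \<odot>\<^bsub>X\<^esub> x)"
    using assms linear_scale[OF _ linear_id, of "vs X"]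
    by (intro blinI linear_mapI) (auto simp: vsp_smult mult.commute)
  note g = linear_lift[OF _ _ _ bl]
  show "?g t \<in> carrier X" if "t \<in> carrier (vs X \<otimes>\<^sub>v vs \<I>\<^sub>1)" for t using linear_closed[OF g that] assms by simp
  show "?g (lu X x) = x" if "x \<in> carrier X" for x using that assms bl by simp
  have s: "Scalar 1 \<in> carrier (vs \<I>\<^sub>1)" by simp
  show "lu X (?g t) = t" if t: "t \<in> carrier (vs X \<otimes>\<^sub>v vs \<I>\<^sub>1)" for t
  proof (rule tensor_eqI[OF _ _ linear_comp[OF g linear_pure_left_id[OF s]] linear_id t])
    fix x c assume xc: "x \<in> carrier (vs X)" "c \<in> carrier (vs \<I>\<^sub>1)"
    then show "lu X (?g (pure (vs X) (vs \<I>\<^sub>1) x c)) = pure (vs X) (vs \<I>\<^sub>1) x c"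
      using linear_smult[OF blin_right[OF blin_pure[of "vs X" "vs \<I>\<^sub>1"]], of x "Scalar 1" "scalar_of c"]
        linear_smult[OF blin_left[OF blin_pure[of "vs X" "vs \<I>\<^sub>1"]], of "Scalar 1" x "scalar_of c"]
        assms bl by auto
  qed (simp_all add: assms)
qed

lemma ru_inverse:
  assumes "lm X"
  obtains g where "\<And>t. t \<in> carrier (vs \<I>\<^sub>1 \<otimes>\<^sub>v vs X) \<Longrightarrow> g t \<in> carrier X"
    "\<And>x. x \<in> carrier X \<Longrightarrow> g (ru X x) = x" "\<And>t. t \<in> carrier (vs \<I>\<^sub>1 \<otimes>\<^sub>v vs X) \<Longrightarrow> ru X (g t) = t"
proof
  let ?g = "tensor_lift (vs X) (\<lambda>s x. scalar_of s \<odot>\<^bsub>X\<^esub> x)"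
  have bl: "blin (vs \<I>\<^sub>1) (vs X) (vs X) (\<lambda>s x. scalar_of s \<odot>\<^bsub>X\<^esub> x)"
    using assms linear_scale[OF _ linear_id, of "vs X"]
    by (intro blinI linear_mapI) (auto simp: vsp_smult mult.commute)
  note g = linear_lift[OF _ _ _ bl]
  show "?g t \<in> carrier X" if "t \<in> carrier (vs \<I>\<^sub>1 \<otimes>\<^sub>v vs X)" for t using linear_closed[OF g that] assms by simp
  show "?g (ru X x) = x" if "x \<in> carrier X" for x using that assms bl by simp
  have s: "Scalar 1 \<in> carrier (vs \<I>\<^sub>1)" by simp
  show "ru X (?g t) = t" if t: "t \<in> carrier (vs \<I>\<^sub>1 \<otimes>\<^sub>v vs X)" for t
  proof (rule tensor_eqI[OF _ _ linear_comp[OF g linear_pure_right_id[OF s]] linear_id t])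
    fix c x assume xc: "c \<in> carrier (vs \<I>\<^sub>1)" "x \<in> carrier (vs X)"
    then show "ru X (?g (pure (vs \<I>\<^sub>1) (vs X) c x)) = pure (vs \<I>\<^sub>1) (vs X) c x"
      using linear_smult[OF blin_right[OF blin_pure[of "vs \<I>\<^sub>1" "vs X"]], of "Scalar 1" x "scalar_of c"]
        linear_smult[OF blin_left[OF blin_pure[of "vs \<I>\<^sub>1" "vs X"]], of x "Scalar 1" "scalar_of c"]
        assms bl by auto
  qed (simp_all add: assms)
qed

lemma monoidal: "monoidal_category M"
proof unfold_locales
  note [simp del] = unit_mod_simps
  note [simp] = hm_id arr_hom hm_comp hm_asc hm_lu hm_ru hm_tm
  fix X assume "X \<in> Ob M"
  then have X: "lm X" by simp
  show "Idm M X \<in> Hom M X X" using X by simp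
  obtain g where g: "\<And>t. t \<in> carrier (vs X \<otimes>\<^sub>v vs \<I>\<^sub>1) \<Longrightarrow> g t \<in> carrier X"
    "\<And>x. x \<in> carrier X \<Longrightarrow> g (lu X x) = x" "\<And>t. t \<in> carrier (vs X \<otimes>\<^sub>v vs \<I>\<^sub>1) \<Longrightarrow> lu X (g t) = t"
    using lu_inverse[OF X] by blast
  then show "iso_mor M X (TensO M X (Unit M)) (Lun M X)"
    using X hm_inverse[OF hm_lu[OF X], of g] unfolding TensO_M Unit_M Lun_M
    by (intro iso_arr[OF _ _ hm_lu, of _ g]) simp_all
  obtain g where g: "\<And>t. t \<in> carrier (vs \<I>\<^sub>1 \<otimes>\<^sub>v vs X) \<Longrightarrow> g t \<in> carrier X"
    "\<And>x. x \<in> carrier X \<Longrightarrow> g (ru X x) = x" "\<And>t. t \<in> carrier (vs \<I>\<^sub>1 \<otimes>\<^sub>v vs X) \<Longrightarrow> ru X (g t) = t"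
    using ru_inverse[OF X] by blast
  then show "iso_mor M X (TensO M (Unit M) X) (Run M X)"
    using X hm_inverse[OF hm_ru[OF X], of g] unfolding TensO_M Unit_M Run_M
    by (intro iso_arr[OF _ _ hm_ru, of _ g]) simp_all
  fix Y assume "Y \<in> Ob M"
  then have Y: "lm Y" by simp
  show "TensO M X Y \<in> Ob M" using X Y by simp
  show "TensM M (Idm M X) (Idm M Y) = Idm M (TensO M X Y)" using X Y by (auto intro!: arr_cong)
  show "Comp M f (Idm M X) = f" if "f \<in> Hom M X Y" for f using that X Y by (auto elim!: HomE)
  show "Comp M (Idm M Y) f = f" if "f \<in> Hom M X Y" for f using that X Y by (auto elim!: HomE)
  show "Comp M (Lun M Y) f = Comp M (TensM M f (Idm M (Unit M))) (Lun M X)" if "f \<in> Hom M X Y" for f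
    using that
  proof (rule HomE)
    fix k assume k: "f = arr X Y k" "hm X Y k"
    then show ?thesis
      using X Y by (auto intro!: arr_cong simp: tmap_pure[OF hm_linear[OF k(2)] linear_id] unit_mod_simps(1) hm_closed)
  qed
  show "Comp M (Run M Y) f = Comp M (TensM M (Idm M (Unit M)) f) (Run M X)" if "f \<in> Hom M X Y" for f
    using that
  proof (rule HomE)
    fix k assume k: "f = arr X Y k" "hm X Y k"
    then show ?thesis
      using X Y by (auto intro!: arr_cong simp: tmap_pure[OF linear_id hm_linear[OF k(2)]] unit_mod_simps(1) hm_closed)
  qed
  show "Comp M (Assoc M X (Unit M) Y) (TensM M (Lun M X) (Idm M Y)) = TensM M (Idm M X) (Run M Y)"
    using X Y triangle_D[OF X Y] hm_tm(2)[of X Y "tD X \<I>\<^sub>1" Y "lu X" "\<lambda>x. x"] by (auto intro!: arr_cong)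
  fix Z assume "Z \<in> Ob M"
  then have Z: "lm Z" by simp
  show "Comp M g f \<in> Hom M X Z" if "f \<in> Hom M X Y" "g \<in> Hom M Y Z" for f g
    using that X Y Z by (auto elim!: HomE) 
  show "iso_mor M (TensO M (TensO M X Y) Z) (TensO M X (TensO M Y Z)) (Assoc M X Y Z)"
    unfolding TensO_M Assoc_M by (rule iso_arr[OF _ _ hm_asc hm_asci]) (use X Y Z in \<open>simp_all add: asc_asci asci_asc\<close>)
  fix W assume "W \<in> Ob M"
  then have W: "lm W" by simp
  show "Comp M (Comp M h g) f = Comp M h (Comp M g f)" if "f \<in> Hom M W X" "g \<in> Hom M X Y" "h \<in> Hom M Y Z" for f g h
    using that by (auto elim!: HomE)
  show "Comp M (Assoc M W X (TensO M Y Z)) (Assoc M (TensO M W X) Y Z)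
     = Comp M (TensM M (Idm M W) (Assoc M X Y Z)) (Comp M (Assoc M W (TensO M X Y) Z) (TensM M (Assoc M W X Y) (Idm M Z)))"
  proof -
    have h: "hm (tD (tD (tD W X) Y) Z) (tD (tD W (tD X Y)) Z) (tm (tD W (tD X Y)) Z (asc W X Y) (\<lambda>x. x))"
      using W X Y Z by (intro hm_tm hm_asc hm_id) simp_all
    have "hm (tD (tD (tD W X) Y) Z) (tD W (tD (tD X Y) Z))
        (\<lambda>t. asc W (tD X Y) Z (tm (tD W (tD X Y)) Z (asc W X Y) (\<lambda>x. x) t))"
      using W X Y Z by (intro hm_comp[OF h hm_asc]) simp_all
    then show ?thesis
      using W X Y Z pentagon_D[OF W X Y Z] h by (auto intro!: arr_cong)
  qed
next
  note [simp del] = unit_mod_simps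
  note [simp] = hm_id arr_hom hm_comp hm_asc hm_lu hm_ru hm_tm
  fix X X' Y Y' assume "X \<in> Ob M" "X' \<in> Ob M" "Y \<in> Ob M" "Y' \<in> Ob M"
  then have X: "lm X" "lm X'" "lm Y" "lm Y'" by simp_all
  show "TensM M f g \<in> Hom M (TensO M X Y) (TensO M X' Y')" if "f \<in> Hom M X X'" "g \<in> Hom M Y Y'" for f g
    using that X by (auto elim!: HomE)
  fix Z Z' assume "Z \<in> Ob M" "Z' \<in> Ob M"
  then have Z: "lm Z" "lm Z'" by simp_all
  show "Comp M (Assoc M X' Y' Z') (TensM M (TensM M f g) h) = Comp M (TensM M f (TensM M g h)) (Assoc M X Y Z)"
    if "f \<in> Hom M X X'" "g \<in> Hom M Y Y'" "h \<in> Hom M Z Z'" for f g h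
  proof -
    obtain f' where f': "f = arr X X' f'" "hm X X' f'" using \<open>f \<in> _\<close> by (rule HomE)
    obtain g' where g': "g = arr Y Y' g'" "hm Y Y' g'" using \<open>g \<in> _\<close> by (rule HomE)
    obtain h' where h': "h = arr Z Z' h'" "hm Z Z' h'" using \<open>h \<in> _\<close> by (rule HomE)
    note k = f' g' h'
    have "hm (tD (tD X Y) Z) (tD (tD X' Y') Z') (tm (tD X' Y') Z' (tm X' Y' f' g') h')"
      using X Z k by (intro hm_tm) simp_all
    then show ?thesis using k X Z asc_nat[OF X(1,3) Z(1) X(2,4) Z(2) k(2,4,6)] by (auto intro!: arr_cong)
  qed
next
  note [simp] = hm_id arr_hom hm_comp hm_tm
  fix X X' X'' Y Y' Y'' f f' g g'
  assume "X \<in> Ob M" "X' \<in> Ob M" "X'' \<in> Ob M" "Y \<in> Ob M" "Y' \<in> Ob M" "Y'' \<in> Ob M"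
  then have X: "lm X" "lm X'" "lm X''" "lm Y" "lm Y'" "lm Y''" by simp_all
  assume h: "f \<in> Hom M X X'" "f' \<in> Hom M X' X''" "g \<in> Hom M Y Y'" "g' \<in> Hom M Y' Y''"
  obtain p where p: "f = arr X X' p" "hm X X' p" using h(1) by (rule HomE)
  obtain p' where p': "f' = arr X' X'' p'" "hm X' X'' p'" using h(2) by (rule HomE)
  obtain q where q: "g = arr Y Y' q" "hm Y Y' q" using h(3) by (rule HomE)
  obtain q' where q': "g' = arr Y' Y'' q'" "hm Y' Y'' q'" using h(4) by (rule HomE)
  note k = p p' q q'
  show "TensM M (Comp M f' f) (Comp M g' g) = Comp M (TensM M f' g') (TensM M f g)"
    using k X tmap_comp[OF hm_linear hm_linear hm_linear hm_linear, OF k(2,6,4,8)] by (auto intro!: arr_cong)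
next
  show "Unit M \<in> Ob M" by simp
qed

end

section \<open>The bar structure of a twist\<close>

lemma bar_mod_simps [simp]:
  "carrier (bar_mod A T X) = carrier X" "vs (bar_mod A T X) = cj (vs X)"
  by (simp_all add: bar_mod_def vs_def cj_def module.defs)

lemma act_bar_mod [simp]:
  "\<lbrakk>h \<in> carrier A; x \<in> carrier X\<rbrakk> \<Longrightarrow> act (bar_mod A T X) h x = act X (T h) x"
  by (simp add: bar_mod_def)

lemma bar_mod_cong:
  assumes "carrier A = carrier A'" "\<And>h. h \<in> carrier A \<Longrightarrow> T h = T' h"
  shows "bar_mod A T = bar_mod A' T'"
  unfolding bar_mod_def using assms by (auto simp: fun_eq_iff restrict_def)

text \<open>An antilinear \<open>T\<close> is a linear homomorphism from \<open>H\<close> to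
  \<open>cj H\<close>, and \<open>cj H\<close> acts on the conjugate space by the old action; the
  module structure is pulled back along \<open>T\<close>.\<close>

lemma (in star_hopf_algebra) lm_bar:
  assumes "lm X" and A: "carrier A = carrier H" and T: "antilinear_algebra_hom H T"
  shows "lm (bar_mod A T X)"
proof -
  have T: "linear_map H (cj H) T" "T \<one> = \<one>" "\<And>h k. \<lbrakk>h \<in> carrier H; k \<in> carrier H\<rbrakk> \<Longrightarrow> T (h \<otimes> k) = T h \<otimes> T k"
    using T by (auto simp: antilinear_algebra_hom_def antilinear_iff)
  have "alg_rep (cj H) (cj (vs X)) (act X)"
    using lm_rep[OF assms(1)] by (simp add: alg_rep_def)
  then have "alg_rep H (cj (vs X)) (\<lambda>h. act X (T h))"
    by (rule alg_rep_pull[OF _ T(1)]) (simp_all add: T)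
  then show ?thesis
    unfolding left_module_iff bar_mod_simps
    by (rule alg_rep_cong[OF _ complex_algebra_axioms]) (simp add: A)
qed

lemma (in star_hopf_algebra) hm_bar:
  assumes u: "hm X Y u" and A: "carrier A = carrier H" and T: "antilinear_algebra_hom H T"
  shows "hm (bar_mod A T X) (bar_mod A T Y) u"
proof -
  have "T h \<in> carrier H" if "h \<in> carrier H" for h
    using T that by (auto simp: antilinear_algebra_hom_def antilinear_map_def)
  then show ?thesis using hmD[OF u] by (simp add: equivariant_def A)
qed

context twisted
begin

definition ups :: "'a vuniv \<Rightarrow> 'a hmod \<Rightarrow> 'a hmod \<Rightarrow> 'a vuniv \<Rightarrow> 'a vuniv" where
  "ups G X Y t = tensor_swap (vs X) (vs Y) (a2 X Y G t)"

text \<open>The nested sums in \<open>bar_structure\<close> are the action of \<open>G\<close>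
  followed by the flip. In the form \<open>ups\<close>, linearity and naturality are inherited from
  these two maps.\<close>

lemma ups_lift:
  assumes X: "lm X" "lm Y" and G: "G \<in> carrier (H \<otimes>\<^sub>v H)" and t: "t \<in> carrier (vs X \<otimes>\<^sub>v vs Y)"
  shows "tensor_lift (vs Y \<otimes>\<^sub>v vs X) (\<lambda>x y. tensor_lift (vs Y \<otimes>\<^sub>v vs X)
      (\<lambda>a b. pure (vs Y) (vs X) (act Y b y) (act X a x)) G) t = ups G X Y t"
proof -
  have L: "linear_map (vs X \<otimes>\<^sub>v vs Y) (vs Y \<otimes>\<^sub>v vs X) (ups G X Y)"
    unfolding ups_def[abs_def] using X G by (intro linear_comp[OF a2_linear linear_swap]) simp_all
  have bl: "blin (vs X) (vs Y) (vs Y \<otimes>\<^sub>v vs X) (\<lambda>x y. ups G X Y (pure (vs X) (vs Y) x y))"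
    using X by (intro blin_comp[OF blin_pure linear_id linear_id L]) simp_all
  have "tensor_lift (vs Y \<otimes>\<^sub>v vs X) (\<lambda>a b. pure (vs Y) (vs X) (act Y b y) (act X a x)) G
    = ups G X Y (pure (vs X) (vs Y) x y)" if xy: "x \<in> carrier (vs X)" "y \<in> carrier (vs Y)" for x y
  proof -
    have m: "tensor_map (vs X) (vs Y) (act X a) (act Y b) (pure (vs X) (vs Y) x y) = pure (vs X) (vs Y) (act X a x) (act Y b y)"
      if "a \<in> carrier H" "b \<in> carrier H" for a b
      using that X xy by (simp add: tmap_pure[OF blin_right[OF lm_blin] blin_right[OF lm_blin]])
    have "ups G X Y (pure (vs X) (vs Y) x y) = tensor_lift (vs Y \<otimes>\<^sub>v vs X)
       (\<lambda>a b. tensor_swap (vs X) (vs Y) (tensor_map (vs X) (vs Y) (act X a) (act Y b) (pure (vs X) (vs Y) x y))) G"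
      unfolding ups_def a2_def tensor_act_def using X xy m G
      by (intro linear_of_lift[OF linear_swap, of _ _ H H]) simp_all
    also have "\<dots> = tensor_lift (vs Y \<otimes>\<^sub>v vs X) (\<lambda>a b. pure (vs Y) (vs X) (act Y b y) (act X a x)) G"
      using X xy by (intro lift_cong[of H H] G) (simp_all add: m)
    finally show ?thesis by simp
  qed
  then have "tensor_lift (vs Y \<otimes>\<^sub>v vs X) (\<lambda>x y. tensor_lift (vs Y \<otimes>\<^sub>v vs X)
      (\<lambda>a b. pure (vs Y) (vs X) (act Y b y) (act X a x)) G) t
    = tensor_lift (vs Y \<otimes>\<^sub>v vs X) (\<lambda>x y. ups G X Y (pure (vs X) (vs Y) x y)) t"
    using X t by (intro lift_cong[of "vs X" "vs Y"]) simp_all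
  also have "\<dots> = ups G X Y t"
    by (rule tensor_eqI[OF _ _ linear_lift[OF _ _ _ bl] L t]) (use X bl in simp_all)
  finally show ?thesis .
qed

lemma ups_nat:
  assumes X: "lm X" "lm Y" "lm X'" "lm Y'" and G: "G \<in> carrier (H \<otimes>\<^sub>v H)" and t: "t \<in> carrier (vs X \<otimes>\<^sub>v vs Y)"
    and u: "hm X X' u" "hm Y Y' v"
  shows "ups G X' Y' (tm X' Y' u v t) = tm Y' X' v u (ups G X Y t)"
  unfolding ups_def a2_nat[OF X u G t]
  by (rule swap_tmap) (use X G t in \<open>simp_all add: hm_linear u\<close>)

lemma sS_hom: "antilinear_algebra_hom H sS"
  using sS_linear by (simp add: antilinear_algebra_hom_def antilinear_iff sS_mult)

abbreviation bC :: "'a hmod \<Rightarrow> 'a hmod" where "bC \<equiv> bar_mod (hopf_quasi H) sS"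
abbreviation sw :: "'a hmod \<Rightarrow> 'a hmod \<Rightarrow> 'a vuniv \<Rightarrow> 'a vuniv" where
  "sw X Y \<equiv> tensor_swap (vs X) (vs Y)"

lemma lm_bC [simp]: "lm X \<Longrightarrow> lm (bC X)"
  by (rule lm_bar[OF _ _ sS_hom]) simp_all

lemma sS_tmap_closed [simp]: "t \<in> carrier (H \<otimes>\<^sub>v H) \<Longrightarrow> tensor_map H H sS sS t \<in> carrier (H \<otimes>\<^sub>v H)"
  using tmap_closed[OF sS_linear sS_linear] by simp

text \<open>Conjugate modules are acted on through \<open>sS\<close> in each factor, so
  \<open>F\<close> acts on them as its image under \<open>sS\<close> \<otimes> \<open>sS\<close>.
  Moved through the flip by \<open>swap_a2\<close>, this is the factor of \<open>G\<close> built
  from \<open>F\<^sub>2\<^sub>1\<close>.\<close>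

lemma a2_bC:
  assumes X: "lm X" "lm Y" and t: "t \<in> carrier (H \<otimes>\<^sub>v H)" and s: "s \<in> carrier (vs X \<otimes>\<^sub>v vs Y)"
  shows "a2 (bC X) (bC Y) t s = a2 X Y (tensor_map H H sS sS t) s"
proof -
  have "a2 (bC X) (bC Y) t s = tensor_act (cj (vs X)) (cj (vs Y)) (\<lambda>h. act X (sS h)) (\<lambda>h. act Y (sS h)) t s"
    unfolding a2_def bar_mod_simps using X s t by (intro tact_cong[of H H]) simp_all
  also have "\<dots> = tensor_act (cj (vs X)) (cj (vs Y)) (act X) (act Y) (tensor_map (cj H) (cj H) sS sS t) s"
    using X s t by (intro tact_pull[symmetric, OF _ _ _ _ _ _ _ _ sS_linear sS_linear]) (simp_all add: lm_blin)
  finally show ?thesis by (simp add: a2_def)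
qed

lemma swap_a2:
  "\<lbrakk>lm X; lm Y; t \<in> carrier (H \<otimes>\<^sub>v H); s \<in> carrier (vs X \<otimes>\<^sub>v vs Y)\<rbrakk>
    \<Longrightarrow> sw X Y (a2 X Y t s) = a2 Y X (tensor_swap H H t) (sw X Y s)"
  unfolding a2_def by (rule tact_swap) (simp_all add: lm_blin)

text \<open>\<open>sS\<close> reverses the coproduct and the flip reverses the factors; the two
  reversals cancel.\<close>

lemma hm_sw:
  assumes X: "lm X" "lm Y"
  shows "hm (bC (tC X Y)) (tC (bC Y) (bC X)) (sw X Y)"
  unfolding equivariant_def
proof (intro conjI ballI)
  show "linear_map (vs (bC (tC X Y))) (vs (tC (bC Y) (bC X))) (sw X Y)"
    using X by (simp add: linear_swap)
  fix h s assume h: "h \<in> carrier H" and "s \<in> carrier (bC (tC X Y))"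
  then have s: "s \<in> carrier (vs X \<otimes>\<^sub>v vs Y)" by simp
  show "sw X Y (act (bC (tC X Y)) h s) = act (tC (bC Y) (bC X)) h (sw X Y s)"
    using X h s by (simp add: swap_a2 a2_bC coprod_sS)
qed

lemma sS_swap: "t \<in> carrier (H \<otimes>\<^sub>v H) \<Longrightarrow> tensor_swap H H (tensor_map H H sS sS t) = tensor_map H H sS sS (tensor_swap H H t)"
  using swap_tmap[OF sS_linear sS_linear] by simp

lemma star_hm: "hm \<I>\<^sub>1 (bar_mod (hopf_quasi H) sS \<I>\<^sub>1) (\<lambda>s. Scalar (cnj (scalar_of s)))"
  by (auto simp: equivariant_def counit_sS intro!: linear_mapI)

end

section \<open>The bar data determined by an invertible \<phi>\<close>

locale bar_twisted = twisted H F for H :: "'a star_hopf" (structure) and F +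
  fixes \<phi> :: "'a vuniv"
  assumes \<phi>_Units: "\<phi> \<in> Units H" and counit_\<phi>: "counit H \<phi> = 1"
begin

definition \<psi> :: "'a vuniv" where "\<psi> = inv \<phi>"

lemma monoid_H: "monoid H" by (rule ring.axioms(2)[OF algebra_ring])

lemma H_simps [simp]:
  "\<lbrakk>s \<in> carrier H; t \<in> carrier H\<rbrakk> \<Longrightarrow> s \<otimes> t \<in> carrier H" "\<one> \<in> carrier H"
  "t \<in> carrier H \<Longrightarrow> \<one> \<otimes> t = t" "t \<in> carrier H \<Longrightarrow> t \<otimes> \<one> = t"
  using monoid.m_closed[OF monoid_H] monoid.one_closed[OF monoid_H] monoid.l_one[OF monoid_H]
    monoid.r_one[OF monoid_H] by auto

lemma \<phi>_closed [simp]: "\<phi> \<in> carrier H" and \<psi>_closed [simp]: "\<psi> \<in> carrier H"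
  and \<phi>_\<psi> [simp]: "\<phi> \<otimes> \<psi> = \<one>" and \<psi>_\<phi> [simp]: "\<psi> \<otimes> \<phi> = \<one>"
  using monoid.Units_closed[OF monoid_H \<phi>_Units] monoid.Units_inv_closed[OF monoid_H \<phi>_Units]
    monoid.Units_r_inv[OF monoid_H \<phi>_Units] monoid.Units_l_inv[OF monoid_H \<phi>_Units]
  by (simp_all add: \<psi>_def)

lemma \<phi>_cancel [simp]: "h \<in> carrier H \<Longrightarrow> \<phi> \<otimes> (\<psi> \<otimes> h) = h" "h \<in> carrier H \<Longrightarrow> \<psi> \<otimes> (\<phi> \<otimes> h) = h"
  by (simp_all add: alg_assoc[symmetric])

lemma sS_\<phi>_cancel [simp]:
  "sS \<phi> \<otimes> sS \<psi> = \<one>" "sS \<psi> \<otimes> sS \<phi> = \<one>"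
  "h \<in> carrier H \<Longrightarrow> sS \<phi> \<otimes> (sS \<psi> \<otimes> h) = h" "h \<in> carrier H \<Longrightarrow> sS \<psi> \<otimes> (sS \<phi> \<otimes> h) = h"
proof -
  show *: "sS \<phi> \<otimes> sS \<psi> = \<one>" "sS \<psi> \<otimes> sS \<phi> = \<one>" by (simp_all add: sS_mult[symmetric])
  show "h \<in> carrier H \<Longrightarrow> sS \<phi> \<otimes> (sS \<psi> \<otimes> h) = h" "h \<in> carrier H \<Longrightarrow> sS \<psi> \<otimes> (sS \<phi> \<otimes> h) = h"
    by (simp_all add: alg_assoc[symmetric] *)
qed

lemma counit_\<psi> [simp]: "counit H \<psi> = 1"
  using counit_mult[of \<phi> \<psi>] by (simp add: counit_one counit_\<phi>)

definition T :: "'a vuniv \<Rightarrow> 'a vuniv" where "T h = \<psi> \<otimes> sS h \<otimes> \<phi>"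
definition \<gamma> :: "'a vuniv" where "\<gamma> = \<psi> \<otimes> sS \<psi>"
definition G :: "'a vuniv" where
  "G = pure H H \<psi> \<psi> \<otimes>\<^bsub>H \<otimes>\<^sub>v H\<^esub> tensor_map H H sS sS (tensor_swap H H F)
    \<otimes>\<^bsub>H \<otimes>\<^sub>v H\<^esub> \<Delta> \<phi> \<otimes>\<^bsub>H \<otimes>\<^sub>v H\<^esub> Fi"

lemma T_hom: "antilinear_algebra_hom H T"
proof -
  interpret cH: complex_algebra "cj H" by (rule complex_algebra_cj[OF complex_algebra_axioms])
  have "linear_map H (cj H) T"
    using cH.linear_mult_left[OF cH.linear_mult_right[OF sS_linear]] by (simp add: T_def[abs_def])
  then show ?thesis
    by (simp add: antilinear_algebra_hom_def antilinear_iff) (simp add: T_def sS_mult alg_assoc)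
qed

lemma T_closed [simp]: "h \<in> carrier H \<Longrightarrow> T h \<in> carrier H" by (simp add: T_def)
lemma \<gamma>_closed [simp]: "\<gamma> \<in> carrier H" by (simp add: \<gamma>_def)
lemma G_closed [simp]: "G \<in> carrier (H \<otimes>\<^sub>v H)" by (simp add: G_def)

lemma counit_T: "h \<in> carrier H \<Longrightarrow> counit H (T h) = cnj (counit H h)"
  by (simp add: T_def counit_mult counit_\<phi> counit_sS)

lemma counit_\<gamma>: "counit H \<gamma> = 1"
  by (simp add: \<gamma>_def counit_mult counit_sS)

lemma \<phi>_T: "h \<in> carrier H \<Longrightarrow> \<phi> \<otimes> T h = sS h \<otimes> \<phi>"
  by (simp add: T_def alg_assoc)

lemma T_\<gamma>: "T \<gamma> = \<gamma>"
  by (simp add: T_def \<gamma>_def sS_mult alg_assoc)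

text \<open>\<open>T\<close> is the involution \<open>sS\<close> followed by an inner automorphism,
  so its square is inner. The conjugating element is \<open>\<gamma>\<close>, which is what
  equivariance of \<open>bb\<close> demands.\<close>

lemma T_T_\<gamma>: "h \<in> carrier H \<Longrightarrow> T (T h) \<otimes> \<gamma> = \<gamma> \<otimes> h"
  by (simp add: T_def \<gamma>_def sS_mult alg_assoc)

text \<open>\<open>sS \<phi> \<otimes> \<phi>\<close> is the action of two successive
  \<open>fb\<close>, the second on a conjugate module where \<phi> acts as \<open>sS \<phi>\<close>.
  It carries the new double conjugate to the old one, whose \<open>bb\<close> is the identity of
  spaces, so \<open>\<gamma>\<close> has to invert it.\<close>

lemma \<gamma>_inverse: "sS \<phi> \<otimes> \<phi> \<otimes> \<gamma> = \<one>" "\<gamma> \<otimes> (sS \<phi> \<otimes> \<phi>) = \<one>"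
  by (simp_all add: \<gamma>_def alg_assoc)

abbreviation bD :: "'a hmod \<Rightarrow> 'a hmod" where "bD \<equiv> bar_mod (twist H F) T"

lemma lm_bD [simp]: "lm X \<Longrightarrow> lm (bD X)"
  by (rule lm_bar[OF _ _ T_hom]) simp_all

lemma act_linear: "\<lbrakk>lm X; h \<in> carrier H\<rbrakk> \<Longrightarrow> linear_map (vs X) (vs X) (act X h)"
  by (rule blin_right[OF lm_blin])

lemma act_act: "\<lbrakk>lm X; h \<in> carrier H; k \<in> carrier H; x \<in> carrier X\<rbrakk> \<Longrightarrow> act X h (act X k x) = act X (h \<otimes> k) x"
  by (simp add: lm_act_mult)

lemma hm_fb: "lm X \<Longrightarrow> hm (bD X) (bC X) (act X \<phi>)"
  and hm_fbi: "lm X \<Longrightarrow> hm (bC X) (bD X) (act X \<psi>)"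
  by (simp_all add: equivariant_def act_linear act_act \<phi>_T) (simp add: T_def alg_assoc)

lemma hm_bb: "lm X \<Longrightarrow> hm X (bD (bD X)) (act X \<gamma>)"
  by (simp add: equivariant_def act_linear act_act T_T_\<gamma>)

lemma fb_fbi [simp]: "\<lbrakk>lm X; x \<in> carrier X\<rbrakk> \<Longrightarrow> act X \<phi> (act X \<psi> x) = x" "\<lbrakk>lm X; x \<in> carrier X\<rbrakk> \<Longrightarrow> act X \<psi> (act X \<phi> x) = x"
  by (simp_all add: act_act)

text \<open>Moving the flip inwards through the factors of \<open>G\<close> turns each into a map:
  the symmetric \<psi> \<otimes> \<psi> inverts \<open>fb\<close> on both factors, the factor from
  \<open>F\<close> becomes \<open>un\<close> on the conjugate modules, and
  \<open>\<Delta> \<phi>\<close> is \<phi> acting on \<open>tC X Y\<close>. Every map in the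
  composite is equivariant and bijective, hence so is \<Upsilon>.\<close>

lemma ups_eq:
  assumes X: "lm X" "lm Y" and t: "t \<in> carrier (vs X \<otimes>\<^sub>v vs Y)"
  shows "ups G X Y t = tm Y X (act Y \<psi>) (act X \<psi>) (un (bC Y) (bC X) (sw X Y (act (tC X Y) \<phi> (tw X Y t))))"
proof -
  note [simp] = X t
  have "ups G X Y t = sw X Y (a2 X Y (pure H H \<psi> \<psi>) (a2 X Y (tensor_map H H sS sS (tensor_swap H H F))
      (a2 X Y (\<Delta> \<phi>) (tw X Y t))))"
    by (simp add: ups_def G_def a2_mult)
  also have "\<dots> = a2 Y X (pure H H \<psi> \<psi>) (a2 Y X (tensor_map H H sS sS F) (sw X Y (a2 X Y (\<Delta> \<phi>) (tw X Y t))))"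
    by (simp add: swap_a2[of X Y] sS_swap)
  also have "\<dots> = tm Y X (act Y \<psi>) (act X \<psi>) (un (bC Y) (bC X) (sw X Y (a2 X Y (\<Delta> \<phi>) (tw X Y t))))"
    by (simp add: a2_pure_left a2_bC)
  finally show ?thesis by simp
qed

lemma hm_ups:
  assumes X: "lm X" "lm Y"
  shows "hm (bD (tD X Y)) (tD (bD Y) (bD X)) (ups G X Y)"
proof -
  have 1: "hm (bD (tD X Y)) (bD (tC X Y)) (tw X Y)"
    by (rule hm_bar[OF hm_tw _ T_hom]) (simp_all add: X)
  have 2: "hm (bD (tC X Y)) (bC (tC X Y)) (act (tC X Y) \<phi>)" using X by (simp add: hm_fb)
  have 3: "hm (tC (bC Y) (bC X)) (tD (bC Y) (bC X)) (un (bC Y) (bC X))" using X by (simp add: hm_un)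
  have 4: "hm (tD (bC Y) (bC X)) (tD (bD Y) (bD X)) (tm (bD Y) (bD X) (act Y \<psi>) (act X \<psi>))"
    using X by (intro hm_tm hm_fbi) simp_all
  show ?thesis
    by (rule hm_cong[OF hm_comp[OF hm_comp[OF hm_comp[OF hm_comp[OF 1 2] hm_sw[OF X]] 3] 4]])
      (use X in \<open>simp_all add: ups_eq\<close>)
qed

lemma ups_closed [simp]:
  "\<lbrakk>lm X; lm Y; t \<in> carrier (vs X \<otimes>\<^sub>v vs Y)\<rbrakk> \<Longrightarrow> ups G X Y t \<in> carrier (vs Y \<otimes>\<^sub>v vs X)"
  using hm_closed[OF hm_ups] by simp

lemma tm_fb_closed [simp]:
  assumes "lm X" "lm Y" "t \<in> carrier (vs X \<otimes>\<^sub>v vs Y)" "h \<in> carrier H" "k \<in> carrier H"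
  shows "tm X Y (act X h) (act Y k) t \<in> carrier (vs X \<otimes>\<^sub>v vs Y)"
  using assms by (intro tmap_closed[OF act_linear act_linear]) simp_all

lemma tm_fb_fbi [simp]:
  assumes "lm X" "lm Y" "t \<in> carrier (vs X \<otimes>\<^sub>v vs Y)"
  shows "tm X Y (act X \<phi>) (act Y \<phi>) (tm X Y (act X \<psi>) (act Y \<psi>) t) = t"
    and "tm X Y (act X \<psi>) (act Y \<psi>) (tm X Y (act X \<phi>) (act Y \<phi>) t) = t"
  using assms by (auto intro!: tm_inverse simp: act_linear)

text \<open>This is \<open>ups_eq\<close> with its outer maps moved to the other side: up to \<phi>
  and the twist, \<Upsilon> is the flip. The associativity and strength axioms use \<Upsilon> in
  this form.\<close>

lemma tw_ups:
  assumes X: "lm X" "lm Y" and t: "t \<in> carrier (vs X \<otimes>\<^sub>v vs Y)"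
  shows "tw (bC Y) (bC X) (tm Y X (act Y \<phi>) (act X \<phi>) (ups G X Y t)) = sw X Y (act (tC X Y) \<phi> (tw X Y t))"
proof -
  have "un (bC Y) (bC X) (sw X Y (act (tC X Y) \<phi> (tw X Y t))) \<in> carrier (vs Y \<otimes>\<^sub>v vs X)"
    using X t a2_closed[of "bC Y" "bC X" F] by simp
  then show ?thesis using X t tw_un[of "bC Y" "bC X"] by (simp add: ups_eq)
qed

definition upsi :: "'a hmod \<Rightarrow> 'a hmod \<Rightarrow> 'a vuniv \<Rightarrow> 'a vuniv" where
  "upsi X Y s = un X Y (act (tC X Y) \<psi> (sw Y X (tw (bC Y) (bC X) (tm Y X (act Y \<phi>) (act X \<phi>) s))))"

lemma upsi_closed [simp]:
  assumes X: "lm X" "lm Y" and t: "s \<in> carrier (vs Y \<otimes>\<^sub>v vs X)"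
  shows "upsi X Y s \<in> carrier (vs X \<otimes>\<^sub>v vs Y)"
  using X t a2_closed[of "bC Y" "bC X" Fi] by (simp add: upsi_def)

lemma upsi_ups:
  assumes X: "lm X" "lm Y" and t: "t \<in> carrier (vs X \<otimes>\<^sub>v vs Y)"
  shows "upsi X Y (ups G X Y t) = t"
  using X t fb_fbi(2)[of "tC X Y" "tw X Y t"] by (simp add: upsi_def tw_ups del: fb_fbi)

lemma ups_upsi:
  assumes X: "lm X" "lm Y" and s: "s \<in> carrier (vs Y \<otimes>\<^sub>v vs X)"
  shows "ups G X Y (upsi X Y s) = s"
proof -
  have 1: "tw (bC Y) (bC X) (tm Y X (act Y \<phi>) (act X \<phi>) s) \<in> carrier (vs Y \<otimes>\<^sub>v vs X)"
    using X s a2_closed[of "bC Y" "bC X" Fi] by simp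
  then show ?thesis
    using X s fb_fbi(1)[of "tC X Y"] un_tw[of "bC Y" "bC X"] lm_act_closed[of "tC X Y" \<psi>]
    by (simp add: ups_eq) (simp add: upsi_def)
qed

end

text \<open>The associativity axiom of a bar category for the flip of plain spaces: both sides send
  x, y, z to the bracketing z, (y, x) of pure tensors.\<close>

lemma assoc_swap:
  assumes V: "vsp X" "vsp Y" "vsp Z" and q: "q \<in> carrier ((X \<otimes>\<^sub>v Y) \<otimes>\<^sub>v Z)"
  shows "tensor_assoc Z Y X (tensor_map (Z \<otimes>\<^sub>v Y) X (tensor_swap Y Z) (\<lambda>x. x)
      (tensor_swap X (Y \<otimes>\<^sub>v Z) (tensor_assoc X Y Z q)))
    = tensor_map Z (Y \<otimes>\<^sub>v X) (\<lambda>x. x) (tensor_swap X Y) (tensor_swap (X \<otimes>\<^sub>v Y) Z q)"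
proof -
  note [simp] = V
  have s1: "linear_map (Y \<otimes>\<^sub>v Z) (Z \<otimes>\<^sub>v Y) (tensor_swap Y Z)" and s2: "linear_map (X \<otimes>\<^sub>v Y) (Y \<otimes>\<^sub>v X) (tensor_swap X Y)"
    by (simp_all add: linear_swap)
  have F: "linear_map ((X \<otimes>\<^sub>v Y) \<otimes>\<^sub>v Z) (Z \<otimes>\<^sub>v Y \<otimes>\<^sub>v X) (\<lambda>q. tensor_assoc Z Y X
      (tensor_map (Z \<otimes>\<^sub>v Y) X (tensor_swap Y Z) (\<lambda>x. x) (tensor_swap X (Y \<otimes>\<^sub>v Z) (tensor_assoc X Y Z q))))"
    by (rule linear_comp[OF linear_comp[OF linear_comp[OF linear_assoc linear_swap]
      linear_tmap[OF s1 linear_id]] linear_assoc]) simp_all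
  have G: "linear_map ((X \<otimes>\<^sub>v Y) \<otimes>\<^sub>v Z) (Z \<otimes>\<^sub>v Y \<otimes>\<^sub>v X)
      (\<lambda>q. tensor_map Z (Y \<otimes>\<^sub>v X) (\<lambda>x. x) (tensor_swap X Y) (tensor_swap (X \<otimes>\<^sub>v Y) Z q))"
    by (rule linear_comp[OF linear_swap linear_tmap[OF linear_id s2]]) simp_all
  show ?thesis
    by (rule tensor_eqI_left[OF _ _ _ F G q]) (simp_all add: tmap_pure[OF s1 linear_id] tmap_pure[OF linear_id s2])
qed

context bar_twisted
begin

lemma ups_linear: "\<lbrakk>lm X; lm Y\<rbrakk> \<Longrightarrow> linear_map (vs X \<otimes>\<^sub>v vs Y) (vs Y \<otimes>\<^sub>v vs X) (ups G X Y)"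
  using hm_linear[OF hm_ups] by simp

lemma tm_fb_linear: "\<lbrakk>lm X; lm Y; h \<in> carrier H; k \<in> carrier H\<rbrakk>
    \<Longrightarrow> linear_map (vs X \<otimes>\<^sub>v vs Y) (vs X \<otimes>\<^sub>v vs Y) (tm X Y (act X h) (act Y k))"
  by (intro linear_tmap act_linear) simp_all

lemma tm3_fb_inverse:
  assumes X: "lm X" "lm Y" "lm Z" and t: "t \<in> carrier (vs Z \<otimes>\<^sub>v vs Y \<otimes>\<^sub>v vs X)"
  shows "tm Z (tC Y X) (act Z \<psi>) (tm Y X (act Y \<psi>) (act X \<psi>))
    (tm Z (tC Y X) (act Z \<phi>) (tm Y X (act Y \<phi>) (act X \<phi>)) t) = t"
  using tm_inverse[OF _ _ _ _ act_linear act_linear tm_fb_linear tm_fb_linear _ _ t] X by simp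

text \<open>The outer \<Upsilon> has the twisted product \<open>tD Y Z\<close> as an argument;
  \<open>ups_nat\<close> along \<open>tw Y Z\<close> replaces it by \<open>tC Y Z\<close>. Then
  \<open>tw_ups\<close> turns the inner and the outer \<Upsilon> into flips, \<open>R3_asc\<close>
  replaces both associators by those of spaces, and \<phi> moves to the innermost position by
  equivariance.\<close>

lemma bar_assoc_left:
  assumes X: "lm X" "lm Y" "lm Z" and t: "t \<in> carrier ((vs X \<otimes>\<^sub>v vs Y) \<otimes>\<^sub>v vs Z)"
  shows "R3 (bC Z) (bC Y) (bC X) (tm Z (tC Y X) (act Z \<phi>) (tm Y X (act Y \<phi>) (act X \<phi>))
      (asc (bD Z) (bD Y) (bD X) (tm (tC Z Y) X (ups G Y Z) (\<lambda>x. x) (ups G X (tD Y Z) (asc X Y Z t)))))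
    = as Z Y X (tm (tC Z Y) X (sw Y Z) (\<lambda>x. x) (tensor_swap (vs X) (vs Y \<otimes>\<^sub>v vs Z)
      (as X Y Z (act (tC (tC X Y) Z) \<phi> (L3 X Y Z t)))))"
proof -
  note [simp] = X
  define s where "s = asc X Y Z t"
  define w1 where "w1 = ups G X (tD Y Z) s"
  define w where "w = tm (tC Z Y) X (ups G Y Z) (\<lambda>x. x) w1"
  define r1 where "r1 = tm X (tC Y Z) (\<lambda>x. x) (tw Y Z) s"
  define q where "q = act (tC (tC X Y) Z) \<phi> (L3 X Y Z t)"
  have s: "s \<in> carrier (vs X \<otimes>\<^sub>v vs Y \<otimes>\<^sub>v vs Z)" using t by (simp add: s_def)
  have w1: "w1 \<in> carrier ((vs Y \<otimes>\<^sub>v vs Z) \<otimes>\<^sub>v vs X)" using s ups_closed[of X "tD Y Z" s] by (simp add: w1_def)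
  have up: "linear_map (vs Y \<otimes>\<^sub>v vs Z) (vs Z \<otimes>\<^sub>v vs Y) (ups G Y Z)" by (simp add: ups_linear)
  have twb: "linear_map (vs Z \<otimes>\<^sub>v vs Y) (vs Z \<otimes>\<^sub>v vs Y) (tw (bC Z) (bC Y))"
    using a2_linear[of "bC Z" "bC Y" Fi] by simp
  have w: "w \<in> carrier ((vs Z \<otimes>\<^sub>v vs Y) \<otimes>\<^sub>v vs X)"
    using tmap_closed[OF up linear_id _ _ _ _ w1] by (simp add: w_def)
  have r1: "r1 \<in> carrier (vs X \<otimes>\<^sub>v vs Y \<otimes>\<^sub>v vs Z)"
    using tmap_closed[OF linear_id a2_linear _ _ _ _ s] by (simp add: r1_def)
  define v where "v = tm (tC Y Z) X (act (tC Y Z) \<phi>) (act X \<phi>) (ups G X (tC Y Z) r1)"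
  have v: "v \<in> carrier ((vs Y \<otimes>\<^sub>v vs Z) \<otimes>\<^sub>v vs X)"
    using tm_fb_closed[of "tC Y Z" X "ups G X (tC Y Z) r1" \<phi> \<phi>] ups_closed[of X "tC Y Z" r1] r1 by (simp add: v_def)
  have aYZ: "linear_map (vs Y \<otimes>\<^sub>v vs Z) (vs Y \<otimes>\<^sub>v vs Z) (act (tC Y Z) \<phi>)"
    using act_linear[of "tC Y Z" \<phi>] by simp
  have twYZ: "linear_map (vs Y \<otimes>\<^sub>v vs Z) (vs Y \<otimes>\<^sub>v vs Z) (tw Y Z)" by (simp add: a2_linear)
  have swYZ: "linear_map (vs Y \<otimes>\<^sub>v vs Z) (vs Z \<otimes>\<^sub>v vs Y) (sw Y Z)" by (simp add: linear_swap)
  have aX: "linear_map (vs X) (vs X) (act X \<phi>)" by (simp add: act_linear)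
  have fZY: "linear_map (vs Z \<otimes>\<^sub>v vs Y) (vs Z \<otimes>\<^sub>v vs Y) (tm Z Y (act Z \<phi>) (act Y \<phi>))" by (simp add: tm_fb_linear)
  have fw: "tm (tC Z Y) X (tm Z Y (act Z \<phi>) (act Y \<phi>)) (act X \<phi>) w
      = tm (tC Z Y) X (\<lambda>r. tm Z Y (act Z \<phi>) (act Y \<phi>) (ups G Y Z r)) (act X \<phi>) w1"
    using tmap_comp[OF up linear_id fZY aX _ _ _ _ _ _ w1] by (simp add: w_def)
  have fwc: "tm (tC Z Y) X (tm Z Y (act Z \<phi>) (act Y \<phi>)) (act X \<phi>) w \<in> carrier ((vs Z \<otimes>\<^sub>v vs Y) \<otimes>\<^sub>v vs X)"
    using tmap_closed[OF fZY aX _ _ _ _ w] by simp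
  have "tm Z (tC Y X) (act Z \<phi>) (tm Y X (act Y \<phi>) (act X \<phi>)) (asc (bD Z) (bD Y) (bD X) w)
    = asc (bC Z) (bC Y) (bC X) (tm (tC Z Y) X (tm Z Y (act Z \<phi>) (act Y \<phi>)) (act X \<phi>) w)"
    using asc_nat[of "bD Z" "bD Y" "bD X" "bC Z" "bC Y" "bC X" "act Z \<phi>" "act Y \<phi>" "act X \<phi>" w] w
    by (simp add: hm_fb)
  then have 1: "R3 (bC Z) (bC Y) (bC X) (tm Z (tC Y X) (act Z \<phi>) (tm Y X (act Y \<phi>) (act X \<phi>)) (asc (bD Z) (bD Y) (bD X) w))
    = as Z Y X (L3 (bC Z) (bC Y) (bC X) (tm (tC Z Y) X (tm Z Y (act Z \<phi>) (act Y \<phi>)) (act X \<phi>) w))"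
    using R3_asc[of "bC Z" "bC Y" "bC X" "tm (tC Z Y) X (tm Z Y (act Z \<phi>) (act Y \<phi>)) (act X \<phi>) w"] fwc by simp
  have "tm (tC Z Y) X (tw (bC Z) (bC Y)) (\<lambda>x. x) (tm (tC Z Y) X (tm Z Y (act Z \<phi>) (act Y \<phi>)) (act X \<phi>) w)
    = tm (tC Z Y) X (\<lambda>r. tw (bC Z) (bC Y) (tm Z Y (act Z \<phi>) (act Y \<phi>) (ups G Y Z r))) (act X \<phi>) w1"
    unfolding fw using tmap_comp[OF linear_comp[OF up fZY] aX twb linear_id _ _ _ _ _ _ w1] by simp
  also have "\<dots> = tm (tC Z Y) X (\<lambda>r. sw Y Z (act (tC Y Z) \<phi> (tw Y Z r))) (act X \<phi>) w1"
    by (rule tmap_cong[OF _ _ w1]) (simp_all add: tw_ups)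
  also have "\<dots> = tm (tC Z Y) X (sw Y Z) (\<lambda>x. x) (tm (tC Y Z) X (\<lambda>r. act (tC Y Z) \<phi> (tw Y Z r)) (act X \<phi>) w1)"
    using tmap_comp[OF linear_comp[OF twYZ aYZ] aX swYZ linear_id _ _ _ _ _ _ w1] by simp
  also have "tm (tC Y Z) X (\<lambda>r. act (tC Y Z) \<phi> (tw Y Z r)) (act X \<phi>) w1
    = tm (tC Y Z) X (act (tC Y Z) \<phi>) (act X \<phi>) (tm (tC Y Z) X (tw Y Z) (\<lambda>x. x) w1)"
    using tmap_comp[OF twYZ linear_id aYZ aX _ _ _ _ _ _ w1] by simp
  also have "tm (tC Y Z) X (tw Y Z) (\<lambda>x. x) w1 = ups G X (tC Y Z) r1"
    using ups_nat[of X "tD Y Z" X "tC Y Z" G s "\<lambda>x. x" "tw Y Z"] s by (simp add: w1_def r1_def hm_id hm_tw)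
  finally have 2: "L3 (bC Z) (bC Y) (bC X) (tm (tC Z Y) X (tm Z Y (act Z \<phi>) (act Y \<phi>)) (act X \<phi>) w)
    = tw (tC (bC Z) (bC Y)) (bC X) (tm (tC Z Y) X (sw Y Z) (\<lambda>x. x) v)"
    by (simp add: L3_def v_def)
  also have "\<dots> = tm (tC Z Y) X (sw Y Z) (\<lambda>x. x) (tw (bC (tC Y Z)) (bC X) v)"
    using a2_nat[of "bC (tC Y Z)" "bC X" "tC (bC Z) (bC Y)" "bC X" "sw Y Z" "\<lambda>x. x" Fi v] v hm_sw[of Y Z]
    by (simp add: hm_id)
  also have "tw (bC (tC Y Z)) (bC X) v = tensor_swap (vs X) (vs Y \<otimes>\<^sub>v vs Z) (act (tC X (tC Y Z)) \<phi> (tw X (tC Y Z) r1))"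
    using tw_ups[of X "tC Y Z" r1] r1 by (simp add: v_def)
  also have "tw X (tC Y Z) r1 = as X Y Z (L3 X Y Z t)"
    using R3_asc[OF X t] by (simp add: R3_def r1_def s_def)
  also have "act (tC X (tC Y Z)) \<phi> (as X Y Z (L3 X Y Z t)) = as X Y Z q"
    using hm_act[OF hm_assoc[OF X], of \<phi> "L3 X Y Z t"] t by (simp add: q_def)
  finally show ?thesis using 1 by (simp add: q_def w_def w1_def s_def)
qed

text \<open>The mirror computation, with \<open>ups_nat\<close> along \<open>tw X Y\<close>. It ends
  at the same vector \<open>act (tC (tC X Y) Z) \<phi> (L3 X Y Z t)\<close> as
  \<open>bar_assoc_left\<close>, so that only \<open>assoc_swap\<close> remains to compare the
  two.\<close>

lemma bar_assoc_right:
  assumes X: "lm X" "lm Y" "lm Z" and t: "t \<in> carrier ((vs X \<otimes>\<^sub>v vs Y) \<otimes>\<^sub>v vs Z)"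
  shows "R3 (bC Z) (bC Y) (bC X) (tm Z (tC Y X) (act Z \<phi>) (tm Y X (act Y \<phi>) (act X \<phi>))
      (tm Z (tC Y X) (\<lambda>x. x) (ups G X Y) (ups G (tD X Y) Z t)))
    = tm Z (tC Y X) (\<lambda>x. x) (sw X Y) (tensor_swap (vs X \<otimes>\<^sub>v vs Y) (vs Z) (act (tC (tC X Y) Z) \<phi> (L3 X Y Z t)))"
proof -
  note [simp] = X
  define r2 where "r2 = ups G (tD X Y) Z t"
  define r3 where "r3 = tm (tC X Y) Z (tw X Y) (\<lambda>x. x) t"
  have r2: "r2 \<in> carrier (vs Z \<otimes>\<^sub>v vs X \<otimes>\<^sub>v vs Y)" using t ups_closed[of "tD X Y" Z t] by (simp add: r2_def)
  have r3: "r3 \<in> carrier ((vs X \<otimes>\<^sub>v vs Y) \<otimes>\<^sub>v vs Z)"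
    using tmap_closed[OF a2_linear linear_id _ _ _ _ t] by (simp add: r3_def)
  define v where "v = tm Z (tC X Y) (act Z \<phi>) (act (tC X Y) \<phi>) (ups G (tC X Y) Z r3)"
  have v: "v \<in> carrier (vs Z \<otimes>\<^sub>v vs X \<otimes>\<^sub>v vs Y)"
    using tm_fb_closed[of Z "tC X Y" "ups G (tC X Y) Z r3" \<phi> \<phi>] ups_closed[of "tC X Y" Z r3] r3 by (simp add: v_def)
  have up: "linear_map (vs X \<otimes>\<^sub>v vs Y) (vs Y \<otimes>\<^sub>v vs X) (ups G X Y)" by (simp add: ups_linear)
  have twb: "linear_map (vs Y \<otimes>\<^sub>v vs X) (vs Y \<otimes>\<^sub>v vs X) (tw (bC Y) (bC X))"
    using a2_linear[of "bC Y" "bC X" Fi] by simp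
  have aXY: "linear_map (vs X \<otimes>\<^sub>v vs Y) (vs X \<otimes>\<^sub>v vs Y) (act (tC X Y) \<phi>)"
    using act_linear[of "tC X Y" \<phi>] by simp
  have twXY: "linear_map (vs X \<otimes>\<^sub>v vs Y) (vs X \<otimes>\<^sub>v vs Y) (tw X Y)" by (simp add: a2_linear)
  have swXY: "linear_map (vs X \<otimes>\<^sub>v vs Y) (vs Y \<otimes>\<^sub>v vs X) (sw X Y)" by (simp add: linear_swap)
  have aZ: "linear_map (vs Z) (vs Z) (act Z \<phi>)" by (simp add: act_linear)
  have fYX: "linear_map (vs Y \<otimes>\<^sub>v vs X) (vs Y \<otimes>\<^sub>v vs X) (tm Y X (act Y \<phi>) (act X \<phi>))" by (simp add: tm_fb_linear)
  have e: "tm Z (tC Y X) (act Z \<phi>) (tm Y X (act Y \<phi>) (act X \<phi>)) (tm Z (tC Y X) (\<lambda>x. x) (ups G X Y) r2)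
    = tm Z (tC Y X) (act Z \<phi>) (\<lambda>r. tm Y X (act Y \<phi>) (act X \<phi>) (ups G X Y r)) r2"
    using tmap_comp[OF linear_id up aZ fYX _ _ _ _ _ _ r2] by simp
  have "tm Z (tC Y X) (\<lambda>x. x) (tw (bC Y) (bC X)) (tm Z (tC Y X) (act Z \<phi>)
      (tm Y X (act Y \<phi>) (act X \<phi>)) (tm Z (tC Y X) (\<lambda>x. x) (ups G X Y) r2))
    = tm Z (tC Y X) (act Z \<phi>) (\<lambda>r. tw (bC Y) (bC X) (tm Y X (act Y \<phi>) (act X \<phi>) (ups G X Y r))) r2"
    unfolding e using tmap_comp[OF aZ linear_comp[OF up fYX] linear_id twb _ _ _ _ _ _ r2] by simp
  also have "\<dots> = tm Z (tC Y X) (act Z \<phi>) (\<lambda>r. sw X Y (act (tC X Y) \<phi> (tw X Y r))) r2"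
    by (rule tmap_cong[OF _ _ r2]) (simp_all add: tw_ups)
  also have "\<dots> = tm Z (tC Y X) (\<lambda>x. x) (sw X Y) (tm Z (tC X Y) (act Z \<phi>) (\<lambda>r. act (tC X Y) \<phi> (tw X Y r)) r2)"
    using tmap_comp[OF aZ linear_comp[OF twXY aXY] linear_id swXY _ _ _ _ _ _ r2] by simp
  also have "tm Z (tC X Y) (act Z \<phi>) (\<lambda>r. act (tC X Y) \<phi> (tw X Y r)) r2
    = tm Z (tC X Y) (act Z \<phi>) (act (tC X Y) \<phi>) (tm Z (tC X Y) (\<lambda>x. x) (tw X Y) r2)"
    using tmap_comp[OF linear_id twXY aZ aXY _ _ _ _ _ _ r2] by simp
  also have "tm Z (tC X Y) (\<lambda>x. x) (tw X Y) r2 = ups G (tC X Y) Z r3"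
    using ups_nat[of "tD X Y" Z "tC X Y" Z G t "tw X Y" "\<lambda>x. x"] t by (simp add: r2_def r3_def hm_id hm_tw)
  finally have "R3 (bC Z) (bC Y) (bC X) (tm Z (tC Y X) (act Z \<phi>) (tm Y X (act Y \<phi>) (act X \<phi>)) (tm Z (tC Y X) (\<lambda>x. x) (ups G X Y) r2))
    = tw (bC Z) (tC (bC Y) (bC X)) (tm Z (tC Y X) (\<lambda>x. x) (sw X Y) v)"
    by (simp add: R3_def v_def)
  also have "\<dots> = tm Z (tC Y X) (\<lambda>x. x) (sw X Y) (tw (bC Z) (bC (tC X Y)) v)"
    using a2_nat[of "bC Z" "bC (tC X Y)" "bC Z" "tC (bC Y) (bC X)" "\<lambda>x. x" "sw X Y" Fi v] v hm_sw[of X Y]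
    by (simp add: hm_id)
  also have "tw (bC Z) (bC (tC X Y)) v = tensor_swap (vs X \<otimes>\<^sub>v vs Y) (vs Z) (act (tC (tC X Y) Z) \<phi> (tw (tC X Y) Z r3))"
    using tw_ups[of "tC X Y" Z r3] r3 by (simp add: v_def)
  finally show ?thesis by (simp add: L3_def r3_def r2_def)
qed

lemma bar_assoc_D:
  assumes X: "lm X" "lm Y" "lm Z" and t: "t \<in> carrier ((vs X \<otimes>\<^sub>v vs Y) \<otimes>\<^sub>v vs Z)"
  shows "asc (bD Z) (bD Y) (bD X) (tm (tC Z Y) X (ups G Y Z) (\<lambda>x. x) (ups G X (tD Y Z) (asc X Y Z t)))
    = tm Z (tC Y X) (\<lambda>x. x) (ups G X Y) (ups G (tD X Y) Z t)" (is "?l = ?r")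
proof -
  note [simp] = X
  let ?S = "vs Z \<otimes>\<^sub>v vs Y \<otimes>\<^sub>v vs X" and ?f = "tm Z (tC Y X) (act Z \<phi>) (tm Y X (act Y \<phi>) (act X \<phi>))"
  have a: "ups G X (tD Y Z) (asc X Y Z t) \<in> carrier ((vs Y \<otimes>\<^sub>v vs Z) \<otimes>\<^sub>v vs X)"
    using ups_closed[of X "tD Y Z" "asc X Y Z t"] t by simp
  have b: "tm (tC Z Y) X (ups G Y Z) (\<lambda>x. x) (ups G X (tD Y Z) (asc X Y Z t)) \<in> carrier ((vs Z \<otimes>\<^sub>v vs Y) \<otimes>\<^sub>v vs X)"
    using tmap_closed[OF ups_linear linear_id _ _ _ _ a] by simp
  have c: "ups G (tD X Y) Z t \<in> carrier (vs Z \<otimes>\<^sub>v vs X \<otimes>\<^sub>v vs Y)"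
    using ups_closed[of "tD X Y" Z t] t by simp
  have l: "?l \<in> carrier ?S" using asc_closed[of "bD Z" "bD Y" "bD X"] b by simp
  have r: "?r \<in> carrier ?S" using tmap_closed[OF linear_id ups_linear _ _ _ _ c] by simp
  have f: "?f s \<in> carrier ?S" if "s \<in> carrier ?S" for s
    using tmap_closed[OF act_linear tm_fb_linear _ _ _ _ that] by simp
  have q: "act (tC (tC X Y) Z) \<phi> (L3 X Y Z t) \<in> carrier ((vs X \<otimes>\<^sub>v vs Y) \<otimes>\<^sub>v vs Z)"
    using lm_act_closed[of "tC (tC X Y) Z" \<phi> "L3 X Y Z t"] t by simp
  have "R3 (bC Z) (bC Y) (bC X) (?f ?l) = R3 (bC Z) (bC Y) (bC X) (?f ?r)"
    unfolding bar_assoc_left[OF X t] bar_assoc_right[OF X t] using assoc_swap[OF _ _ _ q] by simp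
  then have "?f ?l = ?f ?r"
    using R3i_R3[of "bC Z" "bC Y" "bC X" "?f ?l"] R3i_R3[of "bC Z" "bC Y" "bC X" "?f ?r"] f[OF l] f[OF r] by simp
  then show ?thesis
    using tm3_fb_inverse[OF X l] tm3_fb_inverse[OF X r] by simp
qed

text \<open>
  Removing the twists and \<open>\<phi>\<close> from both sides leaves the square of the flip; it is the identity because
  \<open>sS \<phi> \<otimes> \<phi>\<close> is inverse to \<open>\<gamma>\<close>.
\<close>

lemma strong_D:
  assumes X: "lm X" "lm Y" and t: "t \<in> carrier (vs X \<otimes>\<^sub>v vs Y)"
  shows "ups G (bD Y) (bD X) (ups G X Y (act (tD X Y) \<gamma> t)) = tm X Y (act X \<gamma>) (act Y \<gamma>) t"
proof -
  note [simp] = X t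
  define r where "r = act (tD X Y) \<gamma> t"
  have r: "r \<in> carrier (vs X \<otimes>\<^sub>v vs Y)" using lm_act_closed[of "tD X Y" \<gamma> t] by (simp add: r_def)
  define s where "s = ups G X Y r"
  have s: "s \<in> carrier (vs Y \<otimes>\<^sub>v vs X)" using r by (simp add: s_def)
  define P where "P = ups G (bD Y) (bD X) s"
  have P: "P \<in> carrier (vs X \<otimes>\<^sub>v vs Y)" using ups_closed[of "bD Y" "bD X" s] s by (simp add: P_def)
  define P' where "P' = tm X Y (act (bD X) \<phi>) (act (bD Y) \<phi>) P"
  have P': "P' \<in> carrier (vs X \<otimes>\<^sub>v vs Y)" using tm_fb_closed[of "bD X" "bD Y" P \<phi> \<phi>] P by (simp add: P'_def)
  \<comment> \<open>\<open>A\<close> is what \<open>tw_ups\<close> leaves of the outer \<Upsilon>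
    before its flip. Fact \<open>1\<close> evaluates it through the inner \<Upsilon>, and fact
    \<open>2\<close> ties it to the outer one.\<close>
  define A where "A = act (tC (bD Y) (bD X)) \<phi> (tw (bD Y) (bD X) s)"
  have tws: "tw (bD Y) (bD X) s \<in> carrier (vs Y \<otimes>\<^sub>v vs X)" using a2_closed[of "bD Y" "bD X" Fi s] s by simp
  have A: "A \<in> carrier (vs Y \<otimes>\<^sub>v vs X)"
    using lm_act_closed[of "tC (bD Y) (bD X)" \<phi> "tw (bD Y) (bD X) s"] tws by (simp add: A_def)
  have twr: "tw X Y r = act (tC X Y) \<gamma> (tw X Y t)" using hm_act[OF hm_tw[OF X], of \<gamma> t] by (simp add: r_def)
  have fb: "hm (tC (bD Y) (bD X)) (tC (bC Y) (bC X)) (tm Y X (act Y \<phi>) (act X \<phi>))"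
    using hm_tm(1)[of "bD Y" "bD X" "bC Y" "bC X" "act Y \<phi>" "act X \<phi>"] by (simp add: hm_fb)
  have "tm Y X (act Y \<phi>) (act X \<phi>) A
    = act (tC (bC Y) (bC X)) \<phi> (tm Y X (act Y \<phi>) (act X \<phi>) (tw (bD Y) (bD X) s))"
    using hm_act[OF fb, of \<phi> "tw (bD Y) (bD X) s"] tws by (simp add: A_def)
  also have "tm Y X (act Y \<phi>) (act X \<phi>) (tw (bD Y) (bD X) s) = tw (bC Y) (bC X) (tm Y X (act Y \<phi>) (act X \<phi>) s)"
    using a2_nat[of "bD Y" "bD X" "bC Y" "bC X" "act Y \<phi>" "act X \<phi>" Fi s] s by (simp add: hm_fb)
  also have "\<dots> = sw X Y (act (tC X Y) \<phi> (tw X Y r))" unfolding s_def by (rule tw_ups[OF X r])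
  also have "act (tC (bC Y) (bC X)) \<phi> \<dots> = sw X Y (act (bC (tC X Y)) \<phi> (act (tC X Y) \<phi> (tw X Y r)))"
    using hm_act[OF hm_sw[OF X], of \<phi> "act (tC X Y) \<phi> (tw X Y r)"] r by simp
  also have "act (bC (tC X Y)) \<phi> (act (tC X Y) \<phi> (tw X Y r)) = act (tC X Y) (sS \<phi> \<otimes> \<phi> \<otimes> \<gamma>) (tw X Y t)"
    unfolding twr using lm_act_closed[of "tC X Y" \<phi>] lm_act_closed[of "tC X Y" \<gamma>]
    by (simp add: lm_act_mult[of "tC X Y"] del: act_tC)
  also have "\<dots> = tw X Y t" using lm_act_one[of "tC X Y" "tw X Y t"] by (simp add: \<gamma>_inverse del: act_tC)
  finally have 1: "tm Y X (act Y \<phi>) (act X \<phi>) A = sw X Y (tw X Y t)" .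
  have 2: "tw (bC (bD X)) (bC (bD Y)) P' = sw Y X A"
    using tw_ups[of "bD Y" "bD X" s] s by (simp add: P'_def P_def A_def)
  \<comment> \<open>On double conjugates the twist acts through the square of \<open>sS\<close> in
    each factor, hence as on the original modules.\<close>
  have sS2: "tensor_map H H sS sS (tensor_map H H sS sS Fi) = Fi"
    using tm_inverse[of H H "cj H" "cj H" sS sS sS sS Fi] sS_linear by (simp add: linear_cj_left)
  have "tw X Y (tm X Y (act X \<phi>) (act Y \<phi>) P') = tw (bC (bC X)) (bC (bC Y)) (tm X Y (act X \<phi>) (act Y \<phi>) P')"
    using a2_bC[of "bC X" "bC Y" Fi] P' by (simp add: a2_bC sS2)
  also have "\<dots> = tm X Y (act X \<phi>) (act Y \<phi>) (tw (bC (bD X)) (bC (bD Y)) P')"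
    using a2_nat[of "bC (bD X)" "bC (bD Y)" "bC (bC X)" "bC (bC Y)" "act X \<phi>" "act Y \<phi>" Fi P'] P'
      hm_bar[OF hm_fb _ sS_hom, of _ "hopf_quasi H"] by simp
  also have "\<dots> = sw Y X (tm Y X (act Y \<phi>) (act X \<phi>) A)"
    unfolding 2 using swap_tmap[OF act_linear act_linear _ _ _ _ A] by simp
  also have "\<dots> = tw X Y t" unfolding 1 by simp
  finally have "un X Y (tw X Y (tm X Y (act X \<phi>) (act Y \<phi>) P')) = un X Y (tw X Y t)" by (rule arg_cong)
  then have "tm X Y (act X \<phi>) (act Y \<phi>) P' = t" using P' by simp
  moreover have "tm X Y (act X \<phi>) (act Y \<phi>) P' = tm X Y (act X (sS \<phi> \<otimes> \<phi>)) (act Y (sS \<phi> \<otimes> \<phi>)) P"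
  proof -
    have "tm X Y (act X \<phi>) (act Y \<phi>) P' = tm X Y (\<lambda>x. act X \<phi> (act (bD X) \<phi> x)) (\<lambda>x. act Y \<phi> (act (bD Y) \<phi> x)) P"
      using tmap_comp[OF act_linear[of "bD X" \<phi>] act_linear[of "bD Y" \<phi>], of "cj (vs X)" "act X \<phi>" "cj (vs Y)" "act Y \<phi>" P] P
      by (simp add: P'_def act_linear)
    also have "\<dots> = tm X Y (act X (sS \<phi> \<otimes> \<phi>)) (act Y (sS \<phi> \<otimes> \<phi>)) P"
      by (rule tmap_cong[OF _ _ P]) (simp_all add: act_act \<phi>_T)
    finally show ?thesis .
  qed
  moreover have "tm X Y (act X \<gamma>) (act Y \<gamma>) (tm X Y (act X (sS \<phi> \<otimes> \<phi>)) (act Y (sS \<phi> \<otimes> \<phi>)) P) = P"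
    by (rule tm_inverse[OF _ _ _ _ act_linear act_linear act_linear act_linear _ _ P])
      (simp_all add: act_act \<gamma>_inverse)
  ultimately show ?thesis by (simp add: P_def s_def r_def)
qed

end

section \<open>The bar category of modules over a twist\<close>

abbreviation conj_scalar :: "'a vuniv \<Rightarrow> 'a vuniv" where
  "conj_scalar s \<equiv> Scalar (cnj (scalar_of s))"

lemma bar_structure_simps:
  "barO (bar_structure A T \<gamma> G) = bar_mod A T"
  "barM (bar_structure A T \<gamma> G) (arr X Y f) = arr (bar_mod A T X) (bar_mod A T Y) f"
  "bbM (bar_structure A T \<gamma> G) X = arr X (bar_mod A T (bar_mod A T X)) (act X \<gamma>)"
  "starM (bar_structure A T \<gamma> G) = arr (unit_mod A) (bar_mod A T (unit_mod A)) conj_scalar"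
  by (simp_all add: bar_structure_def arr_def)

context twisted
begin

lemma Ups_arr:
  assumes "lm X" "lm Y" "G \<in> carrier (H \<otimes>\<^sub>v H)"
  shows "Ups (bar_structure A T \<gamma> G) X Y = arr (bar_mod A T (tensor_mod A X Y))
      (tensor_mod A (bar_mod A T Y) (bar_mod A T X)) (ups G X Y)"
  unfolding bar_structure_def arr_def Let_def barstr.select_convs
  by (simp add: to_vs, rule restrict_ext) (simp add: ups_lift assms)

lemma tm_conj_ru:
  assumes "lm X" "y \<in> carrier X"
  shows "tm \<I>\<^sub>1 X conj_scalar (\<lambda>x. x) (pure (vs \<I>\<^sub>1) (cj (vs X)) (Scalar 1) y) = ru X y"
    and "tm X \<I>\<^sub>1 (\<lambda>x. x) conj_scalar (pure (cj (vs X)) (vs \<I>\<^sub>1) y (Scalar 1)) = lu X y"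
  using assms hm_linear[OF star_hm] tmap_pure[of "vs \<I>\<^sub>1" "cj (vs \<I>\<^sub>1)" conj_scalar "cj (vs X)" "cj (vs X)" "\<lambda>x. x" "Scalar 1" y]
    tmap_pure[of "cj (vs X)" "cj (vs X)" "\<lambda>x. x" "vs \<I>\<^sub>1" "cj (vs \<I>\<^sub>1)" conj_scalar y "Scalar 1"]
  by (simp_all add: linear_id)

lemma tm_conj_ru':
  assumes "lm X" "y \<in> carrier X"
  shows "tensor_map (vs \<I>\<^sub>1) (cj (vs X)) conj_scalar (\<lambda>x. x) (ru X y) = pure (vs \<I>\<^sub>1) (cj (vs X)) (Scalar 1) y"
    and "tensor_map (cj (vs X)) (vs \<I>\<^sub>1) (\<lambda>x. x) conj_scalar (lu X y) = pure (cj (vs X)) (vs \<I>\<^sub>1) y (Scalar 1)"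
  using assms hm_linear[OF star_hm] tmap_pure[of "cj (vs \<I>\<^sub>1)" "vs \<I>\<^sub>1" conj_scalar "cj (vs X)" "cj (vs X)" "\<lambda>x. x" "Scalar 1" y]
    tmap_pure[of "cj (vs X)" "cj (vs X)" "\<lambda>x. x" "cj (vs \<I>\<^sub>1)" "vs \<I>\<^sub>1" conj_scalar y "Scalar 1"]
  by (simp_all add: linear_id linear_cj_left)

text \<open>The bar of the unit module is isomorphic to the unit through conjugation of scalars,
  which fixes 1. Naturality of \<open>un\<close> along that isomorphism carries the unit case
  over.\<close>

lemma un_bC:
  assumes X: "lm X" and y: "y \<in> carrier X"
  shows "un (bC \<I>\<^sub>1) (bC X) (ru X y) = ru X y" "un (bC X) (bC \<I>\<^sub>1) (lu X y) = lu X y"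
proof -
  note [simp del] = unit_mod_simps
  note [simp] = unit_mod_simps(1)
  have "un (bC \<I>\<^sub>1) (bC X) (tensor_map (vs (bC \<I>\<^sub>1)) (vs (bC X)) conj_scalar (\<lambda>x. x) (ru (bC X) y))
    = tensor_map (vs (bC \<I>\<^sub>1)) (vs (bC X)) conj_scalar (\<lambda>x. x) (un \<I>\<^sub>1 (bC X) (ru (bC X) y))"
    using X y by (intro a2_nat star_hm hm_id) simp_all
  also have "un \<I>\<^sub>1 (bC X) (ru (bC X) y) = ru (bC X) y" using X y by (intro un_ru) simp_all
  finally show "un (bC \<I>\<^sub>1) (bC X) (ru X y) = ru X y" using X y by (simp add: tm_conj_ru)
  have "un (bC X) (bC \<I>\<^sub>1) (tensor_map (vs (bC X)) (vs (bC \<I>\<^sub>1)) (\<lambda>x. x) conj_scalar (lu (bC X) y))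
    = tensor_map (vs (bC X)) (vs (bC \<I>\<^sub>1)) (\<lambda>x. x) conj_scalar (un (bC X) \<I>\<^sub>1 (lu (bC X) y))"
    using X y by (intro a2_nat star_hm hm_id) simp_all
  also have "un (bC X) \<I>\<^sub>1 (lu (bC X) y) = lu (bC X) y" using X y by (intro un_lu) simp_all
  finally show "un (bC X) (bC \<I>\<^sub>1) (lu X y) = lu X y" using X y by (simp add: tm_conj_ru)
qed

end

context bar_twisted
begin

text \<open>\<open>tw\<close> and \<open>un\<close> are trivial on unit vectors, and \<psi> cancels
  \<phi> on \<open>X\<close>. On the unit module \<psi> acts by its counit, and \<epsilon>(\<phi>) =
  1 removes this scalar.\<close>

lemma ups_lu:
  assumes X: "lm X" and x: "x \<in> carrier X"
  shows "ups G X \<I>\<^sub>1 (lu X x) = ru X x"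
proof -
  note [simp del] = unit_mod_simps
  note [simp] = unit_mod_simps(1)
  have "act (tC X \<I>\<^sub>1) \<phi> (lu X x) = lu X (act X \<phi> x)"
    using hm_act[OF hm_lu_C[OF X], of \<phi> x] x by simp
  then have "ups G X \<I>\<^sub>1 (lu X x) = tm \<I>\<^sub>1 X (act \<I>\<^sub>1 \<psi>) (act X \<psi>) (ru X (act X \<phi> x))"
    using X x by (simp add: ups_eq tw_lu un_bC)
  then show ?thesis
    using X x by (simp add: tmap_pure[OF act_linear act_linear])
qed

lemma ups_ru:
  assumes X: "lm X" and x: "x \<in> carrier X"
  shows "ups G \<I>\<^sub>1 X (ru X x) = lu X x"
proof -
  note [simp del] = unit_mod_simps
  note [simp] = unit_mod_simps(1)
  have "act (tC \<I>\<^sub>1 X) \<phi> (ru X x) = ru X (act X \<phi> x)"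
    using hm_act[OF hm_ru_C[OF X], of \<phi> x] x by simp
  then have "ups G \<I>\<^sub>1 X (ru X x) = tm X \<I>\<^sub>1 (act X \<psi>) (act \<I>\<^sub>1 \<psi>) (lu X (act X \<phi> x))"
    using X x by (simp add: ups_eq tw_ru un_bC)
  then show ?thesis
    using X x by (simp add: tmap_pure[OF act_linear act_linear])
qed

abbreviation E :: "('a hmod, 'a harr) barstr" where "E \<equiv> bar_structure (twist H F) T \<gamma> G"

lemma E_simps [simp]:
  "barO E = bD" "barM E (arr X Y f) = arr (bD X) (bD Y) f" "bbM E X = arr X (bD (bD X)) (act X \<gamma>)"
  "starM E = arr \<I>\<^sub>1 (bD \<I>\<^sub>1) conj_scalar"
  "\<lbrakk>lm X; lm Y\<rbrakk> \<Longrightarrow> Ups E X Y = arr (bD (tD X Y)) (tD (bD Y) (bD X)) (ups G X Y)"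
  by (simp_all add: bar_structure_simps unit_mod_twist Ups_arr)

lemma hm_bD: "hm X Y u \<Longrightarrow> hm (bD X) (bD Y) u"
  by (rule hm_bar[OF _ _ T_hom]) simp_all

lemma hm_star: "hm \<I>\<^sub>1 (bD \<I>\<^sub>1) conj_scalar" "hm (bD \<I>\<^sub>1) \<I>\<^sub>1 conj_scalar"
  by (auto simp: equivariant_def counit_T intro!: linear_mapI)

lemma inv_star [simp]: "inv_mor M \<I>\<^sub>1 (bD \<I>\<^sub>1) (starM E) = arr (bD \<I>\<^sub>1) \<I>\<^sub>1 conj_scalar"
  unfolding E_simps by (rule inv_arr[OF _ _ hm_star]) auto

lemma hm_bb_inverse: "lm X \<Longrightarrow> hm (bD (bD X)) X (act X (sS \<phi> \<otimes> \<phi>))"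
  by (rule hm_inverse[OF hm_bb]) (simp_all add: act_act \<gamma>_inverse)

lemma hm_upsi: "\<lbrakk>lm X; lm Y\<rbrakk> \<Longrightarrow> hm (tD (bD Y) (bD X)) (bD (tD X Y)) (upsi X Y)"
  by (rule hm_inverse[OF hm_ups]) (simp_all add: ups_upsi upsi_ups)

lemma strong_bar: "strong_bar_category M E"
proof -
  interpret monoidal_category M by (rule monoidal)
  note [simp del] = unit_mod_simps
  note [simp] = hm_id arr_hom hm_lu hm_ru hm_asc hm_tm hm_bD hm_star hm_bb hm_ups
  show ?thesis
  proof unfold_locales
    fix X assume "X \<in> Ob M"
    then have X: "lm X" by simp
    show "barO E X \<in> Ob M" using X by simp
    show "barM E (Idm M X) = Idm M (barO E X)" by simp
    show "iso_mor M X (barO E (barO E X)) (bbM E X)"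
      unfolding E_simps by (rule iso_arr[OF _ _ hm_bb hm_bb_inverse]) (use X in \<open>simp_all add: act_act \<gamma>_inverse\<close>)
    show "Comp M (TensM M (inv_mor M (Unit M) (barO E (Unit M)) (starM E)) (Idm M (barO E X)))
        (Comp M (Ups E X (Unit M)) (barM E (Lun M X))) = Run M (barO E X)"
      unfolding Unit_M E_simps(1) inv_star
    proof -
      have h: "hm (bD X) (tD (bD \<I>\<^sub>1) (bD X)) (\<lambda>x. ups G X \<I>\<^sub>1 (lu X x))"
        using hm_comp[OF hm_bD[OF hm_lu[OF X]] hm_ups[OF X lm_unit]] by simp
      show "Comp M (TensM M (arr (bD \<I>\<^sub>1) \<I>\<^sub>1 conj_scalar) (Idm M (bD X)))
        (Comp M (Ups E X \<I>\<^sub>1) (barM E (Lun M X))) = Run M (bD X)"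
        using X h by (auto intro!: arr_cong simp: ups_lu tm_conj_ru')
    qed
    show "Comp M (TensM M (Idm M (barO E X)) (inv_mor M (Unit M) (barO E (Unit M)) (starM E)))
        (Comp M (Ups E (Unit M) X) (barM E (Run M X))) = Lun M (barO E X)"
      unfolding Unit_M E_simps(1) inv_star
    proof -
      have h: "hm (bD X) (tD (bD X) (bD \<I>\<^sub>1)) (\<lambda>x. ups G \<I>\<^sub>1 X (ru X x))"
        using hm_comp[OF hm_bD[OF hm_ru[OF X]] hm_ups[OF lm_unit X]] by simp
      show "Comp M (TensM M (Idm M (bD X)) (arr (bD \<I>\<^sub>1) \<I>\<^sub>1 conj_scalar))
        (Comp M (Ups E \<I>\<^sub>1 X) (barM E (Run M X))) = Lun M (bD X)"
        using X h by (auto intro!: arr_cong simp: ups_ru tm_conj_ru')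
    qed
    show "barM E (bbM E X) = bbM E (barO E X)"
      using X by (auto intro!: arr_cong simp: T_\<gamma>)
    fix Y assume "Y \<in> Ob M"
    then have Y: "lm Y" by simp
    show "barM E f \<in> Hom M (barO E X) (barO E Y)" if "f \<in> Hom M X Y" for f
      using that X Y by (auto elim!: HomE)
    show "Comp M (bbM E Y) f = Comp M (barM E (barM E f)) (bbM E X)" if "f \<in> Hom M X Y" for f
      using that X Y by (auto elim!: HomE intro!: arr_cong simp: hm_act)
    show "iso_mor M (barO E (TensO M X Y)) (TensO M (barO E Y) (barO E X)) (Ups E X Y)"
      unfolding E_simps(1) TensO_M E_simps(5)[OF X Y]
      by (rule iso_arr[OF _ _ hm_ups hm_upsi]) (use X Y in \<open>simp_all add: ups_upsi upsi_ups\<close>)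
    show "Comp M (Ups E (barO E Y) (barO E X)) (Comp M (barM E (Ups E X Y)) (bbM E (TensO M X Y)))
      = TensM M (bbM E X) (bbM E Y)"
    proof -
      have "hm (tD X Y) (bD (tD (bD Y) (bD X))) (\<lambda>t. ups G X Y (act (tD X Y) \<gamma> t))"
        using X Y by (intro hm_comp[OF hm_bb hm_bD[OF hm_ups]]) simp_all
      then show ?thesis
        using X Y strong_D[OF X Y] by (auto intro!: arr_cong simp del: act_tD)
    qed
    fix Z assume "Z \<in> Ob M"
    then have Z: "lm Z" by simp
    show "barM E (Comp M g f) = Comp M (barM E g) (barM E f)" if "f \<in> Hom M X Y" "g \<in> Hom M Y Z" for f g
      using that X Y Z by (auto elim!: HomE)
    show "Comp M (Assoc M (barO E Z) (barO E Y) (barO E X)) (Comp M (TensM M (Ups E Y Z) (Idm M (barO E X)))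
        (Comp M (Ups E X (TensO M Y Z)) (barM E (Assoc M X Y Z))))
      = Comp M (TensM M (Idm M (barO E Z)) (Ups E X Y)) (Ups E (TensO M X Y) Z)"
    proof -
      have 1: "hm (bD (tD (tD X Y) Z)) (tD (bD (tD Y Z)) (bD X)) (\<lambda>t. ups G X (tD Y Z) (asc X Y Z t))"
        using X Y Z by (intro hm_comp[OF hm_bD[OF hm_asc] hm_ups]) simp_all
      have 2: "hm (bD (tD (tD X Y) Z)) (tD (tD (bD Z) (bD Y)) (bD X))
          (\<lambda>t. tm (tD (bD Z) (bD Y)) (bD X) (ups G Y Z) (\<lambda>x. x) (ups G X (tD Y Z) (asc X Y Z t)))"
        using X Y Z by (intro hm_comp[OF 1] hm_tm) simp_all
      show ?thesis
        using X Y Z 1 2 bar_assoc_D[OF X Y Z] by (auto intro!: arr_cong)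
    qed
  next
    fix X X' Y Y' f g
    assume "X \<in> Ob M" "X' \<in> Ob M" "Y \<in> Ob M" "Y' \<in> Ob M"
    then have X: "lm X" "lm X'" "lm Y" "lm Y'" by simp_all
    assume f: "f \<in> Hom M X X'" and g: "g \<in> Hom M Y Y'"
    obtain f' where f': "f = arr X X' f'" "hm X X' f'" using f by (rule HomE)
    obtain g' where g': "g = arr Y Y' g'" "hm Y Y' g'" using g by (rule HomE)
    show "Comp M (Ups E X' Y') (barM E (TensM M f g)) = Comp M (TensM M (barM E g) (barM E f)) (Ups E X Y)"
      using X f' g' by (auto intro!: arr_cong simp: ups_nat)
  next
    show "iso_mor M (Unit M) (barO E (Unit M)) (starM E)"
      unfolding Unit_M E_simps by (rule iso_arr[OF _ _ hm_star]) (auto simp: unit_mod_simps(1))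
    show "Comp M (barM E (starM E)) (starM E) = bbM E (Unit M)"
      by (auto intro!: arr_cong simp: unit_mod_simps(1) counit_\<gamma>)
  qed
qed

end

section \<open>The twisting functor\<close>

context star_hopf_algebra
begin

lemma coprod_unit_inverse: "inv\<^bsub>H \<otimes>\<^sub>v H\<^esub> \<one>\<^bsub>H \<otimes>\<^sub>v H\<^esub> = \<one>\<^bsub>H \<otimes>\<^sub>v H\<^esub>"
  using monoid.inv_one[OF ring.axioms(2)[OF HH.T.algebra_ring]] .

lemma twisted_one: "twisted H \<one>\<^bsub>H \<otimes>\<^sub>v H\<^esub>"
proof
  have m: "monoid (H \<otimes>\<^sub>v H)" by (rule ring.axioms(2)[OF HH.T.algebra_ring])
  have o: "\<one> \<in> carrier H" by (rule monoid.one_closed[OF ring.axioms(2)[OF algebra_ring]])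
  show "\<one>\<^bsub>H \<otimes>\<^sub>v H\<^esub> \<in> Units (H \<otimes>\<^sub>v H)" by (rule monoid.Units_one_closed[OF m])
  have "blin H H H (\<lambda>x y. counit H x \<odot> y)" "blin H H H (\<lambda>x y. counit H y \<odot> x)"
    by (intro blinI linear_counit linear_scale linear_id; simp)+
  then show "tensor_lift H (\<lambda>x y. counit H x \<odot> y) \<one>\<^bsub>H \<otimes>\<^sub>v H\<^esub> = \<one>"
    "tensor_lift H (\<lambda>x y. counit H y \<odot> x) \<one>\<^bsub>H \<otimes>\<^sub>v H\<^esub> = \<one>"
    using o by (simp_all add: HH.tensor_one counit_one)
qed

lemma bar_twisted_one: "bar_twisted H \<one>\<^bsub>H \<otimes>\<^sub>v H\<^esub> \<one>"
  using twisted_one monoid.Units_one_closed[OF ring.axioms(2)[OF algebra_ring]]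
  by (simp add: bar_twisted_def bar_twisted_axioms_def counit_one)

lemma tensor_mod_one: "tensor_mod (twist H \<one>\<^bsub>H \<otimes>\<^sub>v H\<^esub>) = tensor_mod (hopf_quasi H)"
proof -
  interpret twisted H "\<one>\<^bsub>H \<otimes>\<^sub>v H\<^esub>" by (rule twisted_one)
  show ?thesis by (simp add: fun_eq_iff tensor_mod_def coprod_unit_inverse cong: restrict_cong)
qed

lemma twist_assoc_one: "twist_assoc H \<one>\<^bsub>H \<otimes>\<^sub>v H\<^esub> = \<one>\<^bsub>H \<otimes>\<^sub>v H \<otimes>\<^sub>v H\<^esub>"
proof -
  interpret HHH: algebra_pair H "H \<otimes>\<^sub>v H"
    by (simp add: algebra_pair_def complex_algebra_axioms HH.T.complex_algebra_axioms)
  have m: "monoid (H \<otimes>\<^sub>v H \<otimes>\<^sub>v H)" by (rule ring.axioms(2)[OF HHH.T.algebra_ring])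
  have o: "\<one> \<in> carrier H" by (rule monoid.one_closed[OF ring.axioms(2)[OF algebra_ring]])
  have oo: "\<one>\<^bsub>H \<otimes>\<^sub>v H\<^esub> \<in> carrier (H \<otimes>\<^sub>v H)" using o by (simp add: HH.tensor_one)
  have 1: "tensor_map H (H \<otimes>\<^sub>v H) (\<lambda>x. x) \<Delta> \<one>\<^bsub>H \<otimes>\<^sub>v H\<^esub> = \<one>\<^bsub>H \<otimes>\<^sub>v H \<otimes>\<^sub>v H\<^esub>"
    using o tmap_pure[OF linear_id coprod_linear, of H \<one> \<one>] by (simp add: HH.tensor_one HHH.tensor_one coprod_one)
  have 2: "tensor_map (H \<otimes>\<^sub>v H) H \<Delta> (\<lambda>x. x) \<one>\<^bsub>H \<otimes>\<^sub>v H\<^esub> = pure (H \<otimes>\<^sub>v H) H \<one>\<^bsub>H \<otimes>\<^sub>v H\<^esub> \<one>"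
    using o tmap_pure[OF coprod_linear linear_id, of H \<one> \<one>] by (simp add: HH.tensor_one coprod_one)
  have 3: "tensor_assoc H H H (pure (H \<otimes>\<^sub>v H) H \<one>\<^bsub>H \<otimes>\<^sub>v H\<^esub> \<one>) = \<one>\<^bsub>H \<otimes>\<^sub>v H \<otimes>\<^sub>v H\<^esub>"
    using o by (simp add: HH.tensor_one HHH.tensor_one)
  show ?thesis
    unfolding twist_assoc_def coprod_unit_inverse 1 2 3
    using monoid.l_one[OF m monoid.one_closed[OF m]] by (simp add: HHH.tensor_one)
qed

lemma module_category_one: "module_category (twist H \<one>\<^bsub>H \<otimes>\<^sub>v H\<^esub>) = module_category (hopf_quasi H)"
  by (simp add: module_category_def tensor_mod_one twist_assoc_one unit_mod_def)

lemma hopf_bar_structure_eq: "hopf_bar_structure H = bar_structure (hopf_quasi H) sS \<one> \<one>\<^bsub>H \<otimes>\<^sub>v H\<^esub>"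
proof -
  have "bar_mod (hopf_quasi H) (\<lambda>h. inv_into (carrier H) S (star H h)) = bar_mod (hopf_quasi H) sS"
    by (rule bar_mod_cong) (simp_all add: inv_antipode_star)
  then show ?thesis by (simp add: hopf_bar_structure_def bar_structure_def)
qed

text \<open>The modules over \<open>H\<close> are the case \<open>F = 1\<close>, \<open>\<phi> = 1\<close> of the twisted ones.\<close>

lemma strong_bar_hopf: "strong_bar_category (module_category (hopf_quasi H)) (hopf_bar_structure H)"
proof -
  interpret C: bar_twisted H "\<one>\<^bsub>H \<otimes>\<^sub>v H\<^esub>" \<one> by (rule bar_twisted_one)
  have i: "C.\<psi> = \<one>" by (simp add: C.\<psi>_def monoid.inv_one[OF C.monoid_H])
  have "C.T h = sS h" if "h \<in> carrier H" for h using that by (simp add: C.T_def i)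
  then have "bar_mod (twist H \<one>\<^bsub>H \<otimes>\<^sub>v H\<^esub>) C.T = bar_mod (hopf_quasi H) sS"
    by (intro bar_mod_cong) simp_all
  moreover have "C.\<gamma> = \<one>" by (simp add: C.\<gamma>_def i)
  moreover have "C.G = \<one>\<^bsub>H \<otimes>\<^sub>v H\<^esub>"
    using tmap_pure[OF sS_linear sS_linear, of \<one> \<one>]
    unfolding C.G_def i C.Fi_def coprod_unit_inverse coprod_one by (simp add: HH.tensor_one)
  ultimately have "bar_structure (twist H \<one>\<^bsub>H \<otimes>\<^sub>v H\<^esub>) C.T C.\<gamma> C.G = hopf_bar_structure H"
    by (simp add: hopf_bar_structure_eq bar_structure_def tensor_mod_one unit_mod_def)
  then show ?thesis using C.strong_bar by (simp add: module_category_one)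
qed

end

context twisted
begin

abbreviation M0 :: "('a hmod, 'a harr) moncat" where "M0 \<equiv> module_category (hopf_quasi H)"
abbreviation B :: "('a hmod, 'a harr) barstr" where "B \<equiv> hopf_bar_structure H"

lemma M0_simps [simp]:
  "Ob M0 = Ob M" "Hom M0 = Hom M" "Idm M0 = Idm M" "Comp M0 = Comp M" "TensO M0 = tC" "Unit M0 = \<I>\<^sub>1"
  "Lun M0 X = arr X (tC X \<I>\<^sub>1) (lu X)" "Run M0 X = arr X (tC \<I>\<^sub>1 X) (ru X)"
  by (simp_all add: module_category_def arr_def to_vs)

lemma TensM_M0 [simp]:
  assumes "lm X" "lm Y"
  shows "TensM M0 (arr X X' u) (arr Y Y' v) = arr (tC X Y) (tC X' Y') (tm X' Y' u v)"
  by (simp add: module_category_def arr_def to_vs)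
    (intro restrict_ext tmap_cong[of "vs X" "vs Y"]; simp add: assms)

lemma Assoc_M0 [simp]:
  assumes X: "lm X" "lm Y" "lm Z"
  shows "Assoc M0 X Y Z = arr (tC (tC X Y) Z) (tC X (tC Y Z)) (as X Y Z)"
proof -
  have "alg_rep (H \<otimes>\<^sub>v H \<otimes>\<^sub>v H) (vs X \<otimes>\<^sub>v vs Y \<otimes>\<^sub>v vs Z) (a3 X Y Z)"
    by (intro alg_rep_tact complex_algebra_axioms HH.T.complex_algebra_axioms lm_rep a2_rep X)
  from alg_rep_one[OF this] show ?thesis
    using X by (simp add: module_category_def arr_def to_vs a2_def) (rule restrict_ext, simp)
qed

lemma B_simps [simp]:
  "barO B = bC" "barM B (arr X Y f) = arr (bC X) (bC Y) f" "bbM B X = arr X (bC (bC X)) (act X \<one>)"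
  "starM B = arr \<I>\<^sub>1 (bC \<I>\<^sub>1) conj_scalar"
  "\<lbrakk>lm X; lm Y\<rbrakk> \<Longrightarrow> Ups B X Y = arr (bC (tC X Y)) (tC (bC Y) (bC X)) (sw X Y)"
proof -
  show "barO B = bC" "barM B (arr X Y f) = arr (bC X) (bC Y) f" "bbM B X = arr X (bC (bC X)) (act X \<one>)"
    "starM B = arr \<I>\<^sub>1 (bC \<I>\<^sub>1) conj_scalar"
    by (simp_all add: hopf_bar_structure_eq bar_structure_simps)
  assume X: "lm X" "lm Y"
  show "Ups B X Y = arr (bC (tC X Y)) (tC (bC Y) (bC X)) (sw X Y)"
    unfolding hopf_bar_structure_eq Ups_arr[OF X HH_simps(2)]
    using X by (intro arr_cong) (simp add: ups_def alg_rep_one[OF a2_rep])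
qed

lemma twist_iso_arr: "twist_iso H F X Y = arr (tD X Y) (tC X Y) (tw X Y)"
  by (simp add: twist_iso_def arr_def to_vs a2_def Fi_def)

lemma twist_fb_arr: "twist_fb H (bar_structure A T \<gamma> G) \<phi> X = arr (bar_mod A T X) (bC X) (act X \<phi>)"
  by (simp add: twist_fb_def arr_def bar_structure_simps)

lemma inv_twist_iso: "\<lbrakk>lm X; lm Y\<rbrakk> \<Longrightarrow> inv_mor M (tD X Y) (tC X Y) (twist_iso H F X Y) = arr (tC X Y) (tD X Y) (un X Y)"
  unfolding twist_iso_arr by (rule inv_arr[OF _ _ hm_tw hm_un]) simp_all

lemma monoidal_M0: "monoidal_category M0"
  using strong_bar_hopf by (simp add: strong_bar_category_def bar_category_def)

lemma twisting_functor: "monoidal_functor M0 M (\<lambda>X. X) (\<lambda>u. u) (twist_iso H F)"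
proof -
  interpret C: monoidal_category M0 by (rule monoidal_M0)
  interpret D: monoidal_category M by (rule monoidal)
  note [simp del] = unit_mod_simps
  note [simp] = hm_id arr_hom hm_tw hm_un hm_lu hm_ru hm_asc hm_tm twist_iso_arr
  show ?thesis
  proof unfold_locales
    fix X assume "X \<in> Ob M0"
    then have X: "lm X" by simp
    show "X \<in> Ob M" "Idm M0 X = Idm M X" using X by simp_all
    show "Lun M0 X = Comp M (twist_iso H F X (Unit M0)) (Lun M X)"
      using X by (auto intro!: arr_cong simp: tw_lu)
    show "Run M0 X = Comp M (twist_iso H F (Unit M0) X) (Run M X)"
      using X by (auto intro!: arr_cong simp: tw_ru)
    fix Y assume "Y \<in> Ob M0"
    then have Y: "lm Y" by simp
    show "u \<in> Hom M X Y" if "u \<in> Hom M0 X Y" for u using that by simp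
    show "iso_mor M (TensO M X Y) (TensO M0 X Y) (twist_iso H F X Y)"
      unfolding TensO_M M0_simps twist_iso_arr by (rule iso_arr[OF _ _ hm_tw hm_un]) (use X Y in simp_all)
    fix Z assume "Z \<in> Ob M0"
    then have Z: "lm Z" by simp
    show "Comp M0 v u = Comp M v u" if "u \<in> Hom M0 X Y" "v \<in> Hom M0 Y Z" for u v by simp
    show "Comp M (Assoc M0 X Y Z) (Comp M (twist_iso H F (TensO M0 X Y) Z) (TensM M (twist_iso H F X Y) (Idm M Z)))
      = Comp M (twist_iso H F X (TensO M0 Y Z)) (Comp M (TensM M (Idm M X) (twist_iso H F Y Z)) (Assoc M X Y Z))"
    proof -
      have 1: "hm (tD (tD X Y) Z) (tD (tC X Y) Z) (tm (tC X Y) Z (tw X Y) (\<lambda>x. x))"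
        and 2: "hm (tD (tD X Y) Z) (tD X (tC Y Z)) (\<lambda>t. tm X (tC Y Z) (\<lambda>x. x) (tw Y Z) (asc X Y Z t))"
        using X Y Z by (intro hm_tm hm_comp[OF hm_asc]; simp)+
      have 3: "hm (tD (tD X Y) Z) (tC (tC X Y) Z) (\<lambda>t. tw (tC X Y) Z (tm (tC X Y) Z (tw X Y) (\<lambda>x. x) t))"
        by (rule hm_comp[OF 1 hm_tw]) (use X Y Z in simp_all)
      \<comment> \<open>Coherence of the monoidal structure is \<open>R3_asc\<close> with
        \<open>R3\<close> and \<open>L3\<close> written out.\<close>
      show ?thesis
        using X Y Z 1 2 3 R3_asc[OF X Y Z] by (auto intro!: arr_cong simp: R3_def L3_def)
    qed
  next
    fix X X' Y Y' u v
    assume "X \<in> Ob M0" "X' \<in> Ob M0" "Y \<in> Ob M0" "Y' \<in> Ob M0"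
    then have X: "lm X" "lm X'" "lm Y" "lm Y'" by simp_all
    assume f: "u \<in> Hom M0 X X'" and g: "v \<in> Hom M0 Y Y'"
    obtain f' where f': "u = arr X X' f'" "hm X X' f'" using f unfolding M0_simps by (rule HomE)
    obtain g' where g': "v = arr Y Y' g'" "hm Y Y' g'" using g unfolding M0_simps by (rule HomE)
    show "Comp M (twist_iso H F X' Y') (TensM M u v) = Comp M (TensM M0 u v) (twist_iso H F X Y)"
      using X f' g' by (auto intro!: arr_cong simp: a2_nat)
  next
    show "Unit M0 = Unit M" by simp
  qed
qed

end

context bar_twisted
begin

text \<open>A bar functor asks for equal objects here, not for an isomorphism. Both conjugates of
  the unit carry the action by the conjugate of the counit, since the counit does not see the
  conjugation by \<phi> in \<open>T\<close>.\<close>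

lemma bar_unit: "bC \<I>\<^sub>1 = bD \<I>\<^sub>1"
  unfolding bar_mod_def
  by (auto simp: fun_eq_iff counit_T counit_sS intro!: arg_cong2[of _ _ _ _ "\<lambda>f x. act_update f (smult_update x \<I>\<^sub>1)"] restrict_ext)

lemma twisting_bar_functor: "bar_functor M0 B M E (\<lambda>X. X) (\<lambda>u. u) (twist_iso H F) (twist_fb H E \<phi>)"
proof -
  interpret C: strong_bar_category M0 B by (rule strong_bar_hopf)
  interpret D: strong_bar_category M E by (rule strong_bar)
  interpret monoidal_functor M0 M "\<lambda>X. X" "\<lambda>u. u" "twist_iso H F" by (rule twisting_functor)
  note [simp del] = unit_mod_simps
  note [simp] = hm_id arr_hom hm_tw hm_un hm_lu hm_ru hm_asc hm_tm hm_fb hm_bD hm_ups hm_sw hm_bb twist_fb_arr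
  show ?thesis
  proof unfold_locales
    fix Y assume "Y \<in> Ob M0"
    then have Y: "lm Y" by simp
    show "iso_mor M (barO E Y) (barO B Y) (twist_fb H E \<phi> Y)"
      unfolding E_simps(1) B_simps(1) twist_fb_arr
      by (rule iso_arr[OF _ _ hm_fb hm_fbi]) (use Y in simp_all)
    show "bbM B Y = Comp M (twist_fb H E \<phi> (barO B Y)) (Comp M (barM E (twist_fb H E \<phi> Y)) (bbM E Y))"
    proof -
      have "hm Y (bD (bC Y)) (\<lambda>y. act Y \<phi> (act Y \<gamma> y))"
        using Y by (intro hm_comp[OF hm_bb hm_bD[OF hm_fb]]) simp_all
      then show ?thesis
        using Y by (auto intro!: arr_cong simp: act_act \<gamma>_inverse[unfolded alg_assoc] alg_assoc[symmetric] \<gamma>_inverse)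
    qed
  next
    fix X Y u assume "X \<in> Ob M0" "Y \<in> Ob M0" "u \<in> Hom M0 X Y"
    then have X: "lm X" "lm Y" and u: "u \<in> Hom M X Y" by simp_all
    obtain f where f: "u = arr X Y f" "hm X Y f" using u by (rule HomE)
    show "Comp M (twist_fb H E \<phi> Y) (barM E u) = Comp M (barM B u) (twist_fb H E \<phi> X)"
      using X f by (auto intro!: arr_cong simp: hm_act)
  next
    show "barO B (Unit M0) = barO E (Unit M0)" by (simp add: bar_unit)
    show "starM B = starM E" by (simp add: bar_unit)
  next
    fix X Y assume "X \<in> Ob M0" "Y \<in> Ob M0"
    then have X: "lm X" "lm Y" by simp_all
    have 1: "hm (bD (tC X Y)) (tD (bD Y) (bD X)) (\<lambda>t. ups G X Y (un X Y t))"
      using X by (intro hm_comp[OF hm_bD[OF hm_un] hm_ups]) simp_all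
    have 2: "hm (bD (tC X Y)) (tC (bC Y) (bC X)) (\<lambda>t. sw X Y (act (tC X Y) \<phi> t))"
      using X by (intro hm_comp[OF hm_fb hm_sw]) simp_all
    have 3: "tm Y X (act Y \<phi>) (act X \<phi>) (ups G X Y (un X Y t)) = un (bC Y) (bC X) (sw X Y (act (tC X Y) \<phi> t))"
      if "t \<in> carrier (vs X \<otimes>\<^sub>v vs Y)" for t
      using X that by (simp add: ups_eq)
        (rule tm_fb_fbi(1); use that a2_closed[of "bC Y" "bC X" F] in simp)
    show "Comp M (TensM M (twist_fb H E \<phi> Y) (twist_fb H E \<phi> X)) (Comp M (Ups E X Y)
        (barM E (inv_mor M (TensO M X Y) (TensO M0 X Y) (twist_iso H F X Y))))
      = Comp M (inv_mor M (TensO M (barO B Y) (barO B X)) (TensO M0 (barO B Y) (barO B X)) (twist_iso H F (barO B Y) (barO B X)))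
         (Comp M (Ups B X Y) (twist_fb H E \<phi> (TensO M0 X Y)))"
      using X 1 2 3 by (auto intro!: arr_cong simp: inv_twist_iso)
  qed
qed

lemma data: "twisted_bar_data H F \<phi> T \<gamma> G"
  using T_hom strong_bar twisting_bar_functor by (simp add: twisted_bar_data_def Let_def)

end

section \<open>Necessity of the conditions and uniqueness of the data\<close>

context star_hopf_algebra
begin

text \<open>Evaluating the axioms of a bar functor at \<open>1\<close> in the regular module determines all data.\<close>

definition regular :: "'a hmod" where
  "regular = \<lparr>carrier = carrier H, mult = mult H, one = one H, zero = zero H, add = add H,
    smult = smult H, act = mult H\<rparr>"

lemma regular_simps [simp]:
  "carrier regular = carrier H" "act regular = mult H"
  by (simp_all add: regular_def)

lemma tensor_eq_regular: "tensor_eq (vs regular) (vs regular) = tensor_eq H H"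
  by (intro ext iffI; erule tensor_eq_mono[rotated 7]; simp add: regular_def)

lemma pure_regular [simp]: "pure (vs regular) (vs regular) = pure H H"
  by (simp add: fun_eq_iff pure_def tensor_class_def tensor_eq_regular)

lemma vtensor_regular [simp]: "vs regular \<otimes>\<^sub>v vs regular = H \<otimes>\<^sub>v H"
  by (simp add: vtensor_def tensor_class_def tensor_eq_regular) (simp add: regular_def)

lemma tensor_regular [simp]:
  "tensor_map (vs regular) (vs regular) = tensor_map H H" "tensor_swap (vs regular) (vs regular) = tensor_swap H H"
  by (simp_all add: fun_eq_iff tensor_map_def tensor_swap_def)

lemma lm_regular [simp]: "lm regular"
proof -
  have l: "linear_map (vs regular) (vs regular) f \<longleftrightarrow> linear_map H H f"
    "linear_map H (vs regular) f \<longleftrightarrow> linear_map H H f" for f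
    by (simp_all add: linear_map_def) (simp_all add: regular_def)
  have "vsp (vs regular)" by (rule vsp_cong[OF algebra_vsp]) (simp_all add: regular_def)
  moreover have "blin H (vs regular) (vs regular) (\<otimes>)"
    using blin_mult by (simp add: blin_def l)
  moreover have "\<one> \<otimes> x = x" if "x \<in> carrier H" for x
    using monoid.l_one[OF ring.axioms(2)[OF algebra_ring] that] .
  ultimately show ?thesis
    by (simp add: left_module_iff alg_rep_def alg_assoc)
qed

lemma a2_regular:
  assumes t: "t \<in> carrier (H \<otimes>\<^sub>v H)" and s: "s \<in> carrier (H \<otimes>\<^sub>v H)"
  shows "a2 regular regular t s = t \<otimes>\<^bsub>H \<otimes>\<^sub>v H\<^esub> s"
proof (rule tensor_eqI2[OF _ _ _ _ _ HH.blin_tensor_mult t s])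
  show "blin (H \<otimes>\<^sub>v H) (H \<otimes>\<^sub>v H) (H \<otimes>\<^sub>v H) (a2 regular regular)"
    using a2_blin[of regular regular] by simp
  fix a b x y assume "a \<in> carrier H" "b \<in> carrier H" "x \<in> carrier H" "y \<in> carrier H"
  then show "a2 regular regular (pure H H a b) (pure H H x y) = pure H H a b \<otimes>\<^bsub>H \<otimes>\<^sub>v H\<^esub> pure H H x y"
    using a2_pure[of regular regular a b x y] by simp
qed simp_all

end

section \<open>Invertibility of \<phi>, its counit and the formulas, from given bar data\<close>

locale bar_data = twisted H F for H :: "'a star_hopf" (structure) and F +
  fixes \<phi> T \<gamma> G
  assumes \<phi> [simp]: "\<phi> \<in> carrier H" and data: "twisted_bar_data H F \<phi> T \<gamma> G"
begin

abbreviation "E \<equiv> bar_structure (twist H F) T \<gamma> G"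
abbreviation "bD \<equiv> bar_mod (twist H F) T"

lemma T_hom: "antilinear_algebra_hom H T" and \<gamma>_closed [simp]: "\<gamma> \<in> carrier H"
  and G_closed [simp]: "G \<in> carrier (H \<otimes>\<^sub>v H)"
  and bar: "bar_category M E" and bar_fun: "bar_functor M0 B M E (\<lambda>X. X) (\<lambda>u. u) (twist_iso H F) (twist_fb H E \<phi>)"
  using data by (simp_all add: twisted_bar_data_def Let_def strong_bar_category_def)

lemma T_closed [simp]: "h \<in> carrier H \<Longrightarrow> T h \<in> carrier H"
  using T_hom by (auto simp: antilinear_algebra_hom_def antilinear_map_def)

lemma lm_bD [simp]: "lm X \<Longrightarrow> lm (bD X)"
  by (rule lm_bar[OF _ _ T_hom]) simp_all

lemma hm_bD: "hm X Y u \<Longrightarrow> hm (bD X) (bD Y) u"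
  by (rule hm_bar[OF _ _ T_hom]) simp_all

lemma hm_of_iso: "\<lbrakk>lm X; iso_mor M X Y (arr X Y f)\<rbrakk> \<Longrightarrow> hm X Y f"
  by (simp add: iso_mor_def Hom_M)

lemma H_facts [simp]:
  "\<one> \<in> carrier H" "t \<in> carrier H \<Longrightarrow> \<one> \<otimes> t = t" "t \<in> carrier H \<Longrightarrow> t \<otimes> \<one> = t"
  "\<lbrakk>s \<in> carrier H; t \<in> carrier H\<rbrakk> \<Longrightarrow> s \<otimes> t \<in> carrier H"
proof -
  have m: "monoid H" by (rule ring.axioms(2)[OF algebra_ring])
  show "\<one> \<in> carrier H" "t \<in> carrier H \<Longrightarrow> \<one> \<otimes> t = t" "t \<in> carrier H \<Longrightarrow> t \<otimes> \<one> = t"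
    "\<lbrakk>s \<in> carrier H; t \<in> carrier H\<rbrakk> \<Longrightarrow> s \<otimes> t \<in> carrier H"
    by (fact monoid.one_closed[OF m] monoid.l_one[OF m] monoid.r_one[OF m] monoid.m_closed[OF m])+
qed

lemma fb_iso: "lm X \<Longrightarrow> iso_mor M (bD X) (bC X) (arr (bD X) (bC X) (act X \<phi>))"
  using bar_functor.fb_iso[OF bar_fun, of X] by (simp add: twist_fb_arr bar_structure_simps)

lemma hm_fb: "lm X \<Longrightarrow> hm (bD X) (bC X) (act X \<phi>)"
  using hm_of_iso[OF _ fb_iso] by simp

lemma hm_ups: "\<lbrakk>lm X; lm Y\<rbrakk> \<Longrightarrow> hm (bD (tD X Y)) (tD (bD Y) (bD X)) (ups G X Y)"
  using hm_of_iso[of "bD (tD X Y)" "tD (bD Y) (bD X)"] bar_category.ups_iso[OF bar, of X Y]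
  by (simp add: Ups_arr bar_structure_simps)

text \<open>The inverse of \<open>fb\<close> on the regular module sends \<open>\<one>\<close> to a
  right inverse of \<phi>. Left multiplication by \<phi> is injective, so the right inverse is a
  left inverse too.\<close>

lemma \<phi>_Units: "\<phi> \<in> Units H"
proof -
  obtain g where g: "g \<in> Hom M (bC regular) (bD regular)"
    "Comp M g (arr (bD regular) (bC regular) (act regular \<phi>)) = Idm M (bD regular)"
    "Comp M (arr (bD regular) (bC regular) (act regular \<phi>)) g = Idm M (bC regular)"
    using fb_iso[OF lm_regular] by (auto simp: iso_mor_def inverse_of_def)
  obtain k where k: "g = arr (bC regular) (bD regular) k" "hm (bC regular) (bD regular) k"
    using g(1) by (rule HomE)
  have kc: "k x \<in> carrier H" if "x \<in> carrier H" for x using hm_closed[OF k(2), of x] that by simp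
  have "arr (bD regular) (bD regular) (\<lambda>x. k (\<phi> \<otimes> x)) = arr (bD regular) (bD regular) (\<lambda>x. x)"
    using g(2) k hm_fb[OF lm_regular] by simp
  then have 1: "k (\<phi> \<otimes> x) = x" if "x \<in> carrier H" for x
    using arr_eqD[of "bD regular" "bD regular" "\<lambda>x. k (\<phi> \<otimes> x)" "\<lambda>x. x" x] that by simp
  have "arr (bC regular) (bC regular) (\<lambda>x. \<phi> \<otimes> k x) = arr (bC regular) (bC regular) (\<lambda>x. x)"
    using g(3) k by simp
  then have 2: "\<phi> \<otimes> k \<one> = \<one>"
    using arr_eqD[of "bC regular" "bC regular" "\<lambda>x. \<phi> \<otimes> k x" "\<lambda>x. x" \<one>] by simp
  have "\<phi> \<otimes> (k \<one> \<otimes> \<phi>) = \<phi> \<otimes> \<one>" using 2 kc[of \<one>] by (simp add: alg_assoc[symmetric])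
  then have "k \<one> \<otimes> \<phi> = \<one>" using 1[of "k \<one> \<otimes> \<phi>"] 1[of \<one>] kc[of \<one>] by simp
  then show ?thesis using 2 kc[of \<one>] by (auto simp: Units_def)
qed

abbreviation \<psi> where "\<psi> \<equiv> inv \<phi>"

lemma \<psi>_facts [simp]: "\<psi> \<in> carrier H" "\<phi> \<otimes> \<psi> = \<one>" "\<psi> \<otimes> \<phi> = \<one>"
  using monoid.Units_inv_closed[OF _ \<phi>_Units] monoid.Units_r_inv[OF _ \<phi>_Units] monoid.Units_l_inv[OF _ \<phi>_Units]
    ring.axioms(2)[OF algebra_ring] by auto

lemma \<psi>_cancel: "h \<in> carrier H \<Longrightarrow> \<psi> \<otimes> (\<phi> \<otimes> h) = h"
  by (simp add: alg_assoc[symmetric])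

lemma T_eq:
  assumes h: "h \<in> carrier H"
  shows "T h = \<psi> \<otimes> sS h \<otimes> \<phi>"
proof -
  have "\<phi> \<otimes> T h = sS h \<otimes> \<phi>"
    using hm_act[OF hm_fb[OF lm_regular], of h \<one>] h by simp
  then have "\<psi> \<otimes> (\<phi> \<otimes> T h) = \<psi> \<otimes> (sS h \<otimes> \<phi>)" by simp
  then show ?thesis using h by (simp add: \<psi>_cancel alg_assoc)
qed

lemma \<gamma>_eq: "\<gamma> = \<psi> \<otimes> sS \<psi>"
proof -
  have hb: "hm regular (bD (bD regular)) (act regular \<gamma>)"
    using hm_of_iso[of regular] bar_category.bb_iso[OF bar, of regular] by (simp add: bar_structure_simps)
  have h2: "hm regular (bD (bC regular)) (\<lambda>x. \<phi> \<otimes> (\<gamma> \<otimes> x))"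
    using hm_comp[OF hb hm_bD[OF hm_fb[OF lm_regular]]] by simp
  have "arr regular (bC (bC regular)) (act regular \<one>) = arr regular (bC (bC regular)) (\<lambda>x. act (bC regular) \<phi> (\<phi> \<otimes> (\<gamma> \<otimes> x)))"
    using bar_functor.F_bb[OF bar_fun, of regular] hb h2 by (simp add: twist_fb_arr bar_structure_simps)
  \<comment> \<open>The outer \<open>fb\<close> belongs to a conjugate module, where \<phi> acts as
    \<open>sS \<phi>\<close>.\<close>
  from arr_eqD[OF this, of \<one>] have "sS \<phi> \<otimes> (\<phi> \<otimes> \<gamma>) = \<one>" by simp
  then have "sS \<psi> \<otimes> (sS \<phi> \<otimes> (\<phi> \<otimes> \<gamma>)) = sS \<psi> \<otimes> \<one>" by simp
  moreover have "sS \<psi> \<otimes> (sS \<phi> \<otimes> (\<phi> \<otimes> \<gamma>)) = \<phi> \<otimes> \<gamma>"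
    by (simp add: alg_assoc[symmetric] sS_mult[symmetric])
  ultimately have "\<psi> \<otimes> (\<phi> \<otimes> \<gamma>) = \<psi> \<otimes> sS \<psi>" by simp
  then show ?thesis by (simp add: \<psi>_cancel)
qed

lemma fb_ups:
  assumes X: "lm X" "lm Y" and t: "t \<in> carrier (vs X \<otimes>\<^sub>v vs Y)"
  shows "tm Y X (act Y \<phi>) (act X \<phi>) (ups G X Y (un X Y t)) = un (bC Y) (bC X) (sw X Y (act (tC X Y) \<phi> t))"
proof -
  have 1: "hm (bD (tC X Y)) (tD (bD Y) (bD X)) (\<lambda>t. ups G X Y (un X Y t))"
    using X by (intro hm_comp[OF hm_bD[OF hm_un] hm_ups]) simp_all
  have 2: "hm (bD (tC X Y)) (tC (bC Y) (bC X)) (\<lambda>t. sw X Y (act (tC X Y) \<phi> t))"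
    using X by (intro hm_comp[OF hm_fb hm_sw]) simp_all
  have "arr (bD (tC X Y)) (tD (bC Y) (bC X)) (\<lambda>t. tm Y X (act Y \<phi>) (act X \<phi>) (ups G X Y (un X Y t)))
    = arr (bD (tC X Y)) (tD (bC Y) (bC X)) (\<lambda>t. un (bC Y) (bC X) (sw X Y (act (tC X Y) \<phi> t)))"
    using bar_functor.F_ups[OF bar_fun, of X Y] X 1 2 hm_fb[of "tC X Y"] hm_bD[OF hm_un[OF X]]
    by (simp add: twist_fb_arr bar_structure_simps inv_twist_iso Ups_arr del: act_tC)
  from arr_eqD[OF this, of t] show ?thesis using t by simp
qed

text \<open>Here \<Upsilon> is known only through the axioms. Since \<star> is conjugation of
  scalars and undoes itself, the unit axiom can be solved for the value of \<Upsilon> at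
  \<open>lu X x\<close>.\<close>

lemma ups_lu:
  assumes X: "lm X" and x: "x \<in> carrier X"
  shows "ups G X \<I>\<^sub>1 (lu X x) = ru X x"
proof -
  note [simp del] = unit_mod_simps
  note [simp] = unit_mod_simps(1)
  have st: "hm \<I>\<^sub>1 (bD \<I>\<^sub>1) conj_scalar"
    using hm_of_iso[of \<I>\<^sub>1] bar_category.star_iso[OF bar] by (simp add: bar_structure_simps unit_mod_twist)
  have sti: "hm (bD \<I>\<^sub>1) \<I>\<^sub>1 conj_scalar" by (rule hm_inverse[OF st]) auto
  have inv: "inv_mor M \<I>\<^sub>1 (bD \<I>\<^sub>1) (arr \<I>\<^sub>1 (bD \<I>\<^sub>1) conj_scalar) = arr (bD \<I>\<^sub>1) \<I>\<^sub>1 conj_scalar"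
    by (rule inv_arr[OF _ _ st sti]) auto
  have h: "hm (bD X) (tD (bD \<I>\<^sub>1) (bD X)) (\<lambda>x. ups G X \<I>\<^sub>1 (lu X x))"
    using hm_comp[OF hm_bD[OF hm_lu[OF X]] hm_ups[OF X lm_unit]] by simp
  have c: "ups G X \<I>\<^sub>1 (lu X x) \<in> carrier (vs \<I>\<^sub>1 \<otimes>\<^sub>v vs X)" using hm_closed[OF h, of x] x by simp
  have "arr (bD X) (tD \<I>\<^sub>1 (bD X)) (\<lambda>x. tensor_map (vs \<I>\<^sub>1) (cj (vs X)) conj_scalar (\<lambda>x. x) (ups G X \<I>\<^sub>1 (lu X x)))
    = arr (bD X) (tD \<I>\<^sub>1 (bD X)) (ru (bD X))"
    using bar_category.bar_lun[OF bar, of X] X h hm_bD[OF hm_lu[OF X]]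
    by (simp add: bar_structure_simps unit_mod_twist inv Ups_arr)
  from arr_eqD[OF this, of x] have
    1: "tensor_map (vs \<I>\<^sub>1) (cj (vs X)) conj_scalar (\<lambda>x. x) (ups G X \<I>\<^sub>1 (lu X x)) = pure (vs \<I>\<^sub>1) (cj (vs X)) (Scalar 1) x"
    using x by simp
  have l: "linear_map (cj (vs \<I>\<^sub>1)) (vs \<I>\<^sub>1) conj_scalar" "linear_map (vs \<I>\<^sub>1) (cj (vs \<I>\<^sub>1)) conj_scalar"
    using hm_linear[OF st] by (simp_all add: linear_cj_left)
  have "tensor_map (cj (vs \<I>\<^sub>1)) (cj (vs X)) conj_scalar (\<lambda>x. x)
      (tensor_map (vs \<I>\<^sub>1) (cj (vs X)) conj_scalar (\<lambda>x. x) (ups G X \<I>\<^sub>1 (lu X x))) = ups G X \<I>\<^sub>1 (lu X x)"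
    using c X by (intro tm_inverse[OF _ _ _ _ l(1) l(2) linear_id linear_id]) auto
  then show ?thesis unfolding 1 using tm_conj_ru(1)[OF X x] by simp
qed

text \<open>
  Comparing the compatibility of \<open>fb\<close> with \<open>\<Upsilon>\<close> on \<open>H \<otimes> 1\<close> with the unit axiom of the bar category gives
  \<open>\<epsilon>(\<phi>) \<phi> = \<phi>\<close>.
\<close>

lemma counit_\<phi>: "counit H \<phi> = 1"
proof -
  note [simp del] = unit_mod_simps
  note [simp] = unit_mod_simps(1)
  have "act (tC regular \<I>\<^sub>1) \<phi> (lu regular \<one>) = lu regular \<phi>"
    using hm_act[OF hm_lu_C[OF lm_regular], of \<phi> \<one>] by simp
  then have "tm \<I>\<^sub>1 regular (act \<I>\<^sub>1 \<phi>) (act regular \<phi>) (ru regular \<one>) = ru regular \<phi>"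
    using fb_ups[OF lm_regular lm_unit, of "lu regular \<one>"] by (simp add: un_lu ups_lu un_bC)
  moreover have "tm \<I>\<^sub>1 regular (act \<I>\<^sub>1 \<phi>) (act regular \<phi>) (ru regular \<one>)
    = pure (vs \<I>\<^sub>1) (vs regular) (Scalar (counit H \<phi>)) \<phi>"
    using tmap_pure[OF blin_right[OF lm_blin[OF lm_unit] \<phi>] blin_right[OF lm_blin[OF lm_regular] \<phi>], of "Scalar 1" \<one>]
    by simp
  moreover have "pure (vs \<I>\<^sub>1) (vs regular) (Scalar (counit H \<phi>)) \<phi> = ru regular (counit H \<phi> \<odot> \<phi>)"
  proof -
    have "counit H \<phi> \<odot>\<^bsub>vs \<I>\<^sub>1\<^esub> Scalar 1 = Scalar (counit H \<phi>)" by (simp add: unit_mod_simps)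
    moreover have "smult regular = smult H" by (simp add: regular_def)
    ultimately show ?thesis
      using linear_smult[OF blin_left[OF blin_pure[of "vs \<I>\<^sub>1" "vs regular"]], of \<phi> "Scalar 1" "counit H \<phi>"]
        linear_smult[OF blin_right[OF blin_pure[of "vs \<I>\<^sub>1" "vs regular"]], of "Scalar 1" \<phi> "counit H \<phi>"] by simp
  qed
  ultimately have eq: "ru regular (counit H \<phi> \<odot> \<phi>) = ru regular \<phi>" by simp
  obtain g where "\<And>t. t \<in> carrier (vs \<I>\<^sub>1 \<otimes>\<^sub>v vs regular) \<Longrightarrow> g t \<in> carrier regular"
    and g: "\<And>x. x \<in> carrier regular \<Longrightarrow> g (ru regular x) = x"
    and "\<And>t. t \<in> carrier (vs \<I>\<^sub>1 \<otimes>\<^sub>v vs regular) \<Longrightarrow> ru regular (g t) = t"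
  proof (rule ru_inverse[OF lm_regular])
    fix g assume "\<And>t. t \<in> carrier (vs \<I>\<^sub>1 \<otimes>\<^sub>v vs regular) \<Longrightarrow> g t \<in> carrier regular"
      "\<And>x. x \<in> carrier regular \<Longrightarrow> g (ru regular x) = x"
      "\<And>t. t \<in> carrier (vs \<I>\<^sub>1 \<otimes>\<^sub>v vs regular) \<Longrightarrow> ru regular (g t) = t"
    then show thesis by (rule that)
  qed
  have "counit H \<phi> \<odot> \<phi> = g (ru regular (counit H \<phi> \<odot> \<phi>))" by (rule g[symmetric]) simp
  also have "\<dots> = \<phi>" unfolding eq by (rule g) simp
  finally have e: "counit H \<phi> \<odot> \<phi> = \<phi>" .
  \<comment> \<open>Applying the counit to \<open>e\<close> shows that \<epsilon>(\<phi>) is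
    idempotent; it is nonzero because \<phi> is invertible.\<close>
  have "counit H \<phi> * counit H \<phi> = counit H (counit H \<phi> \<odot> \<phi>)" by (simp add: counit_smult)
  then have "counit H \<phi> * counit H \<phi> = counit H \<phi>" unfolding e .
  moreover have "counit H \<phi> * counit H \<psi> = 1" using counit_mult[of \<phi> \<psi>] by (simp add: counit_one)
  ultimately show ?thesis by (metis mult_cancel_left2 mult_zero_left zero_neq_one)
qed

text \<open>For two copies of the regular module, at the unit of
  \<open>H \<otimes>\<^sub>v H\<close>, compatibility with \<Upsilon> is an equation in the algebra
  \<open>H \<otimes>\<^sub>v H\<close>. After the flip, which is multiplicative, \<open>G\<close>
  stands between \<phi> \<otimes> \<phi> and \<open>F\<close>, and cancelling these leaves the
  formula.\<close>

lemma G_eq: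
  "G = pure H H \<psi> \<psi> \<otimes>\<^bsub>H \<otimes>\<^sub>v H\<^esub> tensor_map H H sS sS (tensor_swap H H F)
    \<otimes>\<^bsub>H \<otimes>\<^sub>v H\<^esub> \<Delta> \<phi> \<otimes>\<^bsub>H \<otimes>\<^sub>v H\<^esub> Fi"
proof -
  let ?T = "H \<otimes>\<^sub>v H"
  have "pure H H \<phi> \<phi> \<otimes>\<^bsub>?T\<^esub> tensor_swap H H (G \<otimes>\<^bsub>?T\<^esub> F)
    = tensor_map H H sS sS F \<otimes>\<^bsub>?T\<^esub> tensor_swap H H (\<Delta> \<phi>)"
    using fb_ups[OF lm_regular lm_regular, of "\<one>\<^bsub>?T\<^esub>"] a2_pure_left[of regular regular \<phi> \<phi>] a2_bC[of regular regular F]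
    by (simp add: ups_def a2_regular)
  then have "tensor_swap H H (pure H H \<phi> \<phi> \<otimes>\<^bsub>?T\<^esub> tensor_swap H H (G \<otimes>\<^bsub>?T\<^esub> F))
    = tensor_swap H H (tensor_map H H sS sS F \<otimes>\<^bsub>?T\<^esub> tensor_swap H H (\<Delta> \<phi>))" by (rule arg_cong)
  then have "pure H H \<phi> \<phi> \<otimes>\<^bsub>?T\<^esub> (G \<otimes>\<^bsub>?T\<^esub> F) = tensor_map H H sS sS (tensor_swap H H F) \<otimes>\<^bsub>?T\<^esub> \<Delta> \<phi>"
    by (simp add: swap_mult[OF complex_algebra_axioms complex_algebra_axioms] sS_swap)
  then have "pure H H \<psi> \<psi> \<otimes>\<^bsub>?T\<^esub> (pure H H \<phi> \<phi> \<otimes>\<^bsub>?T\<^esub> (G \<otimes>\<^bsub>?T\<^esub> F)) \<otimes>\<^bsub>?T\<^esub> Fi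
    = pure H H \<psi> \<psi> \<otimes>\<^bsub>?T\<^esub> (tensor_map H H sS sS (tensor_swap H H F) \<otimes>\<^bsub>?T\<^esub> \<Delta> \<phi>) \<otimes>\<^bsub>?T\<^esub> Fi" by simp
  moreover have "pure H H \<psi> \<psi> \<otimes>\<^bsub>?T\<^esub> (pure H H \<phi> \<phi> \<otimes>\<^bsub>?T\<^esub> (G \<otimes>\<^bsub>?T\<^esub> F)) \<otimes>\<^bsub>?T\<^esub> Fi = G"
  proof -
    have "pure H H \<psi> \<psi> \<otimes>\<^bsub>?T\<^esub> (pure H H \<phi> \<phi> \<otimes>\<^bsub>?T\<^esub> (G \<otimes>\<^bsub>?T\<^esub> F)) = G \<otimes>\<^bsub>?T\<^esub> F"
      by (simp add: HH.T.alg_assoc[symmetric]) (simp add: HH.tensor_one[symmetric])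
    then show ?thesis by (simp add: HH.T.alg_assoc F_Fi)
  qed
  ultimately show ?thesis by (simp add: HH.T.alg_assoc)
qed

end

theorem theorem3p12:
  fixes H :: "'a star_hopf" and F \<phi> :: "'a vuniv"
  assumes H: "star_hopf_algebra H"
    and F: "F \<in> Units (H \<otimes>\<^sub>v H)"
    and F_counit_left: "tensor_lift H (\<lambda>x y. counit H x \<odot>\<^bsub>H\<^esub> y) F = \<one>\<^bsub>H\<^esub>"
    and F_counit_right: "tensor_lift H (\<lambda>x y. counit H y \<odot>\<^bsub>H\<^esub> x) F = \<one>\<^bsub>H\<^esub>"
    and \<phi>: "\<phi> \<in> carrier H"
  shows "((\<exists>T \<gamma> G. twisted_bar_data H F \<phi> T \<gamma> G) \<longleftrightarrow> \<phi> \<in> Units H \<and> counit H \<phi> = 1)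
    \<and> (\<forall>T \<gamma> G. twisted_bar_data H F \<phi> T \<gamma> G \<longrightarrow>
        (\<forall>h\<in>carrier H. T h = inv\<^bsub>H\<^esub> \<phi> \<otimes>\<^bsub>H\<^esub> star H (antipode H h) \<otimes>\<^bsub>H\<^esub> \<phi>)
        \<and> \<gamma> = inv\<^bsub>H\<^esub> \<phi> \<otimes>\<^bsub>H\<^esub> star H (antipode H (inv\<^bsub>H\<^esub> \<phi>))
        \<and> G = pure H H (inv\<^bsub>H\<^esub> \<phi>) (inv\<^bsub>H\<^esub> \<phi>)
            \<otimes>\<^bsub>H \<otimes>\<^sub>v H\<^esub> tensor_map H H (\<lambda>h. star H (antipode H h)) (\<lambda>h. star H (antipode H h))
                  (tensor_swap H H F)
            \<otimes>\<^bsub>H \<otimes>\<^sub>v H\<^esub> coprod H \<phi> \<otimes>\<^bsub>H \<otimes>\<^sub>v H\<^esub> inv\<^bsub>H \<otimes>\<^sub>v H\<^esub> F)"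
proof -
  have tw: "twisted H F"
    unfolding twisted_def twisted_axioms_def using H F F_counit_left F_counit_right by blast
  interpret twisted H F by (rule tw)
  have sS: "sS = (\<lambda>h. star H (antipode H h))" by (simp add: sS_def fun_eq_iff)
  have bd: "bar_data H F \<phi> T \<gamma> G" if "twisted_bar_data H F \<phi> T \<gamma> G" for T \<gamma> G
    unfolding bar_data_def bar_data_axioms_def using tw \<phi> that by blast
  have "\<exists>T \<gamma> G. twisted_bar_data H F \<phi> T \<gamma> G" if "\<phi> \<in> Units H \<and> counit H \<phi> = 1"
  proof -
    have "bar_twisted H F \<phi>" unfolding bar_twisted_def bar_twisted_axioms_def using tw that by blast
    then show ?thesis using bar_twisted.data by blast
  qed
  moreover have "\<phi> \<in> Units H \<and> counit H \<phi> = 1" if "twisted_bar_data H F \<phi> T \<gamma> G" for T \<gamma> G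
    using bar_data.\<phi>_Units[OF bd[OF that]] bar_data.counit_\<phi>[OF bd[OF that]] by blast
  ultimately show ?thesis
    using bar_data.T_eq[OF bd] bar_data.\<gamma>_eq[OF bd] bar_data.G_eq[OF bd]
    unfolding sS Fi_def by blast
qed

end
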